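(* Consider the gradient of the velocity $\boldsymbol{v}(y,t)$, i.e., the matrix $$A_v = \left( \frac{\partial}{\partial y_i} v_j \right)_{i,j=1}^{n},$$ and assume that it is positive semi-definite. Then for all $q \in Y\setminus\{0\}$ there exists a $u_q \in X_v$ such that $b(u_q,q) > 0$.
   Context: Let $\Omega\subset\mathbb{R}^n$ be a bounded Lipschitz domain, $T>0$, and let $\varphi(t,\cdot)$, $t\in(0,T)$, be a deformation which is bijective and sufficiently regular for all $t\in(0,T)$, with $\varphi(0,x)=x$ for all $x\in\Omega$. Set $\Omega(t) := \{ y=\varphi(t,x) : x\in\Omega\}$ and let the space-time domain be $$Q := \{(y,t)\in\mathbb{R}^{n+1} : y=\varphi(t,x),\ x\in\Omega,\ t\in(0,T)\}.$$ The velocity is $\boldsymbol{v}(y,t) = \frac{d}{dt}y(t)$ along the trajectory $y(t)=\varphi(t,x)$ for a reference point $x\in\Omega$, and it is assumed that $\operatorname{div}_y\boldsymbol{v}(y,t)=0$. Positive semi-definiteness of $A_v$ means $(A_v(y,t)\xi,\xi)\ge 0$ for all $\xi\in\mathbb{R}^n$ and $(y,t)\in Q$. The diffusion coefficient $\alpha(y)$ is bounded and strictly positive, $0<\underline\alpha\le\alpha(y)\le\overline\alpha$. Define the Bochner space $Y := L^2(0,T;H^1_0(\Omega(t)))$ with norm $$\|q\|_Y^2 := \int_0^T\int_{\Omega(t)} \alpha(y)\,|\nabla_y q(y,t)|^2\,dy\,dt,$$ its dual $Y^*$ with respect to the duality pairing extending the $L^2(Q)$ inner product, and $$X_v := \Big\{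 u\in Y : \tfrac{d}{dt}u = \partial_t u + \boldsymbol{v}\cdot\nabla_y u \in Y^*,\ u(x,0)=0 \text{ for } x\in\Omega \Big\}.$$ The bilinear form $b: X_v\times Y\to\mathbb{R}$ is $$b(u,q) := \int_0^T\int_{\Omega(t)} \Big[\partial_t u(y,t) + \boldsymbol{v}(y,t)\cdot\nabla_y u(y,t)\Big] q(y,t)\,dy\,dt + \int_0^T\int_{\Omega(t)} \alpha(y)\,\nabla_y u(y,t)\cdot\nabla_y q(y,t)\,dy\,dt,$$ where the first integral is understood as the duality pairing between $Y^*$ and $Y$. *)

theory Defs
  imports "HOL-Analysis.Analysis"
begin

section \<open>Function classes\<close>

text \<open>Continuous differentiability of order k, meant for open S (the derivatives are two-sided).\<close>

primrec Ck :: "nat \<Rightarrow> 'a::euclidean_space set \<Rightarrow> ('a \<Rightarrow> 'b::real_normed_vector) \<Rightarrow> bool" where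
  "Ck 0 S f \<longleftrightarrow> continuous_on S f"
| "Ck (Suc k) S f \<longleftrightarrow> (\<forall>x\<in>S. f differentiable (at x)) \<and>
     (\<forall>e\<in>Basis. Ck k S (\<lambda>x. frechet_derivative f (at x) e))"

definition test_functions :: "'a::euclidean_space set \<Rightarrow> ('a \<Rightarrow> real) set" where
  "test_functions U = {\<psi>. (\<forall>k. Ck k UNIV \<psi>) \<and>
     compact (closure {x. \<psi> x \<noteq> 0}) \<and> closure {x. \<psi> x \<noteq> 0} \<subseteq> U}"

text \<open>Elements of Lebesgue, Sobolev and Bochner spaces are represented by Borel functions;
  two of them are identified when they agree almost everywhere, so that being nonzero means
  not vanishing almost everywhere.\<close>

definition L2 :: "'a::euclidean_space set \<Rightarrow> ('a \<Rightarrow> 'b::euclidean_space) set" where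
  "L2 U = {f. set_borel_measurable lborel U f \<and> set_integrable lborel U (\<lambda>x. (norm (f x))\<^sup>2)}"

definition grad :: "(real^'n \<Rightarrow> real) \<Rightarrow> real^'n \<Rightarrow> real^'n" where
  "grad f y = (\<chi> i. frechet_derivative f (at y) (axis i 1))"

text \<open>The function u belongs to the Sobolev space of order one on U, with weak gradient g.\<close>

definition weak_gradient :: "(real^'n) set \<Rightarrow> (real^'n \<Rightarrow> real) \<Rightarrow> (real^'n \<Rightarrow> real^'n) \<Rightarrow> bool" where
  "weak_gradient U u g \<longleftrightarrow> u \<in> L2 U \<and> g \<in> L2 U \<and>
     (\<forall>\<psi>\<in>test_functions U. \<forall>i.
        (LINT y:U|lborel. u y * (grad \<psi> y $ i)) = - (LINT y:U|lborel. (g y $ i) * \<psi> y))"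

text \<open>The closure of the test functions in the Sobolev norm of order one.\<close>

definition H10 :: "(real^'n) set \<Rightarrow> (real^'n \<Rightarrow> real) set" where
  "H10 U = {u. \<exists>g. weak_gradient U u g \<and>
     (\<exists>\<psi> :: nat \<Rightarrow> real^'n \<Rightarrow> real. (\<forall>k. \<psi> k \<in> test_functions U) \<and>
        (\<lambda>k. (LINT y:U|lborel. (u y - \<psi> k y)\<^sup>2)
            + (LINT y:U|lborel. (norm (g y - grad (\<psi> k) y))\<^sup>2)) \<longlonglongrightarrow> 0)}"

section \<open>Reference domain and deformation\<close>

text \<open>Near every boundary point, and after a rotation turning \<open>\<nu>\<close> into the last coordinate
  direction, the domain is the strict epigraph of a Lipschitz function \<open>\<gamma>\<close> on the hyperplane
  orthogonal to \<open>\<nu>\<close>.\<close>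

definition lipschitz_domain :: "'a::euclidean_space set \<Rightarrow> bool" where
  "lipschitz_domain \<Omega> \<longleftrightarrow> open \<Omega> \<and> connected \<Omega> \<and> \<Omega> \<noteq> {} \<and>
     (\<forall>p\<in>frontier \<Omega>. \<exists>\<nu> r L (\<gamma> :: 'a \<Rightarrow> real).
        norm \<nu> = 1 \<and> 0 < r \<and> L-lipschitz_on {z. z \<bullet> \<nu> = 0} \<gamma> \<and>
        \<Omega> \<inter> ball p r = {x \<in> ball p r. \<gamma> (x - (x \<bullet> \<nu>) *\<^sub>R \<nu>) < x \<bullet> \<nu>})"

text \<open>Sufficient regularity is read as: jointly \<open>C\<^sup>2\<close> in time and space on \<open>[0,T) \<times> \<Omega>\<close>
  (on a neighbourhood, to include the initial time), with invertible spatial Jacobians.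
  Each \<open>\<phi> t\<close> is then a diffeomorphism of \<open>\<Omega>\<close> onto its image, and the velocity is
  continuously differentiable on the space-time domain.\<close>

definition regular_deformation ::
  "(real^'n) set \<Rightarrow> real \<Rightarrow> (real \<Rightarrow> real^'n \<Rightarrow> real^'n) \<Rightarrow> bool" where
  "regular_deformation \<Omega> T \<phi> \<longleftrightarrow>
     (\<exists>W. open W \<and> {0..<T} \<times> \<Omega> \<subseteq> W \<and> Ck 2 W (\<lambda>(t, x). \<phi> t x)) \<and>
     (\<forall>t\<in>{0..<T}. inj_on (\<phi> t) \<Omega> \<and>
        (\<forall>x\<in>\<Omega>. invertible (matrix (frechet_derivative (\<phi> t) (at x))))) \<and>
     (\<forall>x\<in>\<Omega>. \<phi> 0 x = x)"

definition spacetime_domain ::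
  "(real^'n) set \<Rightarrow> real \<Rightarrow> (real \<Rightarrow> real^'n \<Rightarrow> real^'n) \<Rightarrow> ((real^'n) \<times> real) set" where
  "spacetime_domain \<Omega> T \<phi> = {(y, t). t \<in> {0<..<T} \<and> y \<in> \<phi> t ` \<Omega>}"

text \<open>Time derivative of the trajectory through y at time t.\<close>

definition velocity ::
  "(real^'n) set \<Rightarrow> (real \<Rightarrow> real^'n \<Rightarrow> real^'n) \<Rightarrow> real^'n \<Rightarrow> real \<Rightarrow> real^'n" where
  "velocity \<Omega> \<phi> y t = vector_derivative (\<lambda>s. \<phi> s (inv_into \<Omega> (\<phi> t) y)) (at t)"

definition velocity_gradient ::
  "(real^'n) set \<Rightarrow> (real \<Rightarrow> real^'n \<Rightarrow> real^'n) \<Rightarrow> real^'n \<Rightarrow> real \<Rightarrow> real^'n^'n" where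
  "velocity_gradient \<Omega> \<phi> y t =
     (\<chi> i j. frechet_derivative (\<lambda>z. velocity \<Omega> \<phi> z t) (at y) (axis i 1) $ j)"

definition divergence :: "(real^'n \<Rightarrow> real^'n) \<Rightarrow> real^'n \<Rightarrow> real" where
  "divergence w y = (\<Sum>i\<in>UNIV. frechet_derivative w (at y) (axis i 1) $ i)"

section \<open>Bochner spaces on the moving domain\<close>

definition st_integral :: "(real^'n) set \<Rightarrow> real \<Rightarrow> (real \<Rightarrow> real^'n \<Rightarrow> real^'n)
    \<Rightarrow> (real^'n \<Rightarrow> real \<Rightarrow> real) \<Rightarrow> real" where
  "st_integral \<Omega> T \<phi> f = (LINT t:{0<..<T}|lborel. (LINT y:\<phi> t ` \<Omega>|lborel. f y t))"

definition has_grad_y :: "(real^'n) set \<Rightarrow> real \<Rightarrow> (real \<Rightarrow> real^'n \<Rightarrow> real^'n)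
    \<Rightarrow> ((real^'n) \<times> real \<Rightarrow> real) \<Rightarrow> ((real^'n) \<times> real \<Rightarrow> real^'n) \<Rightarrow> bool" where
  "has_grad_y \<Omega> T \<phi> q g \<longleftrightarrow> g \<in> L2 (spacetime_domain \<Omega> T \<phi>) \<and>
     (AE t in lborel. t \<in> {0<..<T} \<longrightarrow>
        weak_gradient (\<phi> t ` \<Omega>) (\<lambda>y. q (y, t)) (\<lambda>y. g (y, t)))"

text \<open>Unique up to a null set.\<close>

definition grad_y :: "(real^'n) set \<Rightarrow> real \<Rightarrow> (real \<Rightarrow> real^'n \<Rightarrow> real^'n)
    \<Rightarrow> ((real^'n) \<times> real \<Rightarrow> real) \<Rightarrow> (real^'n) \<times> real \<Rightarrow> real^'n" where
  "grad_y \<Omega> T \<phi> q = (SOME g. has_grad_y \<Omega> T \<phi> q g)"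

definition Y_space :: "(real^'n) set \<Rightarrow> real \<Rightarrow> (real \<Rightarrow> real^'n \<Rightarrow> real^'n)
    \<Rightarrow> ((real^'n) \<times> real \<Rightarrow> real) set" where
  "Y_space \<Omega> T \<phi> = {q. q \<in> L2 (spacetime_domain \<Omega> T \<phi>) \<and>
     (\<exists>g. has_grad_y \<Omega> T \<phi> q g) \<and>
     (AE t in lborel. t \<in> {0<..<T} \<longrightarrow> (\<lambda>y. q (y, t)) \<in> H10 (\<phi> t ` \<Omega>))}"

definition Y_norm :: "(real^'n) set \<Rightarrow> real \<Rightarrow> (real \<Rightarrow> real^'n \<Rightarrow> real^'n)
    \<Rightarrow> (real^'n \<Rightarrow> real) \<Rightarrow> ((real^'n) \<times> real \<Rightarrow> real) \<Rightarrow> real" where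
  "Y_norm \<Omega> T \<phi> \<alpha> q =
     sqrt (st_integral \<Omega> T \<phi> (\<lambda>y t. \<alpha> y * (norm (grad_y \<Omega> T \<phi> q (y, t)))\<^sup>2))"

text \<open>Bounded linear functionals on the space Y; their values outside Y are irrelevant.\<close>

definition Y_dual :: "(real^'n) set \<Rightarrow> real \<Rightarrow> (real \<Rightarrow> real^'n \<Rightarrow> real^'n)
    \<Rightarrow> (real^'n \<Rightarrow> real) \<Rightarrow> (((real^'n) \<times> real \<Rightarrow> real) \<Rightarrow> real) set" where
  "Y_dual \<Omega> T \<phi> \<alpha> = {F.
     (\<forall>p\<in>Y_space \<Omega> T \<phi>. \<forall>q\<in>Y_space \<Omega> T \<phi>. \<forall>a b.
        F (\<lambda>z. a * p z + b * q z) = a * F p + b * F q) \<and>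
     (\<exists>C. \<forall>q\<in>Y_space \<Omega> T \<phi>. \<bar>F q\<bar> \<le> C * Y_norm \<Omega> T \<phi> \<alpha> q)}"

text \<open>The distribution \<open>\<partial>\<^sub>t u + v \<bullet> \<nabla>u\<close> on the space-time domain extends to the bounded
  functional F on Y: the time derivative is moved onto the test function, whereas the
  spatial gradient of u is an honest function because u belongs to Y. Test functions being
  dense in Y, there is at most one such F on Y.\<close>

definition has_material_derivative :: "(real^'n) set \<Rightarrow> real \<Rightarrow> (real \<Rightarrow> real^'n \<Rightarrow> real^'n)
    \<Rightarrow> (real^'n \<Rightarrow> real) \<Rightarrow> ((real^'n) \<times> real \<Rightarrow> real)
    \<Rightarrow> (((real^'n) \<times> real \<Rightarrow> real) \<Rightarrow> real) \<Rightarrow> bool" where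
  "has_material_derivative \<Omega> T \<phi> \<alpha> u F \<longleftrightarrow> F \<in> Y_dual \<Omega> T \<phi> \<alpha> \<and>
     (\<forall>\<psi>\<in>test_functions (spacetime_domain \<Omega> T \<phi>).
        F \<psi> = st_integral \<Omega> T \<phi> (\<lambda>y t.
          - u (y, t) * frechet_derivative \<psi> (at (y, t)) (0, 1)
          + (velocity \<Omega> \<phi> y t \<bullet> grad_y \<Omega> T \<phi> u (y, t)) * \<psi> (y, t)))"

definition material_derivative :: "(real^'n) set \<Rightarrow> real \<Rightarrow> (real \<Rightarrow> real^'n \<Rightarrow> real^'n)
    \<Rightarrow> (real^'n \<Rightarrow> real) \<Rightarrow> ((real^'n) \<times> real \<Rightarrow> real)
    \<Rightarrow> ((real^'n) \<times> real \<Rightarrow> real) \<Rightarrow> real" where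
  "material_derivative \<Omega> T \<phi> \<alpha> u = (SOME F. has_material_derivative \<Omega> T \<phi> \<alpha> u F)"

text \<open>An element of Y with material derivative in the dual of Y has a representative w which,
  pulled back to the reference domain, is continuous in time with values in \<open>L\<^sup>2(\<Omega>)\<close>; its
  initial value is that of this representative.\<close>

definition zero_initial_value :: "(real^'n) set \<Rightarrow> real \<Rightarrow> (real \<Rightarrow> real^'n \<Rightarrow> real^'n)
    \<Rightarrow> ((real^'n) \<times> real \<Rightarrow> real) \<Rightarrow> bool" where
  "zero_initial_value \<Omega> T \<phi> u \<longleftrightarrow> (\<exists>w.
     (AE z in lborel. z \<in> spacetime_domain \<Omega> T \<phi> \<longrightarrow> w z = u z) \<and>
     (\<forall>t\<in>{0..<T}. (\<lambda>x. w (\<phi> t x, t)) \<in> L2 \<Omega>) \<and>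
     (\<forall>s\<in>{0..<T}. ((\<lambda>t. LINT x:\<Omega>|lborel. (w (\<phi> t x, t) - w (\<phi> s x, s))\<^sup>2) \<longlongrightarrow> 0)
        (at s within {0..<T})) \<and>
     (AE x in lborel. x \<in> \<Omega> \<longrightarrow> w (x, 0) = 0))"

definition X_space :: "(real^'n) set \<Rightarrow> real \<Rightarrow> (real \<Rightarrow> real^'n \<Rightarrow> real^'n)
    \<Rightarrow> (real^'n \<Rightarrow> real) \<Rightarrow> ((real^'n) \<times> real \<Rightarrow> real) set" where
  "X_space \<Omega> T \<phi> \<alpha> = {u \<in> Y_space \<Omega> T \<phi>.
     (\<exists>F. has_material_derivative \<Omega> T \<phi> \<alpha> u F) \<and> zero_initial_value \<Omega> T \<phi> u}"

definition bform :: "(real^'n) set \<Rightarrow> real \<Rightarrow> (real \<Rightarrow> real^'n \<Rightarrow> real^'n)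
    \<Rightarrow> (real^'n \<Rightarrow> real) \<Rightarrow> ((real^'n) \<times> real \<Rightarrow> real) \<Rightarrow> ((real^'n) \<times> real \<Rightarrow> real) \<Rightarrow> real" where
  "bform \<Omega> T \<phi> \<alpha> u q = material_derivative \<Omega> T \<phi> \<alpha> u q
     + st_integral \<Omega> T \<phi> (\<lambda>y t. \<alpha> y * (grad_y \<Omega> T \<phi> u (y, t) \<bullet> grad_y \<Omega> T \<phi> q (y, t)))"

end

theory Submission
  imports Defs
begin

text \<open>
  The trace of the velocity gradient is the divergence, which vanishes; a positive semi-definite
  matrix with trace zero has vanishing quadratic form. Hence the velocity does not change the
  distance of nearby particles, the spatial derivatives of \<open>\<phi> t\<close> are isometries, and, the
  reference domain being connected, \<open>\<phi> t x = R t x + c t\<close> is a rigid motion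
  (\<open>velocity_skew\<close>, \<open>deformation_isometric\<close>, \<open>deformation_rigid\<close>). In the coordinates of the
  reference domain, the space-time domain becomes the cylinder over \<open>\<Omega>\<close>, Lebesgue measure is
  preserved, spatial gradients are rotated, and the material derivative becomes the time
  derivative.

  Given a nonzero q in Y, the form would be positive for the backward Steklov average
  \<open>u(t) = (1/h) \<integral>\<^sub>0\<^sup>h q(t - s) ds\<close>, taken along the trajectories, with q extended by zero. It
  starts from zero. Its material derivative is \<open>(q(t) - q(t - h)) / h\<close>, and pairing this with q
  gives something nonnegative, because a translate of q has the norm of q, so that by the
  Cauchy-Schwarz inequality its correlation with q is at most the square of that norm. The
  diffusion term is an average over \<open>0 \<le> s \<le> h\<close> of the energy products of q(t - s) with q. As
  translation is continuous in \<open>L\<^sup>2\<close>, it is close to \<open>N = \<integral> \<alpha> |\<nabla>q|\<^sup>2\<close> for small h, and N is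
  positive by the Poincare inequality.

  To have a function u whose membership in X can be checked by hand, q is replaced by a finite
  sum of products \<open>\<eta> i (t) \<psi> i (x)\<close> of test functions in reference coordinates
  (\<open>tensor_approximation\<close>, \<open>pullback_tensor_approximation\<close>). Here h is fixed first and the
  approximation is chosen to be accurate relative to h. Then the first term of the form is at
  least \<open>- N/4\<close> and the second at least \<open>3 N/4\<close> (\<open>difference_quotient_estimate\<close>,
  \<open>energy_estimate\<close>, \<open>exists_trial_function_with_positive_form\<close>).

  The material derivative of u is given by a square integrable function, and thus is a bounded
  functional on Y by the Poincare inequality (\<open>l2_functional_in_dual\<close>). But it is characterized
  only by its values on test functions of the space-time domain, and so its value at q is known
  once these are shown to be dense in Y (\<open>test_functions_dense\<close>). As the motion need not be
  smooth in time, a tensor product carried along by the motion is not a test function; it becomes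
  one if its position is frozen on short time intervals (\<open>freeze_in_time\<close>).
\<close>

section \<open>Functions of class \<open>C\<^sup>k\<close>\<close>

lemma Ck_Suc_imp_Ck: "Ck (Suc k) S f \<Longrightarrow> Ck k S f"
proof (induction k arbitrary: f)
  case 0
  then have "f differentiable_on S"
    unfolding differentiable_on_def by (simp add: differentiable_at_withinI)
  then show ?case by (simp add: differentiable_imp_continuous_on)
next
  case (Suc k)
  have "\<forall>x\<in>S. f differentiable at x" "\<forall>e\<in>Basis. Ck (Suc k) S (\<lambda>x. frechet_derivative f (at x) e)"
    using Suc.prems Ck.simps(2)[of "Suc k" S f] by blast+
  then show ?case using Suc.IH Ck.simps(2)[of k S f] by blast
qed

lemma Ck_const: "Ck k S (\<lambda>x. c)"
  by (induction k arbitrary: c) auto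

lemma Ck_add: "Ck k UNIV f \<Longrightarrow> Ck k UNIV g \<Longrightarrow> Ck k UNIV (\<lambda>x. f x + g x)"
proof (induction k arbitrary: f g)
  case 0
  then show ?case by (auto intro: continuous_intros)
next
  case (Suc k)
  have "frechet_derivative (\<lambda>x. f x + g x) (at x) e
      = frechet_derivative f (at x) e + frechet_derivative g (at x) e" for x e
  proof -
    have "((\<lambda>x. f x + g x) has_derivative
        (\<lambda>e. frechet_derivative f (at x) e + frechet_derivative g (at x) e)) (at x)"
      using Suc.prems by (intro has_derivative_add; simp flip: frechet_derivative_works)
    from frechet_derivative_at[OF this, symmetric] show ?thesis by simp
  qed
  with Suc show ?case by (auto intro: differentiable_add)
qed

lemma Ck_mult:
  fixes f g :: "'a::euclidean_space \<Rightarrow> real"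
  shows "Ck k UNIV f \<Longrightarrow> Ck k UNIV g \<Longrightarrow> Ck k UNIV (\<lambda>x. f x * g x)"
proof (induction k arbitrary: f g)
  case 0
  then show ?case by (auto intro: continuous_intros)
next
  case (Suc k)
  have *: "frechet_derivative (\<lambda>x. f x * g x) (at x) e
      = f x * frechet_derivative g (at x) e + frechet_derivative f (at x) e * g x" for x e
  proof -
    have "((\<lambda>x. f x * g x) has_derivative
        (\<lambda>e. f x * frechet_derivative g (at x) e + frechet_derivative f (at x) e * g x)) (at x)"
      using Suc.prems by (intro has_derivative_mult; simp flip: frechet_derivative_works)
    from frechet_derivative_at[OF this, symmetric] show ?thesis by simp
  qed
  have "Ck k UNIV f" "Ck k UNIV g" using Suc.prems[THEN Ck_Suc_imp_Ck] by simp_all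
  then have "Ck k UNIV (\<lambda>x. frechet_derivative (\<lambda>x. f x * g x) (at x) e)" if "e \<in> Basis" for e
    unfolding * using that Suc by (intro Ck_add Suc.IH) auto
  moreover have "(\<lambda>x. f x * g x) differentiable at x" for x
    using Suc.prems by (intro differentiable_mult) auto
  ultimately show ?case by simp
qed

lemma Ck_sum:
  fixes f :: "'i \<Rightarrow> 'a::euclidean_space \<Rightarrow> 'b::real_normed_vector"
  shows "(\<And>i. i \<in> I \<Longrightarrow> Ck k UNIV (f i)) \<Longrightarrow> Ck k UNIV (\<lambda>x. \<Sum>i\<in>I. f i x)"
  by (induction I rule: infinite_finite_induct) (auto intro: Ck_const Ck_add)

lemma Ck_prod:
  fixes f :: "'i \<Rightarrow> 'a::euclidean_space \<Rightarrow> real"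
  shows "(\<And>i. i \<in> I \<Longrightarrow> Ck k UNIV (f i)) \<Longrightarrow> Ck k UNIV (\<lambda>x. \<Prod>i\<in>I. f i x)"
  by (induction I rule: infinite_finite_induct) (auto intro: Ck_const Ck_mult)

lemma Ck_compose_affine:
  fixes f :: "'b::euclidean_space \<Rightarrow> real" and L :: "'a::euclidean_space \<Rightarrow> 'b"
  assumes L: "linear L"
  shows "Ck k UNIV f \<Longrightarrow> Ck k UNIV (\<lambda>x. f (L x + b))"
proof (induction k arbitrary: f)
  case 0
  have "continuous_on UNIV (\<lambda>x. L x + b)"
    using L by (intro continuous_intros linear_continuous_on) (simp add: linear_conv_bounded_linear)
  with 0 show ?case by (auto intro: continuous_on_compose2)
next
  case (Suc k)
  have dL: "(L has_derivative L) (at x)" for x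
    using L by (simp add: linear_conv_bounded_linear bounded_linear_imp_has_derivative)
  have d: "((\<lambda>x. f (L x + b)) has_derivative (\<lambda>e. frechet_derivative f (at (L x + b)) (L e))) (at x)" for x
  proof -
    have "(f has_derivative frechet_derivative f (at (L x + b))) (at (L x + b))"
      using Suc.prems by (auto simp flip: frechet_derivative_works)
    moreover have "((\<lambda>x. L x + b) has_derivative L) (at x)"
      by (auto intro!: derivative_eq_intros dL)
    ultimately show ?thesis
      using has_derivative_compose by fastforce
  qed
  have e: "frechet_derivative f (at z) v = (\<Sum>j\<in>Basis. (v \<bullet> j) * frechet_derivative f (at z) j)" for z v
  proof -
    have "linear (frechet_derivative f (at z))"
      using Suc.prems by (auto intro: linear_frechet_derivative)
    then have "frechet_derivative f (at z) (\<Sum>j\<in>Basis. (v \<bullet> j) *\<^sub>R j)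
        = (\<Sum>j\<in>Basis. (v \<bullet> j) * frechet_derivative f (at z) j)"
      by (simp add: linear_sum linear_cmul)
    then show ?thesis by (simp add: euclidean_representation)
  qed
  have "frechet_derivative (\<lambda>x. f (L x + b)) (at x) e
      = (\<Sum>j\<in>Basis. (L e \<bullet> j) * frechet_derivative f (at (L x + b)) j)" for x e
    using d[of x] e by (metis frechet_derivative_at)
  moreover have "Ck k UNIV (\<lambda>x. \<Sum>j\<in>Basis. (L e \<bullet> j) * frechet_derivative f (at (L x + b)) j)" for e
    using Suc by (intro Ck_sum Ck_mult Ck_const) auto
  ultimately show ?case using differentiableI[OF d] by simp
qed

section \<open>Smooth bump functions\<close>

text \<open>The functions \<open>p(1/s) exp(-c/s)\<close>, extended by zero to \<open>s \<le> 0\<close>, are closed under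
  differentiation when p ranges over the polynomials; this is why the bump function is smooth.\<close>

definition flat_exp :: "real \<Rightarrow> real poly \<Rightarrow> real \<Rightarrow> real" where
  "flat_exp c p s = (if 0 < s then poly p (1 / s) * exp (- c / s) else 0)"

lemma poly_times_exp_tendsto_0:
  assumes "0 < (c::real)"
  shows "((\<lambda>x. poly p x * exp (- c * x)) \<longlongrightarrow> 0) at_top"
proof -
  have mono: "((\<lambda>x. x ^ k * exp (- c * x)) \<longlongrightarrow> 0) at_top" for k
  proof -
    have "((\<lambda>x. (c * x) ^ k / exp (c * x)) \<longlongrightarrow> 0) at_top"
      using assms by (intro filterlim_compose[OF tendsto_power_div_exp_0]
          filterlim_tendsto_pos_mult_at_top[OF tendsto_const]) (auto simp: filterlim_ident)
    then have "((\<lambda>x. (1 / c ^ k) * ((c * x) ^ k / exp (c * x))) \<longlongrightarrow> (1 / c ^ k) * 0) at_top"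
      by (intro tendsto_intros)
    then show ?thesis using assms
      by (simp add: power_mult_distrib exp_minus divide_simps)
  qed
  have "((\<lambda>x. \<Sum>i\<le>degree p. coeff p i * (x ^ i * exp (- c * x))) \<longlongrightarrow> (\<Sum>i\<le>degree p. coeff p i * 0)) at_top"
    by (intro tendsto_intros mono)
  then show ?thesis by (simp add: poly_altdef sum_distrib_right mult.assoc)
qed

lemma flat_exp_has_derivative:
  assumes "0 < c"
  shows "(flat_exp c p has_real_derivative
    flat_exp c ([:0, 0, 1:] * (smult c p - pderiv p)) s) (at s)"
proof -
  consider "0 < s" | "s < 0" | "s = 0" by linarith
  then show ?thesis
  proof cases
    case 1
    have "((\<lambda>s. poly p (1 / s) * exp (- c / s)) has_real_derivative
      (poly (pderiv p) (1 / s) * (- 1 / s\<^sup>2)) * exp (- c / s) + poly p (1 / s) * (exp (- c / s) * (c / s\<^sup>2))) (at s)"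
      using 1 by (auto intro!: derivative_eq_intros DERIV_chain2[OF poly_DERIV] simp: field_simps power2_eq_square)
    moreover have "flat_exp c ([:0, 0, 1:] * (smult c p - pderiv p)) s =
      (poly (pderiv p) (1 / s) * (- 1 / s\<^sup>2)) * exp (- c / s) + poly p (1 / s) * (exp (- c / s) * (c / s\<^sup>2))"
      using 1 by (simp add: flat_exp_def field_simps power2_eq_square)
    ultimately have "((\<lambda>s. poly p (1 / s) * exp (- c / s)) has_real_derivative
      flat_exp c ([:0, 0, 1:] * (smult c p - pderiv p)) s) (at s)" by simp
    then show ?thesis
      by (rule has_field_derivative_transform_within_open[where S="{0<..}"])
         (use 1 in \<open>auto simp: flat_exp_def\<close>)
  next
    case 2
    have "((\<lambda>s. 0) has_real_derivative 0) (at s)" by simp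
    then have "(flat_exp c p has_real_derivative 0) (at s)"
      by (rule has_field_derivative_transform_within_open[where S="{..<0}"]) (use 2 in \<open>auto simp: flat_exp_def\<close>)
    then show ?thesis using 2 by (simp add: flat_exp_def)
  next
    case 3
    have "((\<lambda>h. flat_exp c p h / h) \<longlongrightarrow> 0) (at_right 0)"
    proof -
      have "((\<lambda>h. poly ([:0, 1:] * p) (inverse h) * exp (- c * inverse h)) \<longlongrightarrow> 0) (at_right 0)"
        by (rule filterlim_compose[OF poly_times_exp_tendsto_0[OF assms] filterlim_inverse_at_top_right])
      then show ?thesis
        by (rule Lim_transform_eventually)
           (auto simp: flat_exp_def eventually_at_right_field field_simps intro!: exI[of _ 1])
    qed
    moreover have "((\<lambda>h. flat_exp c p h / h) \<longlongrightarrow> 0) (at_left 0)"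
      by (rule Lim_transform_eventually[OF tendsto_const])
         (auto simp: flat_exp_def eventually_at_left_field intro!: exI[of _ "-1"])
    ultimately have "((\<lambda>h. flat_exp c p h / h) \<longlongrightarrow> 0) (at 0)"
      by (simp add: filterlim_split_at_real)
    then show ?thesis using 3
      by (simp add: has_field_derivative_iff flat_exp_def)
  qed
qed

lemma Ck_flat_exp: "0 < c \<Longrightarrow> Ck k UNIV (flat_exp c p)"
proof (induction k arbitrary: p)
  case 0
  then show ?case
    using DERIV_isCont[OF flat_exp_has_derivative] by (auto intro!: continuous_at_imp_continuous_on)
next
  case (Suc k)
  have d: "(flat_exp c p has_derivative (*) (flat_exp c ([:0, 0, 1:] * (smult c p - pderiv p)) s)) (at s)" for s
    using flat_exp_has_derivative[OF Suc.prems] has_field_derivative_def by blast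
  have "frechet_derivative (flat_exp c p) (at s) 1 = flat_exp c ([:0, 0, 1:] * (smult c p - pderiv p)) s" for s
    using d[of s] by (metis frechet_derivative_at mult.right_neutral)
  then show ?case using Suc differentiableI[OF d] by (simp del: mult_pCons_left)
qed

text \<open>The exponents tend to zero as m grows, so that the bumps with support in a box converge to its
  indicator function.\<close>

definition box_bump :: "'a::euclidean_space \<Rightarrow> 'a \<Rightarrow> nat \<Rightarrow> 'a \<Rightarrow> real" where
  "box_bump a b m x = (\<Prod>i\<in>Basis. flat_exp (1 / Suc m) 1 (x \<bullet> i - a \<bullet> i) * flat_exp (1 / Suc m) 1 (b \<bullet> i - x \<bullet> i))"

lemma flat_exp_1_bounds: "0 < c \<Longrightarrow> 0 \<le> flat_exp c 1 s \<and> flat_exp c 1 s \<le> 1"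
  by (auto simp: flat_exp_def)

lemma box_bump_nonneg: "0 \<le> box_bump a b m x"
  unfolding box_bump_def by (intro prod_nonneg mult_nonneg_nonneg ballI) (auto simp: flat_exp_1_bounds)

lemma box_bump_le_1: "box_bump a b m x \<le> 1"
  unfolding box_bump_def by (intro prod_le_1 conjI mult_nonneg_nonneg mult_le_one) (auto simp: flat_exp_1_bounds)

lemma box_bump_eq_0: "x \<notin> box a b \<Longrightarrow> box_bump a b m x = 0"
  unfolding box_bump_def by (auto simp: mem_box flat_exp_def prod_zero_iff)

lemma Ck_box_bump: "Ck k UNIV (box_bump a b m)"
proof -
  have "Ck k UNIV (\<lambda>x::'a. flat_exp (1 / Suc m) 1 (x \<bullet> i + (- (a \<bullet> i))))"
       "Ck k UNIV (\<lambda>x::'a. flat_exp (1 / Suc m) 1 ((- (x \<bullet> i)) + b \<bullet> i))" for i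
    by (intro Ck_compose_affine Ck_flat_exp; simp add: linear_iff inner_left_distrib)+
  then show ?thesis
    unfolding box_bump_def[abs_def] by (intro Ck_prod Ck_mult) (auto simp: algebra_simps)
qed

lemma box_bump_tendsto: "(\<lambda>m. box_bump a b m x) \<longlonglongrightarrow> indicator (box a b) x"
proof (cases "x \<in> box a b")
  case True
  have f: "(\<lambda>m. flat_exp (1 / Suc m) 1 s) \<longlonglongrightarrow> 1" if "0 < s" for s
  proof -
    have "(\<lambda>m. exp (- (1 / real (Suc m)) / s)) \<longlonglongrightarrow> exp (- 0 / s)"
      using that by (intro tendsto_intros LIMSEQ_inverse_real_of_nat[unfolded inverse_eq_divide]) auto
    then show ?thesis using that by (simp add: flat_exp_def)
  qed
  have "(\<lambda>m. box_bump a b m x) \<longlonglongrightarrow> (\<Prod>i\<in>(Basis::'a set). 1 * 1)"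
    unfolding box_bump_def using True by (intro tendsto_prod tendsto_mult f) (auto simp: mem_box)
  then show ?thesis using True by simp
next
  case False
  then show ?thesis by (simp add: box_bump_eq_0)
qed

section \<open>Test functions\<close>

lemma test_functionsI:
  assumes "\<And>k. Ck k UNIV \<psi>" "compact K" "K \<subseteq> U" "\<And>x. x \<notin> K \<Longrightarrow> \<psi> x = 0"
  shows "\<psi> \<in> test_functions U"
proof -
  have "closure {x. \<psi> x \<noteq> 0} \<subseteq> K"
    using assms(2,4) by (intro closure_minimal) (auto intro: compact_imp_closed)
  moreover have "compact (closure {x. \<psi> x \<noteq> 0})"
    unfolding compact_closure by (rule bounded_subset[OF compact_imp_bounded[OF assms(2)]]) (use assms(4) in blast)
  moreover have "\<forall>k. Ck k UNIV \<psi>" using assms(1) by blast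
  ultimately show ?thesis using assms(3) unfolding test_functions_def by blast
qed

lemma test_functionsE:
  assumes "\<psi> \<in> test_functions U"
  obtains K where "\<And>k. Ck k UNIV \<psi>" "compact K" "K \<subseteq> U" "\<And>x. x \<notin> K \<Longrightarrow> \<psi> x = 0"
    "\<And>x e. x \<notin> K \<Longrightarrow> frechet_derivative \<psi> (at x) e = 0"
proof -
  define K where "K = closure {x. \<psi> x \<noteq> 0}"
  have "{x. \<psi> x \<noteq> 0} \<subseteq> K" unfolding K_def by (rule closure_subset)
  then have 0: "\<psi> x = 0" if "x \<notin> K" for x using that by blast
  have opn: "open (- K)" by (simp add: K_def open_Compl)
  have 1: "frechet_derivative \<psi> (at x) e = 0" if "x \<notin> K" for x e
  proof -
    have "((\<lambda>x. 0) has_derivative (\<lambda>e. 0)) (at x)" by simp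
    then have "(\<psi> has_derivative (\<lambda>e. 0)) (at x)"
      by (rule has_derivative_transform_within_open[OF _ opn]) (simp_all add: that 0)
    from frechet_derivative_at[OF this, symmetric] show ?thesis by simp
  qed
  have "\<forall>k. Ck k UNIV \<psi>" "compact K" "K \<subseteq> U"
    using assms unfolding test_functions_def K_def by blast+
  then show ?thesis by (intro that[of K] 0 1) blast+
qed

lemma test_outside: "\<rho> \<in> test_functions U \<Longrightarrow> z \<notin> U \<Longrightarrow> \<rho> z = 0"
  by (rule test_functionsE) auto

lemma test_functions_mono: "U \<subseteq> V \<Longrightarrow> test_functions U \<subseteq> test_functions V"
  by (auto simp: test_functions_def)

lemma test_zero: "(\<lambda>x. 0) \<in> test_functions U"
  by (rule test_functionsI[where K="{}"]) (simp_all add: Ck_const del: Ck.simps)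

lemma test_add:
  assumes "\<psi> \<in> test_functions U" "\<rho> \<in> test_functions U"
  shows "(\<lambda>x. \<psi> x + \<rho> x) \<in> test_functions U"
proof -
  obtain K where K: "\<And>k. Ck k UNIV \<psi>" "compact K" "K \<subseteq> U" "\<And>x. x \<notin> K \<Longrightarrow> \<psi> x = 0"
    by (rule test_functionsE[OF assms(1)]) blast
  obtain C where C: "\<And>k. Ck k UNIV \<rho>" "compact C" "C \<subseteq> U" "\<And>x. x \<notin> C \<Longrightarrow> \<rho> x = 0"
    by (rule test_functionsE[OF assms(2)]) blast
  show ?thesis
    by (rule test_functionsI[where K="K \<union> C"]) (use K C in \<open>simp_all add: Ck_add compact_Un del: Ck.simps\<close>)
qed

lemma test_mult_smooth:
  assumes "\<And>k. Ck k UNIV f" "\<psi> \<in> test_functions U"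
  shows "(\<lambda>x. f x * \<psi> x) \<in> test_functions U"
proof -
  obtain K where K: "\<And>k. Ck k UNIV \<psi>" "compact K" "K \<subseteq> U" "\<And>x. x \<notin> K \<Longrightarrow> \<psi> x = 0"
    by (rule test_functionsE[OF assms(2)]) blast
  show ?thesis
    by (rule test_functionsI[where K="K"]) (use K assms(1) in \<open>simp_all add: Ck_mult del: Ck.simps\<close>)
qed

lemma test_cmult: "\<psi> \<in> test_functions U \<Longrightarrow> (\<lambda>x. c * \<psi> x) \<in> test_functions U"
  by (intro test_mult_smooth Ck_const)

lemma test_sum: "(\<And>i. i \<in> I \<Longrightarrow> \<psi> i \<in> test_functions U) \<Longrightarrow> (\<lambda>x. \<Sum>i\<in>I. \<psi> i x) \<in> test_functions U"
  by (induction I rule: infinite_finite_induct) (auto intro: test_zero test_add)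

lemma test_box_bump: "cbox a b \<subseteq> U \<Longrightarrow> box_bump a b m \<in> test_functions U"
  by (rule test_functionsI[where K="cbox a b"])
     (use box_subset_cbox in \<open>auto simp add: Ck_box_bump intro!: box_bump_eq_0 simp del: Ck.simps\<close>)

lemma test_continuous: "\<psi> \<in> test_functions U \<Longrightarrow> continuous_on UNIV \<psi>"
  using Ck.simps(1) by (auto simp: test_functions_def simp del: Ck.simps)

lemma test_has_derivative: "\<psi> \<in> test_functions U \<Longrightarrow> (\<psi> has_derivative frechet_derivative \<psi> (at x)) (at x)"
  using Ck.simps(2)[of 0 UNIV \<psi>] by (auto simp: test_functions_def simp del: Ck.simps simp flip: frechet_derivative_works)

lemma compact_support_bounded:
  fixes f :: "'a::euclidean_space \<Rightarrow> 'b::real_normed_vector"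
  assumes "continuous_on UNIV f" "compact K" "\<And>x. x \<notin> K \<Longrightarrow> f x = 0"
  obtains B where "0 < B" "\<And>x. norm (f x) \<le> B"
proof -
  have "compact (f ` K)" using assms by (intro compact_continuous_image continuous_on_subset[OF assms(1)]) auto
  then obtain B where B: "0 < B" "\<And>y. y \<in> f ` K \<Longrightarrow> norm y \<le> B"
    by (meson bounded_pos compact_imp_bounded)
  have "norm (f x) \<le> B" for x
    using B assms(3)[of x] by (cases "x \<in> K") auto
  with B(1) that show ?thesis by blast
qed

lemma test_bounded:
  assumes "\<psi> \<in> test_functions U"
  obtains B where "0 < B" "\<And>x. \<bar>\<psi> x\<bar> \<le> B"
proof -
  obtain K where K: "compact K" "\<And>x. x \<notin> K \<Longrightarrow> \<psi> x = 0" by (rule test_functionsE[OF assms]) blast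
  show ?thesis using compact_support_bounded[OF test_continuous[OF assms] K] that by auto
qed

lemma test_partial:
  fixes \<psi> :: "'a::euclidean_space \<Rightarrow> real"
  assumes "\<psi> \<in> test_functions U"
  shows "(\<lambda>x. frechet_derivative \<psi> (at x) e) \<in> test_functions U"
proof -
  obtain K where K: "\<And>k. Ck k UNIV \<psi>" "compact K" "K \<subseteq> U"
    "\<And>x e. x \<notin> K \<Longrightarrow> frechet_derivative \<psi> (at x) e = 0"
    by (rule test_functionsE[OF assms]) blast
  have lin: "linear (frechet_derivative \<psi> (at x))" for x
    using test_has_derivative[OF assms] has_derivative_linear by blast
  have "frechet_derivative \<psi> (at x) (\<Sum>j\<in>Basis. (e \<bullet> j) *\<^sub>R j)
        = (\<Sum>j\<in>Basis. (e \<bullet> j) * frechet_derivative \<psi> (at x) j)" for x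
    using lin[of x] by (simp add: linear_sum linear_cmul)
  then have eq: "(\<lambda>x. frechet_derivative \<psi> (at x) e) = (\<lambda>x. \<Sum>j\<in>Basis. (e \<bullet> j) * frechet_derivative \<psi> (at x) j)"
    by (simp add: euclidean_representation)
  have "Ck k UNIV (\<lambda>x. frechet_derivative \<psi> (at x) j)" if "j \<in> Basis" for j k
    using K(1)[of "Suc k"] that by auto
  then have "Ck k UNIV (\<lambda>x. frechet_derivative \<psi> (at x) e)" for k
    unfolding eq by (intro Ck_sum Ck_mult Ck_const) auto
  with K show ?thesis by (intro test_functionsI[of _ K]) auto
qed

lemma test_compose_affine:
  fixes \<psi> :: "'b::euclidean_space \<Rightarrow> real" and L :: "'a::euclidean_space \<Rightarrow> 'b"
  assumes "\<psi> \<in> test_functions V" "linear L"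
    and K: "\<And>C. compact C \<Longrightarrow> C \<subseteq> V \<Longrightarrow> \<exists>D. compact D \<and> D \<subseteq> U \<and> (\<forall>x. L x + b \<in> C \<longrightarrow> x \<in> D)"
  shows "(\<lambda>x. \<psi> (L x + b)) \<in> test_functions U"
proof -
  obtain C where C: "\<And>k. Ck k UNIV \<psi>" "compact C" "C \<subseteq> V" "\<And>x. x \<notin> C \<Longrightarrow> \<psi> x = 0"
    by (rule test_functionsE[OF assms(1)]) blast
  obtain D where D: "compact D" "D \<subseteq> U" "\<And>x. L x + b \<in> C \<Longrightarrow> x \<in> D" using K[OF C(2,3)] by blast
  show ?thesis
  proof (rule test_functionsI[OF _ D(1,2)])
    show "Ck k UNIV (\<lambda>x. \<psi> (L x + b))" for k by (rule Ck_compose_affine[OF assms(2) C(1)])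
    show "\<psi> (L x + b) = 0" if "x \<notin> D" for x using C(4) D(3) that by blast
  qed
qed

lemma grad_component: "grad f y $ i = frechet_derivative f (at y) (axis i 1)"
  by (simp add: grad_def)

lemma inner_grad:
  fixes f :: "real^'n \<Rightarrow> real"
  assumes "(f has_derivative D) (at y)"
  shows "grad f y \<bullet> e = D e"
proof -
  have lin: "linear D" using assms has_derivative_linear by blast
  have "D = frechet_derivative f (at y)" using assms frechet_derivative_at by blast
  then have "grad f y \<bullet> e = (\<Sum>i\<in>UNIV. D (axis i 1) * e $ i)"
    by (simp add: inner_vec_def grad_component)
  also have "\<dots> = D (\<Sum>i\<in>UNIV. e $ i *\<^sub>R axis i 1)"
    using lin by (simp add: linear_sum linear_cmul mult.commute)
  also have "(\<Sum>i\<in>UNIV. e $ i *\<^sub>R axis i 1) = e"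
    using basis_expansion[of e] by (simp add: scalar_mult_eq_scaleR)
  finally show ?thesis .
qed

lemma grad_eqI:
  fixes f :: "real^'n \<Rightarrow> real"
  assumes "(f has_derivative (\<lambda>e. g \<bullet> e)) (at y)"
  shows "grad f y = g"
  using inner_grad[OF assms] by (metis vector_eq_rdot)

lemma grad_continuous:
  fixes \<psi> :: "real^'n \<Rightarrow> real"
  assumes "\<psi> \<in> test_functions U" shows "continuous_on UNIV (grad \<psi>)"
  unfolding grad_def[abs_def]
  by (intro continuous_on_vec_lambda test_continuous[OF test_partial[OF assms]])

lemma compact_support_uniformly_continuous:
  fixes g :: "'a::euclidean_space \<Rightarrow> 'b::metric_space"
  assumes g: "continuous_on UNIV g" "\<And>x. R \<le> norm x \<Longrightarrow> g x = z" and c: "0 < c"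
  obtains \<delta> where "0 < \<delta>" "\<And>x y. dist x y < \<delta> \<Longrightarrow> dist (g x) (g y) < c"
proof -
  have "uniformly_continuous_on (cball 0 (R + 2)) g"
    by (intro compact_uniformly_continuous continuous_on_subset[OF g(1)]) auto
  then obtain \<delta> where \<delta>: "0 < \<delta>" "\<And>x y. x \<in> cball 0 (R + 2) \<Longrightarrow> y \<in> cball 0 (R + 2) \<Longrightarrow> dist y x < \<delta> \<Longrightarrow> dist (g y) (g x) < c"
    unfolding uniformly_continuous_on_def using c by meson
  show ?thesis
  proof (rule that[of "min \<delta> 1"])
    fix x y :: 'a assume d: "dist x y < min \<delta> 1"
    have n: "norm x \<le> norm y + dist x y" "norm y \<le> norm x + dist x y"
      using norm_triangle_sub[of x y] norm_triangle_sub[of y x] by (auto simp: dist_norm norm_minus_commute)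
    show "dist (g x) (g y) < c"
    proof (cases "norm x \<le> R + 1")
      case True
      then show ?thesis using \<delta>(2)[of y x] d n by simp
    next
      case False
      then show ?thesis using g(2)[of x] g(2)[of y] d n c by simp
    qed
  qed (use \<delta> in auto)
qed

section \<open>Square integrable functions\<close>

text \<open>Functions on a domain are treated as functions on the whole space that vanish outside; the
  predicate is \<open>L\<^sup>2\<close> membership for these, and \<open>l2n\<close> below is the seminorm.\<close>

definition l2 :: "('a::euclidean_space \<Rightarrow> 'b::euclidean_space) \<Rightarrow> bool" where
  "l2 f \<longleftrightarrow> f \<in> borel_measurable lborel \<and> integrable lborel (\<lambda>x. (norm (f x))\<^sup>2)"

definition l2n :: "('a::euclidean_space \<Rightarrow> 'b::euclidean_space) \<Rightarrow> real" where
  "l2n f = sqrt (LINT x|lborel. (norm (f x))\<^sup>2)"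

lemma l2_measurable[measurable_dest]: "l2 f \<Longrightarrow> f \<in> borel_measurable lborel"
  by (simp add: l2_def)

lemma l2_measurable': "l2 f \<Longrightarrow> f \<in> borel_measurable borel"
  by (simp add: l2_def)

lemma L2_iff_l2: "f \<in> L2 U \<longleftrightarrow> l2 (\<lambda>x. indicator U x *\<^sub>R f x)"
proof -
  have "(\<lambda>x. (norm (indicator U x *\<^sub>R f x))\<^sup>2) = (\<lambda>x. indicator U x *\<^sub>R (norm (f x))\<^sup>2)"
    by (auto simp: indicator_def)
  then show ?thesis
    by (simp add: L2_def l2_def set_borel_measurable_def set_integrable_def)
qed

lemma l2n_nonneg[simp]: "0 \<le> l2n f"
  by (simp add: l2n_def)

lemma l2n_square: "(l2n f)\<^sup>2 = (LINT x|lborel. (norm (f x))\<^sup>2)"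
  by (simp add: l2n_def)

lemma l2_mult_integrable:
  assumes "l2 f" "l2 g"
  shows "integrable lborel (\<lambda>x. norm (f x) * norm (g x))"
proof (rule Bochner_Integration.integrable_bound)
  show "integrable lborel (\<lambda>x. (norm (f x))\<^sup>2 + (norm (g x))\<^sup>2)"
    using assms by (simp add: l2_def)
  show "(\<lambda>x. norm (f x) * norm (g x)) \<in> borel_measurable lborel"
    using assms[THEN l2_measurable'] by measurable
  have "a * b \<le> a\<^sup>2 + b\<^sup>2" if "0 \<le> a" "0 \<le> b" for a b :: real
    using sum_squares_bound[of a b] mult_nonneg_nonneg[OF that] by linarith
  then show "AE x in lborel. norm (norm (f x) * norm (g x)) \<le> norm ((norm (f x))\<^sup>2 + (norm (g x))\<^sup>2)"
    by (simp add: abs_mult)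
qed

lemma l2_inner_integrable:
  assumes "l2 f" "l2 g"
  shows "integrable lborel (\<lambda>x. f x \<bullet> g x)"
  by (rule Bochner_Integration.integrable_bound[OF l2_mult_integrable[OF assms]])
     (use assms in \<open>auto simp: l2_def Cauchy_Schwarz_ineq2 abs_mult\<close>)

lemma l2_real_mult_integrable:
  fixes f g :: "'a::euclidean_space \<Rightarrow> real"
  assumes "l2 f" "l2 g" shows "integrable lborel (\<lambda>x. f x * g x)"
  using l2_inner_integrable[OF assms] by simp

lemma l2_cauchy_schwarz_norm:
  assumes "l2 f" "l2 g"
  shows "(LINT x|lborel. norm (f x) * norm (g x)) \<le> l2n f * l2n g"
proof -
  let ?P = "LINT x|lborel. norm (f x) * norm (g x)"
  define F where "F = l2n f"
  define G where "G = l2n g"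
  have F: "F\<^sup>2 = (LINT x|lborel. (norm (f x))\<^sup>2)" and G: "G\<^sup>2 = (LINT x|lborel. (norm (g x))\<^sup>2)"
    by (simp_all add: F_def G_def l2n_square)
  have i: "integrable lborel (\<lambda>x. (norm (f x))\<^sup>2)" "integrable lborel (\<lambda>x. (norm (g x))\<^sup>2)"
    using assms by (auto simp: l2_def)
  \<comment> \<open>positivity of the integral of the square of \<open>a |f| - b |g|\<close>\<close>
  have key: "2 * a * b * ?P \<le> a\<^sup>2 * F\<^sup>2 + b\<^sup>2 * G\<^sup>2" for a b
  proof -
    have "0 \<le> (LINT x|lborel. (a * norm (f x) - b * norm (g x))\<^sup>2)" by simp
    also have "\<dots> = (LINT x|lborel. a\<^sup>2 * (norm (f x))\<^sup>2 - 2 * a * b * (norm (f x) * norm (g x)) + b\<^sup>2 * (norm (g x))\<^sup>2)"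
      by (intro Bochner_Integration.integral_cong) (auto simp: power2_eq_square algebra_simps)
    also have "\<dots> = a\<^sup>2 * F\<^sup>2 - 2 * a * b * ?P + b\<^sup>2 * G\<^sup>2"
      using i l2_mult_integrable[OF assms] by (simp add: F G)
    finally show ?thesis by simp
  qed
  have "0 \<le> F" "0 \<le> G" by (simp_all add: F_def G_def)
  have P0: "0 \<le> ?P" by (intro integral_nonneg_AE) auto
  show ?thesis
  proof (cases "F = 0 \<or> G = 0")
    case False
    then have "0 < F" "0 < G" using \<open>0 \<le> F\<close> \<open>0 \<le> G\<close> by auto
    have "2 * (F * G) * ?P \<le> 2 * (F * G) * (F * G)"
      using key[of G F] by (simp add: power2_eq_square algebra_simps)
    then show ?thesis using \<open>0 < F\<close> \<open>0 < G\<close> by (simp add: F_def G_def)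
  next
    case True
    have "?P \<le> 0"
    proof (rule ccontr)
      assume "\<not> ?P \<le> 0"
      then have p: "0 < ?P" by simp
      from True show False
      proof
        assume "F = 0"
        then have "2 * a * ?P \<le> G\<^sup>2" for a using key[of a 1] by simp
        \<comment> \<open>as a is arbitrary, its coefficient cannot be positive\<close>
        from this[of "(G\<^sup>2 + 1) / ?P"] p zero_le_power2[of G] show False by simp
      next
        assume "G = 0"
        then have "2 * a * ?P \<le> F\<^sup>2" for a using key[of 1 a] by simp
        from this[of "(F\<^sup>2 + 1) / ?P"] p zero_le_power2[of F] show False by simp
      qed
    qed
    then show ?thesis using \<open>0 \<le> F\<close> \<open>0 \<le> G\<close> by (metis F_def G_def mult_nonneg_nonneg order_trans)
  qed
qed

lemma l2_cauchy_schwarz: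
  assumes "l2 f" "l2 g"
  shows "\<bar>LINT x|lborel. f x \<bullet> g x\<bar> \<le> l2n f * l2n g"
proof -
  have "\<bar>LINT x|lborel. f x \<bullet> g x\<bar> \<le> (LINT x|lborel. \<bar>f x \<bullet> g x\<bar>)"
    by (rule integral_abs_bound)
  also have "\<dots> \<le> (LINT x|lborel. norm (f x) * norm (g x))"
    using assms by (intro integral_mono l2_mult_integrable integrable_abs l2_inner_integrable Cauchy_Schwarz_ineq2)
  also have "\<dots> \<le> l2n f * l2n g" by (rule l2_cauchy_schwarz_norm[OF assms])
  finally show ?thesis .
qed

lemma l2_add:
  assumes "l2 f" "l2 g" shows "l2 (\<lambda>x. f x + g x)"
  unfolding l2_def
proof
  show "(\<lambda>x. f x + g x) \<in> borel_measurable lborel" using assms[THEN l2_measurable'] by measurable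
  show "integrable lborel (\<lambda>x. (norm (f x + g x))\<^sup>2)"
  proof (rule Bochner_Integration.integrable_bound)
    show "integrable lborel (\<lambda>x. 2 * (norm (f x))\<^sup>2 + 2 * (norm (g x))\<^sup>2)" using assms by (simp add: l2_def)
    show "(\<lambda>x. (norm (f x + g x))\<^sup>2) \<in> borel_measurable lborel" using assms[THEN l2_measurable'] by measurable
    have "(norm (u + v))\<^sup>2 \<le> 2 * (norm u)\<^sup>2 + 2 * (norm v)\<^sup>2" for u v :: 'b
    proof -
      have "(norm (u + v))\<^sup>2 \<le> (norm u + norm v)\<^sup>2" by (simp add: norm_triangle_ineq power_mono)
      also have "\<dots> \<le> 2 * (norm u)\<^sup>2 + 2 * (norm v)\<^sup>2" using sum_squares_bound[of "norm u" "norm v"]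
        by (simp add: power2_sum)
      finally show ?thesis .
    qed
    then show "AE x in lborel. norm ((norm (f x + g x))\<^sup>2) \<le> norm (2 * (norm (f x))\<^sup>2 + 2 * (norm (g x))\<^sup>2)"
      by simp
  qed
qed

lemma l2_mult_bounded:
  fixes m :: "'a::euclidean_space \<Rightarrow> real"
  assumes f: "l2 f" and m: "m \<in> borel_measurable lborel" and b: "\<And>x. \<bar>m x\<bar> \<le> B"
  shows "l2 (\<lambda>x. m x *\<^sub>R f x)" "l2n (\<lambda>x. m x *\<^sub>R f x) \<le> B * l2n f"
proof -
  have le: "(norm (m x *\<^sub>R f x))\<^sup>2 \<le> B\<^sup>2 * (norm (f x))\<^sup>2" for x
    using b[of x] by (simp add: power_mult_distrib mult_right_mono abs_le_square_iff[symmetric])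
  have "0 \<le> B" using b[of undefined] by linarith
  have mm: "(\<lambda>x. m x *\<^sub>R f x) \<in> borel_measurable lborel" using l2_measurable'[OF f] m by measurable
  have i: "integrable lborel (\<lambda>x. (norm (m x *\<^sub>R f x))\<^sup>2)"
  proof (rule Bochner_Integration.integrable_bound)
    show "integrable lborel (\<lambda>x. B\<^sup>2 * (norm (f x))\<^sup>2)" using f by (simp add: l2_def)
    show "(\<lambda>x. (norm (m x *\<^sub>R f x))\<^sup>2) \<in> borel_measurable lborel" using mm by measurable
    show "AE x in lborel. norm ((norm (m x *\<^sub>R f x))\<^sup>2) \<le> norm (B\<^sup>2 * (norm (f x))\<^sup>2)" using le by simp
  qed
  show "l2 (\<lambda>x. m x *\<^sub>R f x)" using mm i by (simp add: l2_def)
  have "(l2n (\<lambda>x. m x *\<^sub>R f x))\<^sup>2 \<le> (LINT x|lborel. B\<^sup>2 * (norm (f x))\<^sup>2)"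
    unfolding l2n_square using f by (intro integral_mono i le) (simp add: l2_def)
  also have "\<dots> = (B * l2n f)\<^sup>2" by (simp add: l2n_square power_mult_distrib)
  finally show "l2n (\<lambda>x. m x *\<^sub>R f x) \<le> B * l2n f" using \<open>0 \<le> B\<close> by (simp add: power2_le_iff_abs_le)
qed

lemma l2_scaleR: "l2 f \<Longrightarrow> l2 (\<lambda>x. c *\<^sub>R f x)"
  by (rule l2_mult_bounded(1)[where B="\<bar>c\<bar>"]) auto

lemma l2_mult: "l2 f \<Longrightarrow> l2 (\<lambda>x. c * f x :: real)"
  using l2_scaleR[of f c] by simp

lemma l2_minus: "l2 f \<Longrightarrow> l2 (\<lambda>x. - f x)"
  using l2_scaleR[of f "-1"] by simp

lemma l2_diff: "l2 f \<Longrightarrow> l2 g \<Longrightarrow> l2 (\<lambda>x. f x - g x)"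
  using l2_add[OF _ l2_minus, of f g] by simp

lemma l2_zero: "l2 (\<lambda>x. 0)"
  by (simp add: l2_def)

lemma l2_sum: "(\<And>i. i \<in> I \<Longrightarrow> l2 (f i)) \<Longrightarrow> l2 (\<lambda>x. \<Sum>i\<in>I. f i x)"
  by (induction I rule: infinite_finite_induct) (auto intro: l2_add l2_zero)

lemma l2n_triangle:
  assumes "l2 f" "l2 g" shows "l2n (\<lambda>x. f x + g x) \<le> l2n f + l2n g"
proof -
  have "(l2n (\<lambda>x. f x + g x))\<^sup>2 = (LINT x|lborel. (norm (f x))\<^sup>2 + 2 * (f x \<bullet> g x) + (norm (g x))\<^sup>2)"
    unfolding l2n_square
    by (intro Bochner_Integration.integral_cong) (simp_all add: power2_norm_eq_inner inner_add inner_commute)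
  also have "\<dots> = (l2n f)\<^sup>2 + 2 * (LINT x|lborel. f x \<bullet> g x) + (l2n g)\<^sup>2"
    using assms l2_inner_integrable[OF assms] by (simp add: l2n_square l2_def)
  also have "\<dots> \<le> (l2n f)\<^sup>2 + 2 * (l2n f * l2n g) + (l2n g)\<^sup>2"
    using l2_cauchy_schwarz[OF assms] by simp
  also have "\<dots> = (l2n f + l2n g)\<^sup>2" by (simp add: power2_sum)
  finally show ?thesis by (simp add: power2_le_iff_abs_le)
qed

lemma l2n_diff_commute: "l2n (\<lambda>x. f x - g x) = l2n (\<lambda>x. g x - f x)"
  by (simp add: l2n_def norm_minus_commute)

lemma l2n_triangle_diff:
  assumes "l2 f" "l2 g" "l2 h"
  shows "l2n (\<lambda>x. f x - h x) \<le> l2n (\<lambda>x. f x - g x) + l2n (\<lambda>x. g x - h x)"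
  using l2n_triangle[OF l2_diff[OF assms(1,2)] l2_diff[OF assms(2,3)]] by simp

lemma l2n_zero[simp]: "l2n (\<lambda>x. 0) = 0"
  by (simp add: l2n_def)

lemma l2n_sum_le: "(\<And>i. i \<in> I \<Longrightarrow> l2 (f i)) \<Longrightarrow> l2n (\<lambda>x. \<Sum>i\<in>I. f i x) \<le> (\<Sum>i\<in>I. l2n (f i))"
proof (induction I rule: infinite_finite_induct)
  case (insert a F)
  have "l2n (\<lambda>x. f a x + (\<Sum>i\<in>F. f i x)) \<le> l2n (f a) + l2n (\<lambda>x. \<Sum>i\<in>F. f i x)"
    using insert by (intro l2n_triangle l2_sum) auto
  with insert show ?case by simp
qed auto

lemma l2_norm_dominated:
  assumes "f \<in> borel_measurable lborel" "l2 g" "\<And>x. norm (f x) \<le> norm (g x)"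
  shows "l2 f" "l2n f \<le> l2n g"
proof -
  have i: "integrable lborel (\<lambda>x. (norm (f x))\<^sup>2)"
    by (rule Bochner_Integration.integrable_bound[where f="\<lambda>x. (norm (g x))\<^sup>2"])
       (use assms in \<open>auto simp: l2_def power_mono\<close>)
  then show "l2 f" using assms by (simp add: l2_def)
  show "l2n f \<le> l2n g" unfolding l2n_def
    using assms i by (intro real_sqrt_le_mono integral_mono) (auto simp: l2_def power_mono)
qed

text \<open>A function and its gradient are kept together as one function with values in a product; its
  squared norm is the squared Sobolev norm of order one.\<close>

lemma l2_Pair:
  assumes "l2 f" "l2 g"
  shows "l2 (\<lambda>x. (f x, g x))"
    and "(l2n (\<lambda>x. (f x, g x)))\<^sup>2 = (l2n f)\<^sup>2 + (l2n g)\<^sup>2"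
proof -
  have m[measurable]: "f \<in> borel_measurable lborel" "g \<in> borel_measurable lborel"
    using assms by (auto simp: l2_def)
  have "(\<lambda>x. (f x, g x)) \<in> borel_measurable lborel" by (intro borel_measurable_Pair) auto
  then show "l2 (\<lambda>x. (f x, g x))" using assms by (simp add: l2_def norm_Pair)
  show "(l2n (\<lambda>x. (f x, g x)))\<^sup>2 = (l2n f)\<^sup>2 + (l2n g)\<^sup>2"
    using assms by (simp add: l2n_square norm_Pair l2_def)
qed

lemma l2n_eq_0_iff:
  assumes "l2 f" shows "l2n f = 0 \<longleftrightarrow> (AE x in lborel. f x = 0)"
proof -
  have "l2n f = 0 \<longleftrightarrow> (LINT x|lborel. (norm (f x))\<^sup>2) = 0" by (simp add: l2n_def)
  also have "\<dots> \<longleftrightarrow> (AE x in lborel. (norm (f x))\<^sup>2 = 0)"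
    by (rule integral_nonneg_eq_0_iff_AE) (use assms in \<open>auto simp: l2_def\<close>)
  finally show ?thesis by simp
qed

lemma l2n_cong_AE:
  assumes "AE x in lborel. f x = g x" "f \<in> borel_measurable lborel" "g \<in> borel_measurable lborel"
  shows "l2n f = l2n g"
proof -
  have "(LINT x|lborel. (norm (f x))\<^sup>2) = (LINT x|lborel. (norm (g x))\<^sup>2)"
    using assms by (intro integral_cong_AE) auto
  then show ?thesis by (simp add: l2n_def)
qed

lemma l2_bounded_compact:
  assumes "f \<in> borel_measurable lborel" "\<And>x. norm (f x) \<le> B" "compact K" "\<And>x. x \<notin> K \<Longrightarrow> f x = 0"
  shows "l2 f" "integrable lborel f"
proof -
  have K: "integrable lborel (indicator K :: _ \<Rightarrow> real)"
    using assms(3) emeasure_compact_finite[of K] by (auto simp: compact_imp_closed borel_closed)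
  have 0: "norm (f x) \<le> B * indicator K x" for x using assms(2,4)[of x] by (cases "x \<in> K") auto
  have 1: "(norm (f x))\<^sup>2 \<le> B\<^sup>2 * indicator K x" for x
    using assms(2,4)[of x] by (cases "x \<in> K") (auto simp: power_mono)
  have [measurable]: "f \<in> borel_measurable borel" using assms by simp
  show "integrable lborel f"
  proof (rule Bochner_Integration.integrable_bound[where f="\<lambda>x. B * indicator K x"])
    show "integrable lborel (\<lambda>x. B * indicator K x)" using K by simp
    show "AE x in lborel. norm (f x) \<le> norm (B * indicator K x)"
      using order_trans[OF 0 abs_ge_self] by simp
  qed (use assms in simp)
  have "integrable lborel (\<lambda>x. (norm (f x))\<^sup>2)"
  proof (rule Bochner_Integration.integrable_bound[where f="\<lambda>x. B\<^sup>2 * indicator K x"])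
    show "integrable lborel (\<lambda>x. B\<^sup>2 * indicator K x)" using K by simp
    show "AE x in lborel. norm ((norm (f x))\<^sup>2) \<le> norm (B\<^sup>2 * indicator K x)"
      using order_trans[OF 1 abs_ge_self] by simp
  qed measurable
  with assms show "l2 f" by (simp add: l2_def)
qed

lemma l2_compact_support:
  fixes f :: "'a::euclidean_space \<Rightarrow> 'b::euclidean_space"
  assumes "continuous_on UNIV f" "compact K" "\<And>x. x \<notin> K \<Longrightarrow> f x = 0"
  shows "l2 f" "integrable lborel f"
proof -
  obtain B where B: "\<And>x. norm (f x) \<le> B" using compact_support_bounded[OF assms] by blast
  have m: "f \<in> borel_measurable lborel" using borel_measurable_continuous_onI[OF assms(1)] by simp
  show "l2 f" by (rule l2_bounded_compact(1)[OF m B assms(2,3)])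
  show "integrable lborel f" by (rule l2_bounded_compact(2)[OF m B assms(2,3)])
qed

lemma test_l2:
  assumes "\<psi> \<in> test_functions U" shows "l2 \<psi>"
proof -
  obtain K where K: "compact K" "\<And>x. x \<notin> K \<Longrightarrow> \<psi> x = 0" by (rule test_functionsE[OF assms]) blast
  show "l2 \<psi>" by (rule l2_compact_support(1)[OF test_continuous[OF assms] K])
qed

lemma test_grad_l2:
  fixes \<psi> :: "real^'n \<Rightarrow> real"
  assumes "\<psi> \<in> test_functions U" shows "l2 (grad \<psi>)"
proof -
  obtain K where K: "compact K" "\<And>x e. x \<notin> K \<Longrightarrow> frechet_derivative \<psi> (at x) e = 0"
    by (rule test_functionsE[OF assms]) blast
  then show ?thesis
    by (intro l2_compact_support(1)[OF grad_continuous[OF assms] K(1)]) (simp add: grad_def vec_eq_iff)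
qed

lemma l2_component:
  fixes F :: "'a::euclidean_space \<Rightarrow> real \<times> 'b::euclidean_space"
  assumes "l2 F"
  shows "l2 (\<lambda>z. fst (F z))" "l2n (\<lambda>z. fst (F z)) \<le> l2n F" "l2 (\<lambda>z. snd (F z))" "l2n (\<lambda>z. snd (F z)) \<le> l2n F"
proof -
  have F: "F \<in> borel_measurable borel" using assms by (simp add: l2_def)
  have c: "continuous_on UNIV (fst :: real \<times> 'b \<Rightarrow> real)" "continuous_on UNIV (snd :: real \<times> 'b \<Rightarrow> 'b)"
    by (intro continuous_intros)+
  have m: "(\<lambda>z. fst (F z)) \<in> borel_measurable lborel" "(\<lambda>z. snd (F z)) \<in> borel_measurable lborel"
    using measurable_compose[OF F borel_measurable_continuous_onI[OF c(1)]] measurable_compose[OF F borel_measurable_continuous_onI[OF c(2)]] by auto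
  have b: "norm (fst (F z)) \<le> norm (F z)" "norm (snd (F z)) \<le> norm (F z)" for z
    using norm_fst_le[of "fst (F z)" "snd (F z)"] norm_snd_le[of "snd (F z)" "fst (F z)"] by simp_all
  show "l2 (\<lambda>z. fst (F z))" by (rule l2_norm_dominated(1)[OF m(1) assms b(1)])
  show "l2n (\<lambda>z. fst (F z)) \<le> l2n F" by (rule l2_norm_dominated(2)[OF m(1) assms b(1)])
  show "l2 (\<lambda>z. snd (F z))" by (rule l2_norm_dominated(1)[OF m(2) assms b(2)])
  show "l2n (\<lambda>z. snd (F z)) \<le> l2n F" by (rule l2_norm_dominated(2)[OF m(2) assms b(2)])
qed

section \<open>Integration by parts\<close>

text \<open>The integral of f is invariant under translation along e, so that the difference quotients
  of f in direction e integrate to zero; dominated convergence passes to the limit.\<close>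

lemma integral_directional_derivative_zero:
  fixes f f' :: "'a::euclidean_space \<Rightarrow> real"
  assumes f: "f \<in> borel_measurable lborel" and f': "f' \<in> borel_measurable lborel"
    and d: "\<And>x. ((\<lambda>s. f (x + s *\<^sub>R e)) has_real_derivative f' x) (at 0)"
    and B: "\<And>x. \<bar>f' x\<bar> \<le> B" and Bf: "\<And>x. \<bar>f x\<bar> \<le> B"
    and K: "compact K" "\<And>x. x \<notin> K \<Longrightarrow> f x = 0"
  shows "(LINT x|lborel. f' x) = 0"
proof -
  have ds: "((\<lambda>s. f (x + s *\<^sub>R e)) has_real_derivative f' (x + s *\<^sub>R e)) (at s)" for x s
  proof -
    have "((\<lambda>h. f ((x + s *\<^sub>R e) + h *\<^sub>R e)) has_real_derivative f' (x + s *\<^sub>R e)) (at (0::real))" by (rule d)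
    then have "((\<lambda>h. f (x + (h + s) *\<^sub>R e)) has_real_derivative f' (x + s *\<^sub>R e)) (at 0)"
      by (simp add: algebra_simps)
    then show ?thesis
      using DERIV_shift[of "\<lambda>s. f (x + s *\<^sub>R e)" "f' (x + s *\<^sub>R e)" 0 s] by simp
  qed
  define h where "h n = 1 / real (Suc n)" for n
  have h: "0 < h n" "h n \<le> 1" for n by (auto simp: h_def)
  define u where "u n x = (f (x + h n *\<^sub>R e) - f x) / h n" for n x
  define K' where "K' = (\<lambda>(x, s). x - s *\<^sub>R e) ` (K \<times> {0..1})"
  have cK': "compact K'" unfolding K'_def
    by (intro compact_continuous_image compact_Times K) (auto simp: case_prod_unfold intro!: continuous_intros)
  have int: "integrable lborel f" using l2_bounded_compact(2)[OF f _ K] Bf by auto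
  have bound: "\<bar>u n x\<bar> \<le> B * indicator K' x" for n x
  proof (cases "x \<in> K'")
    case True
    obtain s where "f (x + h n *\<^sub>R e) - f (x + 0 *\<^sub>R e) = (h n - 0) * f' (x + s *\<^sub>R e)"
      using MVT2[OF h(1), of n "\<lambda>s. f (x + s *\<^sub>R e)" "\<lambda>s. f' (x + s *\<^sub>R e)"] ds by blast
    then have "u n x = f' (x + s *\<^sub>R e)" using h[of n] by (simp add: u_def)
    with B True show ?thesis by simp
  next
    case False
    have "x + s *\<^sub>R e \<notin> K" if "s \<in> {0..1}" for s
      using False that unfolding K'_def by (force simp: image_iff)
    from this[of 0] this[of "h n"] h[of n] K(2) show ?thesis using False by (simp add: u_def)
  qed
  have [measurable]: "f \<in> borel_measurable borel" using f by simp
  have "(\<lambda>n. LINT x|lborel. u n x) \<longlonglongrightarrow> (LINT x|lborel. f' x)"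
  proof (rule integral_dominated_convergence[where w="\<lambda>x. B * indicator K' x"])
    show "integrable lborel (\<lambda>x. B * indicator K' x)"
      using cK' emeasure_compact_finite[of K'] by (auto simp: compact_imp_closed borel_closed)
    show "u n \<in> borel_measurable lborel" for n unfolding u_def[abs_def] by measurable
    show "AE x in lborel. (\<lambda>n. u n x) \<longlonglongrightarrow> f' x"
    proof (rule AE_I2)
      fix x
      have "((\<lambda>s. (f (x + s *\<^sub>R e) - f (x + 0 *\<^sub>R e)) / s) \<longlongrightarrow> f' x) (at 0)"
        using d[of x] by (simp add: has_field_derivative_iff)
      moreover have "filterlim h (at 0) sequentially"
        unfolding filterlim_at using h(1) LIMSEQ_inverse_real_of_nat
        by (auto simp: h_def[abs_def] inverse_eq_divide less_imp_neq[symmetric])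
      ultimately have "(\<lambda>n. (f (x + h n *\<^sub>R e) - f (x + 0 *\<^sub>R e)) / h n) \<longlonglongrightarrow> f' x"
        by (rule filterlim_compose)
      then show "(\<lambda>n. u n x) \<longlonglongrightarrow> f' x" by (simp add: u_def)
    qed
  qed (use f' bound in auto)
  moreover have "(LINT x|lborel. u n x) = 0" for n
  proof -
    have tr: "integrable lborel (\<lambda>x. f (x + h n *\<^sub>R e))" "(LINT x|lborel. f (x + h n *\<^sub>R e)) = (LINT x|lborel. f x)"
    proof -
      have "integrable (distr lborel borel ((+) (h n *\<^sub>R e))) f" using int by (simp add: lborel_distr_plus)
      then show "integrable lborel (\<lambda>x. f (x + h n *\<^sub>R e))"
        by (subst (asm) integrable_distr_eq) (auto simp: add.commute)
      have "(LINT x|lborel. f x) = (LINT x|distr lborel borel ((+) (h n *\<^sub>R e)). f x)"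
        by (simp add: lborel_distr_plus)
      also have "\<dots> = (LINT x|lborel. f (x + h n *\<^sub>R e))"
        by (subst integral_distr) (auto simp: add.commute)
      finally show "(LINT x|lborel. f (x + h n *\<^sub>R e)) = (LINT x|lborel. f x)" by simp
    qed
    then show ?thesis using int by (simp add: u_def)
  qed
  ultimately show ?thesis by (simp add: LIMSEQ_const_iff)
qed

lemma integral_test_derivative_zero:
  fixes \<psi> :: "'a::euclidean_space \<Rightarrow> real"
  assumes "\<psi> \<in> test_functions U"
  shows "(LINT x|lborel. frechet_derivative \<psi> (at x) e) = 0"
proof -
  obtain K where K: "compact K" "\<And>x. x \<notin> K \<Longrightarrow> \<psi> x = 0" by (rule test_functionsE[OF assms]) blast
  obtain B where B: "\<And>x. \<bar>\<psi> x\<bar> \<le> B" using test_bounded[OF assms] by blast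
  obtain B' where B': "\<And>x. \<bar>frechet_derivative \<psi> (at x) e\<bar> \<le> B'"
    using test_bounded[OF test_partial[OF assms, of e]] by blast
  show ?thesis
  proof (rule integral_directional_derivative_zero[where f=\<psi> and B="max B B'" and e=e, OF _ _ _ _ _ K])
    show "\<psi> \<in> borel_measurable lborel" "(\<lambda>x. frechet_derivative \<psi> (at x) e) \<in> borel_measurable lborel"
      using test_l2[OF assms] test_l2[OF test_partial[OF assms]] by (auto simp: l2_def)
    fix x
    have "((\<lambda>s. x + s *\<^sub>R e) has_derivative (\<lambda>s. s *\<^sub>R e)) (at 0)" by (auto intro!: derivative_eq_intros)
    moreover have "(\<psi> has_derivative frechet_derivative \<psi> (at x)) (at (x + 0 *\<^sub>R e))"
      using test_has_derivative[OF assms] by simp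
    ultimately have "((\<lambda>s. \<psi> (x + s *\<^sub>R e)) has_derivative (\<lambda>s. frechet_derivative \<psi> (at x) (s *\<^sub>R e))) (at 0)"
      by (rule has_derivative_compose)
    moreover have "linear (frechet_derivative \<psi> (at x))"
      using test_has_derivative[OF assms] has_derivative_linear by blast
    ultimately show "((\<lambda>s. \<psi> (x + s *\<^sub>R e)) has_real_derivative frechet_derivative \<psi> (at x) e) (at 0)"
      by (simp add: has_field_derivative_def linear_cmul mult_commute_abs)
    show "\<bar>frechet_derivative \<psi> (at x) e\<bar> \<le> max B B'" "\<bar>\<psi> x\<bar> \<le> max B B'"
      using B[of x] B'[of x] by auto
  qed
qed

lemma test_product_derivative:
  fixes \<psi> \<rho> :: "'a::euclidean_space \<Rightarrow> real"
  assumes "\<psi> \<in> test_functions U" "\<rho> \<in> test_functions V"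
  shows "frechet_derivative (\<lambda>x. \<psi> x * \<rho> x) (at x) e
    = \<psi> x * frechet_derivative \<rho> (at x) e + frechet_derivative \<psi> (at x) e * \<rho> x"
proof -
  have "((\<lambda>x. \<psi> x * \<rho> x) has_derivative
    (\<lambda>e. \<psi> x * frechet_derivative \<rho> (at x) e + frechet_derivative \<psi> (at x) e * \<rho> x)) (at x)"
    by (intro has_derivative_mult test_has_derivative[OF assms(1)] test_has_derivative[OF assms(2)])
  from frechet_derivative_at[OF this, symmetric] show ?thesis by simp
qed

lemma test_integration_by_parts:
  fixes \<psi> \<rho> :: "'a::euclidean_space \<Rightarrow> real"
  assumes \<psi>: "\<psi> \<in> test_functions U" and \<rho>: "\<rho> \<in> test_functions V"
  shows "(LINT x|lborel. \<psi> x * frechet_derivative \<rho> (at x) e)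
       = - (LINT x|lborel. frechet_derivative \<psi> (at x) e * \<rho> x)"
proof -
  have "\<And>k. Ck k UNIV \<psi>" using \<psi> by (simp add: test_functions_def)
  then have "(LINT x|lborel. frechet_derivative (\<lambda>x. \<psi> x * \<rho> x) (at x) e) = 0"
    by (intro integral_test_derivative_zero[where U=V] test_mult_smooth \<rho>)
  moreover have "integrable lborel (\<lambda>x. \<psi> x * frechet_derivative \<rho> (at x) e)"
     "integrable lborel (\<lambda>x. frechet_derivative \<psi> (at x) e * \<rho> x)"
    by (intro l2_real_mult_integrable test_l2[OF \<psi>] test_l2[OF \<rho>] test_l2[OF test_partial[OF \<psi>]] test_l2[OF test_partial[OF \<rho>]])+
  ultimately show ?thesis by (simp add: test_product_derivative[OF \<psi> \<rho>])
qed

text \<open>Integrating the derivative of \<open>(x - z) \<bullet> e * \<psi>\<^sup>2\<close> in a unit direction e gives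
  \<open>\<integral>\<psi>\<^sup>2 = - 2 \<integral>((x - z) \<bullet> e) \<psi> \<partial>\<^sub>e\<psi>\<close>, whence the Poincare inequality.\<close>

lemma poincare_test:
  fixes \<psi> :: "real^'n \<Rightarrow> real"
  assumes \<psi>: "\<psi> \<in> test_functions U" and U: "U \<subseteq> cball z M" and M: "0 \<le> M"
  shows "l2n \<psi> \<le> 2 * M * l2n (grad \<psi>)"
proof -
  define e :: "real^'n" where "e = axis undefined 1"
  have e1: "norm e = 1" by (simp add: e_def)
  obtain K where K: "\<And>k. Ck k UNIV \<psi>" "K \<subseteq> U" "\<And>x. x \<notin> K \<Longrightarrow> \<psi> x = 0"
    by (rule test_functionsE[OF \<psi>]) blast
  define w where "w x = (x \<bullet> e + (- (z \<bullet> e))) * \<psi> x" for x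
  have "Ck k UNIV (\<lambda>x. x \<bullet> e)" for k
  proof -
    have "Ck k UNIV (\<lambda>t::real. t)"
    proof (cases k)
      case (Suc j)
      then show ?thesis by (simp add: Ck_const)
    qed simp
    from Ck_compose_affine[OF _ this, of "\<lambda>x. x \<bullet> e" 0] show ?thesis
      by (simp add: linear_iff inner_left_distrib)
  qed
  then have w: "w \<in> test_functions U" unfolding w_def[abs_def]
    by (intro test_mult_smooth \<psi> Ck_add Ck_const)
  have dw: "frechet_derivative w (at x) e = \<psi> x + (x \<bullet> e - z \<bullet> e) * frechet_derivative \<psi> (at x) e" for x
  proof -
    have "(w has_derivative (\<lambda>v. (x \<bullet> e + (- (z \<bullet> e))) * frechet_derivative \<psi> (at x) v + (v \<bullet> e) * \<psi> x)) (at x)"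
      unfolding w_def[abs_def] by (auto intro!: derivative_eq_intros test_has_derivative[OF \<psi>])
    from frechet_derivative_at[OF this, symmetric] show ?thesis using e1 by (simp add: norm_eq_1)
  qed
  let ?d = "\<lambda>x. frechet_derivative \<psi> (at x) e"
  have l: "l2 \<psi>" "l2 w" "l2 ?d" "l2 (grad \<psi>)"
    using \<psi> w test_partial[OF \<psi>] test_grad_l2 by (auto intro: test_l2)
  have wd: "\<bar>w x\<bar> \<le> M * \<bar>\<psi> x\<bar>" for x
  proof (cases "x \<in> K")
    case True
    then have "norm (x - z) \<le> M" using K(2) U by (auto simp: dist_norm norm_minus_commute)
    moreover have "\<bar>(x - z) \<bullet> e\<bar> \<le> norm (x - z)" using Cauchy_Schwarz_ineq2[of "x - z" e] e1 by simp
    ultimately show ?thesis by (simp add: w_def inner_diff_left abs_mult mult_right_mono)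
  qed (simp add: w_def K)
  have "(LINT x|lborel. \<psi> x * frechet_derivative w (at x) e) = - (LINT x|lborel. ?d x * w x)"
    by (rule test_integration_by_parts[OF \<psi> w])
  moreover have "(LINT x|lborel. \<psi> x * frechet_derivative w (at x) e) = (LINT x|lborel. \<psi> x * \<psi> x + ?d x * w x)"
    by (intro Bochner_Integration.integral_cong) (auto simp: dw w_def algebra_simps)
  moreover have "\<dots> = (l2n \<psi>)\<^sup>2 + (LINT x|lborel. ?d x * w x)"
    using l2_real_mult_integrable[OF l(3,2)] l2_real_mult_integrable[OF l(1,1)] by (simp add: l2n_square flip: power2_eq_square)
  ultimately have "(l2n \<psi>)\<^sup>2 = - 2 * (LINT x|lborel. ?d x * w x)" by linarith
  also have "\<dots> \<le> 2 * (l2n ?d * l2n w)" using l2_cauchy_schwarz[OF l(3,2)] unfolding inner_real_def by linarith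
  also have "\<dots> \<le> 2 * (l2n (grad \<psi>) * (M * l2n \<psi>))"
  proof -
    have "l2n ?d \<le> l2n (grad \<psi>)"
    proof (rule l2_norm_dominated(2))
      show "norm (?d x) \<le> norm (grad \<psi> x)" for x
        using inner_grad[OF test_has_derivative[OF \<psi>], of x e] Cauchy_Schwarz_ineq2[of "grad \<psi> x" e] e1 by simp
    qed (use l in \<open>auto simp: l2_def\<close>)
    moreover have "l2n w \<le> l2n (\<lambda>x. M *\<^sub>R \<psi> x)"
      by (rule l2_norm_dominated(2)) (use l l2_scaleR[OF l(1), of M] wd M in \<open>auto simp: l2_def abs_mult\<close>)
    moreover have "l2n (\<lambda>x. M *\<^sub>R \<psi> x) \<le> M * l2n \<psi>" using M by (intro l2_mult_bounded l) auto
    ultimately show ?thesis by (intro mult_left_mono mult_mono) auto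
  qed
  finally have "l2n \<psi> * l2n \<psi> \<le> (2 * M * l2n (grad \<psi>)) * l2n \<psi>" by (simp add: power2_eq_square mult_ac)
  then show ?thesis using M by (cases "l2n \<psi> = 0") (auto simp: less_le)
qed

section \<open>Uniqueness of the weak gradient\<close>

lemma AE_cbox_imp_box: "AE x in lborel. x \<in> cbox a b \<longrightarrow> x \<in> box a (b::'a::euclidean_space)"
proof -
  have "cbox a b - box a b \<in> null_sets lborel"
    using negligible_frontier_interval[of a b]
    by (simp add: negligible_iff_null_sets null_sets_completion_iff)
  from AE_not_in[OF this] show ?thesis by eventually_elim auto
qed

text \<open>Bumps converge to indicators of boxes, and boxes form an intersection stable generator of the
  Borel sets: d has integral zero over every Borel set in a box, in particular over the sets where
  it is positive and where it is negative.\<close>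

lemma fundamental_lemma_calculus_of_variations:
  fixes d :: "'a::euclidean_space \<Rightarrow> real"
  assumes "open U" and d: "l2 d"
    and 0: "\<And>\<psi>. \<psi> \<in> test_functions U \<Longrightarrow> (LINT x|lborel. d x * \<psi> x) = 0"
  shows "AE x in lborel. x \<in> U \<longrightarrow> d x = 0"
proof -
  have dm[measurable]: "d \<in> borel_measurable borel" using d by (simp add: l2_def)
  have box_int: "integrable lborel (\<lambda>x. \<bar>d x\<bar> * indicator (cbox a b) x)" for a b
  proof -
    have "l2 (indicator (cbox a b) :: 'a \<Rightarrow> real)" by (rule l2_bounded_compact[of _ 1 "cbox a b"]) auto
    from l2_mult_integrable[OF d this] show ?thesis by simp
  qed
  have box0: "(LINT x|lborel. d x * indicator (box a b) x) = 0" if "cbox a b \<subseteq> U" for a b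
  proof -
    have "(\<lambda>m. LINT x|lborel. d x * box_bump a b m x) \<longlonglongrightarrow> (LINT x|lborel. d x * indicator (box a b) x)"
    proof (rule integral_dominated_convergence[where w="\<lambda>x. \<bar>d x\<bar> * indicator (cbox a b) x", OF _ _ box_int])
      show "(\<lambda>x. d x * box_bump a b m x) \<in> borel_measurable lborel" for m
        using l2_measurable'[OF test_l2[OF test_box_bump[of a b UNIV m]]] by simp
      show "AE x in lborel. (\<lambda>m. d x * box_bump a b m x) \<longlonglongrightarrow> d x * indicator (box a b) x"
        by (intro AE_I2 tendsto_mult tendsto_const box_bump_tendsto)
      show "AE x in lborel. norm (d x * box_bump a b m x) \<le> \<bar>d x\<bar> * indicator (cbox a b) x" for m
      proof (rule AE_I2)
        fix x
        have "\<bar>box_bump a b m x\<bar> \<le> indicator (cbox a b) x"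
          using box_bump_nonneg[of a b m x] box_bump_le_1[of a b m x] box_bump_eq_0[of x a b m] box_subset_cbox
          by (auto simp: indicator_def)
        then show "norm (d x * box_bump a b m x) \<le> \<bar>d x\<bar> * indicator (cbox a b) x"
          by (simp add: abs_mult mult_left_mono)
      qed
    qed auto
    moreover have "(LINT x|lborel. d x * box_bump a b m x) = 0" for m using 0[OF test_box_bump[OF that]] .
    ultimately show ?thesis by (simp add: LIMSEQ_const_iff)
  qed
  have cb: "AE x in lborel. x \<in> cbox a b \<longrightarrow> d x = 0" if U: "cbox a b \<subseteq> U" for a b
  proof -
    define B where "B = box a b"
    have [measurable]: "B \<in> sets borel" by (simp add: B_def)
    have int: "integrable lborel (\<lambda>x. d x * indicator (A \<inter> B) x)" if "A \<in> sets borel" for A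
      by (rule Bochner_Integration.integrable_bound[OF box_int[of a b]])
         (use that box_subset_cbox[of a b] in \<open>auto simp: B_def indicator_def abs_mult\<close>)
    have A0: "(LINT x|lborel. d x * indicator (A \<inter> B) x) = 0" if "A \<in> sets borel" for A
    proof -
      let ?G = "range (\<lambda>(a, b). box a b :: 'a set)"
      have "Int_stable ?G" by (auto simp: Int_stable_def box_Int_box)
      moreover have "?G \<subseteq> Pow UNIV" by simp
      moreover have "A \<in> sigma_sets UNIV ?G" using that unfolding borel_eq_box by simp
      ultimately show ?thesis
      proof (induction rule: sigma_sets_induct_disjoint)
        case (basic A)
        then obtain p q where "A = box p q" by auto
        define p' where "p' = (\<Sum>i\<in>Basis. max (p \<bullet> i) (a \<bullet> i) *\<^sub>R i)"
        define q' where "q' = (\<Sum>i\<in>Basis. min (q \<bullet> i) (b \<bullet> i) *\<^sub>R i)"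
        have e: "A \<inter> B = box p' q'" by (simp add: \<open>A = _\<close> B_def box_Int_box p'_def q'_def)
        show ?case
        proof (cases "box p' q' = {}")
          case False
          then have "cbox p' q' \<subseteq> cbox a b"
            by (auto simp: mem_box p'_def q'_def inner_sum_left_Basis)
          with U show ?thesis unfolding e by (intro box0) auto
        qed (simp add: e)
      next
        case empty
        then show ?case by simp
      next
        case (compl A)
        then have A: "A \<in> sets borel" by (simp add: borel_eq_box)
        have "(LINT x|lborel. d x * indicator ((UNIV - A) \<inter> B) x)
          = (LINT x|lborel. d x * indicator (UNIV \<inter> B) x - d x * indicator (A \<inter> B) x)"
          by (intro Bochner_Integration.integral_cong) (auto simp: indicator_def)
        also have "\<dots> = (LINT x|lborel. d x * indicator (UNIV \<inter> B) x) - (LINT x|lborel. d x * indicator (A \<inter> B) x)"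
          by (intro Bochner_Integration.integral_diff int A) auto
        also have "\<dots> = 0" using compl box0[OF U] by (simp add: B_def)
        finally show ?case .
      next
        case (union A)
        then have Am: "\<And>i. A i \<in> sets borel" by (auto simp: borel_eq_box)
        have S: "(\<lambda>i. indicator (A i \<inter> B) x :: real) sums indicator (\<Union>i. A i \<inter> B) x" for x
          using union(1) by (intro indicator_sums) (auto simp: disjoint_family_on_def)
        have sub: "(\<Union>i. A i \<inter> B) \<subseteq> cbox a b" using box_subset_cbox[of a b] by (auto simp: B_def)
        have "(\<lambda>n. LINT x|lborel. (\<Sum>i<n. d x * indicator (A i \<inter> B) x))
          \<longlonglongrightarrow> (LINT x|lborel. d x * indicator (\<Union>i. A i \<inter> B) x)"
        proof (rule integral_dominated_convergence[where w="\<lambda>x. \<bar>d x\<bar> * indicator (cbox a b) x", OF _ _ box_int])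
          show "AE x in lborel. (\<lambda>n. \<Sum>i<n. d x * indicator (A i \<inter> B) x) \<longlonglongrightarrow> d x * indicator (\<Union>i. A i \<inter> B) x"
            using sums_mult[OF S] by (simp add: sums_def)
          show "AE x in lborel. norm (\<Sum>i<n. d x * indicator (A i \<inter> B) x) \<le> \<bar>d x\<bar> * indicator (cbox a b) x" for n
          proof (rule AE_I2)
            fix x
            have "(\<Sum>i<n. indicator (A i \<inter> B) x :: real) \<le> indicator (\<Union>i. A i \<inter> B) x"
              using sum_le_suminf[OF sums_summable[OF S], of "{..<n}" x] sums_unique[OF S, of x] by simp
            also have "\<dots> \<le> indicator (cbox a b) x" using sub by (auto simp: indicator_def)
            finally have "\<bar>d x\<bar> * (\<Sum>i<n. indicator (A i \<inter> B) x :: real) \<le> \<bar>d x\<bar> * indicator (cbox a b) x"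
              by (intro mult_left_mono) auto
            moreover have "norm (\<Sum>i<n. d x * indicator (A i \<inter> B) x) = \<bar>d x\<bar> * (\<Sum>i<n. indicator (A i \<inter> B) x :: real)"
              by (simp add: abs_mult sum_nonneg flip: sum_distrib_left)
            ultimately show "norm (\<Sum>i<n. d x * indicator (A i \<inter> B) x) \<le> \<bar>d x\<bar> * indicator (cbox a b) x" by simp
          qed
        qed (use Am in auto)
        moreover have "(LINT x|lborel. (\<Sum>i<n. d x * indicator (A i \<inter> B) x)) = 0" for n
          using int Am union(3) by (subst Bochner_Integration.integral_sum) auto
        ultimately have "(LINT x|lborel. d x * indicator (\<Union>i. A i \<inter> B) x) = 0" by (simp only: LIMSEQ_const_iff)
        moreover have "(\<Union>i. A i \<inter> B) = (\<Union>i. A i) \<inter> B" by blast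
        ultimately show ?case by (simp only:)
      qed
    qed
    have p: "{x. 0 < d x} \<in> sets borel" "{x. d x < 0} \<in> sets borel" by measurable
    have "AE x in lborel. d x * indicator ({x. 0 < d x} \<inter> B) x = 0"
      using A0[OF p(1)] by (subst integral_nonneg_eq_0_iff_AE[OF int[OF p(1)], symmetric])
        (auto simp: indicator_def simp del: indicator_simps)
    moreover have "AE x in lborel. - (d x * indicator ({x. d x < 0} \<inter> B) x) = 0"
    proof (subst integral_nonneg_eq_0_iff_AE[symmetric])
      show "integrable lborel (\<lambda>x. - (d x * indicator ({x. d x < 0} \<inter> B) x))" using int[OF p(2)] by simp
      show "(LINT x|lborel. - (d x * indicator ({x. d x < 0} \<inter> B) x)) = 0" using A0[OF p(2)] by simp
    qed (auto simp: indicator_def)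
    ultimately show ?thesis using AE_cbox_imp_box[of a b]
      by eventually_elim (auto simp: B_def indicator_def split: if_splits)
  qed
  obtain \<D> where \<D>: "countable \<D>" "\<And>X. X \<in> \<D> \<Longrightarrow> X \<subseteq> U \<and> (\<exists>a b. X = cbox a b)" "\<Union>\<D> = U"
    using open_countable_Union_open_cbox[OF \<open>open U\<close>] by (metis Pow_iff subset_iff)
  have "AE x in lborel. \<forall>X\<in>\<D>. x \<in> X \<longrightarrow> d x = 0"
  proof (subst AE_ball_countable[OF \<D>(1)], rule ballI)
    fix X assume "X \<in> \<D>"
    with \<D>(2) obtain a b where "X = cbox a b" "cbox a b \<subseteq> U" by blast
    with cb show "AE x in lborel. x \<in> X \<longrightarrow> d x = 0" by blast
  qed
  then show ?thesis by eventually_elim (use \<D>(3) in blast)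
qed

lemma weak_gradient_unique:
  fixes g h :: "real^'n \<Rightarrow> real^'n"
  assumes U: "open U" and g: "weak_gradient U u g" and h: "weak_gradient U u h"
  shows "AE y in lborel. y \<in> U \<longrightarrow> g y = h y"
proof -
  have l: "l2 (\<lambda>y. indicator U y *\<^sub>R g y)" "l2 (\<lambda>y. indicator U y *\<^sub>R h y)"
    using g h by (simp_all add: weak_gradient_def L2_iff_l2)
  have l2c: "l2 (\<lambda>y. f y $ i)" if "l2 f" for f :: "real^'n \<Rightarrow> real^'n" and i
  proof (rule l2_norm_dominated(1)[OF _ that])
    show "(\<lambda>y. f y $ i) \<in> borel_measurable lborel"
      using borel_measurable_inner[OF l2_measurable[OF that] borel_measurable_const, of "axis i 1"]
      by (simp add: inner_axis)
    show "norm (f x $ i) \<le> norm (f x)" for x by (simp add: component_le_norm_cart)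
  qed
  have "AE y in lborel. y \<in> U \<longrightarrow> (indicator U y *\<^sub>R g y) $ i - (indicator U y *\<^sub>R h y) $ i = 0" for i
  proof (rule fundamental_lemma_calculus_of_variations[OF U])
    show "l2 (\<lambda>y. (indicator U y *\<^sub>R g y) $ i - (indicator U y *\<^sub>R h y) $ i)"
      by (intro l2_diff l2c l)
    fix \<psi> assume \<psi>: "\<psi> \<in> test_functions U"
    have "(LINT y:U|lborel. (g y $ i) * \<psi> y) = (LINT y:U|lborel. (h y $ i) * \<psi> y)"
    proof -
      have "(LINT y:U|lborel. u y * (grad \<psi> y $ i)) = - (LINT y:U|lborel. (g y $ i) * \<psi> y)"
        using g \<psi> unfolding weak_gradient_def by blast
      moreover have "(LINT y:U|lborel. u y * (grad \<psi> y $ i)) = - (LINT y:U|lborel. (h y $ i) * \<psi> y)"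
        using h \<psi> unfolding weak_gradient_def by blast
      ultimately show ?thesis by linarith
    qed
    moreover have "(LINT y:U|lborel. (f y $ i) * \<psi> y) = (LINT y|lborel. (indicator U y *\<^sub>R f y) $ i * \<psi> y)" for f :: "real^'n \<Rightarrow> real^'n"
      unfolding set_lebesgue_integral_def by (simp add: mult.assoc)
    moreover have "integrable lborel (\<lambda>y. (indicator U y *\<^sub>R g y) $ i * \<psi> y)" "integrable lborel (\<lambda>y. (indicator U y *\<^sub>R h y) $ i * \<psi> y)"
      by (intro l2_real_mult_integrable l2c l test_l2[OF \<psi>])+
    ultimately show "(LINT y|lborel. ((indicator U y *\<^sub>R g y) $ i - (indicator U y *\<^sub>R h y) $ i) * \<psi> y) = 0"
      by (simp add: left_diff_distrib)
  qed
  then have "AE y in lborel. \<forall>i\<in>UNIV. y \<in> U \<longrightarrow> (indicator U y *\<^sub>R g y) $ i - (indicator U y *\<^sub>R h y) $ i = 0"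
    by (subst AE_finite_all) auto
  then show ?thesis by eventually_elim (auto simp: vec_eq_iff)
qed

section \<open>Approximation in the space of square integrable functions\<close>

lemma l2n_tendsto_dominated:
  fixes f :: "'a::euclidean_space \<Rightarrow> 'b::euclidean_space" and u :: "nat \<Rightarrow> 'a \<Rightarrow> 'b"
  assumes f: "f \<in> borel_measurable lborel" and u: "\<And>n. u n \<in> borel_measurable lborel"
    and w: "integrable lborel w" and b: "\<And>n x. (norm (f x - u n x))\<^sup>2 \<le> w x"
    and lim: "AE x in lborel. (\<lambda>n. u n x) \<longlonglongrightarrow> f x"
  shows "(\<lambda>n. l2n (\<lambda>x. f x - u n x)) \<longlonglongrightarrow> 0"
proof -
  have [measurable]: "f \<in> borel_measurable borel" "u n \<in> borel_measurable borel" for n using f u by auto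
  have "(\<lambda>n. LINT x|lborel. (norm (f x - u n x))\<^sup>2) \<longlonglongrightarrow> (LINT x|(lborel :: 'a measure). 0)"
  proof (rule integral_dominated_convergence[OF _ _ w])
    show "AE x in lborel. (\<lambda>n. (norm (f x - u n x))\<^sup>2) \<longlonglongrightarrow> (0::real)"
      using lim
    proof eventually_elim
      case (elim x)
      have "(\<lambda>n. (norm (f x - u n x))\<^sup>2) \<longlonglongrightarrow> (norm (f x - f x))\<^sup>2"
        by (intro tendsto_intros elim)
      then show ?case by simp
    qed
    show "AE x in lborel. norm ((norm (f x - u n x))\<^sup>2) \<le> w x" for n using b by simp
  qed auto
  then have "(\<lambda>n. sqrt (LINT x|lborel. (norm (f x - u n x))\<^sup>2)) \<longlonglongrightarrow> sqrt 0"
    by (intro tendsto_real_sqrt) simp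
  then show ?thesis by (simp add: l2n_def)
qed

lemma l2_approx_bounded:
  fixes f :: "'a::euclidean_space \<Rightarrow> 'b::euclidean_space"
  assumes f: "l2 f" and e: "0 < e"
  obtains M g where "0 < M" "g \<in> borel_measurable lborel" "\<And>x. norm (g x) \<le> M"
    "\<And>x. x \<notin> cball 0 M \<Longrightarrow> g x = 0" "l2n (\<lambda>x. f x - g x) < e"
proof -
  define u where "u n x = (if norm x \<le> real (Suc n) \<and> norm (f x) \<le> real (Suc n) then f x else 0)" for n x
  have [measurable]: "f \<in> borel_measurable borel" using f by (simp add: l2_def)
  have "(\<lambda>n. l2n (\<lambda>x. f x - u n x)) \<longlonglongrightarrow> 0"
  proof (rule l2n_tendsto_dominated[where w="\<lambda>x. (norm (f x))\<^sup>2"])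
    show "u n \<in> borel_measurable lborel" for n unfolding u_def[abs_def] by measurable
    show "AE x in lborel. (\<lambda>n. u n x) \<longlonglongrightarrow> f x"
    proof (rule AE_I2)
      fix x
      obtain N :: nat where N: "max (norm x) (norm (f x)) \<le> real N" using real_arch_simple by blast
      have "eventually (\<lambda>n. u n x = f x) sequentially"
        using eventually_ge_at_top[of N] by eventually_elim (use N in \<open>auto simp: u_def\<close>)
      then show "(\<lambda>n. u n x) \<longlonglongrightarrow> f x" by (rule tendsto_eventually)
    qed
  qed (use f in \<open>auto simp: l2_def u_def\<close>)
  from LIMSEQ_D[OF this e] obtain n where n: "l2n (\<lambda>x. f x - u n x) < e" by (auto dest: spec[of _ 0])
  show ?thesis
  proof (rule that[OF _ _ _ _ n])
    show "u n \<in> borel_measurable lborel" unfolding u_def[abs_def] by measurable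
  qed (auto simp: u_def)
qed

text \<open>A bounded function with bounded support is almost everywhere the limit of continuous
  functions; cutting these off in the domain and in the range makes the convergence dominated.\<close>

lemma l2_approx_continuous:
  fixes f :: "'a::euclidean_space \<Rightarrow> 'b::euclidean_space"
  assumes f: "l2 f" and e: "0 < e"
  obtains g R where "continuous_on UNIV g" "0 < R" "\<And>x. R \<le> norm x \<Longrightarrow> g x = 0" "l2n (\<lambda>x. f x - g x) < e"
proof -
  obtain M h where h: "0 < M" "h \<in> borel_measurable lborel" "\<And>x. norm (h x) \<le> M"
    "\<And>x. x \<notin> cball 0 M \<Longrightarrow> h x = 0" "l2n (\<lambda>x. f x - h x) < e / 2"
    using l2_approx_bounded[OF f, of "e / 2"] e by auto
  have "h measurable_on UNIV"
    using h(2) by (intro lebesgue_measurable_imp_measurable_on) (auto simp: measurable_completion)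
  then obtain N g where N: "negligible N" and g: "\<And>n. continuous_on UNIV (g n)"
    and lim: "\<And>x. x \<notin> N \<Longrightarrow> (\<lambda>n::nat. g n x) \<longlonglongrightarrow> h x"
    unfolding measurable_on_def by auto
  let ?c = "closest_point (cball 0 M) :: 'b \<Rightarrow> 'b"
  define \<tau> where "\<tau> x = max 0 (min 1 (M + 1 - norm x))" for x :: 'a
  define u where "u n x = \<tau> x *\<^sub>R ?c (g n x)" for n x
  have cc: "continuous_on UNIV ?c" using h(1) by (intro continuous_on_closest_point) auto
  have cM: "norm (?c y) \<le> M" for y
    using closest_point_in_set[of "cball 0 M :: 'b set" y] h(1) by auto
  have cu: "continuous_on UNIV (u n)" for n
    unfolding u_def[abs_def] \<tau>_def
    by (intro continuous_intros continuous_on_compose2[OF cc g]) auto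
  have u0: "u n x = 0" if "M + 1 \<le> norm x" for n x using that by (simp add: u_def \<tau>_def)
  have \<tau>: "0 \<le> \<tau> x" "\<tau> x \<le> 1" for x by (auto simp: \<tau>_def)
  have uM: "norm (u n x) \<le> M" for n x
    using mult_mono[OF \<tau>(2)[of x] cM[of "g n x"]] \<tau> by (simp add: u_def)
  have "(\<lambda>n. l2n (\<lambda>x. h x - u n x)) \<longlonglongrightarrow> 0"
  proof (rule l2n_tendsto_dominated[where w="\<lambda>x. (2 * M)\<^sup>2 * indicator (cball 0 (M + 1)) x"])
    show "integrable lborel (\<lambda>x. (2 * M)\<^sup>2 * indicator (cball 0 (M + 1)) (x::'a))"
      using emeasure_compact_finite[of "cball (0::'a) (M + 1)"] by (auto simp: borel_closed)
    show "u n \<in> borel_measurable lborel" for n using borel_measurable_continuous_onI[OF cu] by simp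
    show "(norm (h x - u n x))\<^sup>2 \<le> (2 * M)\<^sup>2 * indicator (cball 0 (M + 1)) x" for n x
    proof (cases "x \<in> cball 0 (M + 1)")
      case True
      have "norm (h x - u n x) \<le> 2 * M" using norm_triangle_ineq4[of "h x" "u n x"] h(3)[of x] uM[of n x] by simp
      then have "(norm (h x - u n x))\<^sup>2 \<le> (2 * M)\<^sup>2" by (intro power_mono) auto
      then show ?thesis using True by simp
    next
      case False
      then show ?thesis using h(4)[of x] u0[of x n] by simp
    qed
    have "AE x in lebesgue. x \<notin> N" using N by (intro AE_not_in) (simp add: negligible_iff_null_sets)
    then have "AE x in lborel. x \<notin> N" by (simp add: AE_completion_iff)
    then show "AE x in lborel. (\<lambda>n. u n x) \<longlonglongrightarrow> h x"
    proof eventually_elim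
      case (elim x)
      have "isCont ?c (h x)" using cc by (simp add: continuous_on_eq_continuous_at)
      then have "(\<lambda>n. u n x) \<longlonglongrightarrow> \<tau> x *\<^sub>R ?c (h x)"
        unfolding u_def by (intro tendsto_intros isCont_tendsto_compose[OF _ lim[OF elim]])
      moreover have "?c (h x) = h x" using h(3)[of x] by (intro closest_point_self) simp
      moreover have "\<tau> x *\<^sub>R h x = h x" using h(4)[of x] by (cases "norm x \<le> M") (auto simp: \<tau>_def)
      ultimately show ?case by simp
    qed
  qed (use h in auto)
  from LIMSEQ_D[OF this, of "e / 2"] e obtain n where n: "l2n (\<lambda>x. h x - u n x) < e / 2"
    by (auto dest: spec[of _ 0])
  have hl: "l2 h" by (rule l2_bounded_compact(1)[OF h(2,3) compact_cball h(4)])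
  have ul: "l2 (u n)" by (rule l2_compact_support(1)[OF cu compact_cball[of 0 "M + 1"]]) (use u0 in auto)
  show ?thesis
  proof (rule that[OF cu _ u0])
    show "l2n (\<lambda>x. f x - u n x) < e"
      using l2n_triangle_diff[OF f hl ul] h(5) n by simp
  qed (use h(1) in auto)
qed

lemma l2_translate:
  fixes f :: "'a::euclidean_space \<Rightarrow> 'b::euclidean_space"
  assumes "l2 f" shows "l2 (\<lambda>x. f (x - v))" "l2n (\<lambda>x. f (x - v)) = l2n f"
proof -
  have d: "distr lborel borel (\<lambda>x. x - v) = lborel"
  proof -
    have "(\<lambda>x. x - v) = (+) (- v)" by auto
    then show ?thesis using lborel_distr_plus[of "- v"] by simp
  qed
  have [measurable]: "f \<in> borel_measurable borel" using assms by (simp add: l2_def)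
  have "integrable (distr lborel borel (\<lambda>x. x - v)) (\<lambda>x. (norm (f x))\<^sup>2)"
    unfolding d using assms by (simp add: l2_def)
  then have "integrable lborel (\<lambda>x. (norm (f (x - v)))\<^sup>2)"
    by (subst (asm) integrable_distr_eq) auto
  then show "l2 (\<lambda>x. f (x - v))" by (simp add: l2_def)
  have "(LINT x|lborel. (norm (f x))\<^sup>2) = (LINT x|distr lborel borel (\<lambda>x. x - v). (norm (f x))\<^sup>2)" by (simp add: d)
  also have "\<dots> = (LINT x|lborel. (norm (f (x - v)))\<^sup>2)" by (subst integral_distr) auto
  finally show "l2n (\<lambda>x. f (x - v)) = l2n f" by (simp add: l2n_def)
qed

lemma l2n_le_sup:
  fixes f :: "'a::euclidean_space \<Rightarrow> 'b::euclidean_space"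
  assumes f: "f \<in> borel_measurable lborel" and b: "\<And>x. norm (f x) \<le> c" and K: "compact K" "\<And>x. x \<notin> K \<Longrightarrow> f x = 0"
  shows "(l2n f)\<^sup>2 \<le> c\<^sup>2 * measure lborel K"
proof -
  have i: "integrable lborel (\<lambda>x. c\<^sup>2 * indicator K x :: real)"
    using K(1) emeasure_compact_finite[of K] by (auto simp: compact_imp_closed borel_closed)
  have "(l2n f)\<^sup>2 \<le> (LINT x|lborel. c\<^sup>2 * indicator K x)"
    unfolding l2n_square
  proof (rule integral_mono[OF _ i])
    show "integrable lborel (\<lambda>x. (norm (f x))\<^sup>2)" using l2_bounded_compact(1)[OF f b K] by (simp add: l2_def)
    show "(norm (f x))\<^sup>2 \<le> c\<^sup>2 * indicator K x" for x
      using b[of x] K(2)[of x] by (cases "x \<in> K") (auto simp: power_mono)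
  qed
  also have "\<dots> = c\<^sup>2 * measure lborel K"
    using K(1) emeasure_compact_finite[of K] by (simp add: compact_imp_closed borel_closed)
  finally show ?thesis .
qed

text \<open>For a continuous function with compact support this is uniform continuity, and translation
  preserves the error of approximating f by such a function.\<close>

lemma l2_translation_continuous:
  fixes f :: "'a::euclidean_space \<Rightarrow> 'b::euclidean_space"
  assumes f: "l2 f" and e: "0 < e"
  obtains \<delta> where "0 < \<delta>" "\<And>v. norm v < \<delta> \<Longrightarrow> l2n (\<lambda>x. f (x - v) - f x) < e"
proof -
  obtain g R where g: "continuous_on UNIV g" "0 < R" "\<And>x. R \<le> norm x \<Longrightarrow> g x = 0"
    and fg: "l2n (\<lambda>x. f x - g x) < e / 4"
    using l2_approx_continuous[OF f, of "e / 4"] e by auto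
  let ?K = "cball (0::'a) (R + 1)"
  define c where "c = e / (4 * (1 + measure lborel ?K))"
  have c: "0 < c" using e by (simp add: c_def add_pos_nonneg)
  obtain \<delta> where \<delta>: "0 < \<delta>" "\<And>x y. dist x y < \<delta> \<Longrightarrow> dist (g x) (g y) < c"
    using compact_support_uniformly_continuous[OF g(1,3) c] by blast
  have gl: "l2 g" by (rule l2_compact_support(1)[OF g(1) compact_cball[of 0 R]]) (use g in auto)
  show ?thesis
  proof (rule that[of "min \<delta> 1"])
    fix v :: 'a assume v: "norm v < min \<delta> 1"
    have b: "norm (g (x - v) - g x) \<le> c" for x
      using \<delta>(2)[of "x - v" x] v by (simp add: dist_norm less_imp_le)
    have z: "g (x - v) - g x = 0" if "x \<notin> ?K" for x
      using that v norm_triangle_ineq2[of x v] g(3)[of x] g(3)[of "x - v"] by simp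
    have gtl: "l2 (\<lambda>x. g (x - v))" by (rule l2_translate(1)[OF gl])
    have "(l2n (\<lambda>x. g (x - v) - g x))\<^sup>2 \<le> c\<^sup>2 * measure lborel ?K"
      using l2_diff[OF gtl gl] by (intro l2n_le_sup b z) (auto simp: l2_def)
    also have "\<dots> \<le> (e / 4)\<^sup>2"
    proof -
      have m: "0 \<le> measure lborel ?K" by simp
      have "c\<^sup>2 * measure lborel ?K \<le> c\<^sup>2 * (1 + measure lborel ?K)\<^sup>2"
        using m by (intro mult_left_mono) (auto simp: power2_sum)
      also have "\<dots> = (c * (1 + measure lborel ?K))\<^sup>2" by (simp add: power_mult_distrib)
      also have "c * (1 + measure lborel ?K) = e / 4" using m by (simp add: c_def field_simps add_nonneg_eq_0_iff)
      finally show ?thesis .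
    qed
    finally have gg: "l2n (\<lambda>x. g (x - v) - g x) \<le> e / 4" using e by (simp add: power2_le_iff_abs_le)
    have ftl: "l2 (\<lambda>x. f (x - v))" by (rule l2_translate(1)[OF f])
    have "l2n (\<lambda>x. f (x - v) - f x) \<le> l2n (\<lambda>x. f (x - v) - g (x - v)) + l2n (\<lambda>x. g (x - v) - f x)"
      by (rule l2n_triangle_diff[OF ftl gtl f])
    also have "l2n (\<lambda>x. g (x - v) - f x) \<le> l2n (\<lambda>x. g (x - v) - g x) + l2n (\<lambda>x. g x - f x)"
      by (rule l2n_triangle_diff[OF gtl gl f])
    also have "l2n (\<lambda>x. f (x - v) - g (x - v)) = l2n (\<lambda>x. f x - g x)"
      using l2_translate(2)[OF l2_diff[OF f gl]] by simp
    also have "l2n (\<lambda>x. g x - f x) = l2n (\<lambda>x. f x - g x)" by (rule l2n_diff_commute)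
    finally show "l2n (\<lambda>x. f (x - v) - f x) < e" using fg gg e by simp
  qed (use \<delta> in auto)
qed

section \<open>Square integrable functions of space and time\<close>

text \<open>Space comes first and time last in the pairs that make up space-time, so that slices at a fixed
  time are taken in the second component.\<close>

lemma fubini_time_last:
  fixes F :: "'a::euclidean_space \<times> real \<Rightarrow> 'b::euclidean_space"
  assumes "integrable lborel F"
  shows "AE t in lborel. integrable lborel (\<lambda>x. F (x, t))"
    and "integrable lborel (\<lambda>t. LINT x|lborel. F (x, t))"
    and "(LINT t|lborel. LINT x|lborel. F (x, t)) = (LINT z|lborel. F z)"
proof -
  have "integrable (lborel \<Otimes>\<^sub>M lborel) (\<lambda>(x, t). F (x, t))" using assms by (simp add: lborel_prod)
  note * = lborel_pair.AE_integrable_snd[OF this] lborel_pair.integrable_snd[OF this] lborel_pair.integral_snd[OF this]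
  show "AE t in lborel. integrable lborel (\<lambda>x. F (x, t))" "integrable lborel (\<lambda>t. LINT x|lborel. F (x, t))"
    "(LINT t|lborel. LINT x|lborel. F (x, t)) = (LINT z|lborel. F z)"
    using * by (simp_all add: lborel_prod)
qed

lemma integrable_tensor:
  fixes f :: "'a::euclidean_space \<Rightarrow> real" and g :: "'c::euclidean_space \<Rightarrow> real"
  assumes "integrable lborel f" "integrable lborel g"
  shows "integrable (lborel \<Otimes>\<^sub>M lborel) (\<lambda>(x, s). f x * g s)"
proof (rule lborel_pair.Fubini_integrable)
  have [measurable]: "f \<in> borel_measurable borel" "g \<in> borel_measurable borel" using assms by auto
  show "(\<lambda>(x, s). f x * g s) \<in> borel_measurable (lborel \<Otimes>\<^sub>M lborel)" by measurable
  show "integrable lborel (\<lambda>x. LINT s|lborel. norm (case (x, s) of (x, s) \<Rightarrow> f x * g s))"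
    using assms by (simp add: abs_mult)
  show "AE x in lborel. integrable lborel (\<lambda>s. case (x, s) of (x, s) \<Rightarrow> f x * g s)" using assms by simp
qed

lemma slice_measurable:
  assumes "F \<in> borel_measurable (lborel :: ('a::euclidean_space \<times> 'c::euclidean_space) measure)"
  shows "(\<lambda>x. F (x, t)) \<in> borel_measurable lborel"
proof -
  have [measurable]: "F \<in> borel_measurable borel" using assms by simp
  have "(\<lambda>x::'a. (x, t)) \<in> borel_measurable borel"
    by (intro borel_measurable_continuous_onI continuous_intros)
  then show ?thesis by measurable
qed

lemma l2_slices: 
  fixes F :: "'a::euclidean_space \<times> real \<Rightarrow> 'b::euclidean_space"
  assumes "l2 F" shows "AE t in lborel. l2 (\<lambda>x. F (x, t))"
proof -
  have "integrable lborel (\<lambda>z. (norm (F z))\<^sup>2)" using assms by (simp add: l2_def)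
  from fubini_time_last(1)[OF this] show ?thesis
    by eventually_elim (use slice_measurable[OF l2_measurable[OF assms]] in \<open>simp add: l2_def\<close>)
qed

lemma l2n_square_slices:
  fixes F :: "'a::euclidean_space \<times> real \<Rightarrow> 'b::euclidean_space"
  assumes "l2 F"
  shows "integrable lborel (\<lambda>t. (l2n (\<lambda>x. F (x, t)))\<^sup>2)"
    and "(LINT t|lborel. (l2n (\<lambda>x. F (x, t)))\<^sup>2) = (l2n F)\<^sup>2"
proof -
  have "integrable lborel (\<lambda>z. (norm (F z))\<^sup>2)" using assms by (simp add: l2_def)
  from fubini_time_last(2,3)[OF this] show "integrable lborel (\<lambda>t. (l2n (\<lambda>x. F (x, t)))\<^sup>2)"
    "(LINT t|lborel. (l2n (\<lambda>x. F (x, t)))\<^sup>2) = (l2n F)\<^sup>2"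
    by (simp_all add: l2n_square)
qed

lemma l2_tensor:
  fixes d :: "'a::euclidean_space \<Rightarrow> 'b::euclidean_space" and \<eta> :: "real \<Rightarrow> real"
  assumes "l2 \<eta>" "l2 d"
  shows "l2 (\<lambda>z. \<eta> (snd z) *\<^sub>R d (fst z))" "l2n (\<lambda>z. \<eta> (snd z) *\<^sub>R d (fst z)) = l2n \<eta> * l2n d"
proof -
  have [measurable]: "\<eta> \<in> borel_measurable borel" "d \<in> borel_measurable borel" using assms by (auto simp: l2_def)
  have m: "(\<lambda>z::'a \<times> real. \<eta> (snd z) *\<^sub>R d (fst z)) \<in> borel_measurable (borel \<Otimes>\<^sub>M borel)" by measurable
  then have m': "(\<lambda>z::'a \<times> real. \<eta> (snd z) *\<^sub>R d (fst z)) \<in> borel_measurable lborel" by (simp add: borel_prod)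
  have i: "integrable (lborel \<Otimes>\<^sub>M lborel) (\<lambda>(x, t). (norm (d x))\<^sup>2 * (\<eta> t)\<^sup>2)"
  proof (rule lborel_pair.Fubini_integrable)
    show "(\<lambda>(x, t). (norm (d x))\<^sup>2 * (\<eta> t)\<^sup>2) \<in> borel_measurable (lborel \<Otimes>\<^sub>M lborel)" by measurable
    show "integrable lborel (\<lambda>x. LINT t|lborel. norm (case (x, t) of (x, t) \<Rightarrow> (norm (d x))\<^sup>2 * (\<eta> t)\<^sup>2))"
      using assms by (simp add: l2_def)
    show "AE x in lborel. integrable lborel (\<lambda>t. case (x, t) of (x, t) \<Rightarrow> (norm (d x))\<^sup>2 * (\<eta> t)\<^sup>2)"
      using assms by (simp add: l2_def)
  qed
  then have i': "integrable lborel (\<lambda>z::'a \<times> real. (norm (\<eta> (snd z) *\<^sub>R d (fst z)))\<^sup>2)"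
    by (simp add: lborel_prod case_prod_unfold power_mult_distrib mult.commute)
  then show l: "l2 (\<lambda>z. \<eta> (snd z) *\<^sub>R d (fst z))" using m' by (simp add: l2_def)
  have "(l2n (\<lambda>z. \<eta> (snd z) *\<^sub>R d (fst z)))\<^sup>2 = (LINT t|lborel. (l2n (\<lambda>x. \<eta> t *\<^sub>R d x))\<^sup>2)"
    using l2n_square_slices(2)[OF l] by simp
  also have "\<dots> = (LINT t|lborel. (\<eta> t)\<^sup>2 * (l2n d)\<^sup>2)" by (simp add: l2n_square power_mult_distrib)
  also have "\<dots> = (l2n \<eta> * l2n d)\<^sup>2" by (simp add: l2n_square[of \<eta>] power_mult_distrib)
  finally show "l2n (\<lambda>z. \<eta> (snd z) *\<^sub>R d (fst z)) = l2n \<eta> * l2n d"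
    by (simp add: power2_eq_iff_nonneg)
qed

lemma l2_indicator_interval: "l2 (indicator {a..<b::real} :: real \<Rightarrow> real)" "l2 (indicator {a<..<b::real} :: real \<Rightarrow> real)"
  by (rule l2_bounded_compact(1)[of _ 1 "{a..b}"]; auto simp: indicator_def)+

text \<open>The supports of bumps on slightly shrunken intervals are compact in the open interval, and these
  bumps, too, converge to the indicator.\<close>

lemma interval_bump:
  fixes a b :: real
  assumes "a < b" "0 < e"
  obtains \<eta> where "\<eta> \<in> test_functions {a<..<b}" "\<And>t. 0 \<le> \<eta> t" "\<And>t. \<eta> t \<le> 1"
    "l2n (\<lambda>t. indicator {a..<b} t - \<eta> t) < e"
proof -
  define h where "h m = 1 / real (Suc m)" for m
  have h0: "0 < h m" for m by (simp add: h_def)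
  have hl: "h \<longlonglongrightarrow> 0" using LIMSEQ_inverse_real_of_nat by (simp add: h_def[abs_def] inverse_eq_divide)
  define u where "u m = (box_bump (a + h m) (b - h m) m :: real \<Rightarrow> real)" for m
  have u: "u m \<in> test_functions {a<..<b}" for m
    unfolding u_def by (rule test_box_bump) (use h0[of m] in \<open>auto simp: cbox_interval\<close>)
  have lim: "(\<lambda>m. u m t) \<longlonglongrightarrow> indicator {a<..<b} t" for t
  proof (cases "t \<in> {a<..<b}")
    case True
    have f: "(\<lambda>m. flat_exp (h m) 1 (s - h m)) \<longlonglongrightarrow> 1" if "0 < s" for s
    proof -
      have "(\<lambda>m. exp (- h m / (s - h m))) \<longlonglongrightarrow> exp (- 0 / (s - 0))"
        using that by (intro tendsto_intros hl) auto
      moreover have "eventually (\<lambda>m. h m < s) sequentially" using order_tendstoD(2)[OF hl that] .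
      then have "eventually (\<lambda>m. exp (- h m / (s - h m)) = flat_exp (h m) 1 (s - h m)) sequentially"
        by eventually_elim (simp add: flat_exp_def)
      ultimately show ?thesis by (simp add: Lim_transform_eventually)
    qed
    have "(\<lambda>m. flat_exp (h m) 1 ((t - a) - h m) * flat_exp (h m) 1 ((b - t) - h m)) \<longlonglongrightarrow> 1 * 1"
      using True by (intro tendsto_mult f) auto
    then show ?thesis using True by (simp add: u_def box_bump_def h_def algebra_simps)
  next
    case False
    have "u m t = 0" for m unfolding u_def by (rule box_bump_eq_0) (use False h0[of m] in \<open>auto simp: box_real\<close>)
    then show ?thesis using False by simp
  qed
  have "(\<lambda>m. l2n (\<lambda>t. indicator {a..<b} t - u m t)) \<longlonglongrightarrow> 0"
  proof (rule l2n_tendsto_dominated[where w="indicator {a..b}"])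
    show "u m \<in> borel_measurable lborel" for m using test_l2[OF u] by (simp add: l2_def)
    show "AE t in lborel. (\<lambda>m. u m t) \<longlonglongrightarrow> indicator {a..<b} t"
      using AE_lborel_singleton[of a]
    proof eventually_elim
      case (elim t)
      then have "indicator {a..<b} t = (indicator {a<..<b} t :: real)" by (auto simp: indicator_def)
      with lim[of t] show ?case by simp
    qed
    show "(norm (indicator {a..<b} t - u m t))\<^sup>2 \<le> indicator {a..b} t" for m t
    proof (cases "t \<in> {a..b}")
      case True
      have "\<bar>indicator {a..<b} t - u m t\<bar> \<le> 1"
        using box_bump_nonneg[of "a + h m" "b - h m" m t] box_bump_le_1[of "a + h m" "b - h m" m t]
        by (auto simp: u_def indicator_def)
      then show ?thesis using True by (simp add: abs_square_le_1)
    next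
      case False
      have "u m t = 0" unfolding u_def by (rule box_bump_eq_0) (use False h0[of m] in \<open>auto simp: box_real\<close>)
      moreover have "indicator {a..<b} t = (0::real)" using False by (auto simp: indicator_def)
      ultimately show ?thesis using False by simp
    qed
    show "integrable lborel (indicator {a..b} :: real \<Rightarrow> real)"
      by (rule l2_bounded_compact(2)[of _ 1 "{a..b}"]) (auto simp: indicator_def)
  qed auto
  from LIMSEQ_D[OF this assms(2)] obtain m where "l2n (\<lambda>t. indicator {a..<b} t - u m t) < e"
    by (auto dest: spec[of _ 0])
  moreover have "0 \<le> u m t" "u m t \<le> 1" for t
    by (simp_all add: u_def box_bump_nonneg box_bump_le_1)
  ultimately show ?thesis using that[OF u] by blast
qed

lemma power2_sum4_le: "(a + b + c + d)\<^sup>2 \<le> 4 * (a\<^sup>2 + b\<^sup>2 + c\<^sup>2 + (d::real)\<^sup>2)"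
  using sum_squares_bound[of a b] sum_squares_bound[of a c] sum_squares_bound[of a d]
    sum_squares_bound[of b c] sum_squares_bound[of b d] sum_squares_bound[of c d]
  by (simp add: power2_eq_square algebra_simps)

text \<open>On short time intervals V is frozen at a sampling time. The sampling times are taken where V is
  hardly farther from a continuous approximant C than on average, so that sampling V costs about
  as much as approximating it. As V is sampled only finitely often, elements of D near the samples
  can be chosen freely, without having to depend on time in a measurable way.\<close>

lemma tensor_approximation:
  fixes V :: "'a::euclidean_space \<times> real \<Rightarrow> 'b::euclidean_space" and D :: "('a \<Rightarrow> 'b) set"
  assumes V: "l2 V" and T: "0 < T" and supp: "\<And>x t. t \<notin> {0<..<T} \<Longrightarrow> V (x, t) = 0"
    and D: "\<And>d. d \<in> D \<Longrightarrow> l2 d"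
    and cl: "AE t in lborel. t \<in> {0<..<T} \<longrightarrow> (\<forall>e>0. \<exists>d\<in>D. l2n (\<lambda>x. V (x, t) - d x) < e)"
    and e: "0 < e"
  obtains m :: nat and \<eta> :: "nat \<Rightarrow> real \<Rightarrow> real" and d where
    "\<And>i. i < m \<Longrightarrow> \<eta> i \<in> test_functions {0<..<T}" "\<And>i. i < m \<Longrightarrow> d i \<in> D"
    "l2n (\<lambda>z. V z - (\<Sum>i<m. \<eta> i (snd z) *\<^sub>R d i (fst z))) < e"
proof -
  obtain C R where C: "continuous_on UNIV C" "0 < R" "\<And>z. R \<le> norm z \<Longrightarrow> C z = 0"
    and VC: "l2n (\<lambda>z. V z - C z) < e / 8"
    using l2_approx_continuous[OF V, of "e / 8"] e by auto
  let ?K = "cball (0::'a) R"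
  \<comment> \<open>the error of a step function will be at most \<open>8 (e/8)\<^sup>2 + 12 \<kappa> T\<close>, and this is
    \<open>(e/2)\<^sup>2\<close> at most\<close>
  define \<kappa> where "\<kappa> = e\<^sup>2 / (96 * (T + 1))"
  have \<kappa>: "0 < \<kappa>" using e T by (simp add: \<kappa>_def)
  \<comment> \<open>slices of C at times less than \<open>\<delta>\<close> apart then differ by at most \<open>\<kappa>\<close> in squared norm\<close>
  define c where "c = sqrt (\<kappa> / (1 + measure lborel ?K))"
  have m1: "0 < 1 + measure lborel ?K" by (simp add: add_pos_nonneg)
  have c: "0 < c" using \<kappa> m1 by (simp add: c_def)
  have cK: "c\<^sup>2 * measure lborel ?K \<le> \<kappa>"
  proof -
    have "c\<^sup>2 = \<kappa> / (1 + measure lborel ?K)" using \<kappa> m1 by (simp add: c_def)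
    then have "c\<^sup>2 * measure lborel ?K = \<kappa> * (measure lborel ?K / (1 + measure lborel ?K))" by simp
    also have "\<dots> \<le> \<kappa> * 1" using \<kappa> m1 by (intro mult_left_mono) (auto simp: divide_le_eq)
    finally show ?thesis by simp
  qed
  obtain \<delta> where \<delta>: "0 < \<delta>" "\<And>x y. dist x y < \<delta> \<Longrightarrow> dist (C x) (C y) < c"
    using compact_support_uniformly_continuous[OF C(1,3) c] by blast
  obtain m :: nat where m: "T / \<delta> < real m" using reals_Archimedean2 by blast
  have m0: "0 < m" using m T \<delta>(1) by (metis divide_pos_pos gr0I less_asym of_nat_0)
  define w where "w = T / m"
  have w: "0 < w" "w < \<delta>" "real m * w = T" using m m0 T \<delta>(1) by (auto simp: w_def field_simps)
  define I where "I i = {real i * w ..< real (Suc i) * w}" for i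
  have Im[measurable]: "I i \<in> sets borel" for i by (simp add: I_def)
  have Iint: "integrable lborel (indicator (I i) :: real \<Rightarrow> real)" "(LINT t|lborel. indicator (I i) t) = w" for i
    using w(1) by (simp_all add: I_def algebra_simps)
  have disj: "i = k" if "t \<in> I i" "t \<in> I k" for t i k
  proof -
    have "real i * w < real (Suc k) * w" "real k * w < real (Suc i) * w" using that unfolding I_def by auto
    then have "i < Suc k" "k < Suc i" using w(1) by (auto simp del: of_nat_Suc)
    then show ?thesis by simp
  qed
  have cover: "\<exists>k<m. t \<in> I k" if "0 \<le> t" "t < T" for t
  proof (intro exI conjI)
    let ?k = "nat \<lfloor>t / w\<rfloor>"
    have k: "real ?k \<le> t / w" "t / w < real ?k + 1" using that w(1) by (simp_all add: floor_less_iff)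
    have "t / w < real m" using that w by (simp add: field_simps)
    with k(1) show "?k < m" by linarith
    show "t \<in> I ?k" using k w(1) by (simp add: I_def field_simps)
  qed
  have Isub: "t \<in> {0..<T}" if "t \<in> I i" "i < m" for t i
  proof -
    have "real (Suc i) * w \<le> real m * w" using that w(1) by (intro mult_right_mono) auto
    moreover have "0 \<le> real i * w" using w(1) by simp
    ultimately show ?thesis using that(1) w(3) unfolding I_def by auto
  qed
  have Isum: "(\<Sum>i<m. indicator (I i) t *\<^sub>R f i) = f k" if "t \<in> I k" "k < m" for t k and f :: "nat \<Rightarrow> 'c::real_vector"
  proof -
    have "(\<Sum>i<m. indicator (I i) t *\<^sub>R f i) = (\<Sum>i\<in>{k}. indicator (I i) t *\<^sub>R f i)"
      using that disj by (intro sum.mono_neutral_right) (auto simp: indicator_def)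
    then show ?thesis using that by simp
  qed
  have Cl: "l2 C" by (rule l2_compact_support(1)[OF C(1) compact_cball[of 0 R]]) (use C in auto)
  have VCl: "l2 (\<lambda>z. V z - C z)" by (rule l2_diff[OF V Cl])
  \<comment> \<open>the error of the continuous approximant at time t, and its integrals A i over the intervals\<close>
  define E where "E t = (l2n (\<lambda>x. V (x, t) - C (x, t)))\<^sup>2" for t
  have E: "integrable lborel E" "(LINT t|lborel. E t) = (l2n (\<lambda>z. V z - C z))\<^sup>2"
    using l2n_square_slices[OF VCl] by (simp_all add: E_def[abs_def])
  have E0: "0 \<le> E t" for t by (simp add: E_def)
  have EI: "integrable lborel (\<lambda>t. E t * indicator (I i) t)" for i
    using integrable_mult_indicator[of "I i" lborel E] E(1) by (simp add: mult.commute)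
  define A where "A i = (LINT t|lborel. E t * indicator (I i) t)" for i
  have Csl: "l2 (\<lambda>x. C (x, t))" for t
  proof (rule l2_compact_support(1)[of _ ?K])
    show "continuous_on UNIV (\<lambda>x. C (x, t))"
      by (intro continuous_on_compose2[OF C(1)] continuous_intros) auto
    show "C (x, t) = 0" if "x \<notin> ?K" for x
      using that C(3)[of "(x, t)"] norm_fst_le[of x t] by simp
  qed simp
  define good where "good t \<longleftrightarrow> l2 (\<lambda>x. V (x, t)) \<and> (\<forall>e>0. \<exists>d\<in>D. l2n (\<lambda>x. V (x, t) - d x) < e)" for t
  have AEgood: "AE t in lborel. t \<in> {0<..<T} \<longrightarrow> good t"
    using cl l2_slices[OF V] by eventually_elim (auto simp: good_def)
  \<comment> \<open>otherwise the error would exceed its average over the interval almost everywhere\<close>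
  have sample: "\<exists>s\<in>I i. good s \<and> E s * w \<le> A i + \<kappa> * w" if i: "i < m" for i
  proof (rule ccontr)
    assume n: "\<not> ?thesis"
    have "(LINT t|lborel. (A i / w + \<kappa>) * indicator (I i) t) \<le> (LINT t|lborel. E t * indicator (I i) t)"
    proof (rule integral_mono_AE[OF _ EI])
      show "integrable lborel (\<lambda>t. (A i / w + \<kappa>) * indicator (I i) t)" using Iint(1) by simp
      show "AE t in lborel. (A i / w + \<kappa>) * indicator (I i) t \<le> E t * indicator (I i) t"
        using AEgood AE_lborel_singleton[of 0]
      proof eventually_elim
        case (elim t)
        show ?case
        proof (cases "t \<in> I i")
          case True
          then have "good t" using elim Isub[OF True i] by auto
          with n True have "A i + \<kappa> * w < E t * w" by force
          then have "A i / w + \<kappa> \<le> E t" using w(1) by (simp add: field_simps)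
          then show ?thesis using True by simp
        qed simp
      qed
    qed
    then have "(A i / w + \<kappa>) * w \<le> A i" using Iint(2) by (simp add: A_def)
    then have "\<kappa> * w \<le> 0" using w(1) by (simp add: distrib_right)
    with mult_pos_pos[OF \<kappa> w(1)] show False by simp
  qed
  define s where "s i = (SOME s. s \<in> I i \<and> good s \<and> E s * w \<le> A i + \<kappa> * w)" for i
  have s: "s i \<in> I i" "good (s i)" "E (s i) * w \<le> A i + \<kappa> * w" if "i < m" for i
    using someI_ex[of "\<lambda>s. s \<in> I i \<and> good s \<and> E s * w \<le> A i + \<kappa> * w"] sample[OF that]
    unfolding s_def by blast+
  have "\<forall>i. \<exists>d. i < m \<longrightarrow> d \<in> D \<and> l2n (\<lambda>x. V (x, s i) - d x) < sqrt \<kappa>"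
    using s(2) \<kappa> unfolding good_def by (meson real_sqrt_gt_zero)
  then obtain d where d: "\<And>i. i < m \<Longrightarrow> d i \<in> D" "\<And>i. i < m \<Longrightarrow> l2n (\<lambda>x. V (x, s i) - d i x) < sqrt \<kappa>"
    by metis
  have dl: "i < m \<Longrightarrow> l2 (d i)" for i using d(1) D by blast
  define P where "P z = (\<Sum>i<m. indicator (I i) (snd z) *\<^sub>R d i (fst z))" for z
  have Il: "l2 (indicator (I i) :: real \<Rightarrow> real)" for i unfolding I_def by (rule l2_indicator_interval)
  have Pl: "l2 P" unfolding P_def[abs_def] by (intro l2_sum l2_tensor(1)[OF Il dl]) auto
  have VPl: "l2 (\<lambda>z. V z - P z)" by (rule l2_diff[OF V Pl])
  \<comment> \<open>from V(t) to C(t), to C(s k), to V(s k), to d k: four errors, of which the first and the third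
    are controlled by E, the others by \<open>\<kappa>\<close>\<close>
  have slice: "(l2n (\<lambda>x. V (x, t) - P (x, t)))\<^sup>2 \<le> (\<Sum>i<m. 4 * (E t * indicator (I i) t) + (8 * \<kappa> + 4 * E (s i)) * indicator (I i) t)"
    if t: "l2 (\<lambda>x. V (x, t))" for t
  proof (cases "0 \<le> t \<and> t < T")
    case True
    then obtain k where k: "k < m" "t \<in> I k" using cover by blast
    have Pk: "P (x, t) = d k x" for x unfolding P_def using Isum[OF k(2,1)] by simp
    have sl: "l2 (\<lambda>x. V (x, s k))" using s(2)[OF k(1)] by (simp add: good_def)
    have "l2n (\<lambda>x. V (x, t) - d k x)
      \<le> l2n (\<lambda>x. V (x, t) - C (x, t)) + l2n (\<lambda>x. C (x, t) - C (x, s k)) + l2n (\<lambda>x. V (x, s k) - C (x, s k)) + l2n (\<lambda>x. V (x, s k) - d k x)"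
      using l2n_triangle_diff[OF t Csl[of t] dl[OF k(1)]] l2n_triangle_diff[OF Csl[of t] Csl[of "s k"] dl[OF k(1)]]
        l2n_triangle_diff[OF Csl[of "s k"] sl dl[OF k(1)]] l2n_diff_commute[of "\<lambda>x. C (x, s k)" "\<lambda>x. V (x, s k)"]
      by linarith
    then have "(l2n (\<lambda>x. V (x, t) - d k x))\<^sup>2
      \<le> (l2n (\<lambda>x. V (x, t) - C (x, t)) + l2n (\<lambda>x. C (x, t) - C (x, s k)) + l2n (\<lambda>x. V (x, s k) - C (x, s k)) + l2n (\<lambda>x. V (x, s k) - d k x))\<^sup>2"
      by (intro power_mono) auto
    also have "\<dots> \<le> 4 * (E t + (l2n (\<lambda>x. C (x, t) - C (x, s k)))\<^sup>2 + E (s k) + (l2n (\<lambda>x. V (x, s k) - d k x))\<^sup>2)"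
      unfolding E_def by (rule power2_sum4_le)
    also have "\<dots> \<le> 4 * (E t + \<kappa> + E (s k) + \<kappa>)"
    proof -
      have "\<bar>t - s k\<bar> < w" using k(2) s(1)[OF k(1)] unfolding I_def by (auto simp: algebra_simps)
      then have "norm (C (x, t) - C (x, s k)) \<le> c" for x
        using \<delta>(2)[of "(x, t)" "(x, s k)"] w(2) by (simp add: dist_Pair_Pair dist_norm dist_real_def)
      moreover have "C (x, t) - C (x, s k) = 0" if "x \<notin> ?K" for x
        using that C(3)[of "(x, t)"] C(3)[of "(x, s k)"] norm_fst_le[of x t] norm_fst_le[of x "s k"] by simp
      ultimately have "(l2n (\<lambda>x. C (x, t) - C (x, s k)))\<^sup>2 \<le> c\<^sup>2 * measure lborel ?K"
        using l2_measurable[OF l2_diff[OF Csl Csl]] by (intro l2n_le_sup) auto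
      moreover have "(l2n (\<lambda>x. V (x, s k) - d k x))\<^sup>2 \<le> (sqrt \<kappa>)\<^sup>2"
        using d(2)[OF k(1)] by (intro power_mono) auto
      ultimately show ?thesis using cK \<kappa> by simp
    qed
    also have "\<dots> = (\<Sum>i<m. indicator (I i) t *\<^sub>R (4 * E t + (8 * \<kappa> + 4 * E (s i))))"
      by (subst Isum[OF k(2,1)]) simp
    also have "\<dots> = (\<Sum>i<m. 4 * (E t * indicator (I i) t) + (8 * \<kappa> + 4 * E (s i)) * indicator (I i) t)"
      by (intro sum.cong) (auto simp: algebra_simps)
    finally show ?thesis by (simp add: Pk)
  next
    case False
    then have "P (x, t) = 0" for x unfolding P_def using Isub by (intro sum.neutral) (auto simp: indicator_def)
    moreover have "V (x, t) = 0" for x using False supp[of t x] by auto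
    ultimately show ?thesis using \<kappa> E0 by (simp add: sum_nonneg)
  qed
  have "(l2n (\<lambda>z. V z - P z))\<^sup>2 = (LINT t|lborel. (l2n (\<lambda>x. V (x, t) - P (x, t)))\<^sup>2)"
    using l2n_square_slices(2)[OF VPl] by simp
  also have "\<dots> \<le> (LINT t|lborel. (\<Sum>i<m. 4 * (E t * indicator (I i) t) + (8 * \<kappa> + 4 * E (s i)) * indicator (I i) t))"
  proof (rule integral_mono_AE)
    show "integrable lborel (\<lambda>t. (l2n (\<lambda>x. V (x, t) - P (x, t)))\<^sup>2)" using l2n_square_slices(1)[OF VPl] by simp
    show "integrable lborel (\<lambda>t. \<Sum>i<m. 4 * (E t * indicator (I i) t) + (8 * \<kappa> + 4 * E (s i)) * indicator (I i) t)"
      using EI Iint(1) by (intro Bochner_Integration.integrable_sum Bochner_Integration.integrable_add) auto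
    show "AE t in lborel. (l2n (\<lambda>x. V (x, t) - P (x, t)))\<^sup>2 \<le> (\<Sum>i<m. 4 * (E t * indicator (I i) t) + (8 * \<kappa> + 4 * E (s i)) * indicator (I i) t)"
      using l2_slices[OF V] by eventually_elim (rule slice)
  qed
  also have "\<dots> = (\<Sum>i<m. 4 * A i + (8 * \<kappa> + 4 * E (s i)) * w)"
    using EI Iint by (subst Bochner_Integration.integral_sum) (auto simp: A_def)
  also have "\<dots> \<le> (\<Sum>i<m. 8 * A i + 12 * \<kappa> * w)"
  proof (rule sum_mono)
    fix i assume "i \<in> {..<m}"
    then show "4 * A i + (8 * \<kappa> + 4 * E (s i)) * w \<le> 8 * A i + 12 * \<kappa> * w"
      using s(3)[of i] by (simp add: algebra_simps)
  qed
  also have "\<dots> = 8 * (\<Sum>i<m. A i) + 12 * \<kappa> * T"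
    using w(3) by (simp add: sum.distrib sum_distrib_left mult.assoc mult.left_commute)
  also have "(\<Sum>i<m. A i) \<le> (LINT t|lborel. E t)"
  proof -
    have "(\<Sum>i<m. A i) = (LINT t|lborel. (\<Sum>i<m. E t * indicator (I i) t))"
      unfolding A_def using EI by (subst Bochner_Integration.integral_sum) auto
    also have "\<dots> \<le> (LINT t|lborel. E t)"
    proof (rule integral_mono[OF _ E(1)])
      show "integrable lborel (\<lambda>t. \<Sum>i<m. E t * indicator (I i) t)" using EI by (intro Bochner_Integration.integrable_sum)
      fix t
      show "(\<Sum>i<m. E t * indicator (I i) t) \<le> E t"
      proof (cases "\<exists>k<m. t \<in> I k")
        case True
        then obtain k where k: "k < m" "t \<in> I k" by blast
        have "(\<Sum>i<m. E t * indicator (I i) t) = (\<Sum>i<m. indicator (I i) t *\<^sub>R E t)"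
          by (intro sum.cong) (auto simp only: real_scaleR_def mult.commute)
        also have "\<dots> = E t" by (rule Isum[OF k(2,1)])
        finally show ?thesis by (simp only: order.refl)
      next
        case False
        then have "(\<Sum>i<m. E t * indicator (I i) t) = 0" by (intro sum.neutral) (auto simp: indicator_def)
        then show ?thesis using E0[of t] by (simp only:)
      qed
    qed
    finally show ?thesis .
  qed
  also have "(LINT t|lborel. E t) \<le> (e / 8)\<^sup>2"
    unfolding E(2) using VC by (intro power_mono) auto
  also have "8 * (e / 8)\<^sup>2 + 12 * \<kappa> * T \<le> (e / 2)\<^sup>2"
  proof -
    have "12 * \<kappa> * T \<le> 12 * \<kappa> * (T + 1)" using \<kappa> by simp
    also have "\<dots> = e\<^sup>2 / 8" using T by (simp add: \<kappa>_def field_simps)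
    finally show ?thesis by (simp add: power_divide)
  qed
  finally have "(l2n (\<lambda>z. V z - P z))\<^sup>2 \<le> (e / 2)\<^sup>2" by simp
  then have VP: "l2n (\<lambda>z. V z - P z) \<le> e / 2" using e by (simp add: power2_le_iff_abs_le)
  \<comment> \<open>smoothing the indicators of the intervals costs at most \<open>e/4\<close> altogether\<close>
  define q where "q i = e / (4 * real m * (1 + l2n (d i)))" for i
  have q: "0 < q i" for i using e m0 by (simp add: q_def add_pos_nonneg)
  have "\<forall>i. \<exists>\<eta>. \<eta> \<in> test_functions {real i * w <..< real (Suc i) * w} \<and> l2n (\<lambda>t. indicator (I i) t - \<eta> t) < q i"
  proof
    fix i
    have "real i * w < real (Suc i) * w" using w(1) by simp
    then obtain \<eta> where "\<eta> \<in> test_functions {real i * w <..< real (Suc i) * w}" "l2n (\<lambda>t. indicator (I i) t - \<eta> t) < q i"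
      unfolding I_def by (rule interval_bump[OF _ q[of i]])
    then show "\<exists>\<eta>. \<eta> \<in> test_functions {real i * w <..< real (Suc i) * w} \<and> l2n (\<lambda>t. indicator (I i) t - \<eta> t) < q i"
      by (intro exI conjI)
  qed
  then obtain \<eta> where \<eta>: "\<And>i. \<eta> i \<in> test_functions {real i * w <..< real (Suc i) * w}"
     "\<And>i. l2n (\<lambda>t. indicator (I i) t - \<eta> i t) < q i" by metis
  have \<eta>l: "l2 (\<eta> i)" for i using test_l2[OF \<eta>(1)] .
  have dif: "l2 (\<lambda>t. indicator (I i) t - \<eta> i t)" for i by (rule l2_diff[OF Il \<eta>l])
  let ?Q = "\<lambda>z. \<Sum>i<m. \<eta> i (snd z) *\<^sub>R d i (fst z)"
  have Ql: "l2 ?Q" by (intro l2_sum l2_tensor(1)[OF \<eta>l dl]) auto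
  have "l2n (\<lambda>z. P z - ?Q z) = l2n (\<lambda>z. \<Sum>i<m. (indicator (I i) (snd z) - \<eta> i (snd z)) *\<^sub>R d i (fst z))"
    by (simp add: P_def scaleR_left_diff_distrib sum_subtractf)
  also have "\<dots> \<le> (\<Sum>i<m. l2n (\<lambda>z. (indicator (I i) (snd z) - \<eta> i (snd z)) *\<^sub>R d i (fst z)))"
    by (rule l2n_sum_le) (use l2_tensor(1)[OF dif dl] in auto)
  also have "\<dots> \<le> (\<Sum>i<m. e / (4 * real m))"
  proof (rule sum_mono)
    fix i assume "i \<in> {..<m}"
    then have "l2n (\<lambda>z. (indicator (I i) (snd z) - \<eta> i (snd z)) *\<^sub>R d i (fst z)) = l2n (\<lambda>t. indicator (I i) t - \<eta> i t) * l2n (d i)"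
      using l2_tensor(2)[OF dif dl] by simp
    also have "\<dots> \<le> q i * (1 + l2n (d i))" using \<eta>(2)[of i] q[of i] by (intro mult_mono) auto
    also have "\<dots> = e / (4 * real m)"
    proof -
      have "1 + l2n (d i) \<noteq> 0" using l2n_nonneg[of "d i"] by linarith
      then show ?thesis by (simp add: q_def)
    qed
    finally show "l2n (\<lambda>z. (indicator (I i) (snd z) - \<eta> i (snd z)) *\<^sub>R d i (fst z)) \<le> e / (4 * real m)" .
  qed
  also have "\<dots> = e / 4" using m0 by simp
  finally have PQ: "l2n (\<lambda>z. P z - ?Q z) \<le> e / 4" .
  have "l2n (\<lambda>z. V z - ?Q z) < e" using l2n_triangle_diff[OF V Pl Ql] VP PQ e by simp
  moreover have "\<eta> i \<in> test_functions {0<..<T}" if "i < m" for i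
  proof -
    have "real (Suc i) * w \<le> real m * w" using that w(1) by (intro mult_right_mono) auto
    moreover have "0 \<le> real i * w" using w(1) by simp
    ultimately have "{real i * w <..< real (Suc i) * w} \<subseteq> {0<..<T}" using w(3) by auto
    then show ?thesis using \<eta>(1) test_functions_mono by blast
  qed
  ultimately show ?thesis using that d(1) by blast
qed

section \<open>Rigidity of the deformation\<close>

text \<open>Near each point f and its local inverse are both nonexpansive, so f is a local isometry;
  polarization makes it affine there, so that the derivative is locally constant.\<close>

lemma isometric_derivative_imp_affine:
  fixes f :: "'a::euclidean_space \<Rightarrow> 'a"
  assumes \<Omega>: "open \<Omega>" "connected \<Omega>" and inj: "inj_on f \<Omega>"
    and d: "\<And>x. x \<in> \<Omega> \<Longrightarrow> (f has_derivative F x) (at x)"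
    and iso: "\<And>x h. x \<in> \<Omega> \<Longrightarrow> norm (F x h) = norm h"
    and x: "x \<in> \<Omega>" "x' \<in> \<Omega>"
  shows "f x = f x' + F x' (x - x')"
proof -
  have lin: "linear (F x)" if "x \<in> \<Omega>" for x using d[OF that] has_derivative_linear by blast
  have orth: "orthogonal_transformation (F x)" if "x \<in> \<Omega>" for x
    using lin[OF that] iso[OF that] by (simp add: orthogonal_transformation)
  have cont: "continuous_on \<Omega> f" using has_derivative_continuous[OF d] by (intro continuous_at_imp_continuous_on ballI)
  have opf: "open (f ` \<Omega>)" by (rule invariance_of_domain[OF cont \<Omega>(1) inj])
  define g where "g = inv_into \<Omega> f"
  have gf: "g (f x) = x" if "x \<in> \<Omega>" for x using inj that by (simp add: g_def)
  have dg: "(g has_derivative inv (F x)) (at (f x))" if "x \<in> \<Omega>" for x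
  proof (rule has_derivative_inverse_strong[OF \<Omega>(1) that cont gf d[OF that]])
    show "F x \<circ> inv (F x) = id"
      using orthogonal_transformation_surj[OF orth[OF that]] by (simp add: surj_iff)
  qed auto
  have ng: "norm (inv (F x) h) = norm h" if "x \<in> \<Omega>" for x h
    using orthogonal_transformation_inv[OF orth[OF that]] orthogonal_transformation_norm by blast
  have local_affine: "\<exists>r>0. ball z r \<subseteq> \<Omega> \<and> (\<forall>a. norm a < r \<longrightarrow> f (z + a) = f z + F z a)" if z: "z \<in> \<Omega>" for z
  proof -
    obtain r where r: "0 < r" "ball z r \<subseteq> \<Omega>" using \<Omega>(1) z openE by blast
    obtain \<rho> where \<rho>: "0 < \<rho>" "ball (f z) \<rho> \<subseteq> f ` \<Omega>" using opf z by (meson imageI openE)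
    have le: "norm (f p - f q) \<le> 1 * norm (p - q)" if "p \<in> ball z r" "q \<in> ball z r" for p q
    proof (rule differentiable_bound[where S="ball z r"])
      show "(f has_derivative F x) (at x within ball z r)" if "x \<in> ball z r" for x
        using d that r(2) has_derivative_at_withinI by blast
      show "onorm (F x) \<le> 1" if "x \<in> ball z r" for x
        using iso r(2) that by (intro onorm_le) auto
    qed (use that in auto)
    \<comment> \<open>the inverse is nonexpansive on a ball, on which it is defined because the image is open\<close>
    have ge: "norm (g p - g q) \<le> 1 * norm (p - q)" if "p \<in> ball (f z) \<rho>" "q \<in> ball (f z) \<rho>" for p q
    proof (rule differentiable_bound[where S="ball (f z) \<rho>" and f'="\<lambda>y. inv (F (g y))"])
      fix y assume y: "y \<in> ball (f z) \<rho>"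
      then obtain x where xy: "x \<in> \<Omega>" "y = f x" using \<rho> by blast
      show "(g has_derivative inv (F (g y))) (at y within ball (f z) \<rho>)"
        using dg[OF xy(1)] has_derivative_at_withinI by (simp add: xy gf)
      show "onorm (inv (F (g y))) \<le> 1" using ng xy gf by (intro onorm_le) simp
    qed (use that in auto)
    define s where "s = min r \<rho>"
    have s: "0 < s" "ball z s \<subseteq> \<Omega>" using r \<rho> by (auto simp: s_def)
    have iso_ball: "norm (f p - f q) = norm (p - q)" if p: "p \<in> ball z s" and q: "q \<in> ball z s" for p q
    proof -
      have "f p \<in> ball (f z) \<rho>" "f q \<in> ball (f z) \<rho>"
        using le[of z p] le[of z q] p q r by (auto simp: s_def dist_norm)
      from ge[OF this] have "norm (p - q) \<le> norm (f p - f q)"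
        using gf p q s(2) by (simp add: subset_iff)
      moreover have "norm (f p - f q) \<le> norm (p - q)" using le[of p q] p q by (simp add: s_def)
      ultimately show ?thesis by simp
    qed
    have polar: "(f (z + a) - f z) \<bullet> (f (z + b) - f z) = a \<bullet> b" if a: "norm a < s" and b: "norm b < s" for a b
    proof -
      have m: "z + a \<in> ball z s" "z + b \<in> ball z s" "z \<in> ball z s" using a b s by (auto simp: dist_norm)
      have "norm (f (z + a) - f z) = norm a" "norm (f (z + b) - f z) = norm b"
        "norm ((f (z + a) - f z) - (f (z + b) - f z)) = norm (a - b)"
        using iso_ball[OF m(1,3)] iso_ball[OF m(2,3)] iso_ball[OF m(1,2)] by auto
      then show ?thesis
        using dot_norm_neg[of "f (z + a) - f z" "f (z + b) - f z"] dot_norm_neg[of a b] by simp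
    qed
    have "f (z + a) = f z + F z a" if a: "norm a < s" for a
    proof -
      \<comment> \<open>polarization with b replaced by a small multiple of b, differentiated at zero\<close>
      have in_eq: "(f (z + a) - f z) \<bullet> F z b = F z a \<bullet> F z b" for b
      proof -
        have "((\<lambda>e. z + e *\<^sub>R b) has_derivative (\<lambda>e. e *\<^sub>R b)) (at 0)" by (auto intro!: derivative_eq_intros)
        moreover have "(f has_derivative F z) (at (z + 0 *\<^sub>R b))" using d[OF z] by simp
        ultimately have "((\<lambda>e. f (z + e *\<^sub>R b)) has_derivative (\<lambda>e. F z (e *\<^sub>R b))) (at 0)"
          by (rule has_derivative_compose)
        then have "((\<lambda>e. f (z + e *\<^sub>R b)) has_vector_derivative F z b) (at 0)"
          using lin[OF z] by (simp add: has_vector_derivative_def linear_cmul)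
        then have v: "((\<lambda>e. (f (z + a) - f z) \<bullet> (f (z + e *\<^sub>R b) - f z)) has_vector_derivative ((f (z + a) - f z) \<bullet> F z b)) (at 0)"
          by (auto intro!: bounded_linear.has_vector_derivative[OF bounded_linear_inner_right] derivative_eq_intros)
        have "((\<lambda>e. e * (a \<bullet> b)) has_vector_derivative (a \<bullet> b)) (at 0)"
          by (auto intro!: derivative_eq_intros simp: has_real_derivative_iff_has_vector_derivative[symmetric])
        moreover have "\<forall>\<^sub>F e in at 0. e * (a \<bullet> b) = (f (z + a) - f z) \<bullet> (f (z + e *\<^sub>R b) - f z)"
        proof -
          have "((\<lambda>e. norm (e *\<^sub>R b)) \<longlongrightarrow> norm (0 *\<^sub>R b)) (at (0::real))" by (intro tendsto_intros)
          then have "\<forall>\<^sub>F e in at (0::real). norm (e *\<^sub>R b) < s" using s(1) order_tendstoD(2) by fastforce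
          then show ?thesis by eventually_elim (use polar[OF a] in simp)
        qed
        ultimately have "((\<lambda>e. (f (z + a) - f z) \<bullet> (f (z + e *\<^sub>R b) - f z)) has_vector_derivative (a \<bullet> b)) (at 0)"
          by (subst (asm) has_vector_derivative_cong_ev[where g="\<lambda>e. (f (z + a) - f z) \<bullet> (f (z + e *\<^sub>R b) - f z)"])
             (auto simp: eventually_at_filter elim: eventually_mono)
        with v have "(f (z + a) - f z) \<bullet> F z b = a \<bullet> b" by (rule vector_derivative_unique_at)
        then show ?thesis using orth[OF z] by (simp add: orthogonal_transformation_def)
      qed
      obtain b where "F z b = f (z + a) - f z - F z a"
        using orthogonal_transformation_surj[OF orth[OF z]] by (metis surjD)
      with in_eq[of b] have "(f (z + a) - f z - F z a) \<bullet> (f (z + a) - f z - F z a) = 0"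
        by (simp add: inner_diff_left)
      then have "f (z + a) - f z - F z a = 0" by (simp only: inner_eq_zero_iff)
      then show ?thesis by (simp add: algebra_simps)
    qed
    with s show ?thesis by blast
  qed
  have Fconst: "F z = F x'" if z: "z \<in> \<Omega>" for z
  proof (rule connected_local_const[OF \<Omega>(2) z x(2)], intro ballI)
    fix p assume p: "p \<in> \<Omega>"
    obtain r where r: "0 < r" "ball p r \<subseteq> \<Omega>" "\<And>a. norm a < r \<Longrightarrow> f (p + a) = f p + F p a"
      using local_affine[OF p] by blast
    have "F p = F q" if "q \<in> ball p r" for q
    proof -
      have "((\<lambda>y. f p + F p (y - p)) has_derivative F p) (at q)"
      proof -
        have "(F p has_derivative F p) (at (q - p))"
          using lin[OF p] by (simp add: linear_conv_bounded_linear bounded_linear_imp_has_derivative)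
        moreover have "((\<lambda>y. y - p) has_derivative (\<lambda>y. y)) (at q)" by (auto intro!: derivative_eq_intros)
        ultimately have "((\<lambda>y. F p (y - p)) has_derivative F p) (at q)" using has_derivative_compose by blast
        then show ?thesis by (auto intro!: derivative_eq_intros)
      qed
      then have "(f has_derivative F p) (at q)"
      proof (rule has_derivative_transform_within_open[OF _ open_ball that])
        show "f p + F p (y - p) = f y" if "y \<in> ball p r" for y
          using r(3)[of "y - p"] that by (simp add: dist_norm norm_minus_commute)
      qed
      then show ?thesis using d r(2) that has_derivative_unique by blast
    qed
    then show "\<forall>\<^sub>F b in at p within \<Omega>. F p = F b"
      using r(1) unfolding eventually_at by (metis dist_commute mem_ball)
  qed
  define h where "h y = f y - F x' (y - x')" for y
  have "(h has_derivative (\<lambda>_. 0)) (at y)" if y: "y \<in> \<Omega>" for y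
  proof -
    have "(F x' has_derivative F x') (at (y - x'))"
      using lin[OF x(2)] by (simp add: linear_conv_bounded_linear bounded_linear_imp_has_derivative)
    moreover have "((\<lambda>y. y - x') has_derivative (\<lambda>y. y)) (at y)" by (auto intro!: derivative_eq_intros)
    ultimately have "((\<lambda>y. F x' (y - x')) has_derivative F x') (at y)" using has_derivative_compose by blast
    from has_derivative_diff[OF d[OF y] this] show ?thesis by (simp add: h_def[abs_def] Fconst[OF y])
  qed
  then have "h x = h x'"
    by (intro has_derivative_zero_unique_connected[OF \<Omega> _ x]) auto
  moreover have "F x' 0 = 0" using lin[OF x(2)] linear_0 by blast
  ultimately show ?thesis by (simp add: h_def algebra_simps)
qed

text \<open>The diagonal entries are nonnegative and add up to zero. Evaluating the form at
  \<open>e\<^sub>i + s e\<^sub>j\<close> then leaves a linear function of s that is nonnegative for both signs of s, so that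
  A is skew.\<close>

lemma psd_trace_0_imp_quadratic_form_0:
  fixes A :: "real^'n^'n"
  assumes psd: "\<And>\<xi>. 0 \<le> (A *v \<xi>) \<bullet> \<xi>" and tr: "(\<Sum>i\<in>UNIV. A $ i $ i) = 0"
  shows "(A *v \<xi>) \<bullet> \<xi> = 0"
proof -
  have ax: "(A *v axis j 1) \<bullet> axis i 1 = A $ i $ j" for i j
    by (simp add: matrix_vector_mul_component inner_axis cart_eq_inner_axis[symmetric] matrix_vector_mult_basis column_def)
  have diag: "A $ i $ i = 0" for i
  proof -
    have "0 \<le> A $ i $ i" for i using psd[of "axis i 1"] by (simp add: ax)
    then have "\<forall>i\<in>UNIV. A $ i $ i = 0" using tr by (subst (asm) sum_nonneg_eq_0_iff) auto
    then show ?thesis by simp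
  qed
  have skew: "A $ i $ j + A $ j $ i = 0" for i j
  proof -
    have "(A *v (axis i 1 + s *\<^sub>R axis j 1)) \<bullet> (axis i 1 + s *\<^sub>R axis j 1) = s * (A $ i $ j + A $ j $ i)" for s
      by (simp add: matrix_vector_right_distrib matrix_vector_mult_scaleR inner_add_left inner_add_right ax diag algebra_simps)
    then have "0 \<le> s * (A $ i $ j + A $ j $ i)" for s using psd[of "axis i 1 + s *\<^sub>R axis j 1" for s] by (simp only:)
    from this[of 1] this[of "- 1"] show ?thesis by simp
  qed
  have q: "(A *v \<xi>) \<bullet> \<xi> = (\<Sum>i\<in>UNIV. \<Sum>j\<in>UNIV. A $ i $ j * \<xi> $ j * \<xi> $ i)"
    by (simp add: inner_vec_def matrix_vector_mult_def sum_distrib_right)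
  also have "\<dots> = (\<Sum>i\<in>UNIV. \<Sum>j\<in>UNIV. A $ j $ i * \<xi> $ j * \<xi> $ i)"
    by (subst sum.swap) (simp add: mult_ac)
  also have "\<dots> = - (\<Sum>i\<in>UNIV. \<Sum>j\<in>UNIV. A $ i $ j * \<xi> $ j * \<xi> $ i)"
  proof -
    have e: "A $ j $ i = - A $ i $ j" for i j using skew[of i j] by linarith
    have "A $ j $ i * \<xi> $ j * \<xi> $ i = - (A $ i $ j * \<xi> $ j * \<xi> $ i)" for i j
      by (simp only: e[of j i] mult_minus_left)
    then have "(\<Sum>i\<in>UNIV. \<Sum>j\<in>UNIV. A $ j $ i * \<xi> $ j * \<xi> $ i) = (\<Sum>i\<in>UNIV. \<Sum>j\<in>UNIV. - (A $ i $ j * \<xi> $ j * \<xi> $ i))"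
      by (intro sum.cong refl)
    then show ?thesis by (simp add: sum_negf)
  qed
  finally show ?thesis using q by linarith
qed

text \<open>The velocity gradient has the transposed matrix of the derivative, which has the same quadratic
  form.\<close>

lemma velocity_skew:
  fixes \<Omega> :: "(real^'n) set"
  assumes tr: "divergence (\<lambda>z. velocity \<Omega> \<phi> z t) y = 0"
    and psd: "\<forall>\<xi>. 0 \<le> (velocity_gradient \<Omega> \<phi> y t *v \<xi>) \<bullet> \<xi>"
    and d: "((\<lambda>z. velocity \<Omega> \<phi> z t) has_derivative D) (at y)"
  shows "D \<xi> \<bullet> \<xi> = 0"
proof -
  let ?A = "velocity_gradient \<Omega> \<phi> y t"
  have D: "frechet_derivative (\<lambda>z. velocity \<Omega> \<phi> z t) (at y) = D" using frechet_derivative_at[OF d] by simp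
  have "(?A *v \<xi>) \<bullet> \<xi> = 0"
  proof (rule psd_trace_0_imp_quadratic_form_0)
    show "0 \<le> (?A *v \<xi>) \<bullet> \<xi>" for \<xi> using psd by blast
    show "(\<Sum>i\<in>UNIV. ?A $ i $ i) = 0" using tr by (simp add: velocity_gradient_def divergence_def)
  qed
  also have "(?A *v \<xi>) \<bullet> \<xi> = (\<Sum>i\<in>UNIV. \<xi> $ i *\<^sub>R D (axis i 1)) \<bullet> \<xi>"
    by (simp add: inner_vec_def matrix_vector_mult_def velocity_gradient_def D sum_distrib_right sum_distrib_left sum_component mult_ac)
       (subst sum.swap, simp add: mult_ac)
  also have "(\<Sum>i\<in>UNIV. \<xi> $ i *\<^sub>R D (axis i 1)) = D (\<Sum>i\<in>UNIV. \<xi> $ i *\<^sub>R axis i 1)"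
    using has_derivative_linear[OF d] by (simp add: linear_sum linear_cmul)
  also have "(\<Sum>i\<in>UNIV. \<xi> $ i *\<^sub>R axis i 1) = \<xi>"
    using basis_expansion[of \<xi>] by (simp add: scalar_mult_eq_scaleR)
  finally show ?thesis .
qed

text \<open>Twice continuous differentiability in space-time is needed in this form: F z e has a continuous
  time derivative, from which the regularity in time of the rotation will follow.\<close>

lemma regular_deformation_derivatives:
  fixes \<Omega> :: "(real^'n) set" and \<phi> :: "real \<Rightarrow> real^'n \<Rightarrow> real^'n"
  assumes \<Omega>: "open \<Omega>" and reg: "regular_deformation \<Omega> T \<phi>"
  obtains W V F V' F' where
    "open W" "{0..<T} \<times> \<Omega> \<subseteq> W" "continuous_on W (\<lambda>(t, x). \<phi> t x)"
    "\<And>t x. (t, x) \<in> W \<Longrightarrow> ((\<lambda>s. \<phi> s x) has_vector_derivative V (t, x)) (at t)"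
    "\<And>t x. (t, x) \<in> W \<Longrightarrow> (\<phi> t has_derivative F (t, x)) (at x)"
    "\<And>z. z \<in> W \<Longrightarrow> (V has_derivative V' z) (at z)"
    "\<And>z e. z \<in> W \<Longrightarrow> ((\<lambda>z. F z e) has_derivative F' e z) (at z)"
    "\<And>e. continuous_on W (\<lambda>z. F' e z (1, 0))"
proof -
  define \<Phi> where "\<Phi> = (\<lambda>(t, x). \<phi> t x)"
  obtain W where W: "open W" "{0..<T} \<times> \<Omega> \<subseteq> W" "Ck 2 W \<Phi>"
    using reg unfolding regular_deformation_def \<Phi>_def by blast
  have C1: "Ck (Suc (Suc 0)) W \<Phi>" using W(3) by (simp only: numeral_2_eq_2)
  have d: "(\<Phi> has_derivative frechet_derivative \<Phi> (at z)) (at z)" if "z \<in> W" for z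
    using C1 that by (simp flip: frechet_derivative_works)
  have part: "Ck (Suc 0) W (\<lambda>z. frechet_derivative \<Phi> (at z) b)" if "b \<in> Basis" for b
    using C1 that Ck.simps(2)[of "Suc 0" W \<Phi>] by blast
  define V where "V z = frechet_derivative \<Phi> (at z) (1, 0)" for z
  define F where "F z e = frechet_derivative \<Phi> (at z) (0, e)" for z e
  define V' where "V' z = frechet_derivative V (at z)" for z
  define Fb where "Fb b z = frechet_derivative (\<lambda>z. F z b) (at z)" for b z
  define F' where "F' e z w = (\<Sum>b\<in>Basis. (e \<bullet> b) *\<^sub>R Fb b z w)" for e z w
  have cont: "continuous_on W \<Phi>"
    using has_derivative_continuous[OF d] by (intro continuous_at_imp_continuous_on ballI)
  have B: "(1, 0) \<in> (Basis :: (real \<times> (real^'n)) set)" "b \<in> Basis \<Longrightarrow> (0, b) \<in> (Basis :: (real \<times> (real^'n)) set)" for b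
    by (auto simp: Basis_prod_def)
  have dV: "(V has_derivative V' z) (at z)" if "z \<in> W" for z
    using part[OF B(1)] that unfolding V'_def V_def[abs_def] by (simp flip: frechet_derivative_works)
  have dFb: "((\<lambda>z. F z b) has_derivative Fb b z) (at z)" if "z \<in> W" "b \<in> Basis" for z b
    using part[OF B(2)[OF that(2)]] that unfolding Fb_def F_def[abs_def] by (simp flip: frechet_derivative_works)
  have cFb: "continuous_on W (\<lambda>z. Fb b z (1, 0))" if "b \<in> Basis" for b
    using part[OF B(2)[OF that]] B(1) unfolding Fb_def F_def[abs_def] by simp
  have linF: "linear (F z)" if "z \<in> W" for z
  proof -
    have "linear (frechet_derivative \<Phi> (at z))" using has_derivative_linear[OF d[OF that]] .
    moreover have "linear (\<lambda>e::real^'n. (0::real, e))" by (simp add: linear_iff)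
    ultimately show ?thesis unfolding F_def[abs_def] by (rule linear_compose[unfolded o_def, rotated])
  qed
  have F_sum: "F z e = (\<Sum>b\<in>Basis. (e \<bullet> b) *\<^sub>R F z b)" if "z \<in> W" for z e
  proof -
    have "F z (\<Sum>b\<in>Basis. (e \<bullet> b) *\<^sub>R b) = (\<Sum>b\<in>Basis. (e \<bullet> b) *\<^sub>R F z b)"
      using linF[OF that] by (simp add: linear_sum linear_cmul)
    then show ?thesis by (simp add: euclidean_representation)
  qed
  show ?thesis
  proof (rule that[OF W(1,2), of V F V' F'])
    show "continuous_on W (\<lambda>(t, x). \<phi> t x)" using cont by (simp add: \<Phi>_def)
    fix t x assume tx: "(t, x) \<in> W"
    have 1: "((\<lambda>s. (s, x)) has_derivative (\<lambda>s. (s, 0))) (at t)" by (auto intro!: derivative_eq_intros)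
    have "((\<lambda>s. \<Phi> (s, x)) has_derivative (\<lambda>s. frechet_derivative \<Phi> (at (t, x)) (s, 0))) (at t)"
      by (rule has_derivative_compose[OF 1 d[OF tx]])
    moreover have "frechet_derivative \<Phi> (at (t, x)) (s, 0) = s *\<^sub>R V (t, x)" for s
    proof -
      have "frechet_derivative \<Phi> (at (t, x)) (s *\<^sub>R (1, 0)) = s *\<^sub>R frechet_derivative \<Phi> (at (t, x)) (1, 0)"
        using has_derivative_linear[OF d[OF tx]] linear_cmul by blast
      then show ?thesis by (simp add: V_def)
    qed
    ultimately show "((\<lambda>s. \<phi> s x) has_vector_derivative V (t, x)) (at t)"
      by (simp add: has_vector_derivative_def \<Phi>_def)
    have 2: "(Pair t has_derivative (\<lambda>e. (0, e))) (at x)" by (auto intro!: derivative_eq_intros)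
    from has_derivative_compose[OF 2 d[OF tx]] show "(\<phi> t has_derivative F (t, x)) (at x)"
      unfolding F_def[abs_def] by (simp add: \<Phi>_def)
  next
    fix z assume z: "z \<in> W"
    show "(V has_derivative V' z) (at z)" by (rule dV[OF z])
    fix e
    have "((\<lambda>z. \<Sum>b\<in>Basis. (e \<bullet> b) *\<^sub>R F z b) has_derivative F' e z) (at z)"
      unfolding F'_def[abs_def] by (intro has_derivative_sum has_derivative_scaleR_right dFb z)
    then show "((\<lambda>z. F z e) has_derivative F' e z) (at z)"
      by (rule has_derivative_transform_within_open[OF _ W(1) z]) (simp add: F_sum[symmetric])
  next
    show "continuous_on W (\<lambda>z. F' e z (1, 0))" for e
      unfolding F'_def by (intro continuous_intros cFb)
  qed
qed

text \<open>The velocity field is skew along segments, so that it does not change the distance of two nearby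
  particles; the stretching by the spatial derivative is the limit of quotients of such distances
  and equals one at time zero.\<close>

lemma deformation_isometric:
  fixes \<Omega> :: "(real^'n) set" and \<phi> :: "real \<Rightarrow> real^'n \<Rightarrow> real^'n"
  assumes \<Omega>: "open \<Omega>" and reg: "regular_deformation \<Omega> T \<phi>"
    and W: "open W" "{0..<T} \<times> \<Omega> \<subseteq> W" "continuous_on W (\<lambda>(t, x). \<phi> t x)"
    and dt: "\<And>t x. (t, x) \<in> W \<Longrightarrow> ((\<lambda>s. \<phi> s x) has_vector_derivative V (t, x)) (at t)"
    and dx: "\<And>t x. (t, x) \<in> W \<Longrightarrow> (\<phi> t has_derivative F (t, x)) (at x)"
    and dV: "\<And>z. z \<in> W \<Longrightarrow> (V has_derivative V' z) (at z)"
    and dF: "\<And>z e. z \<in> W \<Longrightarrow> ((\<lambda>z. F z e) has_derivative F' e z) (at z)"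
    and tr: "\<forall>(y, t) \<in> spacetime_domain \<Omega> T \<phi>. divergence (\<lambda>z. velocity \<Omega> \<phi> z t) y = 0"
    and psd: "\<forall>(y, t) \<in> spacetime_domain \<Omega> T \<phi>. \<forall>\<xi>. 0 \<le> (velocity_gradient \<Omega> \<phi> y t *v \<xi>) \<bullet> \<xi>"
    and t: "t \<in> {0..<T}" and x: "x \<in> \<Omega>"
  shows "norm (F (t, x) h) = norm h"
proof -
  have inj: "inj_on (\<phi> t) \<Omega>" if "t \<in> {0..<T}" for t using reg that by (auto simp: regular_deformation_def)
  have inW: "(t, x) \<in> W" if "t \<in> {0..<T}" "x \<in> \<Omega>" for t x using W(2) that by blast
  define g where "g t = inv_into \<Omega> (\<phi> t)" for t
  have gf: "g t (\<phi> t x) = x" if "t \<in> {0..<T}" "x \<in> \<Omega>" for t x using inj that by (simp add: g_def)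
  have contx: "continuous_on \<Omega> (\<phi> t)" if "t \<in> {0..<T}" for t
    using has_derivative_continuous[OF dx[OF inW[OF that]]] by (intro continuous_at_imp_continuous_on ballI)
  have op: "open (\<phi> t ` \<Omega>)" if "t \<in> {0..<T}" for t
    by (rule invariance_of_domain[OF contx[OF that] \<Omega> inj[OF that]])
  have vel: "velocity \<Omega> \<phi> y t = V (t, g t y)" if "t \<in> {0..<T}" "y \<in> \<phi> t ` \<Omega>" for t y
  proof -
    have "g t y \<in> \<Omega>" using that gf by auto
    from dt[OF inW[OF that(1) this]] show ?thesis
      unfolding velocity_def g_def by (rule vector_derivative_at)
  qed
  have dvel: "\<exists>D. ((\<lambda>z. velocity \<Omega> \<phi> z t) has_derivative D) (at y)" if t: "t \<in> {0..<T}" and y: "y \<in> \<phi> t ` \<Omega>" for t y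
  proof -
    obtain x where x: "x \<in> \<Omega>" "y = \<phi> t x" using y by blast
    have "invertible (matrix (frechet_derivative (\<phi> t) (at x)))"
      using reg t x(1) by (auto simp: regular_deformation_def)
    moreover have "frechet_derivative (\<phi> t) (at x) = F (t, x)" using frechet_derivative_at[OF dx[OF inW[OF t x(1)]]] by simp
    moreover have lin: "linear (F (t, x))" using has_derivative_linear[OF dx[OF inW[OF t x(1)]]] .
    ultimately have "\<exists>G. linear G \<and> (\<forall>x'. G (F (t, x) x') = x') \<and> (\<forall>x'. F (t, x) (G x') = x')"
      using matrix_invertible[OF lin] by (metis comp_apply id_apply)
    then obtain G where G: "F (t, x) \<circ> G = id" by (metis comp_apply eq_id_iff)
    have "(g t has_derivative G) (at (\<phi> t x))"
      by (rule has_derivative_inverse_strong[OF \<Omega> x(1) contx[OF t] gf[OF t] dx[OF inW[OF t x(1)]] G])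
    then have "((\<lambda>z. (t, g t z)) has_derivative (\<lambda>h. (0, G h))) (at y)"
      unfolding x(2) by (auto intro!: derivative_eq_intros)
    moreover have "(V has_derivative V' (t, g t y)) (at (t, g t y))" using dV inW[OF t] gf[OF t] x by simp
    ultimately have "((\<lambda>z. V (t, g t z)) has_derivative (\<lambda>h. V' (t, g t y) (0, G h))) (at y)"
      by (rule has_derivative_compose)
    then have "((\<lambda>z. velocity \<Omega> \<phi> z t) has_derivative (\<lambda>h. V' (t, g t y) (0, G h))) (at y)"
      by (rule has_derivative_transform_within_open[OF _ op[OF t] y]) (simp add: vel[OF t])
    then show ?thesis by blast
  qed
  \<comment> \<open>integrating the skew derivative of the velocity along a segment within the moving domain\<close>
  have seg: "(velocity \<Omega> \<phi> y t - velocity \<Omega> \<phi> y' t) \<bullet> (y - y') = 0"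
    if t: "t \<in> {0<..<T}" and s: "closed_segment y' y \<subseteq> \<phi> t ` \<Omega>" for t y y'
  proof -
    have t': "t \<in> {0..<T}" using t by auto
    define p where "p r = y' + r *\<^sub>R (y - y')" for r
    have p: "p r \<in> \<phi> t ` \<Omega>" if "r \<in> {0..1}" for r
    proof -
      have "p r = (1 - r) *\<^sub>R y' + r *\<^sub>R y" by (simp add: p_def algebra_simps)
      then have "p r \<in> closed_segment y' y" using that unfolding in_segment by auto
      then show ?thesis using s by blast
    qed
    have zd: "((\<lambda>r. velocity \<Omega> \<phi> (p r) t \<bullet> (y - y')) has_field_derivative 0) (at r within {0..1})" if r: "r \<in> {0..1}" for r
    proof -
      obtain D where D: "((\<lambda>z. velocity \<Omega> \<phi> z t) has_derivative D) (at (p r))" using dvel[OF t' p[OF r]] by blast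
      have in_Q: "(p r, t) \<in> spacetime_domain \<Omega> T \<phi>" using p[OF r] t by (simp add: spacetime_domain_def)
      have skew: "D (y - y') \<bullet> (y - y') = 0"
        by (rule velocity_skew[OF _ _ D]) (use tr psd in_Q in blast)+
      have "(p has_derivative (\<lambda>s. s *\<^sub>R (y - y'))) (at r)" unfolding p_def by (auto intro!: derivative_eq_intros)
      from has_derivative_compose[OF this D] have "((\<lambda>r. velocity \<Omega> \<phi> (p r) t) has_derivative (\<lambda>s. D (s *\<^sub>R (y - y')))) (at r)" .
      then have "((\<lambda>r. velocity \<Omega> \<phi> (p r) t \<bullet> (y - y')) has_derivative (\<lambda>s. D (s *\<^sub>R (y - y')) \<bullet> (y - y'))) (at r)"
        by (rule has_derivative_inner_left)
      moreover have "(\<lambda>s. D (s *\<^sub>R (y - y')) \<bullet> (y - y')) = (*) 0"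
        using has_derivative_linear[OF D] skew by (auto simp: linear_cmul)
      ultimately have "((\<lambda>r. velocity \<Omega> \<phi> (p r) t \<bullet> (y - y')) has_field_derivative 0) (at r)"
        by (simp add: has_field_derivative_def)
      then show ?thesis by (rule has_field_derivative_at_within)
    qed
    then obtain c where c: "\<forall>r\<in>{0..1}. velocity \<Omega> \<phi> (p r) t \<bullet> (y - y') = c"
      using has_field_derivative_zero_constant[OF convex_real_interval(5) zd] by blast
    have "p 1 = y" "p 0 = y'" by (simp_all add: p_def)
    with c[rule_format, of 0] c[rule_format, of 1] show ?thesis by (simp add: inner_diff_left)
  qed
  \<comment> \<open>two particles near x stay, for a while, within a ball covered by the moving domain; their
    distance is then constant, and so is the stretching factor in the limit\<close>
  have stretch_const: "norm (F (t, x) h) = norm (F (t0, x) h)"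
    if t0: "t0 \<in> {0<..<T}" and tt: "\<bar>t - t0\<bar> < \<delta>"
      and \<delta>: "0 < \<delta>" "\<And>t x'. \<bar>t - t0\<bar> < \<delta> \<Longrightarrow> norm (x' - x) < \<delta> \<Longrightarrow> t \<in> {0<..<T} \<and> x' \<in> \<Omega> \<and> \<phi> t x' \<in> ball (\<phi> t0 x) \<rho>"
      and \<rho>: "\<And>t. \<bar>t - t0\<bar> < \<delta> \<Longrightarrow> ball (\<phi> t0 x) \<rho> \<subseteq> \<phi> t ` \<Omega>"
    for t t0 \<delta> \<rho>
  proof -
    have near: "\<phi> t (x + e *\<^sub>R h) \<in> \<phi> t ` \<Omega>" if "\<bar>t - t0\<bar> < \<delta>" "norm (e *\<^sub>R h) < \<delta>" for t e
      using \<delta>(2)[OF that(1), of "x + e *\<^sub>R h"] that by auto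
    have dist_const: "norm (\<phi> t (x + e *\<^sub>R h) - \<phi> t x) = norm (\<phi> t0 (x + e *\<^sub>R h) - \<phi> t0 x)" if e: "norm (e *\<^sub>R h) < \<delta>" for e
    proof -
      let ?x = "x + e *\<^sub>R h"
      let ?N = "\<lambda>s. (\<phi> s ?x - \<phi> s x) \<bullet> (\<phi> s ?x - \<phi> s x)"
      have "(?N has_field_derivative 0) (at s within {t0 - \<delta><..<t0 + \<delta>})" if s: "s \<in> {t0 - \<delta><..<t0 + \<delta>}" for s
      proof -
        have sd: "\<bar>s - t0\<bar> < \<delta>" using s by auto
        have m: "s \<in> {0<..<T}" "?x \<in> \<Omega>" "x \<in> \<Omega>" "\<phi> s ?x \<in> ball (\<phi> t0 x) \<rho>" "\<phi> s x \<in> ball (\<phi> t0 x) \<rho>"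
          using \<delta>(2)[OF sd, of ?x] \<delta>(2)[OF sd, of x] e \<delta>(1) by auto
        have s': "s \<in> {0..<T}" using m(1) by auto
        have "closed_segment (\<phi> s x) (\<phi> s ?x) \<subseteq> ball (\<phi> t0 x) \<rho>" using m by (intro closed_segment_subset) auto
        also have "\<dots> \<subseteq> \<phi> s ` \<Omega>" by (rule \<rho>[OF sd])
        finally have z: "(velocity \<Omega> \<phi> (\<phi> s ?x) s - velocity \<Omega> \<phi> (\<phi> s x) s) \<bullet> (\<phi> s ?x - \<phi> s x) = 0"
          by (rule seg[OF m(1)])
        have v: "velocity \<Omega> \<phi> (\<phi> s ?x) s = V (s, ?x)" "velocity \<Omega> \<phi> (\<phi> s x) s = V (s, x)"
          using vel[OF s', of "\<phi> s ?x"] vel[OF s', of "\<phi> s x"] gf[OF s'] m(2,3) by auto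
        have d: "((\<lambda>s. \<phi> s ?x - \<phi> s x) has_vector_derivative (V (s, ?x) - V (s, x))) (at s)"
          by (intro has_vector_derivative_diff dt inW s' m)
        have "(?N has_vector_derivative ((\<phi> s ?x - \<phi> s x) \<bullet> (V (s, ?x) - V (s, x)) + (V (s, ?x) - V (s, x)) \<bullet> (\<phi> s ?x - \<phi> s x))) (at s)"
          by (rule bounded_bilinear.has_vector_derivative[OF bounded_bilinear_inner d d])
        then show ?thesis using z unfolding v
          by (simp add: inner_commute has_real_derivative_iff_has_vector_derivative has_vector_derivative_at_within)
      qed
      then obtain c where "\<forall>s\<in>{t0 - \<delta><..<t0 + \<delta>}. ?N s = c"
        using has_field_derivative_zero_constant[of "{t0 - \<delta><..<t0 + \<delta>}" ?N] by auto
      then have "?N t = ?N t0" using tt \<delta>(1) by (auto simp: abs_less_iff)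
      then show ?thesis by (simp add: norm_eq_sqrt_inner)
    qed
    have lim: "((\<lambda>e. norm (\<phi> s (x + e *\<^sub>R h) - \<phi> s x) / \<bar>e\<bar>) \<longlongrightarrow> norm (F (s, x) h)) (at 0)" if s: "\<bar>s - t0\<bar> < \<delta>" for s
    proof -
      have sW: "(s, x) \<in> W" using \<delta>(2)[OF s, of x] \<delta>(1) by (intro inW) auto
      have "((\<lambda>e. x + e *\<^sub>R h) has_derivative (\<lambda>e. e *\<^sub>R h)) (at 0)" by (auto intro!: derivative_eq_intros)
      moreover have "(\<phi> s has_derivative F (s, x)) (at (x + 0 *\<^sub>R h))" using dx[OF sW] by simp
      ultimately have "((\<lambda>e. \<phi> s (x + e *\<^sub>R h)) has_derivative (\<lambda>e. F (s, x) (e *\<^sub>R h))) (at 0)"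
        by (rule has_derivative_compose)
      then have q: "((\<lambda>e. norm (\<phi> s (x + e *\<^sub>R h) - \<phi> s x - F (s, x) (e *\<^sub>R h)) / norm e) \<longlongrightarrow> 0) (at 0)"
        unfolding has_derivative_iff_norm by simp
      have "((\<lambda>e. norm (\<phi> s (x + e *\<^sub>R h) - \<phi> s x) / \<bar>e\<bar> - norm (F (s, x) h)) \<longlongrightarrow> 0) (at 0)"
      proof (rule Lim_null_comparison[OF _ q])
        have "\<forall>\<^sub>F e in at (0::real). e \<noteq> 0" by (simp add: eventually_at_filter)
        then show "\<forall>\<^sub>F e in at 0. norm (norm (\<phi> s (x + e *\<^sub>R h) - \<phi> s x) / \<bar>e\<bar> - norm (F (s, x) h))
            \<le> norm (\<phi> s (x + e *\<^sub>R h) - \<phi> s x - F (s, x) (e *\<^sub>R h)) / norm e"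
        proof eventually_elim
          case (elim e)
          have "norm (F (s, x) h) = norm (F (s, x) (e *\<^sub>R h)) / \<bar>e\<bar>"
            using elim has_derivative_linear[OF dx[OF sW]] by (simp add: linear_cmul)
          then have "norm (\<phi> s (x + e *\<^sub>R h) - \<phi> s x) / \<bar>e\<bar> - norm (F (s, x) h)
              = (norm (\<phi> s (x + e *\<^sub>R h) - \<phi> s x) - norm (F (s, x) (e *\<^sub>R h))) / \<bar>e\<bar>"
            by (simp add: diff_divide_distrib)
          then show ?case
            using norm_triangle_ineq3[of "\<phi> s (x + e *\<^sub>R h) - \<phi> s x" "F (s, x) (e *\<^sub>R h)"]
            by (simp add: divide_right_mono)
        qed
      qed
      then show ?thesis by (rule LIM_zero_cancel)
    qed
    have "((\<lambda>e. norm (\<phi> t (x + e *\<^sub>R h) - \<phi> t x) / \<bar>e\<bar>) \<longlongrightarrow> norm (F (t0, x) h)) (at 0)"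
    proof (rule Lim_transform_eventually)
      show "((\<lambda>e. norm (\<phi> t0 (x + e *\<^sub>R h) - \<phi> t0 x) / \<bar>e\<bar>) \<longlongrightarrow> norm (F (t0, x) h)) (at 0)"
        by (rule lim) (use \<delta>(1) in simp)
      have "((\<lambda>e. norm (e *\<^sub>R h)) \<longlongrightarrow> norm (0 *\<^sub>R h)) (at (0::real))" by (intro tendsto_intros)
      then have "\<forall>\<^sub>F e in at (0::real). norm (e *\<^sub>R h) < \<delta>" using \<delta>(1) order_tendstoD(2) by fastforce
      then show "\<forall>\<^sub>F e in at 0. norm (\<phi> t0 (x + e *\<^sub>R h) - \<phi> t0 x) / \<bar>e\<bar> = norm (\<phi> t (x + e *\<^sub>R h) - \<phi> t x) / \<bar>e\<bar>"
        by eventually_elim (use dist_const in simp)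
    qed
    from tendsto_unique[OF _ lim[OF tt] this] show ?thesis by simp
  qed
  have local_const: "\<forall>\<^sub>F t in at t0. norm (F (t0, x) h) = norm (F (t, x) h)" if t0: "t0 \<in> {0<..<T}" for t0
  proof -
    let ?S = "{0<..<T} \<times> \<Omega>"
    let ?\<Psi> = "\<lambda>(t, x). (t, \<phi> t x)"
    have oS: "open ?S" using \<Omega> by (simp add: open_Times)
    have SW: "?S \<subseteq> W" using W(2) by force
    have cS: "continuous_on ?S (\<lambda>(t, x). \<phi> t x)" using continuous_on_subset[OF W(3) SW] .
    have "continuous_on ?S ?\<Psi>"
    proof -
      have "continuous_on ?S (\<lambda>z. (fst z, (\<lambda>(t, x). \<phi> t x) z))" by (intro continuous_on_Pair continuous_on_fst continuous_on_id cS)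
      then show ?thesis by (simp add: case_prod_unfold)
    qed
    moreover have "inj_on ?\<Psi> ?S"
    proof (rule inj_onI)
      fix z w assume z: "z \<in> ?S" and w: "w \<in> ?S" and eq: "?\<Psi> z = ?\<Psi> w"
      obtain t p where zt: "z = (t, p)" by fastforce
      obtain t' q where wt: "w = (t', q)" by fastforce
      have e: "t' = t" "\<phi> t p = \<phi> t q" using eq unfolding zt wt by auto
      have m: "t \<in> {0..<T}" "p \<in> \<Omega>" "q \<in> \<Omega>" using z w by (simp_all add: zt wt)
      show "z = w" using inj_onD[OF inj[OF m(1)] e(2) m(2,3)] by (simp add: zt wt e)
    qed
    \<comment> \<open>the space-time domain is open, which provides the ball needed above for an interval of
      times\<close>
    ultimately have o1: "open (?\<Psi> ` ?S)" using oS by (intro invariance_of_domain)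
    have m1: "(t0, \<phi> t0 x) \<in> ?\<Psi> ` ?S" by (rule image_eqI[of _ _ "(t0, x)"]) (use t0 x in auto)
    obtain A B where AB: "open A" "open B" "(t0, \<phi> t0 x) \<in> A \<times> B" "A \<times> B \<subseteq> ?\<Psi> ` ?S"
      by (rule open_prod_elim[OF o1 m1])
    obtain \<rho> where \<rho>: "0 < \<rho>" "ball (\<phi> t0 x) \<rho> \<subseteq> B" using openE[OF AB(2), of "\<phi> t0 x"] AB(3) by blast
    have o2: "open (?S \<inter> ((\<lambda>(t, x). \<phi> t x) -` ball (\<phi> t0 x) \<rho>))"
      using iffD1[OF continuous_on_open_vimage[OF oS] cS, rule_format, OF open_ball[of "\<phi> t0 x" \<rho>]]
      by (subst Int_commute)
    have m2: "(t0, x) \<in> ?S \<inter> ((\<lambda>(t, x). \<phi> t x) -` ball (\<phi> t0 x) \<rho>)" using t0 x \<rho>(1) by auto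
    obtain A' B' where AB': "open A'" "open B'" "(t0, x) \<in> A' \<times> B'"
      "A' \<times> B' \<subseteq> ?S \<inter> ((\<lambda>(t, x). \<phi> t x) -` ball (\<phi> t0 x) \<rho>)" by (rule open_prod_elim[OF o2 m2])
    have "open (A \<inter> A')" "t0 \<in> A \<inter> A'" using AB AB' by auto
    then obtain \<delta>1 where \<delta>1: "0 < \<delta>1" "ball t0 \<delta>1 \<subseteq> A \<inter> A'" by (meson openE)
    obtain \<delta>2 where \<delta>2: "0 < \<delta>2" "ball x \<delta>2 \<subseteq> B'" using openE[OF AB'(2), of x] AB'(3) by blast
    define \<delta> where "\<delta> = min \<delta>1 \<delta>2"
    have \<delta>0: "0 < \<delta>" using \<delta>1 \<delta>2 by (simp add: \<delta>_def)
    have mA: "t \<in> A \<and> t \<in> A'" if "\<bar>t - t0\<bar> < \<delta>" for t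
      using that \<delta>1(2) by (auto simp: \<delta>_def dist_real_def subset_iff abs_minus_commute)
    have c1: "t \<in> {0<..<T} \<and> x' \<in> \<Omega> \<and> \<phi> t x' \<in> ball (\<phi> t0 x) \<rho>" if "\<bar>t - t0\<bar> < \<delta>" "norm (x' - x) < \<delta>" for t x'
    proof -
      have "x' \<in> B'" using that(2) \<delta>2(2) by (auto simp: \<delta>_def dist_norm norm_minus_commute subset_iff)
      then have "(t, x') \<in> A' \<times> B'" using mA[OF that(1)] by simp
      then show ?thesis using AB'(4) by auto
    qed
    have c2: "ball (\<phi> t0 x) \<rho> \<subseteq> \<phi> t ` \<Omega>" if "\<bar>t - t0\<bar> < \<delta>" for t
    proof
      fix y assume "y \<in> ball (\<phi> t0 x) \<rho>"
      then have "(t, y) \<in> A \<times> B" using \<rho>(2) mA[OF that] by auto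
      then have "(t, y) \<in> ?\<Psi> ` ?S" using AB(4) by blast
      then show "y \<in> \<phi> t ` \<Omega>" by auto
    qed
    have "norm (F (t0, x) h) = norm (F (t, x) h)" if "\<bar>t - t0\<bar> < \<delta>" for t
      using stretch_const[OF t0 that \<delta>0 c1 c2] by simp
    then show ?thesis using \<delta>0 unfolding eventually_at by (auto simp: dist_real_def)
  qed
  have const: "norm (F (t, x) h) = norm (F (s, x) h)" if "t \<in> {0<..<T}" "s \<in> {0<..<T}" for t s
    by (rule connected_local_const[of "{0<..<T}"])
       (use that local_const in \<open>auto intro: filter_leD[OF at_le[of "{0<..<T}" UNIV]]\<close>)
  have T0: "0 < T" using t by auto
  have W0: "(0, x) \<in> W" using inW x T0 by auto
  \<comment> \<open>at time zero the deformation is the identity, and F is continuous up to that time\<close>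
  have F0: "F (0, x) h = h"
  proof -
    have "((\<lambda>x. x) has_derivative (\<lambda>h. h)) (at x)" by simp
    then have "(\<phi> 0 has_derivative (\<lambda>h. h)) (at x)"
      by (rule has_derivative_transform_within_open[OF _ \<Omega> x]) (use reg in \<open>auto simp: regular_deformation_def\<close>)
    from has_derivative_unique[OF dx[OF W0] this] show ?thesis by simp
  qed
  have "norm (F (s, x) h) = norm h" if s: "s \<in> {0<..<T}" for s
  proof -
    have "continuous (at (0, x)) (\<lambda>z. F z h)" by (rule has_derivative_continuous[OF dF[OF W0]])
    moreover have "((\<lambda>t. (t, x)) \<longlongrightarrow> (0, x)) (at_right 0)" by (intro tendsto_intros)
    ultimately have "((\<lambda>t. F (t, x) h) \<longlongrightarrow> F (0, x) h) (at_right 0)" by (rule isCont_tendsto_compose)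
    then have "((\<lambda>t. norm (F (t, x) h)) \<longlongrightarrow> norm (F (0, x) h)) (at_right 0)" by (rule tendsto_norm)
    moreover have "((\<lambda>t. norm (F (t, x) h)) \<longlongrightarrow> norm (F (s, x) h)) (at_right 0)"
    proof (rule Lim_transform_eventually[OF tendsto_const])
      show "\<forall>\<^sub>F t in at_right 0. norm (F (s, x) h) = norm (F (t, x) h)"
        using eventually_at_right_real[OF T0] by eventually_elim (use const[OF s] in auto)
    qed
    ultimately have "norm (F (0, x) h) = norm (F (s, x) h)"
      by (intro tendsto_unique[OF trivial_limit_at_right_real])
    with F0 show ?thesis by simp
  qed
  with t F0 show ?thesis by (cases "t = 0") auto
qed

text \<open>The motion is described by its rotation R and translation c, extended trivially to times
  outside \<open>[0,T)\<close>, where nothing is known about the deformation.\<close>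

lemma deformation_rigid:
  fixes \<Omega> :: "(real^'n) set" and \<phi> :: "real \<Rightarrow> real^'n \<Rightarrow> real^'n"
  assumes \<Omega>: "open \<Omega>" "connected \<Omega>" "\<Omega> \<noteq> {}" and reg: "regular_deformation \<Omega> T \<phi>"
    and tr: "\<forall>(y, t) \<in> spacetime_domain \<Omega> T \<phi>. divergence (\<lambda>z. velocity \<Omega> \<phi> z t) y = 0"
    and psd: "\<forall>(y, t) \<in> spacetime_domain \<Omega> T \<phi>. \<forall>\<xi>. 0 \<le> (velocity_gradient \<Omega> \<phi> y t *v \<xi>) \<bullet> \<xi>"
  obtains R c R' c' where
    "\<And>t. orthogonal_transformation (R t)"
    "\<And>t. t \<notin> {0..<T} \<Longrightarrow> R t = (\<lambda>x. x)" "\<And>t. t \<notin> {0..<T} \<Longrightarrow> c t = 0"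
    "\<And>t x. t \<in> {0..<T} \<Longrightarrow> x \<in> \<Omega> \<Longrightarrow> \<phi> t x = R t x + c t"
    "\<And>x. continuous_on {0..<T} (\<lambda>t. R t x)" "continuous_on {0..<T} c"
    "\<And>t x. t \<in> {0<..<T} \<Longrightarrow> ((\<lambda>s. R s x) has_vector_derivative R' t x) (at t)"
    "\<And>t. t \<in> {0<..<T} \<Longrightarrow> (c has_vector_derivative c' t) (at t)"
    "\<And>x. continuous_on {0<..<T} (\<lambda>t. R' t x)" "continuous_on {0<..<T} c'"
proof (rule regular_deformation_derivatives[OF \<Omega>(1) reg])
  fix W V F V' F' assume W: "open W" "{0..<T} \<times> \<Omega> \<subseteq> W" "continuous_on W (\<lambda>(t, x). \<phi> t x)"
    and dt: "\<And>t x. (t, x) \<in> W \<Longrightarrow> ((\<lambda>s. \<phi> s x) has_vector_derivative V (t, x)) (at t)"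
    and dx: "\<And>t x. (t, x) \<in> W \<Longrightarrow> (\<phi> t has_derivative F (t, x)) (at x)"
    and dV: "\<And>z. z \<in> W \<Longrightarrow> (V has_derivative V' z) (at z)"
    and dF: "\<And>z e. z \<in> W \<Longrightarrow> ((\<lambda>z. F z e) has_derivative F' e z) (at z)"
    and cF': "\<And>e. continuous_on W (\<lambda>z. F' e z (1, 0))"
  obtain x1 where x1: "x1 \<in> \<Omega>" using \<Omega>(3) by blast
  have inW: "(t, x) \<in> W" if "t \<in> {0..<T}" "x \<in> \<Omega>" for t x using W(2) that by blast
  have iso: "norm (F (t, x) h) = norm h" if "t \<in> {0..<T}" "x \<in> \<Omega>" for t x h
    by (rule deformation_isometric[OF \<Omega>(1) reg W dt dx dV dF tr psd that])
  have lin: "linear (F (t, x))" if "t \<in> {0..<T}" "x \<in> \<Omega>" for t x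
    using has_derivative_linear[OF dx[OF inW[OF that]]] .
  have aff: "\<phi> t x = \<phi> t x1 + F (t, x1) (x - x1)" if t: "t \<in> {0..<T}" and x: "x \<in> \<Omega>" for t x
  proof (rule isometric_derivative_imp_affine[OF \<Omega>(1,2) _ _ _ x x1])
    show "inj_on (\<phi> t) \<Omega>" using reg t by (auto simp: regular_deformation_def)
    show "(\<phi> t has_derivative F (t, x)) (at x)" if "x \<in> \<Omega>" for x by (rule dx[OF inW[OF t that]])
    show "norm (F (t, x) h) = norm h" if "x \<in> \<Omega>" for x h by (rule iso[OF t that])
  qed
  define R where "R t = (if t \<in> {0..<T} then F (t, x1) else (\<lambda>x. x))" for t
  define c where "c t = (if t \<in> {0..<T} then \<phi> t x1 - F (t, x1) x1 else 0)" for t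
  define R' where "R' t x = F' x (t, x1) (1, 0)" for t x
  define c' where "c' t = V (t, x1) - F' x1 (t, x1) (1, 0)" for t
  have tI: "((\<lambda>s. (s, x1)) has_derivative (\<lambda>s. (s, 0))) (at t within S)" for t :: real and S
    by (auto intro!: derivative_eq_intros)
  have curve: "continuous_on S (\<lambda>t. (t, x1))" for S :: "real set" by (intro continuous_intros)
  have cW: "(\<lambda>t. (t, x1)) ` {0..<T} \<subseteq> W" "(\<lambda>t. (t, x1)) ` {0<..<T} \<subseteq> W" using inW x1 by auto
  have cF: "continuous_on W (\<lambda>z. F z x)" for x
    using has_derivative_continuous[OF dF] by (intro continuous_at_imp_continuous_on ballI)
  have cV: "continuous_on W V"
    using has_derivative_continuous[OF dV] by (intro continuous_at_imp_continuous_on ballI)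
  have dFt: "((\<lambda>s. F (s, x1) x) has_vector_derivative R' t x) (at t)" if t: "t \<in> {0<..<T}" for t x
  proof -
    have w: "(t, x1) \<in> W" using t x1 by (intro inW) auto
    have "((\<lambda>s. F (s, x1) x) has_derivative (\<lambda>s. F' x (t, x1) (s, 0))) (at t)"
      by (rule has_derivative_compose[OF tI dF[OF w]])
    moreover have "F' x (t, x1) (s, 0) = s *\<^sub>R R' t x" for s
    proof -
      have "F' x (t, x1) (s *\<^sub>R (1, 0)) = s *\<^sub>R F' x (t, x1) (1, 0)"
        using has_derivative_linear[OF dF[OF w]] linear_cmul by blast
      then show ?thesis by (simp add: R'_def)
    qed
    ultimately show ?thesis by (simp add: has_vector_derivative_def)
  qed
  show ?thesis
  proof (rule that[of R c R' c'])
    show "orthogonal_transformation (R t)" for t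
      using lin[OF _ x1] iso[OF _ x1] by (auto simp: R_def orthogonal_transformation linear_ident)
    show "R t = (\<lambda>x. x)" "c t = 0" if "t \<notin> {0..<T}" for t using that by (auto simp: R_def c_def)
    show "\<phi> t x = R t x + c t" if "t \<in> {0..<T}" "x \<in> \<Omega>" for t x
      using aff[OF that] that lin[OF that(1) x1] by (simp add: R_def c_def linear_diff)
    have cFx: "continuous_on {0..<T} (\<lambda>t. F (t, x1) x)" for x
      by (rule continuous_on_compose2[OF cF curve cW(1)])
    then show "continuous_on {0..<T} (\<lambda>t. R t x)" for x
      by (rule continuous_on_eq) (simp add: R_def)
    have "continuous_on {0..<T} (\<lambda>t. \<phi> t x1)"
      using continuous_on_compose2[OF W(3) curve cW(1)] by simp
    then have "continuous_on {0..<T} (\<lambda>t. \<phi> t x1 - F (t, x1) x1)" by (intro continuous_intros cFx)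
    then show "continuous_on {0..<T} c" by (rule continuous_on_eq) (simp add: c_def)
    have opn: "open {0<..<T}" by simp
    fix t :: real assume t: "t \<in> {0<..<T}"
    then have t': "t \<in> {0..<T}" by auto
    show "((\<lambda>s. R s x) has_vector_derivative R' t x) (at t)" for x
      by (rule has_vector_derivative_transform_within_open[OF dFt[OF t] opn t]) (simp add: R_def)
    have "((\<lambda>t. \<phi> t x1 - F (t, x1) x1) has_vector_derivative c' t) (at t)"
      using dFt[OF t, of x1] unfolding c'_def R'_def
      by (intro has_vector_derivative_diff dt inW t' x1) simp_all
    then show "(c has_vector_derivative c' t) (at t)"
      by (rule has_vector_derivative_transform_within_open[OF _ opn t]) (simp add: c_def)
  next
    have *: "continuous_on {0<..<T} (\<lambda>t. F' x (t, x1) (1, 0))" for x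
      by (rule continuous_on_compose2[OF cF' curve cW(2)])
    show "continuous_on {0<..<T} (\<lambda>t. R' t x)" for x unfolding R'_def by (rule *)
    show "continuous_on {0<..<T} c'" unfolding c'_def
      by (intro continuous_intros * continuous_on_compose2[OF cV curve cW(2)])
  qed
qed

section \<open>Pulling back by the rigid motion\<close>

lemma nn_integral_lborel_translate:
  fixes u :: "'a::euclidean_space \<Rightarrow> ennreal"
  assumes [measurable]: "u \<in> borel_measurable borel"
  shows "(\<integral>\<^sup>+ x. u (x + v) \<partial>lborel) = (\<integral>\<^sup>+ x. u x \<partial>lborel)"
proof -
  have "(\<integral>\<^sup>+ x. u x \<partial>lborel) = (\<integral>\<^sup>+ x. u x \<partial>distr lborel borel ((+) v))" by (simp add: lborel_distr_plus)
  also have "\<dots> = (\<integral>\<^sup>+ x. u (x + v) \<partial>lborel)" by (subst nn_integral_distr) (auto simp: add.commute)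
  finally show ?thesis by simp
qed

text \<open>The image of Lebesgue measure under an orthogonal map is again translation invariant.
  The usual double integral comparing two translation invariant measures shows that they are
  proportional, and both give the same mass to the unit ball.\<close>

lemma orthogonal_distr_lborel:
  fixes f :: "'a::euclidean_space \<Rightarrow> 'a"
  assumes f: "orthogonal_transformation f"
  shows "distr lborel borel f = lborel"
proof (rule measure_eqI)
  fix A assume "A \<in> sets (distr lborel borel f)"
  then have A[measurable]: "A \<in> sets borel" by simp
  have lin: "linear f" by (rule orthogonal_transformation_linear[OF f])
  have fm[measurable]: "f \<in> borel_measurable borel"
    using lin by (intro borel_measurable_continuous_onI linear_continuous_on) (simp add: linear_conv_bounded_linear)
  have fi: "f (inv f x) = x" for x using orthogonal_transformation_surj[OF f] by (simp add: surj_f_inv_f)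
  define B where "B = cball (0::'a) 1"
  have Bm[measurable]: "B \<in> sets borel" by (simp add: B_def)
  have Bf: "f y \<in> B \<longleftrightarrow> y \<in> B" for y using orthogonal_transformation_norm[OF f] by (simp add: B_def)
  have ball: "(\<integral>\<^sup>+ x. indicator B (w - x) \<partial>lborel) = emeasure lborel B" for w :: 'a
  proof -
    have "(\<integral>\<^sup>+ x. indicator B (w - x) \<partial>lborel) = (\<integral>\<^sup>+ x. indicator B (w - (x + w)) \<partial>lborel)"
      by (rule nn_integral_lborel_translate[symmetric]) measurable
    also have "\<dots> = (\<integral>\<^sup>+ x. indicator B x \<partial>lborel)"
      by (intro nn_integral_cong) (auto simp: B_def indicator_def)
    finally show ?thesis by simp
  qed
  have m1: "(\<lambda>(x, y). indicator A (x + f y) * indicator B (f y) :: ennreal) \<in> borel_measurable (lborel \<Otimes>\<^sub>M lborel)"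
    by measurable
  have m2: "(\<lambda>(x, y). indicator A (f y) * indicator B (f y - x) :: ennreal) \<in> borel_measurable (lborel \<Otimes>\<^sub>M lborel)"
    by measurable
  have "emeasure lborel A * emeasure lborel B = (\<integral>\<^sup>+ y. \<integral>\<^sup>+ x. indicator A (x + f y) * indicator B (f y) \<partial>lborel \<partial>lborel)"
  proof -
    have "(\<integral>\<^sup>+ x. indicator A (x + f y) * indicator B (f y) \<partial>lborel) = emeasure lborel A * indicator B y" for y
    proof -
      have e: "indicator B (f y) = (indicator B y :: ennreal)" using Bf[of y] by (simp add: indicator_def)
      have "(\<integral>\<^sup>+ x. indicator A (x + f y) * indicator B (f y) \<partial>lborel) = (\<integral>\<^sup>+ x. indicator A (x + f y) \<partial>lborel) * indicator B y"
        unfolding e by (rule nn_integral_multc) measurable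
      also have "(\<integral>\<^sup>+ x. indicator A (x + f y) \<partial>lborel) = emeasure lborel A"
        using nn_integral_lborel_translate[of "indicator A" "f y"] nn_integral_indicator[of A lborel] A by simp
      finally show ?thesis .
    qed
    then show ?thesis by (simp add: nn_integral_cmult)
  qed
  also have "\<dots> = (\<integral>\<^sup>+ x. \<integral>\<^sup>+ y. indicator A (x + f y) * indicator B (f y) \<partial>lborel \<partial>lborel)"
    using lborel_pair.Fubini'[OF m1] by simp
  also have "\<dots> = (\<integral>\<^sup>+ x. \<integral>\<^sup>+ y. indicator A (f y) * indicator B (f y - x) \<partial>lborel \<partial>lborel)"
  proof (rule nn_integral_cong)
    fix x
    have "(\<integral>\<^sup>+ y. indicator A (f y) * indicator B (f y - x) \<partial>lborel)
      = (\<integral>\<^sup>+ y. indicator A (f (y + inv f x)) * indicator B (f (y + inv f x) - x) \<partial>lborel)"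
      by (rule nn_integral_lborel_translate[symmetric]) measurable
    also have "\<dots> = (\<integral>\<^sup>+ y. indicator A (x + f y) * indicator B (f y) \<partial>lborel)"
      by (simp add: linear_add[OF lin] fi add.commute)
    finally show "(\<integral>\<^sup>+ y. indicator A (x + f y) * indicator B (f y) \<partial>lborel)
      = (\<integral>\<^sup>+ y. indicator A (f y) * indicator B (f y - x) \<partial>lborel)" by simp
  qed
  also have "\<dots> = (\<integral>\<^sup>+ y. \<integral>\<^sup>+ x. indicator A (f y) * indicator B (f y - x) \<partial>lborel \<partial>lborel)"
    using lborel_pair.Fubini'[OF m2] by simp
  also have "\<dots> = (\<integral>\<^sup>+ y. indicator A (f y) \<partial>lborel) * emeasure lborel B"
    by (simp add: nn_integral_cmult ball nn_integral_multc)
  also have "(\<integral>\<^sup>+ y. indicator A (f y) \<partial>lborel) = emeasure (distr lborel borel f) A"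
  proof -
    have "(\<integral>\<^sup>+ y. indicator A (f y) \<partial>lborel) = (\<integral>\<^sup>+ y. indicator A y \<partial>distr lborel borel f)"
      by (subst nn_integral_distr) auto
    then show ?thesis by simp
  qed
  finally have eq: "emeasure lborel A * emeasure lborel B = emeasure (distr lborel borel f) A * emeasure lborel B" .
  have "emeasure lborel B \<noteq> 0"
  proof
    assume "emeasure lborel B = 0"
    then have "measure lborel B = 0" by (simp add: measure_def)
    then show False using content_cball_pos[of 1 "0::'a"] by (simp add: B_def)
  qed
  moreover have "emeasure lborel B \<noteq> \<infinity>" using emeasure_compact_finite[of B] by (auto simp: B_def)
  ultimately show "emeasure (distr lborel borel f) A = emeasure lborel A"
    using eq by (metis ennreal_mult_cancel_left mult.commute infinity_ennreal_def)
qed simp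

lemma orthogonal_affine_distr_lborel:
  fixes f :: "'a::euclidean_space \<Rightarrow> 'a"
  assumes f: "orthogonal_transformation f"
  shows "distr lborel borel (\<lambda>x. f x + b) = lborel"
proof -
  have [measurable]: "f \<in> borel_measurable borel"
    using orthogonal_transformation_linear[OF f]
    by (intro borel_measurable_continuous_onI linear_continuous_on) (simp add: linear_conv_bounded_linear)
  have "distr lborel borel (\<lambda>x. f x + b) = distr (distr lborel borel f) borel (\<lambda>x. b + x)"
    by (subst distr_distr) (auto simp: o_def add.commute)
  then show ?thesis by (simp add: orthogonal_distr_lborel[OF f] lborel_distr_plus)
qed

lemma l2_measure_preserving:
  fixes S :: "'a::euclidean_space \<Rightarrow> 'a" and f :: "'a \<Rightarrow> 'b::euclidean_space"
  assumes S[measurable]: "S \<in> borel_measurable borel" and d: "distr lborel borel S = lborel"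
  shows "integrable lborel f \<Longrightarrow> integrable lborel (\<lambda>x. f (S x))"
    and "f \<in> borel_measurable borel \<Longrightarrow> (LINT x|lborel. f (S x)) = (LINT x|lborel. f x)"
    and "l2 f \<Longrightarrow> l2 (\<lambda>x. f (S x))"
    and "f \<in> borel_measurable borel \<Longrightarrow> l2n (\<lambda>x. f (S x)) = l2n f"
proof -
  have 1: "integrable lborel (\<lambda>x. f (S x))" if "integrable lborel f" for f :: "'a \<Rightarrow> 'c::euclidean_space"
  proof -
    have "integrable (distr lborel borel S) f" using that by (simp add: d)
    then show ?thesis by (subst (asm) integrable_distr_eq) (use that in auto)
  qed
  have 2: "(LINT x|lborel. f (S x)) = (LINT x|lborel. f x)" if [measurable]: "f \<in> borel_measurable borel" for f :: "'a \<Rightarrow> 'c::euclidean_space"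
  proof -
    have "(LINT x|lborel. f x) = (LINT x|distr lborel borel S. f x)" by (simp add: d)
    also have "\<dots> = (LINT x|lborel. f (S x))" by (subst integral_distr) auto
    finally show ?thesis by simp
  qed
  show "integrable lborel f \<Longrightarrow> integrable lborel (\<lambda>x. f (S x))" by (rule 1)
  show "f \<in> borel_measurable borel \<Longrightarrow> (LINT x|lborel. f (S x)) = (LINT x|lborel. f x)" by (rule 2)
  show "l2 f \<Longrightarrow> l2 (\<lambda>x. f (S x))"
  proof -
    assume l: "l2 f"
    then have [measurable]: "f \<in> borel_measurable borel" by (simp add: l2_def)
    have "(\<lambda>x. f (S x)) \<in> borel_measurable lborel" by measurable
    then show ?thesis using 1[of "\<lambda>x. (norm (f x))\<^sup>2"] l by (simp add: l2_def)
  qed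
  show "f \<in> borel_measurable borel \<Longrightarrow> l2n (\<lambda>x. f (S x)) = l2n f"
    using 2[of "\<lambda>x. (norm (f x))\<^sup>2"] by (simp add: l2n_def)
qed

text \<open>The deformation is the rigid motion \<open>x \<mapsto> R t x + c t\<close> on the reference domain, and R', c' are
  the time derivatives of its rotation and its translation.\<close>

locale rigid_motion =
  fixes \<Omega> :: "(real^'n) set" and T :: real and \<phi> :: "real \<Rightarrow> real^'n \<Rightarrow> real^'n"
    and R :: "real \<Rightarrow> real^'n \<Rightarrow> real^'n" and c :: "real \<Rightarrow> real^'n"
    and R' :: "real \<Rightarrow> real^'n \<Rightarrow> real^'n" and c' :: "real \<Rightarrow> real^'n"
  assumes open_\<Omega>: "open \<Omega>" and bounded_\<Omega>: "bounded \<Omega>" and T: "0 < T"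
    and orth: "\<And>t. orthogonal_transformation (R t)"
    and R_out: "\<And>t. t \<notin> {0..<T} \<Longrightarrow> R t = (\<lambda>x. x)" and c_out: "\<And>t. t \<notin> {0..<T} \<Longrightarrow> c t = 0"
    and \<phi>_eq: "\<And>t x. t \<in> {0..<T} \<Longrightarrow> x \<in> \<Omega> \<Longrightarrow> \<phi> t x = R t x + c t"
    and cont_R: "\<And>x. continuous_on {0..<T} (\<lambda>t. R t x)" and cont_c: "continuous_on {0..<T} c"
    and deriv_R: "\<And>t x. t \<in> {0<..<T} \<Longrightarrow> ((\<lambda>s. R s x) has_vector_derivative R' t x) (at t)"
    and deriv_c: "\<And>t. t \<in> {0<..<T} \<Longrightarrow> (c has_vector_derivative c' t) (at t)"
    and cont_R': "\<And>x. continuous_on {0<..<T} (\<lambda>t. R' t x)" and cont_c': "continuous_on {0<..<T} c'"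
begin

abbreviation "Q \<equiv> spacetime_domain \<Omega> T \<phi>"

text \<open>Since the rotation is the identity and the translation vanishes at times outside \<open>[0,T)\<close>, this is
  a measure preserving bijection of the whole space-time, which maps the cylinder over \<open>\<Omega>\<close> to the
  space-time domain.\<close>

definition push :: "(real^'n) \<times> real \<Rightarrow> (real^'n) \<times> real" where
  "push z = (R (snd z) (fst z) + c (snd z), snd z)"

definition pull :: "real \<Rightarrow> real^'n \<Rightarrow> real^'n" where
  "pull t y = inv (R t) (y - c t)"

lemma lin: "linear (R t)" by (rule orthogonal_transformation_linear[OF orth])

lemma inv_orth: "orthogonal_transformation (inv (R t))" by (rule orthogonal_transformation_inv[OF orth])

lemma inv_lin: "linear (inv (R t))" by (rule orthogonal_transformation_linear[OF inv_orth])

lemma R_inv[simp]: "R t (inv (R t) v) = v" "inv (R t) (R t v) = v"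
  using orthogonal_transformation_bij[OF orth, of t] by (simp_all add: bij_is_inj bij_is_surj surj_f_inv_f)

lemma norm_R[simp]: "norm (R t v) = norm v" "norm (inv (R t) v) = norm v"
  using orthogonal_transformation_norm[OF orth] orthogonal_transformation_norm[OF inv_orth] by auto

lemma inner_R: "R t v \<bullet> R t w = v \<bullet> w"
  using orth by (simp add: orthogonal_transformation_def)

lemma inner_inv_R: "inv (R t) v \<bullet> w = v \<bullet> R t w"
  by (metis R_inv(1) inner_R)

text \<open>Continuity, differentiability and measurability in time are known for each R t b separately; the
  expansions in the standard basis carry them over to moving arguments and to the inverse.\<close>

lemma inv_R_expand: "inv (R t) v = (\<Sum>b\<in>Basis. (v \<bullet> R t b) *\<^sub>R b)"
  using euclidean_representation[of "inv (R t) v"] by (simp add: inner_inv_R)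

lemma R_expand: "R t v = (\<Sum>b\<in>Basis. (v \<bullet> b) *\<^sub>R R t b)"
proof -
  have "R t (\<Sum>b\<in>Basis. (v \<bullet> b) *\<^sub>R b) = (\<Sum>b\<in>Basis. (v \<bullet> b) *\<^sub>R R t b)"
    using lin by (simp add: linear_sum linear_cmul)
  then show ?thesis by (simp add: euclidean_representation)
qed

lemma pull_push[simp]: "pull t (R t x + c t) = x" "R t (pull t y) + c t = y"
  by (simp_all add: pull_def)

lemma image_eq: "t \<in> {0..<T} \<Longrightarrow> \<phi> t ` \<Omega> = {y. pull t y \<in> \<Omega>}"
  using \<phi>_eq by (auto simp: image_iff) (metis pull_push(2))

lemma mem_Q: "(y, t) \<in> Q \<longleftrightarrow> t \<in> {0<..<T} \<and> pull t y \<in> \<Omega>"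
proof -
  have "t \<in> {0<..<T} \<Longrightarrow> y \<in> \<phi> t ` \<Omega> \<longleftrightarrow> pull t y \<in> \<Omega>" using image_eq[of t] by (simp add: set_eq_iff)
  then show ?thesis unfolding spacetime_domain_def by blast
qed

lemma continuous_on_inv_R:
  assumes "continuous_on S f" "continuous_on S \<tau>" "\<tau> ` S \<subseteq> {0..<T}"
  shows "continuous_on S (\<lambda>z. inv (R (\<tau> z)) (f z))"
  by (subst inv_R_expand) (intro continuous_intros assms continuous_on_compose2[OF cont_R _ assms(3)])

lemma continuous_on_R_compose:
  assumes "continuous_on S f" "continuous_on S \<tau>" "\<tau> ` S \<subseteq> {0..<T}"
  shows "continuous_on S (\<lambda>z. R (\<tau> z) (f z))"
  by (subst R_expand) (intro continuous_intros assms continuous_on_compose2[OF cont_R _ assms(3)])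

lemma continuous_on_pull:
  assumes "continuous_on S f" "continuous_on S \<tau>" "\<tau> ` S \<subseteq> {0..<T}"
  shows "continuous_on S (\<lambda>z. pull (\<tau> z) (f z))"
  unfolding pull_def
  by (intro continuous_on_inv_R continuous_intros assms continuous_on_compose2[OF cont_c _ assms(3)])

lemma push_mem_Q: "push z \<in> Q \<longleftrightarrow> snd z \<in> {0<..<T} \<and> fst z \<in> \<Omega>"
  by (simp add: push_def mem_Q)

lemma open_Q: "open Q"
proof -
  have "continuous_on (UNIV \<times> {0<..<T}) (\<lambda>z. pull (snd z) (fst z))"
    by (intro continuous_on_pull continuous_intros) auto
  moreover have o: "open (UNIV \<times> {0<..<T} :: ((real^'n) \<times> real) set)" by (intro open_Times) auto
  ultimately have "open ((\<lambda>z. pull (snd z) (fst z)) -` \<Omega> \<inter> UNIV \<times> {0<..<T})"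
    using continuous_on_open_vimage[OF o] open_\<Omega> by blast
  also have "(\<lambda>z. pull (snd z) (fst z)) -` \<Omega> \<inter> UNIV \<times> {0<..<T} = Q"
    by (auto simp: mem_Q)
  finally show ?thesis .
qed

lemma R_measurable[measurable]: "(\<lambda>t. R t x) \<in> borel_measurable borel"
proof -
  have "(\<lambda>t. indicator {0..<T} t *\<^sub>R R t x + indicator (- {0..<T}) t *\<^sub>R x) \<in> borel_measurable borel"
    by (intro borel_measurable_add borel_measurable_continuous_on_indicator cont_R) auto
  also have "(\<lambda>t. indicator {0..<T} t *\<^sub>R R t x + indicator (- {0..<T}) t *\<^sub>R x) = (\<lambda>t. R t x)"
    using R_out by (auto simp: indicator_def)
  finally show ?thesis .
qed

lemma c_measurable[measurable]: "c \<in> borel_measurable borel"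
proof -
  have "(\<lambda>t. indicator {0..<T} t *\<^sub>R c t) \<in> borel_measurable borel"
    by (intro borel_measurable_continuous_on_indicator cont_c) auto
  also have "(\<lambda>t. indicator {0..<T} t *\<^sub>R c t) = c" using c_out by (auto simp: indicator_def)
  finally show ?thesis .
qed

lemma R_compose_measurable[measurable (raw)]:
  assumes [measurable]: "f \<in> borel_measurable M" "\<tau> \<in> borel_measurable M"
  shows "(\<lambda>z. R (\<tau> z) (f z)) \<in> borel_measurable M"
  by (subst R_expand) measurable

lemma inv_R_compose_measurable[measurable (raw)]:
  assumes [measurable]: "f \<in> borel_measurable M" "\<tau> \<in> borel_measurable M"
  shows "(\<lambda>z. inv (R (\<tau> z)) (f z)) \<in> borel_measurable M"
  by (subst inv_R_expand) measurable

lemma fst_measurable_borel[measurable]: "fst \<in> borel_measurable (borel :: ((real^'n) \<times> real) measure)"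
  and snd_measurable_borel[measurable]: "snd \<in> borel_measurable (borel :: ((real^'n) \<times> real) measure)"
  by (intro borel_measurable_continuous_onI continuous_intros)+

lemma push_measurable[measurable]: "push \<in> borel_measurable borel"
  unfolding push_def[abs_def] by measurable

text \<open>Each time slice is moved by an orthogonal map and a translation, which preserve Lebesgue measure;
  integrating over time gives the claim.\<close>

lemma push_distr: "distr lborel borel push = lborel"
proof (rule measure_eqI)
  fix A assume "A \<in> sets (distr lborel borel push)"
  then have A[measurable]: "A \<in> sets (borel :: ((real^'n) \<times> real) measure)" by simp
  have fub: "emeasure lborel B = (\<integral>\<^sup>+ t. \<integral>\<^sup>+ x. indicator B (x, t) \<partial>lborel \<partial>lborel)"
    if B[measurable]: "B \<in> sets (borel :: ((real^'n) \<times> real) measure)" for B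
  proof -
    have m: "(\<lambda>z. indicator B z :: ennreal) \<in> borel_measurable (lborel \<Otimes>\<^sub>M lborel)"
      by (simp add: lborel_prod)
    have "emeasure lborel B = (\<integral>\<^sup>+ z. indicator B z \<partial>(lborel \<Otimes>\<^sub>M lborel))"
      by (simp add: lborel_prod)
    also have "\<dots> = (\<integral>\<^sup>+ t. \<integral>\<^sup>+ x. indicator B (x, t) \<partial>lborel \<partial>lborel)"
      by (rule lborel_pair.nn_integral_snd[OF m, symmetric])
    finally show ?thesis .
  qed
  have sl: "(\<lambda>x. indicator A (x, t) :: ennreal) \<in> borel_measurable borel" for t
    by (rule measurable_compose[of "\<lambda>x. (x, t)" borel borel]) (auto intro!: borel_measurable_continuous_onI continuous_intros)
  have pA: "push -` A \<in> sets borel" using measurable_sets_borel[OF push_measurable A] by simp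
  have "emeasure (distr lborel borel push) A = emeasure lborel (push -` A)"
    by (subst emeasure_distr) auto
  also have "\<dots> = (\<integral>\<^sup>+ t. \<integral>\<^sup>+ x. indicator (push -` A) (x, t) \<partial>lborel \<partial>lborel)" by (rule fub[OF pA])
  also have "\<dots> = (\<integral>\<^sup>+ t. \<integral>\<^sup>+ x. indicator A (x, t) \<partial>lborel \<partial>lborel)"
  proof (rule nn_integral_cong)
    fix t
    have mm: "(\<lambda>x. R t x + c t) \<in> borel_measurable borel" by measurable
    have "(\<integral>\<^sup>+ x. indicator A (x, t) \<partial>lborel) = (\<integral>\<^sup>+ x. indicator A (x, t) \<partial>distr lborel borel (\<lambda>x. R t x + c t))"
      by (simp add: orthogonal_affine_distr_lborel[OF orth])
    also have "\<dots> = (\<integral>\<^sup>+ x. indicator A (R t x + c t, t) \<partial>lborel)"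
      by (subst nn_integral_distr) (use mm sl in auto)
    finally show "(\<integral>\<^sup>+ x. indicator (push -` A) (x, t) \<partial>lborel) = (\<integral>\<^sup>+ x. indicator A (x, t) \<partial>lborel)"
      by (simp add: push_def indicator_def)
  qed
  also have "\<dots> = emeasure lborel A" by (rule fub[OF A, symmetric])
  finally show "emeasure (distr lborel borel push) A = emeasure lborel A" .
qed simp

lemmas push_integral = l2_measure_preserving[OF push_measurable push_distr]

lemma slice_preserving:
  "(\<lambda>x. R t x + c t) \<in> borel_measurable borel" "distr lborel borel (\<lambda>x. R t x + c t) = lborel"
  by (measurable, rule orthogonal_affine_distr_lborel[OF orth])

lemmas slice_integral = l2_measure_preserving[OF slice_preserving]

text \<open>The iterated integral over the moving domain is turned, once and for all, into a Lebesgue integral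
  over space-time.\<close>

lemma st_integral_eq:
  assumes "integrable lborel (\<lambda>z. indicator Q z * f (fst z) (snd z))"
  shows "st_integral \<Omega> T \<phi> f = (LINT z|lborel. indicator Q z * f (fst z) (snd z))"
proof -
  have "st_integral \<Omega> T \<phi> f = (LINT t|lborel. LINT y|lborel. indicator Q (y, t) * f y t)"
    unfolding st_integral_def set_lebesgue_integral_def
    by (auto intro!: Bochner_Integration.integral_cong simp: spacetime_domain_def indicator_def)
  also have "\<dots> = (LINT z|lborel. indicator Q z * f (fst z) (snd z))"
    using fubini_time_last(3)[OF assms] by simp
  finally show ?thesis .
qed

end

text \<open>The gradient in the definition of the Sobolev space agrees almost everywhere with any other weak
  gradient, so that the approximation is valid for whichever one is given.\<close>

lemma H10_approximation:
  fixes u :: "real^'n \<Rightarrow> real"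
  assumes U: "open U" and u: "u \<in> H10 U" and g: "weak_gradient U u g" and e: "0 < e"
  shows "\<exists>\<psi>\<in>test_functions U. l2n (\<lambda>y. (indicator U y * u y, indicator U y *\<^sub>R g y) - (\<psi> y, grad \<psi> y)) < e"
proof -
  obtain h \<psi> where h: "weak_gradient U u h" and \<psi>: "\<And>k. \<psi> k \<in> test_functions U"
    and lim: "(\<lambda>k. (LINT y:U|lborel. (u y - \<psi> k y)\<^sup>2) + (LINT y:U|lborel. (norm (h y - grad (\<psi> k) y))\<^sup>2)) \<longlonglongrightarrow> 0"
    using u unfolding H10_def by blast
  have "0 < e\<^sup>2" using e by simp
  from eventually_happens'[OF sequentially_bot order_tendstoD(2)[OF lim this]] obtain k where k:
    "(LINT y:U|lborel. (u y - \<psi> k y)\<^sup>2) + (LINT y:U|lborel. (norm (h y - grad (\<psi> k) y))\<^sup>2) < e\<^sup>2"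
    by auto
  let ?p = "\<psi> k"
  have z: "?p y = 0" "grad ?p y = 0" if "y \<notin> U" for y
  proof -
    obtain K where "K \<subseteq> U" "\<And>x. x \<notin> K \<Longrightarrow> ?p x = 0" "\<And>x e. x \<notin> K \<Longrightarrow> frechet_derivative ?p (at x) e = 0"
      by (rule test_functionsE[OF \<psi>]) blast
    then show "?p y = 0" "grad ?p y = 0" using that by (auto simp: grad_def vec_eq_iff)
  qed
  have lu: "l2 (\<lambda>y. indicator U y * u y)" using g by (simp add: weak_gradient_def L2_iff_l2)
  have lg: "l2 (\<lambda>y. indicator U y *\<^sub>R g y)" "l2 (\<lambda>y. indicator U y *\<^sub>R h y)"
    using g h by (simp_all add: weak_gradient_def L2_iff_l2)
  have lp: "l2 ?p" "l2 (grad ?p)" using test_l2[OF \<psi>] test_grad_l2[OF \<psi>] by auto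
  have d1: "l2 (\<lambda>y. indicator U y * u y - ?p y)" by (rule l2_diff[OF lu lp(1)])
  have d2: "l2 (\<lambda>y. indicator U y *\<^sub>R g y - grad ?p y)" by (rule l2_diff[OF lg(1) lp(2)])
  have d3: "l2 (\<lambda>y. indicator U y *\<^sub>R h y - grad ?p y)" by (rule l2_diff[OF lg(2) lp(2)])
  have "AE y in lborel. indicator U y *\<^sub>R g y - grad ?p y = indicator U y *\<^sub>R h y - grad ?p y"
    using weak_gradient_unique[OF U g h] by eventually_elim (auto simp: indicator_def)
  then have gh: "l2n (\<lambda>y. indicator U y *\<^sub>R g y - grad ?p y) = l2n (\<lambda>y. indicator U y *\<^sub>R h y - grad ?p y)"
    by (rule l2n_cong_AE) (use d2 d3 in \<open>auto simp: l2_def\<close>)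
  have "(l2n (\<lambda>y. (indicator U y * u y - ?p y, indicator U y *\<^sub>R g y - grad ?p y)))\<^sup>2
     = (l2n (\<lambda>y. indicator U y * u y - ?p y))\<^sup>2 + (l2n (\<lambda>y. indicator U y *\<^sub>R h y - grad ?p y))\<^sup>2"
    unfolding l2_Pair(2)[OF d1 d2] gh ..
  also have "(l2n (\<lambda>y. indicator U y * u y - ?p y))\<^sup>2 = (LINT y:U|lborel. (u y - ?p y)\<^sup>2)"
    unfolding l2n_square set_lebesgue_integral_def
    by (intro Bochner_Integration.integral_cong) (auto simp: indicator_def z)
  also have "(l2n (\<lambda>y. indicator U y *\<^sub>R h y - grad ?p y))\<^sup>2 = (LINT y:U|lborel. (norm (h y - grad ?p y))\<^sup>2)"
    unfolding l2n_square set_lebesgue_integral_def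
    by (intro Bochner_Integration.integral_cong) (auto simp: indicator_def z)
  finally have "(l2n (\<lambda>y. (indicator U y * u y - ?p y, indicator U y *\<^sub>R g y - grad ?p y)))\<^sup>2 < e\<^sup>2" using k by simp
  then have "l2n (\<lambda>y. (indicator U y * u y - ?p y, indicator U y *\<^sub>R g y - grad ?p y)) < e"
    using e by (simp add: power2_less_imp_less)
  then show ?thesis using \<psi> by auto
qed

section \<open>The Bochner spaces on the moving domain\<close>

lemma AE_zero_of_slices:
  fixes F :: "'a::euclidean_space \<times> real \<Rightarrow> 'b::euclidean_space"
  assumes F: "l2 F" and 0: "AE t in lborel. AE x in lborel. F (x, t) = 0"
  shows "AE z in lborel. F z = 0"
proof -
  have "AE t in lborel. (l2n (\<lambda>x. F (x, t)))\<^sup>2 = 0"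
    using 0 l2_slices[OF F] by eventually_elim (simp add: l2n_eq_0_iff)
  then have "(LINT t|lborel. (l2n (\<lambda>x. F (x, t)))\<^sup>2) = (LINT t|(lborel :: real measure). (0::real))"
    using l2n_square_slices(1)[OF F] by (intro integral_cong_AE) auto
  then have "l2n F = 0" using l2n_square_slices(2)[OF F] by simp
  then show ?thesis using l2n_eq_0_iff[OF F] by simp
qed

text \<open>The classical spatial gradient, meant for test functions on space-time.\<close>

definition gradx :: "((real^'n) \<times> real \<Rightarrow> real) \<Rightarrow> (real^'n) \<times> real \<Rightarrow> real^'n" where
  "gradx \<rho> z = grad (\<lambda>y. \<rho> (y, snd z)) (fst z)"

lemma test_slice:
  fixes \<rho> :: "(real^'n) \<times> real \<Rightarrow> real"
  assumes "\<rho> \<in> test_functions U"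
  shows "(\<lambda>y. \<rho> (y, t)) \<in> test_functions {y. (y, t) \<in> U}"
proof -
  have "(\<lambda>y. \<rho> ((y, 0) + (0, t))) \<in> test_functions {y. (y, t) \<in> U}"
  proof (rule test_compose_affine[OF assms])
    show "linear (\<lambda>y::real^'n. (y, 0::real))" by (simp add: linear_iff)
    fix C :: "((real^'n) \<times> real) set" assume C: "compact C" "C \<subseteq> U"
    have "compact (fst ` (C \<inter> UNIV \<times> {t}))"
      by (intro compact_continuous_image compact_Int_closed C closed_Times continuous_intros closed_UNIV closed_singleton)
    moreover have "fst ` (C \<inter> UNIV \<times> {t}) \<subseteq> {y. (y, t) \<in> U}" using C by auto
    moreover have "\<forall>y. (y, 0) + (0, t) \<in> C \<longrightarrow> y \<in> fst ` (C \<inter> UNIV \<times> {t})" by force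
    ultimately show "\<exists>D. compact D \<and> D \<subseteq> {y. (y, t) \<in> U} \<and> (\<forall>y. (y, 0) + (0, t) \<in> C \<longrightarrow> y \<in> D)" by blast
  qed
  then show ?thesis by simp
qed

lemma gradx_component:
  fixes \<rho> :: "(real^'n) \<times> real \<Rightarrow> real"
  assumes "\<rho> \<in> test_functions U"
  shows "gradx \<rho> z $ i = frechet_derivative \<rho> (at z) (axis i 1, 0)"
proof -
  have "((\<lambda>y. (y, snd z)) has_derivative (\<lambda>e. (e, 0))) (at (fst z))" by (auto intro!: derivative_eq_intros)
  moreover have "(\<rho> has_derivative frechet_derivative \<rho> (at z)) (at (fst z, snd z))"
    using test_has_derivative[OF assms] by simp
  ultimately have "((\<lambda>y. \<rho> (y, snd z)) has_derivative (\<lambda>e. frechet_derivative \<rho> (at z) (e, 0))) (at (fst z))"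
    by (rule has_derivative_compose)
  from frechet_derivative_at[OF this, symmetric] show ?thesis by (simp add: gradx_def grad_component)
qed

lemma gradx_test:
  fixes \<rho> :: "(real^'n) \<times> real \<Rightarrow> real"
  assumes "\<rho> \<in> test_functions U"
  shows "continuous_on UNIV (gradx \<rho>)" "l2 (gradx \<rho>)" "z \<notin> U \<Longrightarrow> gradx \<rho> z = 0"
proof -
  have e: "gradx \<rho> = (\<lambda>z. \<chi> i. frechet_derivative \<rho> (at z) (axis i 1, 0))"
    by (rule ext) (simp add: vec_eq_iff gradx_component[OF assms])
  show c: "continuous_on UNIV (gradx \<rho>)"
    unfolding e by (intro continuous_on_vec_lambda test_continuous[OF test_partial[OF assms]])
  obtain K where K: "compact K" "K \<subseteq> U" "\<And>x e. x \<notin> K \<Longrightarrow> frechet_derivative \<rho> (at x) e = 0"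
    by (rule test_functionsE[OF assms]) blast
  show "l2 (gradx \<rho>)" by (rule l2_compact_support(1)[OF c K(1)]) (simp add: e K vec_eq_iff)
  show "gradx \<rho> z = 0" if "z \<notin> U"
  proof -
    have "z \<notin> K" using K(2) that by blast
    then show ?thesis by (simp add: e vec_eq_iff K(3))
  qed
qed

lemma test_weak_gradient:
  fixes \<psi> :: "real^'n \<Rightarrow> real"
  assumes \<psi>: "\<psi> \<in> test_functions U"
  shows "weak_gradient U \<psi> (grad \<psi>)" "\<psi> \<in> H10 U"
proof -
  have out: "indicator U y *\<^sub>R \<psi> y = \<psi> y" "indicator U y *\<^sub>R grad \<psi> y = grad \<psi> y" for y
  proof -
    obtain K where "K \<subseteq> U" "\<And>x. x \<notin> K \<Longrightarrow> \<psi> x = 0" "\<And>x e. x \<notin> K \<Longrightarrow> frechet_derivative \<psi> (at x) e = 0"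
      by (rule test_functionsE[OF \<psi>]) blast
    then show "indicator U y *\<^sub>R \<psi> y = \<psi> y" "indicator U y *\<^sub>R grad \<psi> y = grad \<psi> y"
      by (auto simp: indicator_def grad_def vec_eq_iff)
  qed
  show w: "weak_gradient U \<psi> (grad \<psi>)"
    unfolding weak_gradient_def
  proof (intro conjI ballI allI)
    show "\<psi> \<in> L2 U" "grad \<psi> \<in> L2 U" using test_l2[OF \<psi>] test_grad_l2[OF \<psi>] by (simp_all add: L2_iff_l2 out del: real_scaleR_def)
    fix \<rho> :: "real^'n \<Rightarrow> real" and i assume \<rho>: "\<rho> \<in> test_functions U"
    have "(LINT y:U|lborel. \<psi> y * (grad \<rho> y $ i)) = (LINT y|lborel. \<psi> y * frechet_derivative \<rho> (at y) (axis i 1))"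
      unfolding set_lebesgue_integral_def grad_component
      by (intro Bochner_Integration.integral_cong refl) (metis mult.assoc out(1) real_scaleR_def)
    also have "\<dots> = - (LINT y|lborel. frechet_derivative \<psi> (at y) (axis i 1) * \<rho> y)"
      by (rule test_integration_by_parts[OF \<psi> \<rho>])
    also have "(LINT y|lborel. frechet_derivative \<psi> (at y) (axis i 1) * \<rho> y) = (LINT y:U|lborel. (grad \<psi> y $ i) * \<rho> y)"
      unfolding set_lebesgue_integral_def grad_component
      using test_outside[OF \<rho>] by (intro Bochner_Integration.integral_cong refl) (auto simp: indicator_def)
    finally show "(LINT y:U|lborel. \<psi> y * (grad \<rho> y $ i)) = - (LINT y:U|lborel. (grad \<psi> y $ i) * \<rho> y)" .
  qed
  show "\<psi> \<in> H10 U" unfolding H10_def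
  proof (intro CollectI exI conjI allI)
    show "(\<lambda>k::nat. (LINT y:U|lborel. (\<psi> y - \<psi> y)\<^sup>2) + (LINT y:U|lborel. (norm (grad \<psi> y - grad \<psi> y))\<^sup>2)) \<longlonglongrightarrow> 0"
      by simp
  qed (use w \<psi> in auto)
qed

lemma set_integrable_l2_mult:
  fixes f g :: "'a::euclidean_space \<Rightarrow> real"
  assumes "l2 (\<lambda>y. indicator U y *\<^sub>R f y)" "l2 g"
  shows "integrable lborel (\<lambda>y. indicator U y *\<^sub>R (f y * g y))"
  using l2_real_mult_integrable[OF assms] by (simp add: mult.assoc)

lemma integral_linear_combination:
  fixes f g :: "'a \<Rightarrow> real"
  shows "integrable M f \<Longrightarrow> integrable M g \<Longrightarrow> (LINT y|M. a * f y + b * g y) = a * (LINT y|M. f y) + b * (LINT y|M. g y)"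
  by simp

lemma weak_gradient_add:
  fixes u v :: "real^'n \<Rightarrow> real"
  assumes u: "weak_gradient U u g" and v: "weak_gradient U v h"
  shows "weak_gradient U (\<lambda>y. a * u y + b * v y) (\<lambda>y. a *\<^sub>R g y + b *\<^sub>R h y)"
  unfolding weak_gradient_def
proof (intro conjI ballI allI)
  have l: "l2 (\<lambda>y. indicator U y *\<^sub>R u y)" "l2 (\<lambda>y. indicator U y *\<^sub>R v y)"
    "l2 (\<lambda>y. indicator U y *\<^sub>R g y)" "l2 (\<lambda>y. indicator U y *\<^sub>R h y)"
    using u v by (simp_all add: weak_gradient_def L2_iff_l2)
  have "l2 (\<lambda>y. a *\<^sub>R (indicator U y *\<^sub>R u y) + b *\<^sub>R (indicator U y *\<^sub>R v y))"
    by (intro l2_add l2_scaleR l)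
  then show "(\<lambda>y. a * u y + b * v y) \<in> L2 U" by (simp add: L2_iff_l2 algebra_simps)
  have "l2 (\<lambda>y. a *\<^sub>R (indicator U y *\<^sub>R g y) + b *\<^sub>R (indicator U y *\<^sub>R h y))"
    by (intro l2_add l2_scaleR l)
  then show "(\<lambda>y. a *\<^sub>R g y + b *\<^sub>R h y) \<in> L2 U" by (simp add: L2_iff_l2 scaleR_add_right mult.commute)
  fix \<rho> :: "real^'n \<Rightarrow> real" and i assume \<rho>: "\<rho> \<in> test_functions U"
  have lc: "l2 (\<lambda>y. indicator U y *\<^sub>R (f y $ i))" if "l2 (\<lambda>y. indicator U y *\<^sub>R f y)" for f :: "real^'n \<Rightarrow> real^'n"
  proof (rule l2_norm_dominated(1)[OF _ that])
    show "(\<lambda>y. indicator U y *\<^sub>R (f y $ i)) \<in> borel_measurable lborel"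
      using borel_measurable_inner[OF l2_measurable[OF that] borel_measurable_const, of "axis i 1"]
      by (simp add: inner_axis)
    show "norm (indicator U x *\<^sub>R f x $ i) \<le> norm (indicator U x *\<^sub>R f x)" for x
      by (simp add: component_le_norm_cart mult_left_mono abs_mult)
  qed
  have gl: "l2 (\<lambda>y. grad \<rho> y $ i)" unfolding grad_component by (rule test_l2[OF test_partial[OF \<rho>]])
  note int = set_integrable_l2_mult[OF l(1) gl] set_integrable_l2_mult[OF l(2) gl]
    set_integrable_l2_mult[OF lc[OF l(3)] test_l2[OF \<rho>]] set_integrable_l2_mult[OF lc[OF l(4)] test_l2[OF \<rho>]]
  have eu: "(LINT y:U|lborel. u y * (grad \<rho> y $ i)) = - (LINT y:U|lborel. (g y $ i) * \<rho> y)"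
    and ev: "(LINT y:U|lborel. v y * (grad \<rho> y $ i)) = - (LINT y:U|lborel. (h y $ i) * \<rho> y)"
    using u v \<rho> by (auto simp: weak_gradient_def)
  have "(LINT y:U|lborel. (a * u y + b * v y) * (grad \<rho> y $ i))
      = (LINT y|lborel. a * (indicator U y *\<^sub>R (u y * (grad \<rho> y $ i))) + b * (indicator U y *\<^sub>R (v y * (grad \<rho> y $ i))))"
    unfolding set_lebesgue_integral_def by (intro Bochner_Integration.integral_cong) (auto simp: algebra_simps)
  also have "\<dots> = a * (LINT y:U|lborel. u y * (grad \<rho> y $ i)) + b * (LINT y:U|lborel. v y * (grad \<rho> y $ i))"
    unfolding set_lebesgue_integral_def by (rule integral_linear_combination[OF int(1,2)])
  also have "\<dots> = - (a * (LINT y:U|lborel. (g y $ i) * \<rho> y) + b * (LINT y:U|lborel. (h y $ i) * \<rho> y))"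
    by (simp add: eu ev)
  also have "a * (LINT y:U|lborel. (g y $ i) * \<rho> y) + b * (LINT y:U|lborel. (h y $ i) * \<rho> y)
      = (LINT y|lborel. a * (indicator U y *\<^sub>R ((g y $ i) * \<rho> y)) + b * (indicator U y *\<^sub>R ((h y $ i) * \<rho> y)))"
    unfolding set_lebesgue_integral_def by (rule integral_linear_combination[OF int(3,4), symmetric])
  also have "\<dots> = (LINT y:U|lborel. ((a *\<^sub>R g y + b *\<^sub>R h y) $ i) * \<rho> y)"
    unfolding set_lebesgue_integral_def by (intro Bochner_Integration.integral_cong) (auto simp: algebra_simps)
  finally show "(LINT y:U|lborel. (a * u y + b * v y) * (grad \<rho> y $ i))
      = - (LINT y:U|lborel. ((a *\<^sub>R g y + b *\<^sub>R h y) $ i) * \<rho> y)" .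
qed

lemma test_grad_add:
  fixes \<psi> \<rho> :: "real^'n \<Rightarrow> real"
  assumes "\<psi> \<in> test_functions U" "\<rho> \<in> test_functions V"
  shows "grad (\<lambda>y. a * \<psi> y + b * \<rho> y) y = a *\<^sub>R grad \<psi> y + b *\<^sub>R grad \<rho> y"
proof (rule grad_eqI)
  have "((\<lambda>y. a * \<psi> y + b * \<rho> y) has_derivative
     (\<lambda>e. a * frechet_derivative \<psi> (at y) e + b * frechet_derivative \<rho> (at y) e)) (at y)"
    by (intro has_derivative_add has_derivative_mult_right test_has_derivative[OF assms(1)] test_has_derivative[OF assms(2)])
  then show "((\<lambda>y. a * \<psi> y + b * \<rho> y) has_derivative (\<lambda>e. (a *\<^sub>R grad \<psi> y + b *\<^sub>R grad \<rho> y) \<bullet> e)) (at y)"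
    using inner_grad[OF test_has_derivative[OF assms(1)], of y] inner_grad[OF test_has_derivative[OF assms(2)], of y]
    by (simp add: inner_add_left)
qed

lemma grad_sum:
  fixes \<psi> :: "'i \<Rightarrow> real^'m \<Rightarrow> real"
  assumes "\<And>i. i \<in> I \<Longrightarrow> \<psi> i \<in> test_functions (U i)"
  shows "grad (\<lambda>y. \<Sum>i\<in>I. a i * \<psi> i y) y = (\<Sum>i\<in>I. a i *\<^sub>R grad (\<psi> i) y)"
proof (rule grad_eqI)
  have "((\<lambda>y. \<Sum>i\<in>I. a i * \<psi> i y) has_derivative (\<lambda>e. \<Sum>i\<in>I. a i * frechet_derivative (\<psi> i) (at y) e)) (at y)"
    using assms by (intro has_derivative_sum has_derivative_mult_right test_has_derivative) auto
  also have "(\<lambda>e. \<Sum>i\<in>I. a i * frechet_derivative (\<psi> i) (at y) e) = (\<lambda>e. (\<Sum>i\<in>I. a i *\<^sub>R grad (\<psi> i) y) \<bullet> e)"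
  proof
    fix e
    have "frechet_derivative (\<psi> i) (at y) e = grad (\<psi> i) y \<bullet> e" if "i \<in> I" for i
      using inner_grad[OF test_has_derivative[OF assms[OF that]], of y e] by simp
    then show "(\<Sum>i\<in>I. a i * frechet_derivative (\<psi> i) (at y) e) = (\<Sum>i\<in>I. a i *\<^sub>R grad (\<psi> i) y) \<bullet> e"
      by (simp add: inner_sum_left)
  qed
  finally show "((\<lambda>y. \<Sum>i\<in>I. a i * \<psi> i y) has_derivative (\<lambda>e. (\<Sum>i\<in>I. a i *\<^sub>R grad (\<psi> i) y) \<bullet> e)) (at y)" .
qed

text \<open>Converse of \<open>H10_approximation\<close>.\<close>

lemma weak_gradient_H10I:
  fixes u :: "real^'n \<Rightarrow> real"
  assumes g: "weak_gradient U u g"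
    and ap: "\<And>e. 0 < e \<Longrightarrow> \<exists>\<psi>\<in>test_functions U. l2n (\<lambda>y. (indicator U y * u y, indicator U y *\<^sub>R g y) - (\<psi> y, grad \<psi> y)) < e"
  shows "u \<in> H10 U"
proof -
  have "\<forall>k. \<exists>\<psi>. \<psi> \<in> test_functions U \<and> l2n (\<lambda>y. (indicator U y * u y, indicator U y *\<^sub>R g y) - (\<psi> y, grad \<psi> y)) < 1 / Suc k"
  proof
    fix k
    have "0 < 1 / real (Suc k)" by simp
    from ap[OF this] show "\<exists>\<psi>. \<psi> \<in> test_functions U \<and> l2n (\<lambda>y. (indicator U y * u y, indicator U y *\<^sub>R g y) - (\<psi> y, grad \<psi> y)) < 1 / Suc k"
      unfolding Bex_def .
  qed
  from choice[OF this] obtain \<psi> where \<psi>: "\<And>k. \<psi> k \<in> test_functions U"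
    "\<And>k. l2n (\<lambda>y. (indicator U y * u y, indicator U y *\<^sub>R g y) - (\<psi> k y, grad (\<psi> k) y)) < 1 / Suc k" by blast
  have lu: "l2 (\<lambda>y. indicator U y * u y)" and lg: "l2 (\<lambda>y. indicator U y *\<^sub>R g y)"
    using g by (simp_all add: weak_gradient_def L2_iff_l2)
  have sq: "(LINT y:U|lborel. (u y - \<psi> k y)\<^sup>2) + (LINT y:U|lborel. (norm (g y - grad (\<psi> k) y))\<^sup>2)
     = (l2n (\<lambda>y. (indicator U y * u y, indicator U y *\<^sub>R g y) - (\<psi> k y, grad (\<psi> k) y)))\<^sup>2" for k
  proof -
    have z: "grad (\<psi> k) y = 0" "\<psi> k y = 0" if "y \<notin> U" for y
    proof -
      obtain K where "K \<subseteq> U" "\<And>x. x \<notin> K \<Longrightarrow> \<psi> k x = 0" "\<And>x e. x \<notin> K \<Longrightarrow> frechet_derivative (\<psi> k) (at x) e = 0"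
        by (rule test_functionsE[OF \<psi>(1)]) blast
      then show "grad (\<psi> k) y = 0" "\<psi> k y = 0" using that by (auto simp: grad_def vec_eq_iff)
    qed
    have "(l2n (\<lambda>y. (indicator U y * u y - \<psi> k y, indicator U y *\<^sub>R g y - grad (\<psi> k) y)))\<^sup>2
      = (l2n (\<lambda>y. indicator U y * u y - \<psi> k y))\<^sup>2 + (l2n (\<lambda>y. indicator U y *\<^sub>R g y - grad (\<psi> k) y))\<^sup>2"
      by (intro l2_Pair(2) l2_diff lu lg test_l2[OF \<psi>(1)] test_grad_l2[OF \<psi>(1)])
    also have "(l2n (\<lambda>y. indicator U y * u y - \<psi> k y))\<^sup>2 = (LINT y:U|lborel. (u y - \<psi> k y)\<^sup>2)"
      unfolding l2n_square set_lebesgue_integral_def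
      by (intro Bochner_Integration.integral_cong) (auto simp: indicator_def z)
    also have "(l2n (\<lambda>y. indicator U y *\<^sub>R g y - grad (\<psi> k) y))\<^sup>2 = (LINT y:U|lborel. (norm (g y - grad (\<psi> k) y))\<^sup>2)"
      unfolding l2n_square set_lebesgue_integral_def
      by (intro Bochner_Integration.integral_cong) (auto simp: indicator_def z)
    finally show ?thesis by simp
  qed
  have inv0: "(\<lambda>k. 1 / real (Suc k)) \<longlonglongrightarrow> 0" using LIMSEQ_inverse_real_of_nat by (simp add: inverse_eq_divide)
  have "(\<lambda>k. l2n (\<lambda>y. (indicator U y * u y, indicator U y *\<^sub>R g y) - (\<psi> k y, grad (\<psi> k) y))) \<longlonglongrightarrow> 0"
    by (rule tendsto_sandwich[OF _ _ tendsto_const inv0]) (use \<psi>(2) in \<open>auto intro!: always_eventually less_imp_le\<close>)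
  then have "(\<lambda>k. (l2n (\<lambda>y. (indicator U y * u y, indicator U y *\<^sub>R g y) - (\<psi> k y, grad (\<psi> k) y)))\<^sup>2) \<longlonglongrightarrow> 0\<^sup>2"
    by (rule tendsto_power)
  then have "(\<lambda>k. (LINT y:U|lborel. (u y - \<psi> k y)\<^sup>2) + (LINT y:U|lborel. (norm (g y - grad (\<psi> k) y))\<^sup>2)) \<longlonglongrightarrow> 0"
    unfolding sq by (simp only: zero_power2)
  with g \<psi>(1) show ?thesis unfolding H10_def by blast
qed

lemma H10_add:
  fixes u v :: "real^'n \<Rightarrow> real"
  assumes U: "open U" and u: "u \<in> H10 U" "weak_gradient U u g" and v: "v \<in> H10 U" "weak_gradient U v h"
  shows "(\<lambda>y. a * u y + b * v y) \<in> H10 U"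
proof (rule weak_gradient_H10I[OF weak_gradient_add[OF u(2) v(2)]])
  fix e :: real assume e: "0 < e"
  let ?W = "\<lambda>u g y. (indicator U y * u y, indicator U y *\<^sub>R g y) :: real \<times> (real^'n)"
  define k where "k = e / (2 * (1 + \<bar>a\<bar> + \<bar>b\<bar>))"
  have k: "0 < k" using e by (simp add: k_def add_pos_nonneg)
  obtain \<psi> where \<psi>: "\<psi> \<in> test_functions U" "l2n (\<lambda>y. ?W u g y - (\<psi> y, grad \<psi> y)) < k"
    using H10_approximation[OF U u k] by blast
  obtain \<rho> where \<rho>: "\<rho> \<in> test_functions U" "l2n (\<lambda>y. ?W v h y - (\<rho> y, grad \<rho> y)) < k"
    using H10_approximation[OF U v k] by blast
  have l: "l2 (\<lambda>y. ?W u g y - (\<psi> y, grad \<psi> y))" "l2 (\<lambda>y. ?W v h y - (\<rho> y, grad \<rho> y))"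
    using u(2) v(2) unfolding weak_gradient_def L2_iff_l2
    by (auto intro!: l2_diff l2_Pair(1) test_l2[OF \<psi>(1)] test_grad_l2[OF \<psi>(1)] test_l2[OF \<rho>(1)] test_grad_l2[OF \<rho>(1)] simp del: diff_Pair)
  have le: "l2n (\<lambda>y. c *\<^sub>R F y) \<le> \<bar>c\<bar> * l2n F" if "l2 F" for c and F :: "real^'n \<Rightarrow> real \<times> (real^'n)"
    using l2_mult_bounded(2)[OF that, of "\<lambda>_. c" "\<bar>c\<bar>"] by simp
  have "l2n (\<lambda>y. a *\<^sub>R (?W u g y - (\<psi> y, grad \<psi> y)) + b *\<^sub>R (?W v h y - (\<rho> y, grad \<rho> y))) \<le> \<bar>a\<bar> * k + \<bar>b\<bar> * k"
  proof -
    have "l2n (\<lambda>y. a *\<^sub>R (?W u g y - (\<psi> y, grad \<psi> y)) + b *\<^sub>R (?W v h y - (\<rho> y, grad \<rho> y)))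
      \<le> l2n (\<lambda>y. a *\<^sub>R (?W u g y - (\<psi> y, grad \<psi> y))) + l2n (\<lambda>y. b *\<^sub>R (?W v h y - (\<rho> y, grad \<rho> y)))"
      by (intro l2n_triangle l2_scaleR l)
    also have "\<dots> \<le> \<bar>a\<bar> * l2n (\<lambda>y. ?W u g y - (\<psi> y, grad \<psi> y)) + \<bar>b\<bar> * l2n (\<lambda>y. ?W v h y - (\<rho> y, grad \<rho> y))"
      by (intro add_mono le l)
    also have "\<dots> \<le> \<bar>a\<bar> * k + \<bar>b\<bar> * k" using \<psi>(2) \<rho>(2) by (intro add_mono mult_left_mono) auto
    finally show ?thesis .
  qed
  also have "\<bar>a\<bar> * k + \<bar>b\<bar> * k < e"
  proof -
    have "\<bar>a\<bar> * k + \<bar>b\<bar> * k < 2 * (1 + \<bar>a\<bar> + \<bar>b\<bar>) * k" proof -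
      have "0 \<le> \<bar>a\<bar> * k" "0 \<le> \<bar>b\<bar> * k" using k by simp_all
      moreover have "2 * (1 + \<bar>a\<bar> + \<bar>b\<bar>) * k = 2 * k + 2 * (\<bar>a\<bar> * k) + 2 * (\<bar>b\<bar> * k)" by (simp add: algebra_simps)
      ultimately show ?thesis using k by linarith
    qed
    also have "\<dots> = e" using e by (simp add: k_def)
    finally show ?thesis .
  qed
  also have "(\<lambda>y. a *\<^sub>R (?W u g y - (\<psi> y, grad \<psi> y)) + b *\<^sub>R (?W v h y - (\<rho> y, grad \<rho> y)))
     = (\<lambda>y. ?W (\<lambda>y. a * u y + b * v y) (\<lambda>y. a *\<^sub>R g y + b *\<^sub>R h y) y
          - ((\<lambda>y. a * \<psi> y + b * \<rho> y) y, grad (\<lambda>y. a * \<psi> y + b * \<rho> y) y))"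
    unfolding test_grad_add[OF \<psi>(1) \<rho>(1)]
    by (rule ext, case_tac "y \<in> U") (auto simp: right_diff_distrib scaleR_diff_right)
  finally have "l2n (\<lambda>y. ?W (\<lambda>y. a * u y + b * v y) (\<lambda>y. a *\<^sub>R g y + b *\<^sub>R h y) y
          - ((\<lambda>y. a * \<psi> y + b * \<rho> y) y, grad (\<lambda>y. a * \<psi> y + b * \<rho> y) y)) < e" .
  then show "\<exists>\<psi>\<in>test_functions U. l2n (\<lambda>y. ?W (\<lambda>y. a * u y + b * v y) (\<lambda>y. a *\<^sub>R g y + b *\<^sub>R h y) y - (\<psi> y, grad \<psi> y)) < e"
    by (rule bexI[where x="\<lambda>y. a * \<psi> y + b * \<rho> y"]) (intro test_add test_cmult \<psi>(1) \<rho>(1))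
qed

context rigid_motion
begin

text \<open>Extension by zero from the space-time domain, so that Lebesgue integrals over the whole
  space-time can be used throughout.\<close>

definition ext :: "((real^'n) \<times> real \<Rightarrow> 'b::euclidean_space) \<Rightarrow> (real^'n) \<times> real \<Rightarrow> 'b" where
  "ext f z = indicator Q z *\<^sub>R f z"

abbreviation "has_grad \<equiv> has_grad_y \<Omega> T \<phi>"
abbreviation "Y \<equiv> Y_space \<Omega> T \<phi>"

lemma L2_Q_iff: "f \<in> L2 Q \<longleftrightarrow> l2 (ext f)"
  by (simp add: L2_iff_l2 ext_def[abs_def])

lemma Q_measurable[measurable]: "Q \<in> sets borel" using open_Q by simp

lemma Q_slice: "t \<in> {0<..<T} \<Longrightarrow> {y. (y, t) \<in> Q} = \<phi> t ` \<Omega>"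
  by (auto simp: spacetime_domain_def)

lemma open_slice: "t \<in> {0<..<T} \<Longrightarrow> open (\<phi> t ` \<Omega>)"
proof -
  assume t: "t \<in> {0<..<T}"
  have "open ((\<lambda>y. (y, t)) -` Q)" by (rule open_vimage[OF open_Q]) (intro continuous_intros)
  also have "(\<lambda>y. (y, t)) -` Q = \<phi> t ` \<Omega>" using Q_slice[OF t] by auto
  finally show ?thesis .
qed

lemma ext_slice: "t \<in> {0<..<T} \<Longrightarrow> ext f (y, t) = indicator (\<phi> t ` \<Omega>) y *\<^sub>R f (y, t)"
  by (auto simp: ext_def spacetime_domain_def indicator_def)

lemma ext_outside: "t \<notin> {0<..<T} \<Longrightarrow> ext f (y, t) = 0"
  by (auto simp: ext_def spacetime_domain_def indicator_def)

lemma has_grad_l2: "has_grad q g \<Longrightarrow> l2 (ext g)"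
  by (simp add: has_grad_y_def L2_Q_iff)

lemma Y_l2: "q \<in> Y \<Longrightarrow> l2 (ext q)"
  by (simp add: Y_space_def L2_Q_iff)

text \<open>The gradient chosen by \<open>grad_y\<close> may therefore be replaced in integrals by any other one.\<close>

lemma has_grad_unique:
  assumes g: "has_grad q g" and h: "has_grad q h"
  shows "AE z in lborel. ext g z = ext h z"
proof -
  have "AE z in lborel. ext g z - ext h z = 0"
  proof (rule AE_zero_of_slices)
    show "l2 (\<lambda>z. ext g z - ext h z)" by (intro l2_diff has_grad_l2[OF g] has_grad_l2[OF h])
    have "AE t in lborel. t \<in> {0<..<T} \<longrightarrow> weak_gradient (\<phi> t ` \<Omega>) (\<lambda>y. q (y, t)) (\<lambda>y. g (y, t))"
      "AE t in lborel. t \<in> {0<..<T} \<longrightarrow> weak_gradient (\<phi> t ` \<Omega>) (\<lambda>y. q (y, t)) (\<lambda>y. h (y, t))"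
      using g h by (auto simp: has_grad_y_def)
    then show "AE t in lborel. AE y in lborel. ext g (y, t) - ext h (y, t) = 0"
    proof eventually_elim
      case (elim t)
      show ?case
      proof (cases "t \<in> {0<..<T}")
        case True
        have "AE y in lborel. y \<in> \<phi> t ` \<Omega> \<longrightarrow> g (y, t) = h (y, t)"
          using elim True by (intro weak_gradient_unique[OF open_slice[OF True]]) auto
        then show ?thesis by eventually_elim (auto simp: ext_slice[OF True] indicator_def)
      next
        case False
        show ?thesis unfolding ext_outside[OF False] by simp
      qed
    qed
  qed
  then show ?thesis by simp
qed

lemma grad_y_works: "q \<in> Y \<Longrightarrow> has_grad q (grad_y \<Omega> T \<phi> q)"
proof -
  assume "q \<in> Y"
  then have "\<exists>g. has_grad q g" by (simp add: Y_space_def)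
  then show ?thesis unfolding grad_y_def by (rule someI_ex)
qed

text \<open>The source of elements of Y: functions that are classical test functions at each time.\<close>

lemma Y_of_test_slices:
  assumes u: "l2 (ext u)" and g: "l2 (ext g)"
    and sl: "\<And>t. t \<in> {0<..<T} \<Longrightarrow> (\<lambda>y. u (y, t)) \<in> test_functions (\<phi> t ` \<Omega>)"
    and gr: "\<And>t y. t \<in> {0<..<T} \<Longrightarrow> grad (\<lambda>y. u (y, t)) y = g (y, t)"
  shows "u \<in> Y" "has_grad u g"
proof -
  have w: "weak_gradient (\<phi> t ` \<Omega>) (\<lambda>y. u (y, t)) (\<lambda>y. g (y, t))" "(\<lambda>y. u (y, t)) \<in> H10 (\<phi> t ` \<Omega>)" if t: "t \<in> {0<..<T}" for t
  proof -
    have "grad (\<lambda>y. u (y, t)) = (\<lambda>y. g (y, t))" using gr[OF t] by (simp add: fun_eq_iff)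
    then show "weak_gradient (\<phi> t ` \<Omega>) (\<lambda>y. u (y, t)) (\<lambda>y. g (y, t))" "(\<lambda>y. u (y, t)) \<in> H10 (\<phi> t ` \<Omega>)"
      using test_weak_gradient[OF sl[OF t]] by simp_all
  qed
  show h: "has_grad u g" using g w(1) by (simp add: has_grad_y_def L2_Q_iff)
  then show "u \<in> Y" using u w(2) by (auto simp: Y_space_def L2_Q_iff)
qed

lemma test_ext:
  assumes "\<rho> \<in> test_functions Q" shows "ext \<rho> = \<rho>" "ext (gradx \<rho>) = gradx \<rho>"
proof -
  have "ext \<rho> z = \<rho> z" "ext (gradx \<rho>) z = gradx \<rho> z" for z
    using test_outside[OF assms, of z] gradx_test(3)[OF assms, of z] by (cases "z \<in> Q"; simp add: ext_def)+
  then show "ext \<rho> = \<rho>" "ext (gradx \<rho>) = gradx \<rho>" by (simp_all add: fun_eq_iff)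
qed

lemma test_in_Y:
  assumes \<rho>: "\<rho> \<in> test_functions Q" shows "\<rho> \<in> Y" "has_grad \<rho> (gradx \<rho>)"
proof -
  have "l2 (ext \<rho>)" "l2 (ext (gradx \<rho>))" unfolding test_ext[OF \<rho>] by (rule test_l2[OF \<rho>], rule gradx_test(2)[OF \<rho>])
  moreover have "(\<lambda>y. \<rho> (y, t)) \<in> test_functions (\<phi> t ` \<Omega>)" if "t \<in> {0<..<T}" for t
    using test_slice[OF \<rho>, of t] Q_slice[OF that] by simp
  ultimately show "\<rho> \<in> Y" "has_grad \<rho> (gradx \<rho>)" by (rule Y_of_test_slices; simp add: gradx_def)+
qed

lemma Y_add:
  assumes p: "p \<in> Y" "has_grad p g" and q: "q \<in> Y" "has_grad q h"
  shows "(\<lambda>z. a * p z + b * q z) \<in> Y" "has_grad (\<lambda>z. a * p z + b * q z) (\<lambda>z. a *\<^sub>R g z + b *\<^sub>R h z)"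
proof -
  have "l2 (\<lambda>z. a *\<^sub>R ext p z + b *\<^sub>R ext q z)" by (intro l2_add l2_scaleR Y_l2 p q)
  also have "(\<lambda>z. a *\<^sub>R ext p z + b *\<^sub>R ext q z) = ext (\<lambda>z. a * p z + b * q z)"
    by (auto simp: ext_def indicator_def)
  finally have l1: "l2 (ext (\<lambda>z. a * p z + b * q z))" .
  have "l2 (\<lambda>z. a *\<^sub>R ext g z + b *\<^sub>R ext h z)"
    by (intro l2_add l2_scaleR has_grad_l2[OF p(2)] has_grad_l2[OF q(2)])
  also have "(\<lambda>z. a *\<^sub>R ext g z + b *\<^sub>R ext h z) = ext (\<lambda>z. a *\<^sub>R g z + b *\<^sub>R h z)"
    by (auto simp: ext_def indicator_def)
  finally have l2: "l2 (ext (\<lambda>z. a *\<^sub>R g z + b *\<^sub>R h z))" .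
  have "AE t in lborel. t \<in> {0<..<T} \<longrightarrow> weak_gradient (\<phi> t ` \<Omega>) (\<lambda>y. p (y, t)) (\<lambda>y. g (y, t))"
      "AE t in lborel. t \<in> {0<..<T} \<longrightarrow> weak_gradient (\<phi> t ` \<Omega>) (\<lambda>y. q (y, t)) (\<lambda>y. h (y, t))"
    using p(2) q(2) by (auto simp: has_grad_y_def)
  note ae = this
  have "AE t in lborel. t \<in> {0<..<T} \<longrightarrow>
     weak_gradient (\<phi> t ` \<Omega>) (\<lambda>y. a * p (y, t) + b * q (y, t)) (\<lambda>y. a *\<^sub>R g (y, t) + b *\<^sub>R h (y, t))"
    using ae by eventually_elim (auto intro: weak_gradient_add)
  then show hg: "has_grad (\<lambda>z. a * p z + b * q z) (\<lambda>z. a *\<^sub>R g z + b *\<^sub>R h z)"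
    using l2 by (simp add: has_grad_y_def L2_Q_iff)
  have "AE t in lborel. t \<in> {0<..<T} \<longrightarrow> (\<lambda>y. p (y, t)) \<in> H10 (\<phi> t ` \<Omega>)"
    "AE t in lborel. t \<in> {0<..<T} \<longrightarrow> (\<lambda>y. q (y, t)) \<in> H10 (\<phi> t ` \<Omega>)"
    using p(1) q(1) by (auto simp: Y_space_def)
  with ae have "AE t in lborel. t \<in> {0<..<T} \<longrightarrow> (\<lambda>y. a * p (y, t) + b * q (y, t)) \<in> H10 (\<phi> t ` \<Omega>)"
    by eventually_elim (auto intro: H10_add[OF open_slice])
  then show "(\<lambda>z. a * p z + b * q z) \<in> Y" using l1 hg by (auto simp: Y_space_def L2_Q_iff)
qed

section \<open>The reference cylinder\<close>

text \<open>The gradient is rotated back, so that it becomes the gradient in reference coordinates and the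
  pullback preserves norms.\<close>

definition pullback :: "((real^'n) \<times> real \<Rightarrow> real) \<Rightarrow> ((real^'n) \<times> real \<Rightarrow> real^'n) \<Rightarrow> (real^'n) \<times> real \<Rightarrow> real \<times> (real^'n)" where
  "pullback p g z = (p (push z), inv (R (snd z)) (g (push z)))"

lemma pullback_l2:
  assumes p: "l2 p" and g: "l2 g"
  shows "l2 (pullback p g)" "l2n (pullback p g) = l2n (\<lambda>z. (p z, g z))"
proof -
  have pm[measurable]: "p \<in> borel_measurable borel" and gm[measurable]: "g \<in> borel_measurable borel"
    using p g by (simp_all add: l2_def)
  have sm: "(\<lambda>z::(real^'n) \<times> real. snd z) \<in> borel_measurable borel" by measurable
  have "(\<lambda>z. inv (R (snd z)) (g (push z))) \<in> borel_measurable borel"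
    by (rule inv_R_compose_measurable) measurable
  then have m: "pullback p g \<in> borel_measurable lborel" unfolding pullback_def[abs_def]
    by (intro borel_measurable_Pair) measurable
  have n: "norm (pullback p g z) = norm (p (push z), g (push z))" for z by (simp add: pullback_def norm_Pair)
  have pg: "l2 (\<lambda>z. (p z, g z))" by (rule l2_Pair(1)[OF p g])
  have "l2 (\<lambda>z. (p (push z), g (push z)))" by (rule push_integral(3)[OF pg])
  then show "l2 (pullback p g)" by (rule l2_norm_dominated(1)[OF m]) (simp add: n)
  have "l2n (pullback p g) = l2n (\<lambda>z. (p (push z), g (push z)))" by (simp add: l2n_def n)
  also have "\<dots> = l2n (\<lambda>z. (p z, g z))"
    by (rule push_integral(4)[of "\<lambda>z. (p z, g z)"]) (use pg in \<open>simp add: l2_def\<close>)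
  finally show "l2n (pullback p g) = l2n (\<lambda>z. (p z, g z))" .
qed

lemma test_push_slice:
  assumes t: "t \<in> {0<..<T}" and \<psi>: "\<psi> \<in> test_functions (\<phi> t ` \<Omega>)"
  shows "(\<lambda>x. \<psi> (R t x + c t)) \<in> test_functions \<Omega>"
    and "grad (\<lambda>x. \<psi> (R t x + c t)) x = inv (R t) (grad \<psi> (R t x + c t))"
proof -
  have t': "t \<in> {0..<T}" using t by auto
  show "(\<lambda>x. \<psi> (R t x + c t)) \<in> test_functions \<Omega>"
  proof (rule test_compose_affine[OF \<psi> lin])
    fix C assume C: "compact C" "C \<subseteq> \<phi> t ` \<Omega>"
    have "compact (pull t ` C)"
      by (intro compact_continuous_image continuous_on_pull C continuous_intros) (use t in auto)
    moreover have "pull t ` C \<subseteq> \<Omega>" using C image_eq[OF t'] by auto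
    moreover have "\<forall>x. R t x + c t \<in> C \<longrightarrow> x \<in> pull t ` C" by (metis image_eqI pull_push(1))
    ultimately show "\<exists>D. compact D \<and> D \<subseteq> \<Omega> \<and> (\<forall>x. R t x + c t \<in> C \<longrightarrow> x \<in> D)" by blast
  qed
  have dR: "(R t has_derivative R t) (at x)"
    using lin by (simp add: linear_conv_bounded_linear bounded_linear_imp_has_derivative)
  have "((\<lambda>x. R t x + c t) has_derivative R t) (at x)" by (auto intro!: derivative_eq_intros dR)
  from has_derivative_compose[OF this test_has_derivative[OF \<psi>]]
  have d: "((\<lambda>x. \<psi> (R t x + c t)) has_derivative (\<lambda>e. frechet_derivative \<psi> (at (R t x + c t)) (R t e))) (at x)" .
  show "grad (\<lambda>x. \<psi> (R t x + c t)) x = inv (R t) (grad \<psi> (R t x + c t))"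
  proof (rule grad_eqI)
    show "((\<lambda>x. \<psi> (R t x + c t)) has_derivative (\<lambda>e. inv (R t) (grad \<psi> (R t x + c t)) \<bullet> e)) (at x)"
      using d by (simp add: inner_inv_R inner_grad[OF test_has_derivative[OF \<psi>]])
  qed
qed

lemma test_pull_slice:
  assumes t: "t \<in> {0<..<T}" and \<psi>: "\<psi> \<in> test_functions \<Omega>"
  shows "(\<lambda>y. \<psi> (pull t y)) \<in> test_functions (\<phi> t ` \<Omega>)"
    and "grad (\<lambda>y. \<psi> (pull t y)) y = R t (grad \<psi> (pull t y))"
proof -
  have t': "t \<in> {0..<T}" using t by auto
  have e: "pull t = (\<lambda>y. inv (R t) y + (- inv (R t) (c t)))"
    by (rule ext) (simp add: pull_def linear_diff[OF inv_lin])
  have "(\<lambda>y. \<psi> (inv (R t) y + (- inv (R t) (c t)))) \<in> test_functions (\<phi> t ` \<Omega>)"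
  proof (rule test_compose_affine[OF \<psi> inv_lin])
    fix C assume C: "compact C" "C \<subseteq> \<Omega>"
    have "compact ((\<lambda>x. R t x + c t) ` C)"
      by (intro compact_continuous_image C continuous_intros linear_continuous_on lin[unfolded linear_conv_bounded_linear])
    moreover have "(\<lambda>x. R t x + c t) ` C \<subseteq> \<phi> t ` \<Omega>" using C image_eq[OF t'] by auto
    moreover have "\<forall>y. inv (R t) y + (- inv (R t) (c t)) \<in> C \<longrightarrow> y \<in> (\<lambda>x. R t x + c t) ` C"
      using e pull_push(2) by (metis image_eqI)
    ultimately show "\<exists>D. compact D \<and> D \<subseteq> \<phi> t ` \<Omega> \<and> (\<forall>y. inv (R t) y + (- inv (R t) (c t)) \<in> C \<longrightarrow> y \<in> D)" by blast
  qed
  then show "(\<lambda>y. \<psi> (pull t y)) \<in> test_functions (\<phi> t ` \<Omega>)" by (simp add: e)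
  have dR: "(inv (R t) has_derivative inv (R t)) (at y)"
    using inv_lin by (simp add: linear_conv_bounded_linear bounded_linear_imp_has_derivative)
  have "(pull t has_derivative inv (R t)) (at y)" unfolding e by (auto intro!: derivative_eq_intros dR)
  from has_derivative_compose[OF this test_has_derivative[OF \<psi>]]
  have d: "((\<lambda>y. \<psi> (pull t y)) has_derivative (\<lambda>e. frechet_derivative \<psi> (at (pull t y)) (inv (R t) e))) (at y)" .
  show "grad (\<lambda>y. \<psi> (pull t y)) y = R t (grad \<psi> (pull t y))"
  proof (rule grad_eqI)
    have "R t v \<bullet> e = v \<bullet> inv (R t) e" for v e using inner_inv_R[of t e v] by (simp add: inner_commute)
    then show "((\<lambda>y. \<psi> (pull t y)) has_derivative (\<lambda>e. R t (grad \<psi> (pull t y)) \<bullet> e)) (at y)"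
      using d by (simp add: inner_grad[OF test_has_derivative[OF \<psi>]])
  qed
qed

text \<open>At almost every time, q is approximated by test functions on the moved domain, and the motion
  carries these to test functions on \<open>\<Omega>\<close> without changing the Sobolev norm.\<close>

lemma pullback_slice_approximation:
  assumes q: "q \<in> Y" and g: "has_grad q g"
  shows "AE t in lborel. t \<in> {0<..<T} \<longrightarrow>
    (\<forall>e>0. \<exists>d\<in>(\<lambda>\<psi> x. (\<psi> x, grad \<psi> x)) ` test_functions \<Omega>. l2n (\<lambda>x. pullback (ext q) (ext g) (x, t) - d x) < e)"
proof -
  have "AE t in lborel. t \<in> {0<..<T} \<longrightarrow> weak_gradient (\<phi> t ` \<Omega>) (\<lambda>y. q (y, t)) (\<lambda>y. g (y, t))"
    using g by (auto simp: has_grad_y_def)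
  moreover have "AE t in lborel. t \<in> {0<..<T} \<longrightarrow> (\<lambda>y. q (y, t)) \<in> H10 (\<phi> t ` \<Omega>)"
    using q by (auto simp: Y_space_def)
  ultimately show ?thesis
  proof eventually_elim
    case (elim t)
    show ?case
    proof (intro impI allI)
      assume t: "t \<in> {0<..<T}" fix e :: real assume e: "0 < e"
      let ?U = "\<phi> t ` \<Omega>"
      let ?W = "\<lambda>y. (indicator ?U y * q (y, t), indicator ?U y *\<^sub>R g (y, t))"
      have w: "weak_gradient ?U (\<lambda>y. q (y, t)) (\<lambda>y. g (y, t))" using elim t by blast
      obtain \<psi> where \<psi>: "\<psi> \<in> test_functions ?U" "l2n (\<lambda>y. ?W y - (\<psi> y, grad \<psi> y)) < e"
        using H10_approximation[OF open_slice[OF t] _ w e] elim t by blast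
      let ?d = "\<lambda>x. (\<psi> (R t x + c t), grad (\<lambda>x. \<psi> (R t x + c t)) x)"
      have wl: "l2 ?W" using w by (intro l2_Pair(1)) (simp_all add: weak_gradient_def L2_iff_l2)
      have l: "l2 (\<lambda>y. ?W y - (\<psi> y, grad \<psi> y))"
        by (intro l2_diff wl l2_Pair(1) test_l2[OF \<psi>(1)] test_grad_l2[OF \<psi>(1)])
      have n: "norm (pullback (ext q) (ext g) (x, t) - ?d x) = norm (?W (R t x + c t) - (\<psi> (R t x + c t), grad \<psi> (R t x + c t)))" for x
      proof -
        have "inv (R t) a - inv (R t) b = inv (R t) (a - b)" for a b by (simp add: linear_diff[OF inv_lin])
        then show ?thesis
          by (simp add: pullback_def push_def ext_slice[OF t] test_push_slice(2)[OF t \<psi>(1)] norm_Pair)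
      qed
      have "l2n (\<lambda>x. pullback (ext q) (ext g) (x, t) - ?d x) = l2n (\<lambda>x. ?W (R t x + c t) - (\<psi> (R t x + c t), grad \<psi> (R t x + c t)))"
        unfolding l2n_def n ..
      also have "\<dots> = l2n (\<lambda>y. ?W y - (\<psi> y, grad \<psi> y))"
        by (rule slice_integral(4)[of "\<lambda>y. ?W y - (\<psi> y, grad \<psi> y)"]) (use l in \<open>simp add: l2_def del: diff_Pair\<close>)
      finally have "l2n (\<lambda>x. pullback (ext q) (ext g) (x, t) - ?d x) < e" using \<psi>(2) by simp
      then show "\<exists>d\<in>(\<lambda>\<psi> x. (\<psi> x, grad \<psi> x)) ` test_functions \<Omega>. l2n (\<lambda>x. pullback (ext q) (ext g) (x, t) - d x) < e"
        by (rule bexI[where x="?d"]) (rule imageI[OF test_push_slice(1)[OF t \<psi>(1)]])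
    qed
  qed
qed

definition jet :: "(real^'n \<Rightarrow> real) \<Rightarrow> real^'n \<Rightarrow> real \<times> (real^'n)" where
  "jet \<psi> x = (\<psi> x, grad \<psi> x)"

lemma jet_l2: "\<psi> \<in> test_functions U \<Longrightarrow> l2 (jet \<psi>)"
  unfolding jet_def[abs_def] by (intro l2_Pair(1) test_l2 test_grad_l2)

lemma pullback_tensor_approximation:
  assumes q: "q \<in> Y" and g: "has_grad q g" and e: "0 < e"
  obtains m :: nat and \<eta> \<psi> where
    "\<And>i. i < m \<Longrightarrow> \<eta> i \<in> test_functions {0<..<T}" "\<And>i. i < m \<Longrightarrow> \<psi> i \<in> test_functions \<Omega>"
    "l2n (\<lambda>z. pullback (ext q) (ext g) z - (\<Sum>i<m. \<eta> i (snd z) *\<^sub>R jet (\<psi> i) (fst z))) < e"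
proof -
  have V: "l2 (pullback (ext q) (ext g))" by (rule pullback_l2(1)[OF Y_l2[OF q] has_grad_l2[OF g]])
  have supp: "pullback (ext q) (ext g) (x, t) = 0" if "t \<notin> {0<..<T}" for x t
    using linear_0[OF inv_lin] by (simp add: pullback_def push_def zero_prod_def ext_outside[OF that])
  have D: "l2 d" if "d \<in> (\<lambda>\<psi> x. (\<psi> x, grad \<psi> x)) ` test_functions \<Omega>" for d
    using that jet_l2[unfolded jet_def[abs_def]] by blast
  obtain m :: nat and \<eta> d where *: "\<And>i. i < m \<Longrightarrow> \<eta> i \<in> test_functions {0<..<T}"
      "\<And>i. i < m \<Longrightarrow> d i \<in> (\<lambda>\<psi> x. (\<psi> x, grad \<psi> x)) ` test_functions \<Omega>"
      "l2n (\<lambda>z. pullback (ext q) (ext g) z - (\<Sum>i<m. \<eta> i (snd z) *\<^sub>R d i (fst z))) < e"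
    using tensor_approximation[OF V T supp D pullback_slice_approximation[OF q g] e] by blast
  have "\<forall>i. \<exists>\<psi>. i < m \<longrightarrow> \<psi> \<in> test_functions \<Omega> \<and> d i = jet \<psi>"
    using *(2) unfolding jet_def[abs_def] by blast
  from choice[OF this] obtain \<psi> where \<psi>: "\<And>i. i < m \<Longrightarrow> \<psi> i \<in> test_functions \<Omega>" "\<And>i. i < m \<Longrightarrow> d i = jet (\<psi> i)"
    by blast
  have "(\<lambda>z. pullback (ext q) (ext g) z - (\<Sum>i<m. \<eta> i (snd z) *\<^sub>R d i (fst z)))
     = (\<lambda>z. pullback (ext q) (ext g) z - (\<Sum>i<m. \<eta> i (snd z) *\<^sub>R jet (\<psi> i) (fst z)))"
    by (simp add: \<psi>(2) cong: sum.cong_simp)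
  with *(3) have "l2n (\<lambda>z. pullback (ext q) (ext g) z - (\<Sum>i<m. \<eta> i (snd z) *\<^sub>R jet (\<psi> i) (fst z))) < e" by simp
  with *(1) \<psi>(1) show ?thesis using that[of m \<eta> \<psi>] by blast
qed

section \<open>Test functions are dense\<close>

text \<open>Value and spatial gradient, at the point y and the time s, of the function \<open>\<psi>\<close> carried along by
  the motion.\<close>

definition lift :: "(real^'n \<Rightarrow> real) \<Rightarrow> real \<Rightarrow> real^'n \<Rightarrow> real \<times> (real^'n)" where
  "lift \<psi> s y = (\<psi> (pull s y), R s (grad \<psi> (pull s y)))"

lemma norm_lift: "norm (lift \<psi> s y) = norm (jet \<psi> (pull s y))"
  by (simp add: lift_def jet_def norm_Pair)

lemma lift_continuous:
  assumes \<psi>: "\<psi> \<in> test_functions U"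
    and f: "continuous_on S f" "continuous_on S \<tau>" "\<tau> ` S \<subseteq> {0..<T}"
  shows "continuous_on S (\<lambda>z. lift \<psi> (\<tau> z) (f z))"
  unfolding lift_def
  by (intro continuous_on_Pair continuous_on_R_compose f continuous_on_pull
      continuous_on_compose2[OF test_continuous[OF \<psi>]] continuous_on_compose2[OF grad_continuous[OF \<psi>]]) auto

lemma lift_measurable:
  assumes \<psi>: "\<psi> \<in> test_functions U"
  shows "(\<lambda>z. lift \<psi> (snd z) (fst z)) \<in> borel_measurable borel"
proof -
  have [measurable]: "\<psi> \<in> borel_measurable borel" "grad \<psi> \<in> borel_measurable borel"
    by (intro borel_measurable_continuous_onI test_continuous[OF \<psi>] grad_continuous[OF \<psi>])+
  have m[measurable]: "(\<lambda>z::(real^'n) \<times> real. pull (snd z) (fst z)) \<in> borel_measurable borel"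
    unfolding pull_def by measurable
  have "(\<lambda>z. R (snd z) (grad \<psi> (pull (snd z) (fst z)))) \<in> borel_measurable borel"
    by (rule R_compose_measurable) measurable
  then show ?thesis unfolding lift_def by (intro borel_measurable_Pair) measurable
qed

lemma jet_bounded:
  assumes \<psi>: "\<psi> \<in> test_functions U"
  obtains B where "0 < B" "\<And>x. norm (jet \<psi> x) \<le> B"
proof -
  obtain K where K: "compact K" "\<And>x. x \<notin> K \<Longrightarrow> \<psi> x = 0" "\<And>x e. x \<notin> K \<Longrightarrow> frechet_derivative \<psi> (at x) e = 0"
    by (rule test_functionsE[OF \<psi>]) blast
  have c: "continuous_on UNIV (jet \<psi>)" unfolding jet_def[abs_def]
    by (intro continuous_on_Pair test_continuous[OF \<psi>] grad_continuous[OF \<psi>])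
  have z: "jet \<psi> x = 0" if "x \<notin> K" for x using K that by (simp add: jet_def grad_def zero_prod_def vec_eq_iff)
  show ?thesis using compact_support_bounded[OF c K(1) z] that by blast
qed

lemma time_support:
  assumes \<eta>: "\<eta> \<in> test_functions {0<..<T}"
  obtains a b where "0 < a" "a < b" "b < T" "\<And>t. t \<notin> {a..<b} \<Longrightarrow> \<eta> t = 0"
proof -
  obtain K where K: "compact K" "K \<subseteq> {0<..<T}" "\<And>t. t \<notin> K \<Longrightarrow> \<eta> t = 0"
    by (rule test_functionsE[OF \<eta>]) blast
  show ?thesis
  proof (cases "K = {}")
    case True
    then show ?thesis using K(3) T by (intro that[of "T / 3" "T / 2"]) auto
  next
    case False
    obtain p where p: "p \<in> K" "\<forall>t\<in>K. p \<le> t" using compact_attains_inf[OF K(1) False] by blast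
    obtain q where q: "q \<in> K" "\<forall>t\<in>K. t \<le> q" using compact_attains_sup[OF K(1) False] by blast
    have pq: "0 < p" "q < T" "p \<le> q" using p q K(2) by auto
    show ?thesis
    proof (rule that[of p "(q + T) / 2"])
      show "\<eta> t = 0" if "t \<notin> {p..<(q + T) / 2}" for t
      proof (rule K(3))
        show "t \<notin> K" using that p(2) q(2) pq by force
      qed
    qed (use pq in auto)
  qed
qed

text \<open>The motion is continuous, and so sweeps the support of \<open>\<psi>\<close> over a compact set in a compact time
  interval.\<close>

lemma lift_support:
  assumes \<psi>: "\<psi> \<in> test_functions \<Omega>" and ab: "0 \<le> a" "b < T"
  obtains K where "compact K" "\<And>s y. s \<in> {a..b} \<Longrightarrow> y \<notin> K \<Longrightarrow> lift \<psi> s y = 0"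
proof -
  obtain C where C: "compact C" "\<And>x. x \<notin> C \<Longrightarrow> \<psi> x = 0" "\<And>x e. x \<notin> C \<Longrightarrow> frechet_derivative \<psi> (at x) e = 0"
    by (rule test_functionsE[OF \<psi>]) blast
  let ?K = "(\<lambda>z. R (fst z) (snd z) + c (fst z)) ` ({a..b} \<times> C)"
  show ?thesis
  proof (rule that[of ?K])
    show "compact ?K"
      by (intro compact_continuous_image compact_Times C continuous_intros continuous_on_R_compose
          continuous_on_compose2[OF cont_c]) (use ab in auto)
    fix s y assume s: "s \<in> {a..b}" and y: "y \<notin> ?K"
    have "pull s y \<notin> C"
    proof
      assume "pull s y \<in> C"
      then have "R (fst (s, pull s y)) (snd (s, pull s y)) + c (fst (s, pull s y)) \<in> ?K" using s by (intro imageI) auto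
      then show False using y by simp
    qed
    then have "\<psi> (pull s y) = 0" "grad \<psi> (pull s y) = 0" using C by (auto simp: grad_def vec_eq_iff)
    then show "lift \<psi> s y = 0" using linear_0[OF lin] by (simp add: lift_def zero_prod_def)
  qed
qed

lemma lift_tensor_l2:
  assumes \<psi>: "\<psi> \<in> test_functions \<Omega>" and \<eta>: "\<eta> \<in> test_functions {0<..<T}"
  shows "l2 (\<lambda>z. \<eta> (snd z) *\<^sub>R lift \<psi> (snd z) (fst z))"
proof -
  obtain a b where ab: "0 < a" "a < b" "b < T" "\<And>t. t \<notin> {a..<b} \<Longrightarrow> \<eta> t = 0" using time_support[OF \<eta>] by blast
  obtain K where K: "compact K" "\<And>s y. s \<in> {a..b} \<Longrightarrow> y \<notin> K \<Longrightarrow> lift \<psi> s y = 0"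
    using lift_support[OF \<psi>, of a b] ab by auto
  obtain B where B: "0 < B" "\<And>x. norm (jet \<psi> x) \<le> B" using jet_bounded[OF \<psi>] by blast
  obtain A where A: "0 < A" "\<And>t. \<bar>\<eta> t\<bar> \<le> A" using test_bounded[OF \<eta>] by blast
  have \<eta>m[measurable]: "\<eta> \<in> borel_measurable borel"
    by (intro borel_measurable_continuous_onI test_continuous[OF \<eta>])
  show ?thesis
  proof (rule l2_bounded_compact(1)[where B="A * B" and K="K \<times> {a..b}"])
    have "(\<lambda>z. \<eta> (snd z) *\<^sub>R lift \<psi> (snd z) (fst z)) \<in> borel_measurable borel"
      by (intro borel_measurable_scaleR lift_measurable[OF \<psi>]) measurable
    then show "(\<lambda>z. \<eta> (snd z) *\<^sub>R lift \<psi> (snd z) (fst z)) \<in> borel_measurable lborel" by simp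
    show "norm (\<eta> (snd z) *\<^sub>R lift \<psi> (snd z) (fst z)) \<le> A * B" for z
      using A B by (simp add: norm_lift mult_mono)
    show "\<eta> (snd z) *\<^sub>R lift \<psi> (snd z) (fst z) = 0" if "z \<notin> K \<times> {a..b}" for z
    proof (cases "snd z \<in> {a..b}")
      case True
      then have "fst z \<notin> K" using that by (auto simp: mem_Times_iff)
      then show ?thesis using K(2)[OF True] by simp
    next
      case False
      then have "\<eta> (snd z) = 0" by (intro ab(4)) auto
      then show ?thesis by simp
    qed
  qed (intro compact_Times K(1) compact_Icc)
qed

text \<open>On each of many short time intervals a moving test profile is replaced by the one at the beginning
  of the interval. What results is smooth in space and time, whether or not the motion is smooth in
  time, and its support still lies in the space-time domain if the intervals are short enough.\<close>

lemma freeze_in_time: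
  assumes \<psi>: "\<psi> \<in> test_functions \<Omega>" and \<eta>: "\<eta> \<in> test_functions {0<..<T}" and e: "0 < e"
  shows "\<exists>\<rho>\<in>test_functions Q. l2n (\<lambda>z. \<eta> (snd z) *\<^sub>R lift \<psi> (snd z) (fst z) - (\<rho> z, gradx \<rho> z)) < e"
proof -
  obtain a b where ab: "0 < a" "a < b" "b < T" "\<And>t. t \<notin> {a..<b} \<Longrightarrow> \<eta> t = 0" using time_support[OF \<eta>] by blast
  have sub: "{a..b} \<subseteq> {0..<T}" using ab by auto
  obtain KK where KK: "compact KK" "\<And>s y. s \<in> {a..b} \<Longrightarrow> y \<notin> KK \<Longrightarrow> lift \<psi> s y = 0"
    using lift_support[OF \<psi>, of a b] ab by auto
  obtain K where K: "\<And>k. Ck k UNIV \<psi>" "compact K" "K \<subseteq> \<Omega>" "\<And>x. x \<notin> K \<Longrightarrow> \<psi> x = 0"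
    by (rule test_functionsE[OF \<psi>]) blast
  obtain B where B: "0 < B" "\<And>t. \<bar>\<eta> t\<bar> \<le> B" using test_bounded[OF \<eta>] by blast
  have \<eta>C: "Ck k UNIV \<eta>" for k using \<eta> by (simp add: test_functions_def)
  define M where "M = measure lborel (KK \<times> {a..b})"
  have M: "0 \<le> M" by (simp add: M_def)
  define \<epsilon> where "\<epsilon> = e / (4 * B * (1 + M))"
  have \<epsilon>: "0 < \<epsilon>" using e B(1) M by (simp add: \<epsilon>_def)
  have "uniformly_continuous_on (KK \<times> {a..b}) (\<lambda>z. lift \<psi> (snd z) (fst z))"
    by (intro compact_uniformly_continuous compact_Times KK(1) compact_Icc lift_continuous[OF \<psi>] continuous_intros)
       (use sub in auto)
  then obtain \<rho>1 where \<rho>1: "0 < \<rho>1" "\<And>z z'. z \<in> KK \<times> {a..b} \<Longrightarrow> z' \<in> KK \<times> {a..b} \<Longrightarrow> dist z' z < \<rho>1 \<Longrightarrow>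
     dist (lift \<psi> (snd z') (fst z')) (lift \<psi> (snd z) (fst z)) < \<epsilon>"
    unfolding uniformly_continuous_on_def using \<epsilon> by meson
  obtain r where r: "0 < r" "(\<Union>x\<in>K. ball x r) \<subseteq> \<Omega>"
    using compact_subset_open_imp_ball_epsilon_subset[OF K(2) open_\<Omega> K(3)] by blast
  have "uniformly_continuous_on (K \<times> ({a..b} \<times> {a..b})) (\<lambda>z. pull (snd (snd z)) (R (fst (snd z)) (fst z) + c (fst (snd z))))"
    by (intro compact_uniformly_continuous compact_Times K(2) compact_Icc continuous_on_pull continuous_on_add
        continuous_on_R_compose continuous_on_compose2[OF cont_c] continuous_intros) (use sub in auto)
  then obtain \<rho>2 where \<rho>2: "0 < \<rho>2" "\<And>z z'. z \<in> K \<times> ({a..b} \<times> {a..b}) \<Longrightarrow> z' \<in> K \<times> ({a..b} \<times> {a..b}) \<Longrightarrow> dist z' z < \<rho>2 \<Longrightarrow>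
     dist (pull (snd (snd z')) (R (fst (snd z')) (fst z') + c (fst (snd z')))) (pull (snd (snd z)) (R (fst (snd z)) (fst z) + c (fst (snd z)))) < r"
    unfolding uniformly_continuous_on_def using r(1) by meson
  \<comment> \<open>a point of the support K, moved to its place at time s, lies in the moving domain also at all
    times t near s\<close>
  have stay: "pull t (R s x + c s) \<in> \<Omega>" if "x \<in> K" "s \<in> {a..b}" "t \<in> {a..b}" "\<bar>t - s\<bar> < \<rho>2" for x s t
  proof -
    have "dist (pull t (R s x + c s)) x < r"
      using \<rho>2(2)[of "(x, s, s)" "(x, s, t)"] that by (simp add: dist_Pair_Pair dist_real_def)
    then have "pull t (R s x + c s) \<in> ball x r" by (simp add: dist_commute)
    then show ?thesis using r(2) that(1) by blast
  qed
  obtain N :: nat where N: "(b - a) / min \<rho>1 \<rho>2 < real N" using reals_Archimedean2 by blast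
  have mp: "0 < min \<rho>1 \<rho>2" using \<rho>1 \<rho>2 by simp
  have "0 < (b - a) / min \<rho>1 \<rho>2" using ab mp by (intro divide_pos_pos) auto
  then have N0: "0 < N" using N by linarith
  define w where "w = (b - a) / N"
  have w: "0 < w" "w < \<rho>1" "w < \<rho>2" "real N * w = b - a"
  proof -
    show "0 < w" using ab N0 by (simp add: w_def)
    have "b - a < real N * min \<rho>1 \<rho>2" using N unfolding pos_divide_less_eq[OF mp] .
    moreover have "0 < real N" using N0 by simp
    ultimately have "w < min \<rho>1 \<rho>2" unfolding w_def by (subst pos_divide_less_eq) (simp_all only: mult.commute)
    then show "w < \<rho>1" "w < \<rho>2" by auto
    show "real N * w = b - a" using N0 by (simp add: w_def)
  qed
  define s where "s j = a + real j * w" for j :: nat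
  define J where "J j = {s j ..< s (Suc j)}" for j
  have sS: "s (Suc j) = s j + w" for j by (simp add: s_def algebra_simps)
  have s_in: "s j \<in> {a..b}" if "j \<le> N" for j
  proof -
    have "real j * w \<le> real N * w" using that w(1) by (intro mult_right_mono) auto
    then show ?thesis using w by (simp add: s_def)
  qed
  have disj: "i = j" if "t \<in> J i" "t \<in> J j" for t i j
  proof -
    have "real i * w < real (Suc j) * w" "real j * w < real (Suc i) * w" using that unfolding J_def s_def by auto
    then have "i < Suc j" "j < Suc i" using w(1) by (auto simp del: of_nat_Suc)
    then show ?thesis by simp
  qed
  have cover: "\<exists>j<N. t \<in> J j" if "t \<in> {a..<b}" for t
  proof (intro exI conjI)
    let ?k = "nat \<lfloor>(t - a) / w\<rfloor>"
    have k: "real ?k \<le> (t - a) / w" "(t - a) / w < real ?k + 1" using that w(1) by simp_all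
    have "(t - a) / w < real N" using that w by (simp add: field_simps)
    with k(1) show "?k < N" by linarith
    show "t \<in> J ?k" using k w(1) by (simp add: J_def s_def field_simps)
  qed
  define G where "G j = lift \<psi> (s j)" for j
  have Gl: "l2 (G j)" if "j < N" for j
  proof (rule l2_compact_support(1)[OF _ KK(1)])
    show "continuous_on UNIV (G j)" unfolding G_def
      by (rule lift_continuous[OF \<psi>, where \<tau>="\<lambda>_. s j" and f="\<lambda>y. y"]) (use s_in[of j] that sub in \<open>auto intro: continuous_intros\<close>)
    show "G j y = 0" if "y \<notin> KK" for y unfolding G_def using KK(2)[OF s_in that] \<open>j < N\<close> by simp
  qed
  define q where "q j = e / (4 * B * real N * (1 + l2n (G j)))" for j
  have q: "0 < q j" for j using e B(1) N0 by (simp add: q_def add_pos_nonneg)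
  have "\<forall>j. \<exists>\<beta>. \<beta> \<in> test_functions {s j <..< s (Suc j)} \<and> l2n (\<lambda>t. indicator (J j) t - \<beta> t) < q j"
  proof
    fix j
    have "s j < s (Suc j)" using w(1) sS by simp
    then obtain \<beta> where "\<beta> \<in> test_functions {s j <..< s (Suc j)}" "l2n (\<lambda>t. indicator (J j) t - \<beta> t) < q j"
      unfolding J_def by (rule interval_bump[OF _ q[of j]])
    then show "\<exists>\<beta>. \<beta> \<in> test_functions {s j <..< s (Suc j)} \<and> l2n (\<lambda>t. indicator (J j) t - \<beta> t) < q j" by (intro exI conjI)
  qed
  from choice[OF this] obtain \<beta> where \<beta>: "\<And>j. \<beta> j \<in> test_functions {s j <..< s (Suc j)}"
    "\<And>j. l2n (\<lambda>t. indicator (J j) t - \<beta> j t) < q j" by blast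
  \<comment> \<open>the profile frozen at time \<open>s j\<close>, cut off to the interval \<open>J j\<close> by a smooth bump\<close>
  define \<rho>f where "\<rho>f j z = (\<eta> (snd z) * \<beta> j (snd z)) * \<psi> (pull (s j) (fst z))" for j and z :: "(real^'n) \<times> real"
  have \<rho>t: "\<rho>f j \<in> test_functions Q" if j: "j < N" for j
  proof (rule test_functionsI[where K="((\<lambda>x. R (s j) x + c (s j)) ` K) \<times> {s j .. s (Suc j)}"])
    have b1: "Ck k UNIV (\<lambda>z::(real^'n) \<times> real. \<eta> (snd z + 0))" "Ck k UNIV (\<lambda>z::(real^'n) \<times> real. \<beta> j (snd z + 0))" for k
      using \<beta>(1)[of j] by (intro Ck_compose_affine \<eta>C; simp add: linear_iff test_functions_def)+
    have b2: "Ck k UNIV (\<lambda>z::(real^'n) \<times> real. \<psi> (inv (R (s j)) (fst z) + (- inv (R (s j)) (c (s j)))))" for k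
      by (intro Ck_compose_affine K(1)) (simp add: linear_iff linear_add[OF inv_lin] linear_cmul[OF inv_lin])
    have "pull (s j) y = inv (R (s j)) y + (- inv (R (s j)) (c (s j)))" for y
      by (simp add: pull_def linear_diff[OF inv_lin])
    then show "Ck k UNIV (\<rho>f j)" for k
      unfolding \<rho>f_def[abs_def] using Ck_mult[OF Ck_mult[OF b1(1) b1(2)] b2, of k] by simp
    show "compact (((\<lambda>x. R (s j) x + c (s j)) ` K) \<times> {s j .. s (Suc j)})"
      by (intro compact_Times compact_Icc compact_continuous_image K continuous_intros linear_continuous_on lin[unfolded linear_conv_bounded_linear])
    show "((\<lambda>x. R (s j) x + c (s j)) ` K) \<times> {s j .. s (Suc j)} \<subseteq> Q"
    proof
      fix z assume "z \<in> ((\<lambda>x. R (s j) x + c (s j)) ` K) \<times> {s j .. s (Suc j)}"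
      then obtain x t where z: "z = (R (s j) x + c (s j), t)" "x \<in> K" "t \<in> {s j .. s (Suc j)}" by auto
      have t: "t \<in> {a..b}" using z(3) s_in[of j] s_in[of "Suc j"] j by auto
      have "\<bar>t - s j\<bar> < \<rho>2" using z(3) w(3) sS[of j] by auto
      then have "pull t (R (s j) x + c (s j)) \<in> \<Omega>" using stay[OF z(2) s_in t] j by simp
      then show "z \<in> Q" using t ab by (simp add: z(1) mem_Q)
    qed
    show "\<rho>f j z = 0" if "z \<notin> ((\<lambda>x. R (s j) x + c (s j)) ` K) \<times> {s j .. s (Suc j)}" for z
    proof (cases "snd z \<in> {s j .. s (Suc j)}")
      case True
      then have "fst z \<notin> (\<lambda>x. R (s j) x + c (s j)) ` K" using that by (auto simp: mem_Times_iff)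
      then have "pull (s j) (fst z) \<notin> K" using pull_push(2)[of "s j" "fst z"] by (metis imageI)
      then show ?thesis by (simp add: \<rho>f_def K(4))
    next
      case False
      then have "\<beta> j (snd z) = 0" by (intro test_outside[OF \<beta>(1)]) auto
      then show ?thesis by (simp add: \<rho>f_def)
    qed
  qed
  define \<rho> where "\<rho> z = (\<Sum>j<N. \<rho>f j z)" for z
  have \<rho>Q: "\<rho> \<in> test_functions Q" unfolding \<rho>_def[abs_def] using \<rho>t by (intro test_sum) auto
  have jetG: "(\<rho> z, gradx \<rho> z) = (\<Sum>j<N. (\<eta> (snd z) * \<beta> j (snd z)) *\<^sub>R G j (fst z))" for z
  proof -
    have s0: "s j \<in> {0<..<T}" if "j < N" for j using s_in[of j] that ab by auto
    have "gradx \<rho> z = (\<Sum>j<N. (\<eta> (snd z) * \<beta> j (snd z)) *\<^sub>R grad (\<lambda>y. \<psi> (pull (s j) y)) (fst z))"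
      unfolding gradx_def \<rho>_def \<rho>f_def snd_conv fst_conv
      by (rule grad_sum[where U="\<lambda>j. \<phi> (s j) ` \<Omega>"]) (use test_pull_slice(1)[OF s0 \<psi>] in auto)
    also have "\<dots> = (\<Sum>j<N. (\<eta> (snd z) * \<beta> j (snd z)) *\<^sub>R snd (G j (fst z)))"
      by (intro sum.cong refl) (simp add: G_def lift_def test_pull_slice(2)[OF s0 \<psi>])
    finally have "gradx \<rho> z = snd (\<Sum>j<N. (\<eta> (snd z) * \<beta> j (snd z)) *\<^sub>R G j (fst z))" by (simp add: snd_sum)
    moreover have "\<rho> z = fst (\<Sum>j<N. (\<eta> (snd z) * \<beta> j (snd z)) *\<^sub>R G j (fst z))"
      by (simp add: \<rho>_def \<rho>f_def G_def lift_def fst_sum)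
    ultimately show ?thesis by (simp add: prod_eq_iff)
  qed
  \<comment> \<open>E1 is the error of freezing, E2 that of smoothing the indicators of the intervals\<close>
  define E1 where "E1 z = \<eta> (snd z) *\<^sub>R lift \<psi> (snd z) (fst z) - (\<Sum>j<N. indicator (J j) (snd z) *\<^sub>R (\<eta> (snd z) *\<^sub>R G j (fst z)))" for z
  define E2 where "E2 z = (\<Sum>j<N. (\<eta> (snd z) * (indicator (J j) (snd z) - \<beta> j (snd z))) *\<^sub>R G j (fst z))" for z
  have split: "\<eta> (snd z) *\<^sub>R lift \<psi> (snd z) (fst z) - (\<rho> z, gradx \<rho> z) = E1 z + E2 z" for z
  proof -
    have "(\<Sum>j<N. (\<eta> (snd z) * (indicator (J j) (snd z) - \<beta> j (snd z))) *\<^sub>R G j (fst z))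
      = (\<Sum>j<N. indicator (J j) (snd z) *\<^sub>R (\<eta> (snd z) *\<^sub>R G j (fst z))) - (\<Sum>j<N. (\<eta> (snd z) * \<beta> j (snd z)) *\<^sub>R G j (fst z))"
      by (simp add: right_diff_distrib scaleR_left_diff_distrib sum_subtractf mult.commute)
    then show ?thesis unfolding jetG E1_def E2_def by (simp only: diff_add_eq_diff_diff_swap) simp
  qed
  have \<eta>l: "l2 \<eta>" by (rule test_l2[OF \<eta>])
  have \<eta>m: "\<eta> \<in> borel_measurable lborel" using \<eta>l by (simp add: l2_def)
  have Il: "l2 (indicator (J j) :: real \<Rightarrow> real)" for j unfolding J_def by (rule l2_indicator_interval)
  have dl: "l2 (\<lambda>t. indicator (J j) t - \<beta> j t)" for j by (rule l2_diff[OF Il test_l2[OF \<beta>(1)]])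
  have dl': "l2 (\<lambda>t. \<eta> t * (indicator (J j) t - \<beta> j t))" "l2n (\<lambda>t. \<eta> t * (indicator (J j) t - \<beta> j t)) \<le> B * l2n (\<lambda>t. indicator (J j) t - \<beta> j t)" for j
    using l2_mult_bounded[OF dl \<eta>m, of B] B(2) by simp_all
  have E2l: "l2 E2" unfolding E2_def[abs_def] by (intro l2_sum l2_tensor(1)[OF dl'(1) Gl]) auto
  have E2n: "l2n E2 \<le> e / 4"
  proof -
    have "l2n E2 \<le> (\<Sum>j<N. l2n (\<lambda>z. (\<eta> (snd z) * (indicator (J j) (snd z) - \<beta> j (snd z))) *\<^sub>R G j (fst z)))"
      unfolding E2_def[abs_def] by (rule l2n_sum_le) (use l2_tensor(1)[OF dl'(1) Gl] in auto)
    also have "\<dots> \<le> (\<Sum>j<N. e / (4 * real N))"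
    proof (rule sum_mono)
      fix j assume "j \<in> {..<N}"
      then have "l2n (\<lambda>z. (\<eta> (snd z) * (indicator (J j) (snd z) - \<beta> j (snd z))) *\<^sub>R G j (fst z))
        = l2n (\<lambda>t. \<eta> t * (indicator (J j) t - \<beta> j t)) * l2n (G j)" using l2_tensor(2)[OF dl'(1) Gl] by simp
      also have "\<dots> \<le> (B * q j) * (1 + l2n (G j))"
        using dl'(2)[of j] \<beta>(2)[of j] B(1) q[of j] by (intro mult_mono) (auto intro: order_trans)
      also have "\<dots> = e / (4 * real N)"
      proof -
        have "1 + l2n (G j) \<noteq> 0" using l2n_nonneg[of "G j"] by linarith
        then show ?thesis using B(1) by (simp add: q_def)
      qed
      finally show "l2n (\<lambda>z. (\<eta> (snd z) * (indicator (J j) (snd z) - \<beta> j (snd z))) *\<^sub>R G j (fst z)) \<le> e / (4 * real N)" .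
    qed
    also have "\<dots> = e / 4" using N0 by simp
    finally show ?thesis .
  qed
  have tens: "l2 (\<lambda>z. \<eta> (snd z) *\<^sub>R lift \<psi> (snd z) (fst z))" by (rule lift_tensor_l2[OF \<psi> \<eta>])
  have "l2 (\<lambda>z. \<eta> (snd z) *\<^sub>R lift \<psi> (snd z) (fst z) - (\<rho> z, gradx \<rho> z) - E2 z)"
    by (intro l2_diff tens l2_Pair(1) test_l2[OF \<rho>Q] gradx_test(2)[OF \<rho>Q] E2l)
  then have E1l: "l2 E1" by (simp add: split)
  have E1n: "l2n E1 \<le> e / 4"
  proof -
    have one: "norm (E1 z) \<le> B * \<epsilon>" "z \<notin> KK \<times> {a..b} \<Longrightarrow> E1 z = 0" for z
    proof -
      obtain y t where z: "z = (y, t)" by fastforce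
      have "norm (E1 z) \<le> B * \<epsilon> \<and> (z \<notin> KK \<times> {a..b} \<longrightarrow> E1 z = 0)"
      proof (cases "t \<in> {a..<b}")
        case False
        then have "\<eta> t = 0" by (rule ab(4))
        then have "E1 z = 0" by (simp add: E1_def z)
        then show ?thesis using B(1) \<epsilon> by simp
      next
        case True
        obtain k where k: "k < N" "t \<in> J k" using cover[OF True] by blast
        have "(\<Sum>j<N. indicator (J j) t *\<^sub>R (\<eta> t *\<^sub>R G j y)) = (\<Sum>j\<in>{k}. indicator (J j) t *\<^sub>R (\<eta> t *\<^sub>R G j y))"
          using k disj by (intro sum.mono_neutral_right) (auto simp: indicator_def)
        then have E: "E1 z = \<eta> t *\<^sub>R (lift \<psi> t y - lift \<psi> (s k) y)"
          using k by (simp add: E1_def z G_def scaleR_diff_right)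
        have sk: "s k \<in> {a..b}" "t \<in> {a..b}" using s_in[of k] k True by auto
        have tk: "\<bar>t - s k\<bar> < \<rho>1" using k(2) w(2) sS[of k] by (auto simp: J_def)
        show ?thesis
        proof (cases "y \<in> KK")
          case True
          have "norm (lift \<psi> t y - lift \<psi> (s k) y) \<le> \<epsilon>"
            using \<rho>1(2)[of "(y, s k)" "(y, t)"] True sk tk by (simp add: dist_Pair_Pair dist_real_def dist_norm)
          then have "norm (E1 z) \<le> B * \<epsilon>" using B \<epsilon> by (simp add: E mult_mono)
          then show ?thesis using True sk by (simp add: z)
        next
          case False
          then show ?thesis using KK(2)[OF sk(1) False] KK(2)[OF sk(2) False] B(1) \<epsilon> by (simp add: E)
        qed
      qed
      then show "norm (E1 z) \<le> B * \<epsilon>" "z \<notin> KK \<times> {a..b} \<Longrightarrow> E1 z = 0" by auto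
    qed
    have "(l2n E1)\<^sup>2 \<le> (B * \<epsilon>)\<^sup>2 * M" unfolding M_def
      using E1l by (intro l2n_le_sup one compact_Times KK(1) compact_Icc) (auto simp: l2_def)
    also have "\<dots> \<le> (B * \<epsilon>)\<^sup>2 * (1 + M)\<^sup>2" using M by (intro mult_left_mono) (auto simp: power2_sum)
    also have "\<dots> = (B * \<epsilon> * (1 + M))\<^sup>2" by (simp add: power_mult_distrib)
    also have "B * \<epsilon> * (1 + M) = e / 4"
    proof -
      have "B * (e / (4 * B * X)) * X = e / 4" if "X \<noteq> 0" for X using that B(1) by simp
      moreover have "1 + M \<noteq> 0" using M by linarith
      ultimately show ?thesis unfolding \<epsilon>_def by blast
    qed
    finally show ?thesis using e by (simp add: power2_le_iff_abs_le)
  qed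
  have "l2n (\<lambda>z. \<eta> (snd z) *\<^sub>R lift \<psi> (snd z) (fst z) - (\<rho> z, gradx \<rho> z)) < e"
    unfolding split using l2n_triangle[OF E1l E2l] E1n E2n e by linarith
  then show ?thesis by (rule bexI[OF _ \<rho>Q])
qed

lemma gradx_sum:
  assumes "\<And>i. i \<in> I \<Longrightarrow> \<rho> i \<in> test_functions Q"
  shows "gradx (\<lambda>z. \<Sum>i\<in>I. \<rho> i z) z = (\<Sum>i\<in>I. gradx (\<rho> i) z)"
proof -
  have "grad (\<lambda>y. \<Sum>i\<in>I. 1 * \<rho> i (y, snd z)) (fst z) = (\<Sum>i\<in>I. 1 *\<^sub>R grad (\<lambda>y. \<rho> i (y, snd z)) (fst z))"
    by (rule grad_sum[where U="\<lambda>_. {y. (y, snd z) \<in> Q}"]) (use test_slice[OF assms] in blast)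
  then show ?thesis by (simp add: gradx_def)
qed

text \<open>The tensor approximation in reference coordinates, carried back by the motion.\<close>

lemma tensor_lift_approximation:
  assumes q: "q \<in> Y" and g: "has_grad q g" and e: "0 < e"
  obtains m :: nat and \<eta> \<psi> where
    "\<And>i. i < m \<Longrightarrow> \<eta> i \<in> test_functions {0<..<T}" "\<And>i. i < m \<Longrightarrow> \<psi> i \<in> test_functions \<Omega>"
    "l2n (\<lambda>z. (ext q z, ext g z) - (\<Sum>i<m. \<eta> i (snd z) *\<^sub>R lift (\<psi> i) (snd z) (fst z))) < e"
proof -
  obtain m :: nat and \<eta> \<psi> where *: "\<And>i. i < m \<Longrightarrow> \<eta> i \<in> test_functions {0<..<T}" "\<And>i. i < m \<Longrightarrow> \<psi> i \<in> test_functions \<Omega>"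
    "l2n (\<lambda>z. pullback (ext q) (ext g) z - (\<Sum>i<m. \<eta> i (snd z) *\<^sub>R jet (\<psi> i) (fst z))) < e"
    using pullback_tensor_approximation[OF q g e] by blast
  let ?W = "\<lambda>z. (ext q z, ext g z) - (\<Sum>i<m. \<eta> i (snd z) *\<^sub>R lift (\<psi> i) (snd z) (fst z))"
  have Wl: "l2 ?W"
    by (intro l2_diff l2_Pair(1) Y_l2[OF q] has_grad_l2[OF g] l2_sum lift_tensor_l2) (use * in auto)
  have n: "norm (pullback (ext q) (ext g) z - (\<Sum>i<m. \<eta> i (snd z) *\<^sub>R jet (\<psi> i) (fst z))) = norm (?W (push z))" for z
  proof -
    have "?W (push z) = (fst (pullback (ext q) (ext g) z - (\<Sum>i<m. \<eta> i (snd z) *\<^sub>R jet (\<psi> i) (fst z))),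
       R (snd z) (snd (pullback (ext q) (ext g) z - (\<Sum>i<m. \<eta> i (snd z) *\<^sub>R jet (\<psi> i) (fst z)))))"
      by (simp add: pullback_def jet_def lift_def push_def prod_eq_iff fst_sum snd_sum linear_diff[OF lin] linear_sum[OF lin] linear_cmul[OF lin])
    then show ?thesis by (simp add: norm_prod_def)
  qed
  have "l2n (\<lambda>z. pullback (ext q) (ext g) z - (\<Sum>i<m. \<eta> i (snd z) *\<^sub>R jet (\<psi> i) (fst z))) = l2n (\<lambda>z. ?W (push z))"
    unfolding l2n_def n ..
  also have "\<dots> = l2n ?W" by (rule push_integral(4)) (use Wl in \<open>simp add: l2_def del: diff_Pair\<close>)
  finally have "l2n ?W < e" using *(3) by simp
  with * show ?thesis using that[of m \<eta> \<psi>] by blast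
qed

lemma test_functions_dense:
  assumes q: "q \<in> Y" and g: "has_grad q g" and e: "0 < e"
  shows "\<exists>\<rho>\<in>test_functions Q. l2n (\<lambda>z. (ext q z, ext g z) - (\<rho> z, gradx \<rho> z)) < e"
proof -
  obtain m :: nat and \<eta> \<psi> where *: "\<And>i. i < m \<Longrightarrow> \<eta> i \<in> test_functions {0<..<T}" "\<And>i. i < m \<Longrightarrow> \<psi> i \<in> test_functions \<Omega>"
    "l2n (\<lambda>z. (ext q z, ext g z) - (\<Sum>i<m. \<eta> i (snd z) *\<^sub>R lift (\<psi> i) (snd z) (fst z))) < e / 2"
    using tensor_lift_approximation[OF q g, of "e / 2"] e by auto
  define k where "k = e / (2 * (1 + real m))"
  have k: "0 < k" using e by (simp add: k_def)
  have "\<forall>i. \<exists>\<rho>. i < m \<longrightarrow> \<rho> \<in> test_functions Q \<and> l2n (\<lambda>z. \<eta> i (snd z) *\<^sub>R lift (\<psi> i) (snd z) (fst z) - (\<rho> z, gradx \<rho> z)) < k"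
    using freeze_in_time[OF *(2) *(1) k] by blast
  from choice[OF this] obtain \<rho> where \<rho>: "\<And>i. i < m \<Longrightarrow> \<rho> i \<in> test_functions Q"
    "\<And>i. i < m \<Longrightarrow> l2n (\<lambda>z. \<eta> i (snd z) *\<^sub>R lift (\<psi> i) (snd z) (fst z) - (\<rho> i z, gradx (\<rho> i) z)) < k" by blast
  let ?\<rho> = "\<lambda>z. \<Sum>i<m. \<rho> i z"
  let ?P = "\<lambda>z. \<Sum>i<m. \<eta> i (snd z) *\<^sub>R lift (\<psi> i) (snd z) (fst z)"
  have \<rho>Q: "?\<rho> \<in> test_functions Q" using \<rho>(1) by (intro test_sum) auto
  have tl: "l2 (\<lambda>z. \<eta> i (snd z) *\<^sub>R lift (\<psi> i) (snd z) (fst z))" if "i < m" for i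
    using that by (intro lift_tensor_l2 *) auto
  have jl: "l2 (\<lambda>z. (\<rho> i z, gradx (\<rho> i) z))" if "i < m" for i
    using that \<rho>(1) by (intro l2_Pair(1) test_l2[of _ Q] gradx_test(2)[of _ Q])
  have Pl: "l2 ?P" using tl by (intro l2_sum) auto
  have ql: "l2 (\<lambda>z. (ext q z, ext g z))" by (intro l2_Pair(1) Y_l2[OF q] has_grad_l2[OF g])
  have js: "(?\<rho> z, gradx ?\<rho> z) = (\<Sum>i<m. (\<rho> i z, gradx (\<rho> i) z))" for z
    using gradx_sum[of "{..<m}" \<rho> z] \<rho>(1) by (simp add: prod_eq_iff fst_sum snd_sum)
  have sl: "l2 (\<lambda>z. (?\<rho> z, gradx ?\<rho> z))" unfolding js using jl by (intro l2_sum) auto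
  have "l2n (\<lambda>z. ?P z - (?\<rho> z, gradx ?\<rho> z)) = l2n (\<lambda>z. \<Sum>i<m. (\<eta> i (snd z) *\<^sub>R lift (\<psi> i) (snd z) (fst z) - (\<rho> i z, gradx (\<rho> i) z)))"
    unfolding js by (simp only: sum_subtractf)
  also have "\<dots> \<le> (\<Sum>i<m. l2n (\<lambda>z. \<eta> i (snd z) *\<^sub>R lift (\<psi> i) (snd z) (fst z) - (\<rho> i z, gradx (\<rho> i) z)))"
    by (rule l2n_sum_le) (use l2_diff[OF tl jl] in blast)
  also have "\<dots> \<le> (\<Sum>i<m. k)" using \<rho>(2) by (intro sum_mono less_imp_le) auto
  also have "\<dots> \<le> e / 2" using e by (simp add: k_def field_simps)
  finally have "l2n (\<lambda>z. ?P z - (?\<rho> z, gradx ?\<rho> z)) \<le> e / 2" .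
  then have "l2n (\<lambda>z. (ext q z, ext g z) - (?\<rho> z, gradx ?\<rho> z)) < e"
    using l2n_triangle_diff[OF ql Pl sl] *(3) by linarith
  then show ?thesis by (rule bexI[OF _ \<rho>Q])
qed

end

locale rigid_diffusion = rigid_motion \<Omega> T \<phi> R c R' c'
  for \<Omega> :: "(real^'n) set" and T \<phi> R c R' c' +
  fixes \<alpha> :: "real^'n \<Rightarrow> real" and \<alpha>_lo \<alpha>_up :: real
  assumes \<alpha>_measurable: "set_borel_measurable lborel (\<Union>t\<in>{0<..<T}. \<phi> t ` \<Omega>) \<alpha>"
    and \<alpha>_lo: "0 < \<alpha>_lo"
    and \<alpha>_bounds: "\<And>y. y \<in> (\<Union>t\<in>{0<..<T}. \<phi> t ` \<Omega>) \<Longrightarrow> \<alpha>_lo \<le> \<alpha> y \<and> \<alpha> y \<le> \<alpha>_up"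
begin

section \<open>Poincare inequality, energy norm and duality\<close>

definition diffusivity :: "(real^'n) \<times> real \<Rightarrow> real" where
  "diffusivity z = indicator Q z * \<alpha> (fst z)"

lemma fst_Q:
  assumes "z \<in> Q" shows "fst z \<in> (\<Union>t\<in>{0<..<T}. \<phi> t ` \<Omega>)"
proof -
  obtain y t where z: "z = (y, t)" by fastforce
  with assms have "t \<in> {0<..<T}" "y \<in> \<phi> t ` \<Omega>" by (simp_all add: spacetime_domain_def)
  then show ?thesis unfolding z fst_conv by (rule UN_I)
qed

lemma diffusivity_measurable[measurable]: "diffusivity \<in> borel_measurable borel"
proof -
  let ?U = "\<Union>t\<in>{0<..<T}. \<phi> t ` \<Omega>"
  have [measurable]: "(\<lambda>y. indicator ?U y *\<^sub>R \<alpha> y) \<in> borel_measurable borel"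
    using \<alpha>_measurable by (simp add: set_borel_measurable_def)
  note fst_Q
  then have "diffusivity z = indicator Q z * (indicator ?U (fst z) *\<^sub>R \<alpha> (fst z))" for z
    by (cases "z \<in> Q") (simp_all add: diffusivity_def del: UN_iff)
  then have "diffusivity = (\<lambda>z. indicator Q z * (indicator ?U (fst z) *\<^sub>R \<alpha> (fst z)))" by (rule HOL.ext)
  also have "\<dots> \<in> borel_measurable borel"
    by (intro borel_measurable_times measurable_compose[OF fst_measurable_borel]) measurable
  finally show ?thesis .
qed

lemma diffusivity_bounds:
  "z \<in> Q \<Longrightarrow> \<alpha>_lo \<le> diffusivity z" "0 \<le> diffusivity z" "diffusivity z \<le> \<bar>\<alpha>_up\<bar>" "\<bar>diffusivity z\<bar> \<le> \<bar>\<alpha>_up\<bar>"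
proof -
  have "\<alpha>_lo \<le> \<alpha> (fst z) \<and> \<alpha> (fst z) \<le> \<alpha>_up" if "z \<in> Q"
    by (rule \<alpha>_bounds[OF fst_Q[OF that]])
  then show "z \<in> Q \<Longrightarrow> \<alpha>_lo \<le> diffusivity z" "0 \<le> diffusivity z" "diffusivity z \<le> \<bar>\<alpha>_up\<bar>" "\<bar>diffusivity z\<bar> \<le> \<bar>\<alpha>_up\<bar>"
    using \<alpha>_lo by (cases "z \<in> Q"; auto simp: diffusivity_def)+
qed

lemma diffusivity_inner_integrable:
  fixes g h :: "(real^'n) \<times> real \<Rightarrow> real^'n"
  assumes "l2 g" "l2 h" shows "integrable lborel (\<lambda>z. diffusivity z * (g z \<bullet> h z))"
proof -
  have "l2 (\<lambda>z. diffusivity z *\<^sub>R g z)" by (rule l2_mult_bounded(1)[OF assms(1) _ diffusivity_bounds(4)]) simp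
  from l2_inner_integrable[OF this assms(2)] show ?thesis by simp
qed

text \<open>Every time slice of a test function is supported in a rotated and translated copy of \<open>\<Omega>\<close>, hence
  in a ball of fixed radius; the slices therefore have a common Poincare constant.\<close>

lemma test_poincare:
  obtains C where "0 \<le> C" "\<And>\<rho>. \<rho> \<in> test_functions Q \<Longrightarrow> l2n \<rho> \<le> C * l2n (gradx \<rho>)"
proof -
  obtain M where M: "0 < M" "\<And>x. x \<in> \<Omega> \<Longrightarrow> norm x \<le> M" using bounded_\<Omega> by (auto simp: bounded_pos)
  show ?thesis
  proof (rule that[of "2 * M"])
    fix \<rho> assume \<rho>: "\<rho> \<in> test_functions Q"
    have \<rho>l: "l2 \<rho>" "l2 (gradx \<rho>)" using test_l2[OF \<rho>] gradx_test(2)[OF \<rho>] by auto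
    have sl: "(l2n (\<lambda>y. \<rho> (y, t)))\<^sup>2 \<le> (2 * M)\<^sup>2 * (l2n (\<lambda>y. gradx \<rho> (y, t)))\<^sup>2" for t
    proof (cases "t \<in> {0<..<T}")
      case True
      have "(\<lambda>y. \<rho> (y, t)) \<in> test_functions (\<phi> t ` \<Omega>)" using test_slice[OF \<rho>, of t] Q_slice[OF True] by simp
      moreover have "\<phi> t ` \<Omega> \<subseteq> cball (c t) M"
      proof
        fix y assume "y \<in> \<phi> t ` \<Omega>"
        then have "pull t y \<in> \<Omega>" using image_eq[of t] True by auto
        from M(2)[OF this] show "y \<in> cball (c t) M" by (simp add: pull_def dist_norm norm_minus_commute)
      qed
      ultimately have "l2n (\<lambda>y. \<rho> (y, t)) \<le> 2 * M * l2n (grad (\<lambda>y. \<rho> (y, t)))"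
        using M(1) by (intro poincare_test) auto
      then have "(l2n (\<lambda>y. \<rho> (y, t)))\<^sup>2 \<le> (2 * M * l2n (grad (\<lambda>y. \<rho> (y, t))))\<^sup>2" by (intro power_mono) auto
      then show ?thesis by (simp add: gradx_def power_mult_distrib)
    next
      case False
      then have "\<rho> (y, t) = 0" for y by (intro test_outside[OF \<rho>]) (auto simp: spacetime_domain_def)
      then show ?thesis by simp
    qed
    have "(l2n \<rho>)\<^sup>2 = (LINT t|lborel. (l2n (\<lambda>y. \<rho> (y, t)))\<^sup>2)" using l2n_square_slices(2)[OF \<rho>l(1)] by simp
    also have "\<dots> \<le> (LINT t|lborel. (2 * M)\<^sup>2 * (l2n (\<lambda>y. gradx \<rho> (y, t)))\<^sup>2)"
      by (intro integral_mono l2n_square_slices(1) \<rho>l integrable_mult_right sl)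
    also have "\<dots> = (2 * M)\<^sup>2 * (l2n (gradx \<rho>))\<^sup>2" using l2n_square_slices(2)[OF \<rho>l(2)] by simp
    also have "\<dots> = (2 * M * l2n (gradx \<rho>))\<^sup>2" by (simp add: power_mult_distrib)
    finally show "l2n \<rho> \<le> 2 * M * l2n (gradx \<rho>)" using M(1) by (simp add: power2_le_iff_abs_le)
  qed (use M in auto)
qed

lemma dense_components:
  assumes q: "q \<in> Y" and g: "has_grad q g" and e: "0 < e"
  obtains \<rho> where "\<rho> \<in> test_functions Q" "l2n (\<lambda>z. ext q z - \<rho> z) < e" "l2n (\<lambda>z. ext g z - gradx \<rho> z) < e"
proof -
  obtain \<rho> where \<rho>: "\<rho> \<in> test_functions Q" and n: "l2n (\<lambda>z. (ext q z, ext g z) - (\<rho> z, gradx \<rho> z)) < e"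
    using test_functions_dense[OF assms] by blast
  have l: "l2 (\<lambda>z. ext q z - \<rho> z)" "l2 (\<lambda>z. ext g z - gradx \<rho> z)"
    by (intro l2_diff Y_l2[OF q] has_grad_l2[OF g] test_l2[OF \<rho>] gradx_test(2)[OF \<rho>])+
  have pl: "l2 (\<lambda>z. (ext q z - \<rho> z, ext g z - gradx \<rho> z))" by (rule l2_Pair(1)[OF l])
  have "l2n (\<lambda>z. ext q z - \<rho> z) \<le> l2n (\<lambda>z. (ext q z - \<rho> z, ext g z - gradx \<rho> z))"
    by (rule l2_norm_dominated(2)[OF l2_measurable[OF l(1)] pl norm_fst_le])
  moreover have "l2n (\<lambda>z. ext g z - gradx \<rho> z) \<le> l2n (\<lambda>z. (ext q z - \<rho> z, ext g z - gradx \<rho> z))"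
    by (rule l2_norm_dominated(2)[OF l2_measurable[OF l(2)] pl norm_snd_le])
  ultimately show ?thesis using that[OF \<rho>] n by simp
qed

text \<open>By density of the test functions.\<close>

lemma Y_poincare:
  obtains C where "0 \<le> C" "\<And>q g. q \<in> Y \<Longrightarrow> has_grad q g \<Longrightarrow> l2n (ext q) \<le> C * l2n (ext g)"
proof -
  obtain C where C: "0 \<le> C" "\<And>\<rho>. \<rho> \<in> test_functions Q \<Longrightarrow> l2n \<rho> \<le> C * l2n (gradx \<rho>)"
    using test_poincare by blast
  show ?thesis
  proof (rule that[OF C(1)])
    fix q g assume q: "q \<in> Y" and g: "has_grad q g"
    show "l2n (ext q) \<le> C * l2n (ext g)"
    proof (rule field_le_epsilon)
      fix e :: real assume e: "0 < e"
      define k where "k = e / (1 + C)"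
      have k: "0 < k" "k * (1 + C) = e" using e C(1) by (auto simp: k_def add_pos_nonneg add_nonneg_eq_0_iff)
      obtain \<rho> where \<rho>: "\<rho> \<in> test_functions Q" "l2n (\<lambda>z. ext q z - \<rho> z) < k" "l2n (\<lambda>z. ext g z - gradx \<rho> z) < k"
        using dense_components[OF q g k(1)] by blast
      note l = Y_l2[OF q] has_grad_l2[OF g] test_l2[OF \<rho>(1)] gradx_test(2)[OF \<rho>(1)]
      have 1: "l2n (ext q) \<le> l2n (\<lambda>z. ext q z - \<rho> z) + l2n \<rho>" using l2n_triangle[OF l2_diff[OF l(1,3)] l(3)] by simp
      have 2: "l2n \<rho> \<le> C * l2n (gradx \<rho>)" by (rule C(2)[OF \<rho>(1)])
      have "l2n (gradx \<rho>) \<le> l2n (\<lambda>z. gradx \<rho> z - ext g z) + l2n (ext g)"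
        using l2n_triangle[OF l2_diff[OF l(4,2)] l(2)] by simp
      also have "\<dots> \<le> k + l2n (ext g)" using \<rho>(3) l2n_diff_commute[of "gradx \<rho>" "ext g"] by linarith
      finally have "C * l2n (gradx \<rho>) \<le> C * (k + l2n (ext g))" using C(1) by (rule mult_left_mono)
      then have "l2n (ext q) \<le> k + C * (k + l2n (ext g))" using 1 2 \<rho>(2) by linarith
      also have "\<dots> = C * l2n (ext g) + e" using k(2) by (simp add: algebra_simps)
      finally show "l2n (ext q) \<le> C * l2n (ext g) + e" .
    qed
  qed
qed

lemma energy_integral:
  assumes g: "has_grad q g" and h: "has_grad p h" and q: "q \<in> Y" and p: "p \<in> Y"
  shows "st_integral \<Omega> T \<phi> (\<lambda>y t. \<alpha> y * (grad_y \<Omega> T \<phi> q (y, t) \<bullet> grad_y \<Omega> T \<phi> p (y, t)))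
    = (LINT z|lborel. diffusivity z * (ext g z \<bullet> ext h z))"
proof -
  let ?G = "grad_y \<Omega> T \<phi> q" and ?H = "grad_y \<Omega> T \<phi> p"
  have G: "has_grad q ?G" "has_grad p ?H" by (rule grad_y_works[OF q], rule grad_y_works[OF p])
  note l = has_grad_l2[OF G(1)] has_grad_l2[OF G(2)] has_grad_l2[OF g] has_grad_l2[OF h]
  have e: "indicator Q z * (\<alpha> (fst z) * (?G (fst z, snd z) \<bullet> ?H (fst z, snd z))) = diffusivity z * (ext ?G z \<bullet> ext ?H z)" for z
    by (auto simp: diffusivity_def ext_def indicator_def)
  have "st_integral \<Omega> T \<phi> (\<lambda>y t. \<alpha> y * (?G (y, t) \<bullet> ?H (y, t))) = (LINT z|lborel. diffusivity z * (ext ?G z \<bullet> ext ?H z))"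
    using st_integral_eq[of "\<lambda>y t. \<alpha> y * (?G (y, t) \<bullet> ?H (y, t))"] diffusivity_inner_integrable[OF l(1,2)] by (simp only: e)
  also have "\<dots> = (LINT z|lborel. diffusivity z * (ext g z \<bullet> ext h z))"
  proof (rule integral_cong_AE)
    show "AE z in lborel. diffusivity z * (ext ?G z \<bullet> ext ?H z) = diffusivity z * (ext g z \<bullet> ext h z)"
      using has_grad_unique[OF G(1) g] has_grad_unique[OF G(2) h] by eventually_elim simp
  qed (use diffusivity_inner_integrable[OF l(1,2)] diffusivity_inner_integrable[OF l(3,4)] in auto)
  finally show ?thesis .
qed

lemma Y_norm_bounds:
  assumes q: "q \<in> Y" and g: "has_grad q g"
  shows "sqrt \<alpha>_lo * l2n (ext g) \<le> Y_norm \<Omega> T \<phi> \<alpha> q" "Y_norm \<Omega> T \<phi> \<alpha> q \<le> sqrt \<bar>\<alpha>_up\<bar> * l2n (ext g)"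
proof -
  have l: "l2 (ext g)" by (rule has_grad_l2[OF g])
  have i: "integrable lborel (\<lambda>z. (norm (ext g z))\<^sup>2)" using l by (simp add: l2_def)
  have "Y_norm \<Omega> T \<phi> \<alpha> q = sqrt (st_integral \<Omega> T \<phi> (\<lambda>y t. \<alpha> y * (grad_y \<Omega> T \<phi> q (y, t) \<bullet> grad_y \<Omega> T \<phi> q (y, t))))"
    by (simp add: Y_norm_def power2_norm_eq_inner)
  also have "\<dots> = sqrt (LINT z|lborel. diffusivity z * (ext g z \<bullet> ext g z))" by (simp add: energy_integral[OF g g q q])
  finally have n: "Y_norm \<Omega> T \<phi> \<alpha> q = sqrt (LINT z|lborel. diffusivity z * (ext g z \<bullet> ext g z))" .
  have "(LINT z|lborel. \<alpha>_lo * (norm (ext g z))\<^sup>2) \<le> (LINT z|lborel. diffusivity z * (ext g z \<bullet> ext g z))"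
  proof (rule integral_mono[OF _ diffusivity_inner_integrable[OF l l]])
    show "\<alpha>_lo * (norm (ext g z))\<^sup>2 \<le> diffusivity z * (ext g z \<bullet> ext g z)" for z
    proof (cases "z \<in> Q")
      case True
      then show ?thesis using diffusivity_bounds(1)[OF True] by (simp add: power2_norm_eq_inner mult_right_mono)
    qed (simp add: ext_def)
  qed (use i in simp)
  then have "\<alpha>_lo * (l2n (ext g))\<^sup>2 \<le> (LINT z|lborel. diffusivity z * (ext g z \<bullet> ext g z))" by (simp add: l2n_square)
  from real_sqrt_le_mono[OF this] show "sqrt \<alpha>_lo * l2n (ext g) \<le> Y_norm \<Omega> T \<phi> \<alpha> q"
    by (simp add: n real_sqrt_mult)
  have "(LINT z|lborel. diffusivity z * (ext g z \<bullet> ext g z)) \<le> (LINT z|lborel. \<bar>\<alpha>_up\<bar> * (norm (ext g z))\<^sup>2)"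
    by (rule integral_mono[OF diffusivity_inner_integrable[OF l l]])
       (use i diffusivity_bounds(3) in \<open>auto simp: power2_norm_eq_inner intro!: mult_right_mono\<close>)
  then have "(LINT z|lborel. diffusivity z * (ext g z \<bullet> ext g z)) \<le> \<bar>\<alpha>_up\<bar> * (l2n (ext g))\<^sup>2" by (simp add: l2n_square)
  from real_sqrt_le_mono[OF this] show "Y_norm \<Omega> T \<phi> \<alpha> q \<le> sqrt \<bar>\<alpha>_up\<bar> * l2n (ext g)"
    by (simp add: n real_sqrt_mult)
qed

lemma ext_linear: "ext (\<lambda>z. a * p z + b * q z) z = a * ext p z + b * (ext q z :: real)"
  by (simp add: ext_def algebra_simps)

text \<open>Bounded by the Cauchy-Schwarz inequality, the Poincare inequality and the lower bound on the
  diffusion coefficient.\<close>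

lemma l2_functional_in_dual:
  assumes f: "l2 f" shows "(\<lambda>p. LINT z|lborel. f z * ext p z) \<in> Y_dual \<Omega> T \<phi> \<alpha>"
proof -
  obtain C where C: "0 \<le> C" "\<And>q g. q \<in> Y \<Longrightarrow> has_grad q g \<Longrightarrow> l2n (ext q) \<le> C * l2n (ext g)"
    using Y_poincare by blast
  have lin: "(LINT z|lborel. f z * ext (\<lambda>z. a * p z + b * q z) z) = a * (LINT z|lborel. f z * ext p z) + b * (LINT z|lborel. f z * ext q z)"
    if "p \<in> Y" "q \<in> Y" for p q a b
  proof -
    have "(LINT z|lborel. f z * ext (\<lambda>z. a * p z + b * q z) z) = (LINT z|lborel. a * (f z * ext p z) + b * (f z * ext q z))"
      by (simp add: ext_linear algebra_simps)
    then show ?thesis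
      by (simp only: integral_linear_combination[OF l2_real_mult_integrable[OF f Y_l2[OF that(1)]] l2_real_mult_integrable[OF f Y_l2[OF that(2)]]])
  qed
  have "\<bar>LINT z|lborel. f z * ext q z\<bar> \<le> (l2n f * C / sqrt \<alpha>_lo) * Y_norm \<Omega> T \<phi> \<alpha> q" if q: "q \<in> Y" for q
  proof -
    have g: "has_grad q (grad_y \<Omega> T \<phi> q)" by (rule grad_y_works[OF q])
    have s: "0 < sqrt \<alpha>_lo" using \<alpha>_lo by simp
    have "\<bar>LINT z|lborel. f z * ext q z\<bar> \<le> l2n f * l2n (ext q)" using l2_cauchy_schwarz[OF f Y_l2[OF q]] by simp
    also have "\<dots> \<le> l2n f * (C * l2n (ext (grad_y \<Omega> T \<phi> q)))" by (intro mult_left_mono C(2)[OF q g]) simp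
    also have "\<dots> \<le> l2n f * (C * (Y_norm \<Omega> T \<phi> \<alpha> q / sqrt \<alpha>_lo))"
      using Y_norm_bounds(1)[OF q g] s C(1) by (intro mult_left_mono) (auto simp: field_simps)
    finally show ?thesis by simp
  qed
  then show ?thesis unfolding Y_dual_def using lin by blast
qed

text \<open>Both sides are continuous in q for the norm of Y and agree on test functions, which are dense.\<close>

lemma dual_determined_by_test_functions:
  assumes F: "F \<in> Y_dual \<Omega> T \<phi> \<alpha>" and f: "l2 f"
    and eq: "\<And>\<rho>. \<rho> \<in> test_functions Q \<Longrightarrow> F \<rho> = (LINT z|lborel. f z * \<rho> z)" and q: "q \<in> Y"
  shows "F q = (LINT z|lborel. f z * ext q z)"
proof -
  have linF: "\<And>p q a b. p \<in> Y \<Longrightarrow> q \<in> Y \<Longrightarrow> F (\<lambda>z. a * p z + b * q z) = a * F p + b * F q"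
    using F by (auto simp: Y_dual_def)
  obtain C where C: "\<And>q. q \<in> Y \<Longrightarrow> \<bar>F q\<bar> \<le> C * Y_norm \<Omega> T \<phi> \<alpha> q" using F unfolding Y_dual_def by blast
  have g: "has_grad q (grad_y \<Omega> T \<phi> q)" by (rule grad_y_works[OF q])
  let ?g = "grad_y \<Omega> T \<phi> q"
  define S where "S = \<bar>C\<bar> * sqrt \<bar>\<alpha>_up\<bar> + l2n f"
  have S: "0 \<le> S" by (simp add: S_def)
  have "\<bar>F q - (LINT z|lborel. f z * ext q z)\<bar> \<le> 0 + e" if e: "0 < e" for e
  proof -
    define k where "k = e / (1 + S)"
    have k: "0 < k" using e S by (simp add: k_def add_pos_nonneg)
    obtain \<rho> where \<rho>: "\<rho> \<in> test_functions Q" "l2n (\<lambda>z. ext q z - \<rho> z) < k" "l2n (\<lambda>z. ext ?g z - gradx \<rho> z) < k"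
      using dense_components[OF q g k] by blast
    note ty = test_in_Y[OF \<rho>(1)]
    let ?d = "\<lambda>z. 1 * q z + (-1) * \<rho> z" and ?dg = "\<lambda>z. 1 *\<^sub>R ?g z + (-1) *\<^sub>R gradx \<rho> z"
    have dY: "?d \<in> Y" "has_grad ?d ?dg" by (rule Y_add[OF q g ty])+
    have "ext ?dg z = ext ?g z - gradx \<rho> z" for z
      using gradx_test(3)[OF \<rho>(1), of z] by (cases "z \<in> Q") (auto simp: ext_def)
    then have dg: "ext ?dg = (\<lambda>z. ext ?g z - gradx \<rho> z)" by (rule HOL.ext)
    have "\<bar>F q - F \<rho>\<bar> = \<bar>F ?d\<bar>" using linF[OF q ty(1), of 1 "-1"] by simp
    also have "\<dots> \<le> C * Y_norm \<Omega> T \<phi> \<alpha> ?d" by (rule C[OF dY(1)])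
    also have "\<dots> \<le> \<bar>C\<bar> * Y_norm \<Omega> T \<phi> \<alpha> ?d"
      using order_trans[OF mult_nonneg_nonneg[OF _ l2n_nonneg] Y_norm_bounds(1)[OF dY]] \<alpha>_lo
      by (intro mult_right_mono) auto
    also have "\<dots> \<le> \<bar>C\<bar> * (sqrt \<bar>\<alpha>_up\<bar> * l2n (ext ?dg))" by (intro mult_left_mono Y_norm_bounds(2)[OF dY]) simp
    also have "\<dots> \<le> \<bar>C\<bar> * (sqrt \<bar>\<alpha>_up\<bar> * k)" unfolding dg using \<rho>(3) by (intro mult_left_mono) auto
    finally have 1: "\<bar>F q - F \<rho>\<bar> \<le> \<bar>C\<bar> * sqrt \<bar>\<alpha>_up\<bar> * k" by (simp add: mult.assoc)
    have dl: "l2 (\<lambda>z. ext q z - \<rho> z)" by (intro l2_diff Y_l2[OF q] test_l2[OF \<rho>(1)])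
    have "(LINT z|lborel. f z * ext q z) - F \<rho> = (LINT z|lborel. f z * (ext q z - \<rho> z))"
      unfolding eq[OF \<rho>(1)] right_diff_distrib
      by (rule Bochner_Integration.integral_diff[symmetric])
         (intro l2_real_mult_integrable f Y_l2[OF q] test_l2[OF \<rho>(1)])+
    then have "\<bar>(LINT z|lborel. f z * ext q z) - F \<rho>\<bar> \<le> l2n f * l2n (\<lambda>z. ext q z - \<rho> z)"
      using l2_cauchy_schwarz[OF f dl] by simp
    also have "\<dots> \<le> l2n f * k" using \<rho>(2) by (intro mult_left_mono) auto
    finally have 2: "\<bar>(LINT z|lborel. f z * ext q z) - F \<rho>\<bar> \<le> l2n f * k" .
    have "\<bar>F q - (LINT z|lborel. f z * ext q z)\<bar> \<le> S * k" using 1 2 by (simp add: S_def distrib_right)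
    also have "\<dots> \<le> (1 + S) * k" using k by (intro mult_right_mono) auto
    also have "\<dots> = e" using S by (simp add: k_def add_nonneg_eq_0_iff)
    finally show ?thesis by simp
  qed
  then have "\<bar>F q - (LINT z|lborel. f z * ext q z)\<bar> \<le> 0" by (rule field_le_epsilon)
  then show ?thesis by simp
qed

end

section \<open>Steklov averages\<close>

text \<open>The average of \<open>\<eta>\<close> over \<open>[t - h, t]\<close>, written as an average of translates: any expression that is
  linear in \<open>\<eta>\<close> is averaged in the same way. Looking backward makes the average vanish at time zero
  for an \<open>\<eta>\<close> that vanishes at negative times and at zero.\<close>

definition steklov :: "real \<Rightarrow> (real \<Rightarrow> real) \<Rightarrow> real \<Rightarrow> real" where
  "steklov h \<eta> t = (LINT s|lborel. indicator {0..h} s * \<eta> (t - s)) / h"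

lemma steklov_derivative:
  assumes \<eta>: "continuous_on UNIV \<eta>" and h: "0 < h"
  shows "(steklov h \<eta> has_real_derivative (\<eta> t - \<eta> (t - h)) / h) (at t)"
proof -
  define H where "H x = (LBINT y=0..x. \<eta> y)" for x :: real
  have H: "(H has_real_derivative \<eta> x) (at x)" for x
  proof -
    let ?a = "- \<bar>x\<bar> - 1" and ?b = "\<bar>x\<bar> + 1"
    have "(H has_vector_derivative \<eta> x) (at x within {?a..?b})"
      unfolding H_def zero_ereal_def
      by (rule interval_integral_FTC2) (auto intro: continuous_on_subset[OF \<eta>])
    moreover have "at x within {?a..?b} = at x" by (rule at_within_Icc_at) auto
    ultimately show ?thesis by (simp add: has_real_derivative_iff_has_vector_derivative)
  qed
  have eq: "steklov h \<eta> = (\<lambda>t. (H t - H (t - h)) / h)"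
  proof
    fix t
    have "(LINT s|lborel. \<eta> (t - s) * indicator {0..h} s) = (- H (t - h)) - (- H (t - 0))"
    proof (rule integral_FTC_Icc_real)
      show "DERIV (\<lambda>s. - H (t - s)) s :> \<eta> (t - s)" for s
        by (auto intro!: derivative_eq_intros DERIV_chain2[OF H])
      have "continuous_on UNIV (\<lambda>s. \<eta> (t - s))"
        by (intro continuous_on_compose2[OF \<eta>] continuous_intros) auto
      then show "isCont (\<lambda>s. \<eta> (t - s)) s" for s by (simp add: continuous_on_eq_continuous_at)
    qed (use h in simp)
    then show "steklov h \<eta> t = (H t - H (t - h)) / h" by (simp add: steklov_def mult.commute)
  qed
  show ?thesis unfolding eq using h
    by (auto intro!: derivative_eq_intros H DERIV_chain2[OF H])
qed

lemma steklov_zero: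
  assumes "\<And>s. s \<le> t \<Longrightarrow> \<eta> s = 0" shows "steklov h \<eta> t = 0"
proof -
  have "(LINT s|lborel. indicator {0..h} s * \<eta> (t - s)) = (LINT s|(lborel :: real measure). (0::real))"
    by (intro Bochner_Integration.integral_cong) (use assms in \<open>auto simp: indicator_def\<close>)
  then show ?thesis by (simp add: steklov_def)
qed

lemma steklov_bounded:
  assumes \<eta>: "continuous_on UNIV \<eta>" and B: "\<And>t. \<bar>\<eta> t\<bar> \<le> B" and h: "0 < h"
  shows "\<bar>steklov h \<eta> t\<bar> \<le> B"
proof -
  have I: "integrable lborel (\<lambda>s. indicator {0..h} s * B)"
    using l2_bounded_compact(2)[of "\<lambda>s. indicator {0..h} s * B" "\<bar>B\<bar>" "{0..h}"] by (auto simp: indicator_def)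
  have [measurable]: "\<eta> \<in> borel_measurable borel" by (rule borel_measurable_continuous_onI[OF \<eta>])
  have J: "integrable lborel (\<lambda>s. indicator {0..h} s * \<eta> (t - s))"
  proof (rule Bochner_Integration.integrable_bound[OF I])
    show "AE s in lborel. norm (indicator {0..h} s * \<eta> (t - s)) \<le> norm (indicator {0..h} s * B)"
      using B by (auto simp: indicator_def intro: order_trans[OF _ abs_ge_self])
  qed measurable
  have "\<bar>LINT s|lborel. indicator {0..h} s * \<eta> (t - s)\<bar> \<le> (LINT s|lborel. \<bar>indicator {0..h} s * \<eta> (t - s)\<bar>)"
    by (rule integral_abs_bound)
  also have "\<dots> \<le> (LINT s|lborel. indicator {0..h} s * B)"
    by (rule integral_mono[OF integrable_abs[OF J] I]) (use B in \<open>auto simp: indicator_def\<close>)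
  also have "\<dots> = h * B" using h by simp
  finally show ?thesis using h by (simp add: steklov_def abs_divide pos_divide_le_eq mult.commute)
qed

text \<open>Fubini: integrating an average against k is averaging the integrals.\<close>

lemma steklov_integral:
  fixes k :: "'a::euclidean_space \<times> real \<Rightarrow> real"
  assumes \<eta>: "continuous_on UNIV \<eta>" "\<And>t. \<bar>\<eta> t\<bar> \<le> B" and k: "integrable lborel k"
  shows "integrable lborel (\<lambda>s. indicator {0..h} s * (LINT z|lborel. \<eta> (snd z - s) * k z))"
    and "(LINT z|lborel. steklov h \<eta> (snd z) * k z) = (LINT s|lborel. indicator {0..h} s * (LINT z|lborel. \<eta> (snd z - s) * k z)) / h"
proof -
  have [measurable]: "\<eta> \<in> borel_measurable borel" "k \<in> borel_measurable borel"
    using borel_measurable_continuous_onI[OF \<eta>(1)] k by auto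
  have [measurable]: "(\<lambda>z::'a \<times> real. snd z) \<in> borel_measurable borel" by (intro borel_measurable_continuous_onI continuous_intros)
  let ?F = "\<lambda>z s. indicator {0..h} s * (\<eta> (snd z - s) * k z)"
  have I: "integrable lborel (indicator {0..h} :: real \<Rightarrow> real)"
    by (rule l2_bounded_compact(2)[of _ 1 "{0..h}"]) (auto simp: indicator_def)
  have F: "integrable (lborel \<Otimes>\<^sub>M lborel) (\<lambda>(z, s). ?F z s)"
  proof (rule Bochner_Integration.integrable_bound)
    show "integrable (lborel \<Otimes>\<^sub>M lborel) (\<lambda>(z, s). (B * k z) * (indicator {0..h} s :: real))"
      by (intro integrable_tensor integrable_mult_right k I)
    show "(\<lambda>(z, s). ?F z s) \<in> borel_measurable (lborel \<Otimes>\<^sub>M lborel)" by measurable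
    have "\<bar>\<eta> t\<bar> * \<bar>x\<bar> \<le> \<bar>B\<bar> * \<bar>x\<bar>" for t x using \<eta>(2)[of t] by (intro mult_right_mono) auto
    then show "AE w in lborel \<Otimes>\<^sub>M lborel. norm (case w of (z, s) \<Rightarrow> ?F z s) \<le> norm (case w of (z, s) \<Rightarrow> (B * k z) * indicator {0..h} s)"
      by (auto simp: abs_mult indicator_def split: prod.split)
  qed
  show "integrable lborel (\<lambda>s. indicator {0..h} s * (LINT z|lborel. \<eta> (snd z - s) * k z))"
    using lborel_pair.integrable_snd[OF F] by simp
  have "(LINT z|lborel. steklov h \<eta> (snd z) * k z) = (LINT z|lborel. (LINT s|lborel. ?F z s)) / h"
  proof -
    have "steklov h \<eta> (snd z) * k z = (LINT s|lborel. ?F z s) / h" for z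
      by (simp add: steklov_def mult.assoc[symmetric])
    then show ?thesis by simp
  qed
  also have "(LINT z|lborel. (LINT s|lborel. ?F z s)) = (LINT s|lborel. (LINT z|lborel. ?F z s))"
    using lborel_pair.integral_fst[OF F] lborel_pair.integral_snd[OF F] by simp
  finally show "(LINT z|lborel. steklov h \<eta> (snd z) * k z) = (LINT s|lborel. indicator {0..h} s * (LINT z|lborel. \<eta> (snd z - s) * k z)) / h"
    by simp
qed

section \<open>Functions transported by the motion\<close>

context rigid_motion
begin

text \<open>The velocity of the motion through y at time t, also for y outside the moving domain, which
  avoids the partial inverse of the deformation.\<close>

definition vel :: "real \<Rightarrow> real^'n \<Rightarrow> real^'n" where
  "vel t y = R' t (pull t y) + c' t"

lemma velocity_eq:
  assumes "(y, t) \<in> Q" shows "velocity \<Omega> \<phi> y t = vel t y"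
proof -
  have t: "t \<in> {0<..<T}" and y: "y \<in> \<phi> t ` \<Omega>" using assms by (auto simp: spacetime_domain_def)
  define x where "x = inv_into \<Omega> (\<phi> t) y"
  have x: "x \<in> \<Omega>" "\<phi> t x = y" using y by (simp_all add: x_def inv_into_into f_inv_into_f)
  then have "pull t y = x" using \<phi>_eq[of t x] t by auto
  moreover have "((\<lambda>s. R s x + c s) has_vector_derivative R' t x + c' t) (at t)"
    by (intro has_vector_derivative_add deriv_R deriv_c t)
  then have "((\<lambda>s. \<phi> s x) has_vector_derivative R' t x + c' t) (at t)"
    by (rule has_vector_derivative_transform_within_open[OF _ _ t]) (use \<phi>_eq x(1) in auto)
  ultimately show ?thesis unfolding velocity_def vel_def x_def[symmetric] by (simp add: vector_derivative_at)
qed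

text \<open>The derivative of the constant \<open>R s x \<bullet> R s b\<close>.\<close>

lemma R_skew:
  assumes t: "t \<in> {0<..<T}" shows "R t x \<bullet> R' t b = - (R' t x \<bullet> R t b)"
proof -
  have "((\<lambda>s. R s x \<bullet> R s b) has_vector_derivative (R t x \<bullet> R' t b + R' t x \<bullet> R t b)) (at t)"
    by (rule bounded_bilinear.has_vector_derivative[OF bounded_bilinear_inner deriv_R[OF t] deriv_R[OF t]])
  moreover have "((\<lambda>s. R s x \<bullet> R s b) has_vector_derivative 0) (at t)" by (simp add: inner_R)
  ultimately have "R t x \<bullet> R' t b + R' t x \<bullet> R t b = 0" by (rule vector_derivative_unique_at)
  then show ?thesis by simp
qed

text \<open>The reference coordinate of a fixed position moves against the velocity.\<close>

lemma pull_derivative: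
  assumes t: "t \<in> {0<..<T}"
  shows "((\<lambda>s. pull s y) has_vector_derivative - inv (R t) (vel t y)) (at t)"
proof -
  have "((\<lambda>s. \<Sum>b\<in>Basis. ((y - c s) \<bullet> R s b) *\<^sub>R b) has_vector_derivative
     (\<Sum>b\<in>Basis. ((y - c t) \<bullet> R' t b + (0 - c' t) \<bullet> R t b) *\<^sub>R b)) (at t)"
  proof (rule has_vector_derivative_sum)
    fix b :: "real^'n" assume "b \<in> Basis"
    have "((\<lambda>s. (y - c s) \<bullet> R s b) has_vector_derivative ((y - c t) \<bullet> R' t b + (0 - c' t) \<bullet> R t b)) (at t)"
      by (rule bounded_bilinear.has_vector_derivative[OF bounded_bilinear_inner])
         (intro has_vector_derivative_diff has_vector_derivative_const deriv_c[OF t] deriv_R[OF t])+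
    then show "((\<lambda>s. ((y - c s) \<bullet> R s b) *\<^sub>R b) has_vector_derivative ((y - c t) \<bullet> R' t b + (0 - c' t) \<bullet> R t b) *\<^sub>R b) (at t)"
      by (rule bounded_linear.has_vector_derivative[OF bounded_linear_scaleR_left])
  qed
  moreover have comp: "(y - c t) \<bullet> R' t b + (0 - c' t) \<bullet> R t b = (- inv (R t) (vel t y)) \<bullet> b" for b
  proof -
    have "y - c t = R t (pull t y)" by (simp add: pull_def)
    then show ?thesis by (simp add: R_skew[OF t] vel_def inner_inv_R inner_add_left)
  qed
  moreover have "(\<Sum>b\<in>Basis. ((y - c t) \<bullet> R' t b + (0 - c' t) \<bullet> R t b) *\<^sub>R b) = - inv (R t) (vel t y)"
    unfolding comp by (rule euclidean_representation)
  ultimately show ?thesis unfolding pull_def inv_R_expand[symmetric] by (simp only:)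
qed

lemma transported_time_derivative:
  assumes t: "t \<in> {0<..<T}" and \<psi>: "\<psi> \<in> test_functions U"
  shows "((\<lambda>s. \<psi> (pull s y)) has_real_derivative - (vel t y \<bullet> snd (lift \<psi> t y))) (at t)"
proof -
  have "((\<lambda>s. pull s y) has_derivative (\<lambda>s. s *\<^sub>R (- inv (R t) (vel t y)))) (at t)"
    using pull_derivative[OF t] by (simp add: has_vector_derivative_def)
  from has_derivative_compose[OF this test_has_derivative[OF \<psi>]]
  have d: "((\<lambda>s. \<psi> (pull s y)) has_derivative (\<lambda>s. frechet_derivative \<psi> (at (pull t y)) (s *\<^sub>R (- inv (R t) (vel t y))))) (at t)" .
  have "frechet_derivative \<psi> (at (pull t y)) (s *\<^sub>R (- inv (R t) (vel t y))) = - (vel t y \<bullet> snd (lift \<psi> t y)) * s" for s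
  proof -
    have "frechet_derivative \<psi> (at (pull t y)) (s *\<^sub>R (- inv (R t) (vel t y)))
       = grad \<psi> (pull t y) \<bullet> (s *\<^sub>R (- inv (R t) (vel t y)))"
      by (rule inner_grad[OF test_has_derivative[OF \<psi>], symmetric])
    also have "\<dots> = - s * (inv (R t) (vel t y) \<bullet> grad \<psi> (pull t y))" by (simp add: inner_commute)
    also have "\<dots> = - s * (vel t y \<bullet> snd (lift \<psi> t y))" by (simp add: inner_inv_R lift_def)
    finally show ?thesis by (simp add: mult.commute)
  qed
  then have "(\<lambda>s. frechet_derivative \<psi> (at (pull t y)) (s *\<^sub>R (- inv (R t) (vel t y)))) = (*) (- (vel t y \<bullet> snd (lift \<psi> t y)))"
    by (intro HOL.ext) (simp only:)
  with d show ?thesis unfolding has_field_derivative_def by (simp only:)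
qed

lemma l2_of_push:
  fixes F :: "(real^'n) \<times> real \<Rightarrow> 'b::euclidean_space"
  assumes F[measurable]: "F \<in> borel_measurable borel" and l: "l2 (\<lambda>z. F (push z))"
  shows "l2 F"
proof -
  have "integrable lborel (\<lambda>z. (norm (F (push z)))\<^sup>2)" using l by (simp add: l2_def)
  then have "integrable (distr lborel borel push) (\<lambda>z. (norm (F z))\<^sup>2)" by (subst integrable_distr_eq) auto
  then show ?thesis by (simp add: push_distr l2_def)
qed

text \<open>The function \<open>\<Sum> \<theta> i (t) \<psi> i (x)\<close> of reference coordinates carried along by the motion, together
  with its spatial gradient. Differentiating the \<open>\<theta> i\<close> gives its material derivative.\<close>

definition transported :: "nat \<Rightarrow> (nat \<Rightarrow> real \<Rightarrow> real) \<Rightarrow> (nat \<Rightarrow> real^'n \<Rightarrow> real) \<Rightarrow> (real^'n) \<times> real \<Rightarrow> real \<times> (real^'n)" where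
  "transported m \<theta> \<psi> z = (\<Sum>i<m. \<theta> i (snd z) *\<^sub>R lift (\<psi> i) (snd z) (fst z))"

lemma transported_push:
  "fst (transported m \<theta> \<psi> (push z)) = (\<Sum>i<m. \<theta> i (snd z) * \<psi> i (fst z))"
  "snd (transported m \<theta> \<psi> (push z)) = R (snd z) (\<Sum>i<m. \<theta> i (snd z) *\<^sub>R grad (\<psi> i) (fst z))"
  by (simp_all add: transported_def lift_def push_def fst_sum snd_sum linear_sum[OF lin] linear_cmul[OF lin])

lemma transported_measurable:
  assumes \<theta>: "\<And>i. continuous_on UNIV (\<theta> i)" and \<psi>: "\<And>i. i < m \<Longrightarrow> \<psi> i \<in> test_functions \<Omega>"
  shows "transported m \<theta> \<psi> \<in> borel_measurable borel"
proof -
  have [measurable]: "\<theta> i \<in> borel_measurable borel" for i by (rule borel_measurable_continuous_onI[OF \<theta>])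
  show ?thesis unfolding transported_def[abs_def]
    by (intro borel_measurable_sum borel_measurable_scaleR lift_measurable[of _ \<Omega>] \<psi>) auto
qed

lemma transported_l2:
  assumes \<theta>: "\<And>i. continuous_on UNIV (\<theta> i)" and \<psi>: "\<And>i. i < m \<Longrightarrow> \<psi> i \<in> test_functions \<Omega>"
  shows "l2 (ext (transported m \<theta> \<psi>))"
proof (rule l2_of_push)
  have m: "transported m \<theta> \<psi> \<in> borel_measurable borel" by (rule transported_measurable[OF assms])
  show m': "ext (transported m \<theta> \<psi>) \<in> borel_measurable borel"
    unfolding ext_def[abs_def] by (intro borel_measurable_scaleR m) measurable
  let ?\<tau> = "\<lambda>i t. indicator {0<..<T} t * \<theta> i t"
  have \<tau>: "l2 (?\<tau> i)" for i
  proof -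
    have "compact (\<theta> i ` {0..T})" by (intro compact_continuous_image continuous_on_subset[OF \<theta>]) auto
    then obtain B where B: "0 < B" "\<forall>x\<in>\<theta> i ` {0..T}. norm x \<le> B"
      using compact_imp_bounded bounded_pos by blast
    have [measurable]: "\<theta> i \<in> borel_measurable borel" by (rule borel_measurable_continuous_onI[OF \<theta>])
    show ?thesis by (rule l2_bounded_compact(1)[of _ B "{0..T}"]) (use B in \<open>auto simp: indicator_def\<close>)
  qed
  let ?S = "\<lambda>z. \<Sum>i<m. ?\<tau> i (snd z) *\<^sub>R jet (\<psi> i) (fst z)"
  have S: "l2 ?S" by (intro l2_sum l2_tensor(1)[OF \<tau> jet_l2[of _ \<Omega>]] \<psi>) auto
  have "norm (ext (transported m \<theta> \<psi>) (push z)) \<le> norm (?S z)" for z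
  proof (cases "push z \<in> Q")
    case True
    then have t: "snd z \<in> {0<..<T}" by (simp add: push_mem_Q)
    have "?S z = (fst (transported m \<theta> \<psi> (push z)), inv (R (snd z)) (snd (transported m \<theta> \<psi> (push z))))"
      using t by (simp add: transported_push prod_eq_iff fst_sum snd_sum jet_def)
    then show ?thesis using True by (simp add: ext_def norm_prod_def)
  qed (simp add: ext_def)
  then show "l2 (\<lambda>z. ext (transported m \<theta> \<psi>) (push z))"
    by (rule l2_norm_dominated(1)[OF _ S, rotated]) (use m' in measurable)
qed

lemma ext_fst: "ext (\<lambda>z. fst (F z)) z = fst (ext F z)" and ext_snd: "ext (\<lambda>z. snd (F z)) z = snd (ext F z)"
  by (simp_all add: ext_def)

lemma transported_components_l2:
  assumes \<theta>: "\<And>i. continuous_on UNIV (\<theta> i)" and \<psi>: "\<And>i. i < m \<Longrightarrow> \<psi> i \<in> test_functions \<Omega>"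
  shows "l2 (ext (\<lambda>z. fst (transported m \<theta> \<psi> z)))" "l2 (ext (\<lambda>z. snd (transported m \<theta> \<psi> z)))"
proof -
  have l: "l2 (ext (transported m \<theta> \<psi>))" by (rule transported_l2[OF assms])
  have m: "ext (transported m \<theta> \<psi>) \<in> borel_measurable borel" using l by (simp add: l2_def)
  have c: "continuous_on UNIV (fst :: real \<times> (real^'n) \<Rightarrow> real)" "continuous_on UNIV (snd :: real \<times> (real^'n) \<Rightarrow> real^'n)"
    by (intro continuous_intros)+
  have "(\<lambda>z. fst (ext (transported m \<theta> \<psi>) z)) \<in> borel_measurable lborel" "(\<lambda>z. snd (ext (transported m \<theta> \<psi>) z)) \<in> borel_measurable lborel"
    using measurable_compose[OF m borel_measurable_continuous_onI[OF c(1)]] measurable_compose[OF m borel_measurable_continuous_onI[OF c(2)]] by auto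
  then show "l2 (ext (\<lambda>z. fst (transported m \<theta> \<psi> z)))" "l2 (ext (\<lambda>z. snd (transported m \<theta> \<psi> z)))"
    unfolding ext_fst[abs_def] ext_snd[abs_def] using norm_fst_le norm_snd_le
    by (auto intro!: l2_norm_dominated(1)[OF _ l] simp: norm_prod_def)
qed

lemma transported_in_Y:
  assumes \<theta>: "\<And>i. continuous_on UNIV (\<theta> i)" and \<psi>: "\<And>i. i < m \<Longrightarrow> \<psi> i \<in> test_functions \<Omega>"
  shows "(\<lambda>z. fst (transported m \<theta> \<psi> z)) \<in> Y"
    and "has_grad (\<lambda>z. fst (transported m \<theta> \<psi> z)) (\<lambda>z. snd (transported m \<theta> \<psi> z))"
proof -
  have e: "fst (transported m \<theta> \<psi> (y, t)) = (\<Sum>i<m. \<theta> i t * \<psi> i (pull t y))" for y t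
    by (simp add: transported_def lift_def fst_sum)
  have 1: "(\<lambda>y. fst (transported m \<theta> \<psi> (y, t))) \<in> test_functions (\<phi> t ` \<Omega>)" if "t \<in> {0<..<T}" for t
    unfolding e by (intro test_sum test_cmult test_pull_slice(1)[OF that] \<psi>) auto
  have 2: "grad (\<lambda>y. fst (transported m \<theta> \<psi> (y, t))) y = snd (transported m \<theta> \<psi> (y, t))" if t: "t \<in> {0<..<T}" for t y
  proof -
    have "grad (\<lambda>y. \<Sum>i<m. \<theta> i t * \<psi> i (pull t y)) y = (\<Sum>i<m. \<theta> i t *\<^sub>R grad (\<lambda>y. \<psi> i (pull t y)) y)"
      by (rule grad_sum[where U="\<lambda>_. \<phi> t ` \<Omega>"]) (use test_pull_slice(1)[OF t \<psi>] in auto)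
    then show ?thesis unfolding e
      by (simp add: transported_def lift_def snd_sum test_pull_slice(2)[OF t \<psi>] cong: sum.cong_simp)
  qed
  show "(\<lambda>z. fst (transported m \<theta> \<psi> z)) \<in> Y" "has_grad (\<lambda>z. fst (transported m \<theta> \<psi> z)) (\<lambda>z. snd (transported m \<theta> \<psi> z))"
    by (rule Y_of_test_slices[OF transported_components_l2[OF assms] 1 2]; assumption)+
qed

text \<open>In reference coordinates the function is \<open>\<Sum> \<theta> i (t) \<psi> i (x)\<close>, which depends continuously on time
  in \<open>L\<^sup>2(\<Omega>)\<close>, so that it can serve as its own representative.\<close>

lemma transported_zero_initial_value:
  assumes \<theta>: "\<And>i. continuous_on UNIV (\<theta> i)" and \<psi>: "\<And>i. i < m \<Longrightarrow> \<psi> i \<in> test_functions \<Omega>"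
    and 0: "\<And>i. i < m \<Longrightarrow> \<theta> i 0 = 0"
  shows "zero_initial_value \<Omega> T \<phi> (\<lambda>z. fst (transported m \<theta> \<psi> z))"
proof -
  let ?u = "\<lambda>z. fst (transported m \<theta> \<psi> z)"
  have val: "?u (\<phi> t x, t) = (\<Sum>i<m. \<theta> i t * \<psi> i x)" if "t \<in> {0..<T}" "x \<in> \<Omega>" for t x
    using \<phi>_eq[OF that] transported_push(1)[of m \<theta> \<psi> "(x, t)"] by (simp add: push_def)
  have out: "\<psi> i x = 0" if "i < m" "x \<notin> \<Omega>" for i x using test_outside[OF \<psi>[OF that(1)] that(2)] .
  have sl: "l2 (\<lambda>x. \<Sum>i<m. a i * \<psi> i x)" for a :: "nat \<Rightarrow> real"
    by (intro l2_sum l2_mult test_l2[of _ \<Omega>] \<psi>) auto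
  show ?thesis unfolding zero_initial_value_def
  proof (intro exI[of _ ?u] conjI ballI)
    show "AE z in lborel. z \<in> Q \<longrightarrow> ?u z = ?u z" by simp
    show "(\<lambda>x. ?u (\<phi> t x, t)) \<in> L2 \<Omega>" if t: "t \<in> {0..<T}" for t
    proof -
      have "indicator \<Omega> x *\<^sub>R ?u (\<phi> t x, t) = (\<Sum>i<m. \<theta> i t * \<psi> i x)" for x
        using val[OF t, of x] out by (cases "x \<in> \<Omega>") (auto intro!: sum.neutral[symmetric])
      then show ?thesis unfolding L2_iff_l2 using sl[of "\<lambda>i. \<theta> i t"] by (simp only:)
    qed
    have "?u (x, 0) = 0" for x using 0 by (simp add: transported_def fst_sum)
    then show "AE x in lborel. x \<in> \<Omega> \<longrightarrow> ?u (x, 0) = 0" by simp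
    fix s assume s: "s \<in> {0..<T}"
    have eq: "(LINT x:\<Omega>|lborel. (?u (\<phi> t x, t) - ?u (\<phi> s x, s))\<^sup>2) = (l2n (\<lambda>x. \<Sum>i<m. (\<theta> i t - \<theta> i s) * \<psi> i x))\<^sup>2"
      if t: "t \<in> {0..<T}" for t
    proof -
      have "indicator \<Omega> x *\<^sub>R (?u (\<phi> t x, t) - ?u (\<phi> s x, s))\<^sup>2 = (norm (\<Sum>i<m. (\<theta> i t - \<theta> i s) * \<psi> i x))\<^sup>2" for x
        using val[OF t, of x] val[OF s, of x] out
        by (cases "x \<in> \<Omega>") (auto simp: left_diff_distrib sum_subtractf intro!: sum.neutral)
      then show ?thesis unfolding set_lebesgue_integral_def l2n_square by (simp only:)
    qed
    have bd: "(l2n (\<lambda>x. \<Sum>i<m. (\<theta> i t - \<theta> i s) * \<psi> i x))\<^sup>2 \<le> (\<Sum>i<m. \<bar>\<theta> i t - \<theta> i s\<bar> * l2n (\<psi> i))\<^sup>2" for t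
    proof (rule power_mono)
      have "l2n (\<lambda>x. \<Sum>i<m. (\<theta> i t - \<theta> i s) * \<psi> i x) \<le> (\<Sum>i<m. l2n (\<lambda>x. (\<theta> i t - \<theta> i s) * \<psi> i x))"
        by (rule l2n_sum_le) (intro l2_mult test_l2[of _ \<Omega>] \<psi>, auto)
      also have "\<dots> \<le> (\<Sum>i<m. \<bar>\<theta> i t - \<theta> i s\<bar> * l2n (\<psi> i))"
      proof (rule sum_mono)
        fix i assume "i \<in> {..<m}"
        then have "l2 (\<psi> i)" using test_l2[OF \<psi>] by simp
        from l2_mult_bounded(2)[OF this, of "\<lambda>_. \<theta> i t - \<theta> i s" "\<bar>\<theta> i t - \<theta> i s\<bar>"]
        show "l2n (\<lambda>x. (\<theta> i t - \<theta> i s) * \<psi> i x) \<le> \<bar>\<theta> i t - \<theta> i s\<bar> * l2n (\<psi> i)" by simp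
      qed
      finally show "l2n (\<lambda>x. \<Sum>i<m. (\<theta> i t - \<theta> i s) * \<psi> i x) \<le> (\<Sum>i<m. \<bar>\<theta> i t - \<theta> i s\<bar> * l2n (\<psi> i))" .
    qed simp
    have lim: "((\<lambda>t. (\<Sum>i<m. \<bar>\<theta> i t - \<theta> i s\<bar> * l2n (\<psi> i))\<^sup>2) \<longlongrightarrow> 0) (at s within {0..<T})"
    proof -
      have "(\<theta> i \<longlongrightarrow> \<theta> i s) (at s within {0..<T})" for i
        using continuous_on_subset[OF \<theta>[of i] subset_UNIV, of "{0..<T}"] s unfolding continuous_on_def by blast
      then have "((\<lambda>t. (\<Sum>i<m. \<bar>\<theta> i t - \<theta> i s\<bar> * l2n (\<psi> i))\<^sup>2) \<longlongrightarrow> (\<Sum>i<m. \<bar>\<theta> i s - \<theta> i s\<bar> * l2n (\<psi> i))\<^sup>2) (at s within {0..<T})"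
        by (intro tendsto_intros)
      then show ?thesis by simp
    qed
    show "((\<lambda>t. LINT x:\<Omega>|lborel. (?u (\<phi> t x, t) - ?u (\<phi> s x, s))\<^sup>2) \<longlongrightarrow> 0) (at s within {0..<T})"
    proof (rule tendsto_sandwich[OF _ _ tendsto_const lim])
      have ev: "\<forall>\<^sub>F t in at s within {0..<T}. t \<in> {0..<T}" by (simp add: eventually_at_filter)
      show "\<forall>\<^sub>F t in at s within {0..<T}. 0 \<le> (LINT x:\<Omega>|lborel. (?u (\<phi> t x, t) - ?u (\<phi> s x, s))\<^sup>2)"
        using ev by eventually_elim (simp add: eq)
      show "\<forall>\<^sub>F t in at s within {0..<T}. (LINT x:\<Omega>|lborel. (?u (\<phi> t x, t) - ?u (\<phi> s x, s))\<^sup>2) \<le> (\<Sum>i<m. \<bar>\<theta> i t - \<theta> i s\<bar> * l2n (\<psi> i))\<^sup>2"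
        using ev by eventually_elim (simp only: eq bd)
    qed
  qed
qed

lemma R'_expand:
  assumes t: "t \<in> {0<..<T}" shows "R' t x = (\<Sum>b\<in>Basis. (x \<bullet> b) *\<^sub>R R' t b)"
proof -
  have "((\<lambda>s. \<Sum>b\<in>Basis. (x \<bullet> b) *\<^sub>R R s b) has_vector_derivative (\<Sum>b\<in>Basis. (x \<bullet> b) *\<^sub>R R' t b)) (at t)"
    by (intro has_vector_derivative_sum bounded_linear.has_vector_derivative[OF bounded_linear_scaleR_right] deriv_R t)
  then have "((\<lambda>s. R s x) has_vector_derivative (\<Sum>b\<in>Basis. (x \<bullet> b) *\<^sub>R R' t b)) (at t)"
    by (simp only: R_expand[symmetric])
  from vector_derivative_unique_at[OF deriv_R[OF t] this] show ?thesis .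
qed

lemma vel_continuous: "continuous_on (UNIV \<times> {0<..<T}) (\<lambda>z. vel (snd z) (fst z))"
proof -
  have "continuous_on (UNIV \<times> {0<..<T}) (\<lambda>z. (\<Sum>b\<in>Basis. (pull (snd z) (fst z) \<bullet> b) *\<^sub>R R' (snd z) b) + c' (snd z))"
    by (intro continuous_intros continuous_on_pull continuous_on_compose2[OF cont_R'] continuous_on_compose2[OF cont_c']) auto
  then show ?thesis
    by (rule continuous_on_eq) (auto simp: vel_def R'_expand[symmetric])
qed

lemma transported_continuous:
  assumes \<theta>: "\<And>i. continuous_on UNIV (\<theta> i)" and \<psi>: "\<And>i. i < m \<Longrightarrow> \<psi> i \<in> test_functions \<Omega>"
  shows "continuous_on (UNIV \<times> {0<..<T}) (transported m \<theta> \<psi>)"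
  unfolding transported_def[abs_def]
  by (intro continuous_on_sum continuous_on_scaleR continuous_on_compose2[OF \<theta>] lift_continuous[of _ \<Omega>] \<psi> continuous_intros) auto

text \<open>Along a particle path a transported function only varies through its time profile: its
  time derivative at a fixed position is the transported derivative of the profile minus the
  convective term. The claim is then an integration by parts in the time direction, in
  which the product with \<open>\<rho>\<close> has compact support in the space-time domain.\<close>

lemma transported_distributional_derivative:
  assumes d: "\<And>i t. (\<theta> i has_real_derivative \<theta>' i t) (at t)" and \<theta>': "\<And>i. continuous_on UNIV (\<theta>' i)"
    and \<psi>: "\<And>i. i < m \<Longrightarrow> \<psi> i \<in> test_functions \<Omega>" and \<rho>: "\<rho> \<in> test_functions Q"
  shows "(LINT z|lborel. ext (\<lambda>z. fst (transported m \<theta>' \<psi> z)) z * \<rho> z) =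
    st_integral \<Omega> T \<phi> (\<lambda>y t. - fst (transported m \<theta> \<psi> (y, t)) * frechet_derivative \<rho> (at (y, t)) (0, 1)
      + (velocity \<Omega> \<phi> y t \<bullet> grad_y \<Omega> T \<phi> (\<lambda>z. fst (transported m \<theta> \<psi> z)) (y, t)) * \<rho> (y, t))"
proof -
  have \<theta>: "continuous_on UNIV (\<theta> i)" for i
    using DERIV_isCont[OF d] by (intro continuous_at_imp_continuous_on ballI)
  define u where "u z = fst (transported m \<theta> \<psi> z)" for z
  define G where "G z = snd (transported m \<theta> \<psi> z)" for z
  define f where "f z = fst (transported m \<theta>' \<psi> z)" for z
  define dr where "dr z = frechet_derivative \<rho> (at z) (0, 1)" for z
  define S where "S = (UNIV :: (real^'n) set) \<times> {0<..<T}"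
  have QS: "Q \<subseteq> S" by (auto simp: S_def spacetime_domain_def)
  have oS: "open S" unfolding S_def by (intro open_Times) auto
  define v where "v z = indicator S z *\<^sub>R vel (snd z) (fst z)" for z
  obtain K where K0: "compact K" "K \<subseteq> Q" "\<And>z. z \<notin> K \<Longrightarrow> \<rho> z = 0"
    and K1: "\<And>z e. z \<notin> K \<Longrightarrow> frechet_derivative \<rho> (at z) e = 0"
    by (rule test_functionsE[OF \<rho>]) blast
  have "dr z = 0" if "z \<notin> K" for z unfolding dr_def by (rule K1[OF that])
  note K = K0 this
  have ul: "l2 (ext u)" and Gl: "l2 (ext G)" and fl: "l2 (ext f)"
    unfolding u_def[abs_def] G_def[abs_def] f_def[abs_def]
    by (intro transported_components_l2 \<theta> \<theta>' \<psi>; assumption)+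
  have uY: "u \<in> Y" "has_grad u G" unfolding u_def[abs_def] G_def[abs_def]
    by (intro transported_in_Y \<theta> \<psi>; assumption)+
  have \<rho>l: "l2 \<rho>" "l2 dr" unfolding dr_def[abs_def] by (rule test_l2[OF \<rho>], rule test_l2[OF test_partial[OF \<rho>]])
  have vm: "v \<in> borel_measurable borel" unfolding v_def[abs_def]
    by (rule borel_measurable_continuous_on_indicator) (use oS vel_continuous in \<open>auto simp: S_def\<close>)
  have \<rho>m: "\<rho> \<in> borel_measurable borel" using \<rho>l by (simp add: l2_def)
  have KS: "K \<subseteq> S" using K(2) QS by blast
  have cv: "continuous_on K (\<lambda>z. vel (snd z) (fst z))" using continuous_on_subset[OF vel_continuous] KS by (simp add: S_def)
  have cT: "continuous_on K (transported m \<theta> \<psi>)" "continuous_on K (transported m \<theta>' \<psi>)"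
  proof -
    have "continuous_on S (transported m \<theta> \<psi>)" "continuous_on S (transported m \<theta>' \<psi>)"
      unfolding S_def by (rule transported_continuous, fact \<theta>, fact \<psi>, rule transported_continuous, fact \<theta>', fact \<psi>)
    then show "continuous_on K (transported m \<theta> \<psi>)" "continuous_on K (transported m \<theta>' \<psi>)"
      using KS continuous_on_subset by blast+
  qed
  have c\<rho>: "continuous_on K \<rho>" "continuous_on K dr" unfolding dr_def[abs_def]
    by (intro continuous_on_subset[OF test_continuous[OF \<rho>]] continuous_on_subset[OF test_continuous[OF test_partial[OF \<rho>]]] subset_UNIV)+
  have bnd: "\<exists>B. \<forall>z\<in>K. norm (w z) \<le> B" if "continuous_on K w" for w :: "(real^'n) \<times> real \<Rightarrow> 'x::real_normed_vector"
    using compact_imp_bounded[OF compact_continuous_image[OF that K(1)]] by (auto simp: bounded_iff)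
  have vK: "v z = vel (snd z) (fst z)" if "z \<in> K" for z using that KS by (auto simp: v_def)
  have eK: "ext u z = u z" "ext G z = G z" "ext f z = f z" if "z \<in> K" for z using that K(2) by (auto simp: ext_def)
  \<comment> \<open>k' is the time derivative of k, hence has integral zero\<close>
  define k where "k z = ext u z * \<rho> z" for z
  define k' where "k' z = (ext f z - v z \<bullet> ext G z) * \<rho> z + ext u z * dr z" for z
  have "(LINT z|lborel. k' z) = 0"
  proof -
    have "continuous_on K (\<lambda>z. u z * \<rho> z)" unfolding u_def by (intro continuous_intros cT c\<rho>)
    then obtain B1 where B1: "\<forall>z\<in>K. norm (u z * \<rho> z) \<le> B1" using bnd by blast
    have "continuous_on K (\<lambda>z. (f z - vel (snd z) (fst z) \<bullet> G z) * \<rho> z + u z * dr z)"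
      unfolding u_def f_def G_def by (intro continuous_intros cT c\<rho> cv)
    then obtain B2 where B2: "\<forall>z\<in>K. norm ((f z - vel (snd z) (fst z) \<bullet> G z) * \<rho> z + u z * dr z) \<le> B2" using bnd by blast
    show ?thesis
    proof (rule integral_directional_derivative_zero[where f=k and e="(0, 1)" and B="max 0 (max B1 B2)", OF _ _ _ _ _ K(1)])
      show "k \<in> borel_measurable lborel" unfolding k_def[abs_def]
        using ul \<rho>m by (auto simp: l2_def)
      have [measurable]: "ext f \<in> borel_measurable borel" "ext u \<in> borel_measurable borel" "ext G \<in> borel_measurable borel"
        "dr \<in> borel_measurable borel" "\<rho> \<in> borel_measurable borel" "v \<in> borel_measurable borel"
        using ul Gl fl \<rho>l vm by (auto simp: l2_def)
      show "k' \<in> borel_measurable lborel" unfolding k'_def[abs_def] by measurable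
      show "\<bar>k z\<bar> \<le> max 0 (max B1 B2)" for z
      proof (cases "z \<in> K")
        case True
        then show ?thesis using B1 eK[OF True] by (auto simp: k_def le_max_iff_disj)
      qed (simp add: k_def K(3))
      show "\<bar>k' z\<bar> \<le> max 0 (max B1 B2)" for z
      proof (cases "z \<in> K")
        case True
        then show ?thesis using B2 eK[OF True] vK[OF True] by (auto simp: k'_def le_max_iff_disj)
      qed (simp add: k'_def K(3,4))
      show "k z = 0" if "z \<notin> K" for z using K(3)[OF that] by (simp add: k_def)
      fix z :: "(real^'n) \<times> real"
      show "((\<lambda>s. k (z + s *\<^sub>R (0, 1))) has_real_derivative k' z) (at 0)"
      proof (cases "z \<in> K")
        case True
        obtain y t where z: "z = (y, t)" by fastforce
        have zQ: "(y, t) \<in> Q" using True K(2) z by blast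
        then have t: "t \<in> {0<..<T}" by (simp add: mem_Q)
        have D1: "((\<lambda>s. u (y, s)) has_real_derivative f z - vel t y \<bullet> G z) (at t)"
        proof -
          have "((\<lambda>s. \<Sum>i<m. \<theta> i s * \<psi> i (pull s y)) has_real_derivative
             (\<Sum>i<m. \<theta> i t * (- (vel t y \<bullet> snd (lift (\<psi> i) t y))) + \<theta>' i t * \<psi> i (pull t y))) (at t)"
            by (intro DERIV_sum DERIV_mult' d transported_time_derivative[OF t \<psi>]) auto
          moreover have "(\<Sum>i<m. \<theta> i t * (- (vel t y \<bullet> snd (lift (\<psi> i) t y))) + \<theta>' i t * \<psi> i (pull t y)) = f z - vel t y \<bullet> G z"
            by (simp add: f_def G_def z transported_def fst_sum snd_sum lift_def inner_sum_right sum_subtractf)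
          ultimately show ?thesis by (simp add: u_def transported_def fst_sum lift_def)
        qed
        have D2: "((\<lambda>s. \<rho> (y, s)) has_real_derivative dr z) (at t)"
        proof -
          have "((\<lambda>s. (y, s)) has_derivative (\<lambda>s. (0, s))) (at t)" by (auto intro!: derivative_eq_intros)
          from has_derivative_compose[OF this test_has_derivative[OF \<rho>]]
          have dd: "((\<lambda>s. \<rho> (y, s)) has_derivative (\<lambda>s. frechet_derivative \<rho> (at (y, t)) (0, s))) (at t)" .
          have "frechet_derivative \<rho> (at (y, t)) (0, s) = dr z * s" for s
          proof -
            have "linear (frechet_derivative \<rho> (at (y, t)))" using has_derivative_linear[OF test_has_derivative[OF \<rho>]] .
            from linear_cmul[OF this, of s "(0, 1)"] show ?thesis by (simp add: dr_def z mult.commute)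
          qed
          then have "(\<lambda>s. frechet_derivative \<rho> (at (y, t)) (0, s)) = (*) (dr z)" by (rule HOL.ext)
          with dd show ?thesis by (simp only: has_field_derivative_def)
        qed
        have D3: "((\<lambda>s. u (y, s) * \<rho> (y, s)) has_real_derivative (u (y, t) * dr z + (f z - vel t y \<bullet> G z) * \<rho> (y, t))) (at t)"
          by (rule DERIV_mult'[OF D1 D2])
        have "((\<lambda>s. k (y, s)) has_real_derivative (u (y, t) * dr z + (f z - vel t y \<bullet> G z) * \<rho> (y, t))) (at t)"
        proof (rule has_field_derivative_transform_within_open[OF D3])
          show "open ((\<lambda>s. (y, s)) -` Q)" by (rule open_vimage[OF open_Q]) (intro continuous_intros)
          show "t \<in> (\<lambda>s. (y, s)) -` Q" using zQ by simp
        qed (simp add: k_def ext_def)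
        moreover have "u (y, t) * dr z + (f z - vel t y \<bullet> G z) * \<rho> (y, t) = k' z"
          using eK[OF True] vK[OF True] by (simp add: k'_def z)
        ultimately have "((\<lambda>s. k (y, s)) has_real_derivative k' z) (at (0 + t))" by simp
        then have "((\<lambda>s. k (y, s + t)) has_real_derivative k' z) (at 0)" unfolding DERIV_shift .
        then show ?thesis by (simp add: z add.commute)
      next
        case False
        have "((\<lambda>s::real. 0::real) has_real_derivative 0) (at 0)" by simp
        then have "((\<lambda>s. k (z + s *\<^sub>R (0, 1))) has_real_derivative 0) (at 0)"
        proof (rule has_field_derivative_transform_within_open)
          show "open ((\<lambda>s::real. z + s *\<^sub>R (0, 1)) -` (- K))"
            by (rule open_vimage) (use compact_imp_closed[OF K(1)] in \<open>auto intro!: continuous_intros\<close>)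
          show "(0::real) \<in> (\<lambda>s::real. z + s *\<^sub>R (0, 1)) -` (- K)" using False by (simp add: zero_prod_def[symmetric])
          show "0 = k (z + s *\<^sub>R (0, 1))" if "s \<in> (\<lambda>s::real. z + s *\<^sub>R (0, 1)) -` (- K)" for s
            using K(3)[of "z + s *\<^sub>R (0, 1)"] that by (simp add: k_def)
        qed
        then show ?thesis using False K(3,4) by (simp add: k'_def)
      qed
    qed
  qed
  moreover have \<rho>v: "l2 (\<lambda>z. \<rho> z *\<^sub>R v z)"
  proof -
    have "continuous_on K (\<lambda>z. \<rho> z *\<^sub>R vel (snd z) (fst z))" by (intro continuous_intros c\<rho> cv)
    then obtain B where B: "\<forall>z\<in>K. norm (\<rho> z *\<^sub>R vel (snd z) (fst z)) \<le> B" using bnd by blast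
    show ?thesis
    proof (rule l2_bounded_compact(1)[OF _ _ K(1)])
      show "(\<lambda>z. \<rho> z *\<^sub>R v z) \<in> borel_measurable lborel" using \<rho>m vm by simp
      show "norm (\<rho> z *\<^sub>R v z) \<le> max 0 B" for z
        using B vK K(3) by (cases "z \<in> K") (auto simp: le_max_iff_disj)
    qed (simp add: K(3))
  qed
  have i: "integrable lborel (\<lambda>z. ext f z * \<rho> z)" "integrable lborel (\<lambda>z. (\<rho> z *\<^sub>R v z) \<bullet> ext G z)" "integrable lborel (\<lambda>z. ext u z * dr z)"
    by (intro l2_real_mult_integrable l2_inner_integrable fl \<rho>l \<rho>v Gl ul)+
  moreover have "k' = (\<lambda>z. ext f z * \<rho> z - (\<rho> z *\<^sub>R v z) \<bullet> ext G z + ext u z * dr z)"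
    by (rule HOL.ext) (simp add: k'_def algebra_simps)
  ultimately have F0: "(LINT z|lborel. ext f z * \<rho> z) = (LINT z|lborel. (\<rho> z *\<^sub>R v z) \<bullet> ext G z) - (LINT z|lborel. ext u z * dr z)"
    by simp
  let ?H = "grad_y \<Omega> T \<phi> u"
  have H: "has_grad u ?H" by (rule grad_y_works[OF uY(1)])
  have iH: "integrable lborel (\<lambda>z. (\<rho> z *\<^sub>R v z) \<bullet> ext ?H z)" by (rule l2_inner_integrable[OF \<rho>v has_grad_l2[OF H]])
  let ?E = "\<lambda>y t. - u (y, t) * frechet_derivative \<rho> (at (y, t)) (0, 1) + (velocity \<Omega> \<phi> y t \<bullet> ?H (y, t)) * \<rho> (y, t)"
  have E: "indicator Q z * ?E (fst z) (snd z) = (\<rho> z *\<^sub>R v z) \<bullet> ext ?H z - ext u z * dr z" for z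
  proof (cases "z \<in> Q")
    case True
    then have "velocity \<Omega> \<phi> (fst z) (snd z) = v z" using velocity_eq[of "fst z" "snd z"] QS by (auto simp: v_def)
    then show ?thesis using True by (simp add: ext_def dr_def algebra_simps)
  qed (simp add: ext_def)
  have "st_integral \<Omega> T \<phi> ?E = (LINT z|lborel. (\<rho> z *\<^sub>R v z) \<bullet> ext ?H z - ext u z * dr z)"
    unfolding E[symmetric] by (rule st_integral_eq) (simp only: E Bochner_Integration.integrable_diff[OF iH i(3)])
  also have "\<dots> = (LINT z|lborel. (\<rho> z *\<^sub>R v z) \<bullet> ext ?H z) - (LINT z|lborel. ext u z * dr z)"
    by (rule Bochner_Integration.integral_diff[OF iH i(3)])
  also have "(LINT z|lborel. (\<rho> z *\<^sub>R v z) \<bullet> ext ?H z) = (LINT z|lborel. (\<rho> z *\<^sub>R v z) \<bullet> ext G z)"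
  proof (rule integral_cong_AE)
    show "AE z in lborel. (\<rho> z *\<^sub>R v z) \<bullet> ext ?H z = (\<rho> z *\<^sub>R v z) \<bullet> ext G z"
      using has_grad_unique[OF H uY(2)] by eventually_elim simp
  qed (use iH i(2) in auto)
  finally have "(LINT z|lborel. ext f z * \<rho> z) = st_integral \<Omega> T \<phi> ?E" using F0 by (simp only:)
  moreover have "(\<lambda>z. fst (transported m \<theta> \<psi> z)) = u" "(\<lambda>z. fst (transported m \<theta>' \<psi> z)) = f"
    by (simp_all add: u_def f_def fun_eq_iff)
  ultimately show ?thesis unfolding u_def by simp
qed

end

context rigid_diffusion
begin

text \<open>The derivatives of the \<open>\<theta> i\<close> give one functional that is a material derivative. The form uses a
  chosen one, which agrees with it on test functions and therefore on Y.\<close>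

lemma transported_in_X:
  assumes d: "\<And>i t. (\<theta> i has_real_derivative \<theta>' i t) (at t)" and \<theta>': "\<And>i. continuous_on UNIV (\<theta>' i)"
    and \<psi>: "\<And>i. i < m \<Longrightarrow> \<psi> i \<in> test_functions \<Omega>" and 0: "\<And>i. i < m \<Longrightarrow> \<theta> i 0 = 0"
  shows "(\<lambda>z. fst (transported m \<theta> \<psi> z)) \<in> X_space \<Omega> T \<phi> \<alpha>" (is "?u \<in> _")
    and "q \<in> Y \<Longrightarrow> has_grad q g \<Longrightarrow> bform \<Omega> T \<phi> \<alpha> (\<lambda>z. fst (transported m \<theta> \<psi> z)) q =
      (LINT z|lborel. ext (\<lambda>z. fst (transported m \<theta>' \<psi> z)) z * ext q z)
      + (LINT z|lborel. diffusivity z * (ext (\<lambda>z. snd (transported m \<theta> \<psi> z)) z \<bullet> ext g z))"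
proof -
  have \<theta>: "continuous_on UNIV (\<theta> i)" for i
    using DERIV_isCont[OF d] by (intro continuous_at_imp_continuous_on ballI)
  let ?f = "\<lambda>z. fst (transported m \<theta>' \<psi> z)"
  have fl: "l2 (ext ?f)" by (rule transported_components_l2(1)[OF \<theta>' \<psi>])
  have uY: "?u \<in> Y" "has_grad ?u (\<lambda>z. snd (transported m \<theta> \<psi> z))" by (rule transported_in_Y[OF \<theta> \<psi>]; assumption)+
  have M: "has_material_derivative \<Omega> T \<phi> \<alpha> ?u (\<lambda>p. LINT z|lborel. ext ?f z * ext p z)"
    unfolding has_material_derivative_def
    using l2_functional_in_dual[OF fl] transported_distributional_derivative[OF d \<theta>' \<psi>] by (auto simp: test_ext(1))
  show "?u \<in> X_space \<Omega> T \<phi> \<alpha>"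
  proof -
    have "zero_initial_value \<Omega> T \<phi> ?u" by (rule transported_zero_initial_value[OF \<theta> \<psi> 0])
    with uY(1) M show ?thesis unfolding X_space_def by blast
  qed
  assume q: "q \<in> Y" and g: "has_grad q g"
  let ?F = "material_derivative \<Omega> T \<phi> \<alpha> ?u"
  have F: "has_material_derivative \<Omega> T \<phi> \<alpha> ?u ?F"
    unfolding material_derivative_def by (rule someI[of "has_material_derivative \<Omega> T \<phi> \<alpha> ?u", OF M])
  have "?F q = (LINT z|lborel. ext ?f z * ext q z)"
  proof (rule dual_determined_by_test_functions[OF _ fl _ q])
    show "?F \<in> Y_dual \<Omega> T \<phi> \<alpha>" using F by (simp add: has_material_derivative_def)
    show "?F \<rho> = (LINT z|lborel. ext ?f z * \<rho> z)" if "\<rho> \<in> test_functions Q" for \<rho>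
      using F that transported_distributional_derivative[OF d \<theta>' \<psi> that] by (simp add: has_material_derivative_def)
  qed
  then show "bform \<Omega> T \<phi> \<alpha> ?u q = (LINT z|lborel. ext ?f z * ext q z)
      + (LINT z|lborel. diffusivity z * (ext (\<lambda>z. snd (transported m \<theta> \<psi> z)) z \<bullet> ext g z))"
    by (simp add: bform_def energy_integral[OF uY(2) g uY(1) q])
qed

end

section \<open>Positivity of the form\<close>

text \<open>A translate of V has the norm of V, so that the correlation of V with a translate of itself is
  maximal without translation; replacing V by P in one factor costs k times the norm of V for each
  of the two terms.\<close>

lemma difference_quotient_estimate:
  fixes V P :: "'a::euclidean_space \<Rightarrow> real \<times> 'b::euclidean_space"
  assumes V: "l2 V" and P: "l2 P" and VP: "l2n (\<lambda>z. V z - P z) \<le> k"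
  shows "- (2 * k * l2n V) \<le> (LINT z|lborel. (fst (P z) - fst (P (z - w))) * fst (V z))"
proof -
  define e where "e z = P z - V z" for z
  have el: "l2 e" unfolding e_def[abs_def] by (rule l2_diff[OF P V])
  have en: "l2n e \<le> k" using VP unfolding e_def[abs_def] by (subst l2n_diff_commute)
  note V1 = l2_component(1,2)[OF V] and e1 = l2_component(1,2)[OF el]
  have Vt: "l2 (\<lambda>z. fst (V (z - w)))" "l2n (\<lambda>z. fst (V (z - w))) = l2n (\<lambda>z. fst (V z))"
    using l2_translate[OF V1(1)] by auto
  have et: "l2 (\<lambda>z. fst (e (z - w)))" "l2n (\<lambda>z. fst (e (z - w))) = l2n (\<lambda>z. fst (e z))"
    using l2_translate[OF e1(1)] by auto
  have "(LINT z|lborel. (fst (P z) - fst (P (z - w))) * fst (V z))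
      = (LINT z|lborel. (fst (V z) * fst (V z) - fst (V (z - w)) * fst (V z)) + (fst (e z) * fst (V z) - fst (e (z - w)) * fst (V z)))"
    by (intro Bochner_Integration.integral_cong refl) (simp add: e_def algebra_simps)
  also have "\<dots> = ((LINT z|lborel. fst (V z) * fst (V z)) - (LINT z|lborel. fst (V (z - w)) * fst (V z)))
      + ((LINT z|lborel. fst (e z) * fst (V z)) - (LINT z|lborel. fst (e (z - w)) * fst (V z)))"
    using l2_real_mult_integrable[OF V1(1) V1(1)] l2_real_mult_integrable[OF Vt(1) V1(1)]
      l2_real_mult_integrable[OF e1(1) V1(1)] l2_real_mult_integrable[OF et(1) V1(1)] by simp
  finally have eq: "(LINT z|lborel. (fst (P z) - fst (P (z - w))) * fst (V z)) = \<dots>" .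
  have a: "(LINT z|lborel. fst (V (z - w)) * fst (V z)) \<le> (LINT z|lborel. fst (V z) * fst (V z))"
  proof -
    have "(LINT z|lborel. fst (V (z - w)) * fst (V z)) \<le> l2n (\<lambda>z. fst (V (z - w))) * l2n (\<lambda>z. fst (V z))"
      using l2_cauchy_schwarz[OF Vt(1) V1(1)] by simp
    also have "\<dots> = (l2n (\<lambda>z. fst (V z)))\<^sup>2" by (simp add: Vt(2) power2_eq_square)
    also have "\<dots> = (LINT z|lborel. fst (V z) * fst (V z))" unfolding l2n_square by (simp add: power2_eq_square[symmetric])
    finally show ?thesis .
  qed
  have kV: "l2n (\<lambda>z. fst (e z)) * l2n (\<lambda>z. fst (V z)) \<le> k * l2n V"
    using e1(2) en V1(2) by (intro mult_mono) (auto intro: order_trans[OF l2n_nonneg])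
  have b: "\<bar>LINT z|lborel. fst (e z) * fst (V z)\<bar> \<le> k * l2n V" "\<bar>LINT z|lborel. fst (e (z - w)) * fst (V z)\<bar> \<le> k * l2n V"
    using l2_cauchy_schwarz[OF e1(1) V1(1)] l2_cauchy_schwarz[OF et(1) V1(1)] kV by (auto simp: et(2))
  show ?thesis unfolding eq using a b by linarith
qed

text \<open>The translate of P differs from V by at most 2k in norm: k for approximating and k for translating
  V.\<close>

lemma energy_estimate:
  fixes V P :: "'a::euclidean_space \<Rightarrow> real \<times> 'b::euclidean_space" and a :: "'a \<Rightarrow> real"
  assumes V: "l2 V" and P: "l2 P" and VP: "l2n (\<lambda>z. V z - P z) \<le> k"
    and tr: "l2n (\<lambda>z. V (z - w) - V z) \<le> k"
    and am: "a \<in> borel_measurable borel" and ab: "\<And>z. \<bar>a z\<bar> \<le> U"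
  shows "(LINT z|lborel. a z * (snd (V z) \<bullet> snd (V z))) - U * (2 * k) * l2n V
    \<le> (LINT z|lborel. a z * (snd (P (z - w)) \<bullet> snd (V z)))"
proof -
  define e where "e z = P (z - w) - V z" for z
  have Pt: "l2 (\<lambda>z. P (z - w))" and Vt: "l2 (\<lambda>z. V (z - w))" using l2_translate(1) P V by blast+
  have el: "l2 e" unfolding e_def[abs_def] by (rule l2_diff[OF Pt V])
  have U: "0 \<le> U" using ab[of undefined] by linarith
  have "l2n e \<le> l2n (\<lambda>z. P (z - w) - V (z - w)) + l2n (\<lambda>z. V (z - w) - V z)"
    unfolding e_def[abs_def] by (rule l2n_triangle_diff[OF Pt Vt V])
  also have "l2n (\<lambda>z. P (z - w) - V (z - w)) = l2n (\<lambda>z. P z - V z)" using l2_translate(2)[OF l2_diff[OF P V]] by simp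
  also have "\<dots> = l2n (\<lambda>z. V z - P z)" by (rule l2n_diff_commute)
  finally have en: "l2n e \<le> 2 * k" using VP tr by linarith
  note V2 = l2_component(3,4)[OF V] and e2 = l2_component(3,4)[OF el]
  have ae: "l2 (\<lambda>z. a z *\<^sub>R snd (e z))" "l2n (\<lambda>z. a z *\<^sub>R snd (e z)) \<le> U * l2n (\<lambda>z. snd (e z))"
    using l2_mult_bounded[OF e2(1) _ ab] am by auto
  have aV: "l2 (\<lambda>z. a z *\<^sub>R snd (V z))" using l2_mult_bounded(1)[OF V2(1) _ ab] am by auto
  have "(LINT z|lborel. a z * (snd (P (z - w)) \<bullet> snd (V z))) = (LINT z|lborel. (a z *\<^sub>R snd (V z)) \<bullet> snd (V z) + (a z *\<^sub>R snd (e z)) \<bullet> snd (V z))"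
    by (intro Bochner_Integration.integral_cong refl) (simp add: e_def inner_diff_left algebra_simps)
  also have "\<dots> = (LINT z|lborel. a z * (snd (V z) \<bullet> snd (V z))) + (LINT z|lborel. (a z *\<^sub>R snd (e z)) \<bullet> snd (V z))"
    using l2_inner_integrable[OF aV V2(1)] l2_inner_integrable[OF ae(1) V2(1)]
    by (subst Bochner_Integration.integral_add) simp_all
  finally have eq: "(LINT z|lborel. a z * (snd (P (z - w)) \<bullet> snd (V z))) = \<dots>" .
  have "\<bar>LINT z|lborel. (a z *\<^sub>R snd (e z)) \<bullet> snd (V z)\<bar> \<le> l2n (\<lambda>z. a z *\<^sub>R snd (e z)) * l2n (\<lambda>z. snd (V z))"
    by (rule l2_cauchy_schwarz[OF ae(1) V2(1)])
  also have "\<dots> \<le> (U * (2 * k)) * l2n V"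
  proof (rule mult_mono)
    show "l2n (\<lambda>z. a z *\<^sub>R snd (e z)) \<le> U * (2 * k)"
      using ae(2) mult_left_mono[OF order_trans[OF e2(2) en] U] by linarith
    show "0 \<le> U * (2 * k)" using U order_trans[OF l2n_nonneg VP] by simp
  qed (use V2 in auto)
  finally show ?thesis unfolding eq by linarith
qed

context rigid_diffusion
begin

text \<open>By the Poincare inequality, q would vanish if its gradient did.\<close>

lemma Y_gradient_nonzero:
  assumes q: "q \<in> Y" and g: "has_grad q g" and nz: "\<not> (AE z in lborel. z \<in> Q \<longrightarrow> q z = 0)"
  shows "0 < (LINT z|lborel. diffusivity z * (ext g z \<bullet> ext g z))"
proof -
  have "l2n (ext g) \<noteq> 0"
  proof
    assume g0: "l2n (ext g) = 0"
    obtain C where "l2n (ext q) \<le> C * l2n (ext g)" using Y_poincare q g by metis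
    then have "l2n (ext q) = 0" using g0 l2n_nonneg[of "ext q"] by simp
    then have "AE z in lborel. ext q z = 0" using l2n_eq_0_iff[OF Y_l2[OF q]] by simp
    then have "AE z in lborel. z \<in> Q \<longrightarrow> q z = 0" by eventually_elim (auto simp: ext_def)
    with nz show False by simp
  qed
  then have "0 < sqrt \<alpha>_lo * l2n (ext g)" using \<alpha>_lo by (simp add: less_le)
  also have "\<dots> \<le> Y_norm \<Omega> T \<phi> \<alpha> q" by (rule Y_norm_bounds(1)[OF q g])
  also have "\<dots> = sqrt (LINT z|lborel. diffusivity z * (ext g z \<bullet> ext g z))"
    by (simp add: Y_norm_def power2_norm_eq_inner energy_integral[OF g g q q])
  finally show ?thesis by simp
qed

text \<open>The trial function is the Steklov average of an approximation P of the pullback V of q. The shift h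
  is chosen so small that translations by at most h move V by less than \<open>\<kappa>\<close>; the accuracy k of P is
  then chosen relative to h, since the difference quotient divides the error by h.\<close>

lemma exists_trial_function_with_positive_form:
  assumes q: "q \<in> Y" and nz: "\<not> (AE z in lborel. z \<in> Q \<longrightarrow> q z = 0)"
  shows "\<exists>u\<in>X_space \<Omega> T \<phi> \<alpha>. 0 < bform \<Omega> T \<phi> \<alpha> u q"
proof -
  define g where "g = grad_y \<Omega> T \<phi> q"
  have g: "has_grad q g" unfolding g_def by (rule grad_y_works[OF q])
  define V where "V = pullback (ext q) (ext g)"
  have qm: "ext q \<in> borel_measurable borel" and gm: "ext g \<in> borel_measurable borel"
    using Y_l2[OF q] has_grad_l2[OF g] by (auto simp: l2_def)
  have V: "l2 V" unfolding V_def by (rule pullback_l2(1)[OF Y_l2[OF q] has_grad_l2[OF g]])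
  have Vz: "fst (V z) = ext q (push z)" "snd (V z) = inv (R (snd z)) (ext g (push z))" for z by (simp_all add: V_def pullback_def)
  have Vout: "V z = 0" if "push z \<notin> Q" for z
    using that linear_0[OF inv_lin] by (simp add: prod_eq_iff Vz ext_def)
  define a where "a z = diffusivity (push z)" for z
  have am[measurable]: "a \<in> borel_measurable borel" unfolding a_def[abs_def] by measurable
  define U where "U = \<bar>\<alpha>_up\<bar> + 1"
  have U: "0 < U" "\<bar>a z\<bar> \<le> U" for z using diffusivity_bounds(4)[of "push z"] by (auto simp: U_def a_def)
  define N where "N = (LINT z|lborel. a z * (snd (V z) \<bullet> snd (V z)))"
  have inner_V: "R (snd z) x \<bullet> ext g (push z) = x \<bullet> snd (V z)" for z x
    using inner_inv_R[of "snd z" "ext g (push z)" x] by (simp add: Vz inner_commute)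
  have N: "0 < N"
  proof -
    have "(LINT z|lborel. diffusivity (push z) * (ext g (push z) \<bullet> ext g (push z))) = (LINT z|lborel. diffusivity z * (ext g z \<bullet> ext g z))"
      by (rule push_integral(2)[where f="\<lambda>z. diffusivity z * (ext g z \<bullet> ext g z)"]) (use gm in measurable)
    moreover have "ext g (push z) \<bullet> ext g (push z) = snd (V z) \<bullet> snd (V z)" for z
      using inner_V[of z "snd (V z)"] by (simp add: Vz)
    ultimately show ?thesis using Y_gradient_nonzero[OF q g nz] by (simp add: N_def a_def)
  qed
  \<comment> \<open>a positive upper bound for the norm of V, to divide by\<close>
  define W where "W = l2n V + 1"
  have W: "0 < W" "l2n V \<le> W" using l2n_nonneg[of V] unfolding W_def by linarith+
  \<comment> \<open>so that the error \<open>2 U \<kappa> W\<close> in the diffusive part is \<open>N/4\<close>\<close>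
  define \<kappa> where "\<kappa> = N / (8 * U * W)"
  have \<kappa>: "0 < \<kappa>" using N U(1) W by (simp add: \<kappa>_def)
  obtain \<delta> where \<delta>: "0 < \<delta>" "\<And>w. norm w < \<delta> \<Longrightarrow> l2n (\<lambda>z. V (z - w) - V z) < \<kappa>"
    using l2_translation_continuous[OF V \<kappa>] by blast
  define h where "h = \<delta> / 2"
  have h: "0 < h" "h < \<delta>" using \<delta>(1) by (auto simp: h_def)
  \<comment> \<open>so that the error \<open>2 k W / h\<close> in the convective part is at most \<open>N/4\<close>\<close>
  define k where "k = min \<kappa> (N * h / (8 * W))"
  have k: "0 < k" "k \<le> \<kappa>" "k \<le> N * h / (8 * W)" using \<kappa> N h(1) W(1) by (auto simp: k_def)
  obtain m :: nat and \<eta>0 \<psi> where \<eta>0: "\<And>i. i < m \<Longrightarrow> \<eta>0 i \<in> test_functions {0<..<T}"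
    and \<psi>: "\<And>i. i < m \<Longrightarrow> \<psi> i \<in> test_functions \<Omega>"
    and ap: "l2n (\<lambda>z. V z - (\<Sum>i<m. \<eta>0 i (snd z) *\<^sub>R jet (\<psi> i) (fst z))) < k"
    unfolding V_def using pullback_tensor_approximation[OF q g k(1)] by blast
  \<comment> \<open>test functions for all indices, to have the smoothness of the \<open>\<theta> i\<close> without a guard\<close>
  define \<eta> where "\<eta> i = (if i < m then \<eta>0 i else (\<lambda>_. 0))" for i
  have \<eta>: "\<eta> i \<in> test_functions {0<..<T}" for i using \<eta>0 by (simp add: \<eta>_def test_zero)
  have \<eta>c: "continuous_on UNIV (\<eta> i)" for i by (rule test_continuous[OF \<eta>])
  define P where "P z = (\<Sum>i<m. \<eta> i (snd z) *\<^sub>R jet (\<psi> i) (fst z))" for z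
  have VP: "l2n (\<lambda>z. V z - P z) < k" using ap by (simp add: P_def \<eta>_def cong: sum.cong_simp)
  have P: "l2 P" unfolding P_def[abs_def] by (intro l2_sum l2_tensor(1) test_l2[OF \<eta>] jet_l2[of _ \<Omega>] \<psi>) auto
  define \<theta> where "\<theta> i = steklov h (\<eta> i)" for i
  define \<theta>' where "\<theta>' i t = (\<eta> i t - \<eta> i (t - h)) / h" for i t
  have d: "(\<theta> i has_real_derivative \<theta>' i t) (at t)" for i t
    unfolding \<theta>_def \<theta>'_def by (rule steklov_derivative[OF \<eta>c h(1)])
  have \<theta>'c: "continuous_on UNIV (\<theta>' i)" for i unfolding \<theta>'_def
    using h(1) by (intro continuous_intros \<eta>c continuous_on_compose2[OF \<eta>c]) auto
  have \<theta>0: "\<theta> i 0 = 0" if "i < m" for i unfolding \<theta>_def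
    by (rule steklov_zero) (rule test_outside[OF \<eta>], simp)
  let ?u = "\<lambda>z. fst (transported m \<theta> \<psi> z)"
  note X = transported_in_X[where \<theta>=\<theta> and \<theta>'=\<theta>' and \<psi>=\<psi> and m=m, OF d \<theta>'c \<psi> \<theta>0]
  have \<theta>c: "continuous_on UNIV (\<theta> i)" for i
    using DERIV_isCont[OF d] by (intro continuous_at_imp_continuous_on ballI)
  have fl: "l2 (ext (\<lambda>z. fst (transported m \<theta>' \<psi> z)))" by (rule transported_components_l2(1)[OF \<theta>'c \<psi>])
  have Gl: "l2 (ext (\<lambda>z. snd (transported m \<theta> \<psi> z)))" by (rule transported_components_l2(2)[OF \<theta>c \<psi>])
  have Gm: "ext (\<lambda>z. snd (transported m \<theta> \<psi> z)) \<in> borel_measurable borel" using Gl by (simp add: l2_def)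
  have fm: "ext (\<lambda>z. fst (transported m \<theta>' \<psi> z)) \<in> borel_measurable borel" using fl by (simp add: l2_def)
  \<comment> \<open>the convective part, in the reference cylinder\<close>
  have first: "- (N / 4) \<le> (LINT z|lborel. ext (\<lambda>z. fst (transported m \<theta>' \<psi> z)) z * ext q z)"
  proof -
    have "(LINT z|lborel. ext (\<lambda>z. fst (transported m \<theta>' \<psi> z)) z * ext q z)
        = (LINT z|lborel. ext (\<lambda>z. fst (transported m \<theta>' \<psi> z)) (push z) * ext q (push z))"
      by (rule push_integral(2)[where f="\<lambda>z. ext (\<lambda>z. fst (transported m \<theta>' \<psi> z)) z * ext q z", symmetric])
         (use qm fm in measurable)
    also have "\<dots> = (LINT z|lborel. ((fst (P z) - fst (P (z - (0, h)))) * fst (V z)) / h)"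
    proof (intro Bochner_Integration.integral_cong refl)
      fix z :: "(real^'n) \<times> real"
      have e: "(\<Sum>i<m. \<theta>' i (snd z) * \<psi> i (fst z)) = (fst (P z) - fst (P (z - (0, h)))) / h"
        by (simp add: P_def fst_sum jet_def \<theta>'_def sum_subtractf[symmetric] sum_divide_distrib left_diff_distrib)
      show "ext (\<lambda>z. fst (transported m \<theta>' \<psi> z)) (push z) * ext q (push z) = ((fst (P z) - fst (P (z - (0, h)))) * fst (V z)) / h"
      proof (cases "push z \<in> Q")
        case True
        then have "ext (\<lambda>z. fst (transported m \<theta>' \<psi> z)) (push z) = (fst (P z) - fst (P (z - (0, h)))) / h"
          by (simp add: ext_def transported_push(1) e)
        then show ?thesis by (simp add: Vz)
      next
        case False
        then show ?thesis using Vout[OF False] by (simp add: ext_def)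
      qed
    qed
    also have "\<dots> = (LINT z|lborel. (fst (P z) - fst (P (z - (0, h)))) * fst (V z)) / h" by simp
    finally have eq: "(LINT z|lborel. ext (\<lambda>z. fst (transported m \<theta>' \<psi> z)) z * ext q z) = \<dots>" .
    have "- (2 * k * l2n V) \<le> (LINT z|lborel. (fst (P z) - fst (P (z - (0, h)))) * fst (V z))"
      by (rule difference_quotient_estimate[OF V P less_imp_le[OF VP]])
    moreover have "2 * k * l2n V \<le> N / 4 * h"
    proof -
      have "2 * k * l2n V \<le> 2 * (N * h / (8 * W)) * W"
        using k W N h(1) by (intro mult_mono) auto
      also have "\<dots> = N / 4 * h" using W(1) by simp
      finally show ?thesis .
    qed
    ultimately have "- (N / 4 * h) \<le> (LINT z|lborel. (fst (P z) - fst (P (z - (0, h)))) * fst (V z))" by linarith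
    then show ?thesis unfolding eq using h(1) by (simp add: pos_le_divide_eq)
  qed
  \<comment> \<open>the diffusive part is the average over \<open>0 \<le> s \<le> h\<close> of \<open>\<Psi> s\<close>, the energy product of V with P
    shifted by s; kf i is the integrand to which the time profiles contribute a factor\<close>
  define kf where "kf i z = a z * (snd (indicator {0<..<T} (snd z) *\<^sub>R jet (\<psi> i) (fst z)) \<bullet> snd (V z))" for i z
  have kfi: "integrable lborel (kf i)" if i: "i < m" for i
  proof -
    have "l2 (\<lambda>z::(real^'n) \<times> real. indicator {0<..<T} (snd z) *\<^sub>R jet (\<psi> i) (fst z))"
      by (intro l2_tensor(1) l2_indicator_interval jet_l2[of _ \<Omega>] \<psi> i)
    from l2_component(3)[OF this] have "l2 (\<lambda>z. a z *\<^sub>R snd (indicator {0<..<T} (snd z) *\<^sub>R jet (\<psi> i) (fst z)))"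
      using U(2) am by (intro l2_mult_bounded(1)[where B=U]) auto
    from l2_inner_integrable[OF this l2_component(3)[OF V]] show ?thesis by (simp add: kf_def[abs_def] mult.assoc)
  qed
  have kfP: "(\<Sum>i<m. b i * kf i z) = a z * ((\<Sum>i<m. b i *\<^sub>R grad (\<psi> i) (fst z)) \<bullet> snd (V z))" for b z
  proof (cases "snd z \<in> {0<..<T}")
    case True
    then show ?thesis by (simp add: kf_def jet_def inner_sum_left sum_distrib_left mult.left_commute)
  next
    case False
    then have "push z \<notin> Q" by (auto simp: push_mem_Q)
    from Vout[OF this] show ?thesis by (simp add: kf_def)
  qed
  have \<eta>b: "\<exists>B. \<forall>t. \<bar>\<eta> i t\<bar> \<le> B" for i using test_bounded[OF \<eta>[of i]] by metis
  from choice[of "\<lambda>i B. \<forall>t. \<bar>\<eta> i t\<bar> \<le> B"] \<eta>b obtain B where B: "\<And>i t. \<bar>\<eta> i t\<bar> \<le> B i" by blast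
  define \<Psi> where "\<Psi> s = (\<Sum>i<m. LINT z|lborel. \<eta> i (snd z - s) * kf i z)" for s
  have \<Psi>: "\<Psi> s = (LINT z|lborel. a z * (snd (P (z - (0, s))) \<bullet> snd (V z)))" for s
  proof -
    have [measurable]: "\<eta> i \<in> borel_measurable borel" for i by (rule borel_measurable_continuous_onI[OF \<eta>c])
    have ei: "integrable lborel (\<lambda>z. \<eta> i (snd z - s) * kf i z)" if i: "i < m" for i
    proof (rule Bochner_Integration.integrable_bound)
      show "integrable lborel (\<lambda>z. B i * kf i z)" using kfi[OF i] by simp
      have [measurable]: "kf i \<in> borel_measurable borel" using kfi[OF i] by auto
      show "(\<lambda>z. \<eta> i (snd z - s) * kf i z) \<in> borel_measurable lborel" by measurable
      have "\<bar>\<eta> i t\<bar> \<le> \<bar>B i\<bar>" for t using B[of i t] by linarith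
      then show "AE z in lborel. norm (\<eta> i (snd z - s) * kf i z) \<le> norm (B i * kf i z)"
        by (auto simp: abs_mult intro!: mult_right_mono)
    qed
    have "\<Psi> s = (LINT z|lborel. (\<Sum>i<m. \<eta> i (snd z - s) * kf i z))"
      unfolding \<Psi>_def by (rule Bochner_Integration.integral_sum[symmetric]) (use ei in auto)
    also have "\<dots> = (LINT z|lborel. a z * (snd (P (z - (0, s))) \<bullet> snd (V z)))"
      unfolding kfP by (simp add: P_def snd_sum jet_def)
    finally show ?thesis .
  qed
  have \<Psi>_lower: "3 / 4 * N \<le> \<Psi> s" if s: "s \<in> {0..h}" for s
  proof -
    have "norm ((0, s) :: (real^'n) \<times> real) < \<delta>" using s h(2) by (simp add: norm_Pair)
    from less_imp_le[OF \<delta>(2)[OF this]] have tr: "l2n (\<lambda>z. V (z - (0, s)) - V z) \<le> \<kappa>" .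
    have "l2n (\<lambda>z. V z - P z) \<le> \<kappa>" using VP k(2) by linarith
    from energy_estimate[OF V P this tr am U(2)] have "N - U * (2 * \<kappa>) * l2n V \<le> \<Psi> s" by (simp add: N_def \<Psi>)
    moreover have "U * (2 * \<kappa>) * l2n V \<le> N / 4"
    proof -
      have "U * (2 * \<kappa>) * l2n V \<le> U * (2 * \<kappa>) * W" using U(1) \<kappa> W(2) by (intro mult_left_mono) auto
      also have "\<dots> = N / 4" using U(1) W(1) by (simp add: \<kappa>_def)
      finally show ?thesis .
    qed
    ultimately show ?thesis by linarith
  qed
  have second: "3 / 4 * N \<le> (LINT z|lborel. diffusivity z * (ext (\<lambda>z. snd (transported m \<theta> \<psi> z)) z \<bullet> ext g z))"
  proof -
    have "(LINT z|lborel. diffusivity z * (ext (\<lambda>z. snd (transported m \<theta> \<psi> z)) z \<bullet> ext g z))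
        = (LINT z|lborel. diffusivity (push z) * (ext (\<lambda>z. snd (transported m \<theta> \<psi> z)) (push z) \<bullet> ext g (push z)))"
      by (rule push_integral(2)[where f="\<lambda>z. diffusivity z * (ext (\<lambda>z. snd (transported m \<theta> \<psi> z)) z \<bullet> ext g z)", symmetric])
         (use gm Gm in measurable)
    also have "\<dots> = (LINT z|lborel. (\<Sum>i<m. \<theta> i (snd z) * kf i z))"
    proof (intro Bochner_Integration.integral_cong refl)
      fix z :: "(real^'n) \<times> real"
      show "diffusivity (push z) * (ext (\<lambda>z. snd (transported m \<theta> \<psi> z)) (push z) \<bullet> ext g (push z)) = (\<Sum>i<m. \<theta> i (snd z) * kf i z)"
      proof (cases "push z \<in> Q")
        case True
        then have "ext (\<lambda>z. snd (transported m \<theta> \<psi> z)) (push z) = R (snd z) (\<Sum>i<m. \<theta> i (snd z) *\<^sub>R grad (\<psi> i) (fst z))"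
          by (simp add: ext_def transported_push(2))
        then show ?thesis by (simp only: inner_V kfP a_def)
      next
        case False
        then show ?thesis unfolding kfP using Vout[OF False] by (simp add: ext_def)
      qed
    qed
    also have "\<dots> = (\<Sum>i<m. LINT z|lborel. \<theta> i (snd z) * kf i z)"
    proof (rule Bochner_Integration.integral_sum)
      fix i assume "i \<in> {..<m}"
      then have i: "integrable lborel (kf i)" using kfi by simp
      have tb: "\<bar>\<theta> i t\<bar> \<le> B i" for t unfolding \<theta>_def by (rule steklov_bounded[OF \<eta>c B h(1)])
      have [measurable]: "\<theta> i \<in> borel_measurable borel" "kf i \<in> borel_measurable borel"
        using borel_measurable_continuous_onI[OF \<theta>c] i by auto
      show "integrable lborel (\<lambda>z. \<theta> i (snd z) * kf i z)"
      proof (rule Bochner_Integration.integrable_bound)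
        show "integrable lborel (\<lambda>z. B i * kf i z)" using i by simp
        show "(\<lambda>z. \<theta> i (snd z) * kf i z) \<in> borel_measurable lborel" by measurable
        have "\<bar>\<theta> i t\<bar> \<le> \<bar>B i\<bar>" for t using tb[of t] by linarith
        then show "AE z in lborel. norm (\<theta> i (snd z) * kf i z) \<le> norm (B i * kf i z)"
          by (auto simp: abs_mult intro!: mult_right_mono)
      qed
    qed
    also have "\<dots> = (\<Sum>i<m. (LINT s|lborel. indicator {0..h} s * (LINT z|lborel. \<eta> i (snd z - s) * kf i z)) / h)"
      unfolding \<theta>_def by (intro sum.cong refl steklov_integral(2)[OF \<eta>c B] kfi) simp
    also have "\<dots> = (LINT s|lborel. (\<Sum>i<m. indicator {0..h} s * (LINT z|lborel. \<eta> i (snd z - s) * kf i z))) / h"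
      unfolding sum_divide_distrib[symmetric]
      by (subst Bochner_Integration.integral_sum) (use steklov_integral(1)[OF \<eta>c B kfi] in auto)
    also have "\<dots> = (LINT s|lborel. indicator {0..h} s * \<Psi> s) / h" by (simp add: \<Psi>_def sum_distrib_left)
    finally have eq: "(LINT z|lborel. diffusivity z * (ext (\<lambda>z. snd (transported m \<theta> \<psi> z)) z \<bullet> ext g z)) = \<dots>" .
    have "(LINT s|lborel. indicator {0..h} s * (3 / 4 * N)) \<le> (LINT s|lborel. indicator {0..h} s * \<Psi> s)"
    proof (rule integral_mono)
      show "integrable lborel (\<lambda>s. indicator {0..h} s * (3 / 4 * N))"
        using l2_bounded_compact(2)[of "\<lambda>s. indicator {0..h} s * (3 / 4 * N)" "\<bar>3 / 4 * N\<bar>" "{0..h}"] by (auto simp: indicator_def)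
      have "integrable lborel (\<lambda>s. \<Sum>i<m. indicator {0..h} s * (LINT z|lborel. \<eta> i (snd z - s) * kf i z))"
        using steklov_integral(1)[OF \<eta>c B kfi] by (intro Bochner_Integration.integrable_sum) auto
      then show "integrable lborel (\<lambda>s. indicator {0..h} s * \<Psi> s)" by (simp add: \<Psi>_def sum_distrib_left)
      show "indicator {0..h} s * (3 / 4 * N) \<le> indicator {0..h} s * \<Psi> s" for s
        using \<Psi>_lower[of s] by (auto simp: indicator_def)
    qed
    moreover have "(LINT s|lborel. indicator {0..h} s * (3 / 4 * N)) = h * (3 / 4 * N)" using h(1) by simp
    ultimately show ?thesis unfolding eq using h(1) by (simp add: pos_le_divide_eq mult.commute)
  qed
  have "bform \<Omega> T \<phi> \<alpha> ?u q = (LINT z|lborel. ext (\<lambda>z. fst (transported m \<theta>' \<psi> z)) z * ext q z)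
      + (LINT z|lborel. diffusivity z * (ext (\<lambda>z. snd (transported m \<theta> \<psi> z)) z \<bullet> ext g z))"
    by (rule X(2)[OF _ _ q g])
  then have "0 < bform \<Omega> T \<phi> \<alpha> ?u q" using first second N by linarith
  then show ?thesis by (rule bexI[OF _ X(1)])
qed

end

theorem lemma3p1:
  fixes \<Omega> :: "(real^'n) set"
    and T :: real
    and \<phi> :: "real \<Rightarrow> real^'n \<Rightarrow> real^'n"
    and \<alpha> :: "real^'n \<Rightarrow> real"
    and \<alpha>_lo \<alpha>_up :: real
  assumes "lipschitz_domain \<Omega>" and "bounded \<Omega>"
    and "0 < T"
    and "regular_deformation \<Omega> T \<phi>"
    and "\<forall>(y, t) \<in> spacetime_domain \<Omega> T \<phi>. divergence (\<lambda>z. velocity \<Omega> \<phi> z t) y = 0"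
    and "set_borel_measurable lborel (\<Union>t\<in>{0<..<T}. \<phi> t ` \<Omega>) \<alpha>"
    and "0 < \<alpha>_lo"
    and "\<forall>y \<in> (\<Union>t\<in>{0<..<T}. \<phi> t ` \<Omega>). \<alpha>_lo \<le> \<alpha> y \<and> \<alpha> y \<le> \<alpha>_up"
    and "\<forall>(y, t) \<in> spacetime_domain \<Omega> T \<phi>. \<forall>\<xi>.
           0 \<le> (velocity_gradient \<Omega> \<phi> y t *v \<xi>) \<bullet> \<xi>"
  shows "\<forall>q \<in> Y_space \<Omega> T \<phi>.
           \<not> (AE z in lborel. z \<in> spacetime_domain \<Omega> T \<phi> \<longrightarrow> q z = 0) \<longrightarrow>
           (\<exists>u \<in> X_space \<Omega> T \<phi> \<alpha>. 0 < bform \<Omega> T \<phi> \<alpha> u q)"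
proof -
  have \<Omega>: "open \<Omega>" "connected \<Omega>" "\<Omega> \<noteq> {}" using assms(1) by (auto simp: lipschitz_domain_def)
  show ?thesis
  proof (rule deformation_rigid[OF \<Omega> assms(4,5,9)])
    fix R c R' c'
    assume "\<And>t. orthogonal_transformation (R t)"
      "\<And>t. t \<notin> {0..<T} \<Longrightarrow> R t = (\<lambda>x. x)" "\<And>t. t \<notin> {0..<T} \<Longrightarrow> c t = 0"
      "\<And>t x. t \<in> {0..<T} \<Longrightarrow> x \<in> \<Omega> \<Longrightarrow> \<phi> t x = R t x + c t"
      "\<And>x. continuous_on {0..<T} (\<lambda>t. R t x)" "continuous_on {0..<T} c"
      "\<And>t x. t \<in> {0<..<T} \<Longrightarrow> ((\<lambda>s. R s x) has_vector_derivative R' t x) (at t)"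
      "\<And>t. t \<in> {0<..<T} \<Longrightarrow> (c has_vector_derivative c' t) (at t)"
      "\<And>x. continuous_on {0<..<T} (\<lambda>t. R' t x)" "continuous_on {0<..<T} c'"
    then interpret rigid_motion \<Omega> T \<phi> R c R' c'
      using \<Omega>(1) assms(2,3) by unfold_locales
    interpret rigid_diffusion \<Omega> T \<phi> R c R' c' \<alpha> \<alpha>_lo \<alpha>_up
      using assms(6,7,8) by unfold_locales blast+
    show ?thesis using exists_trial_function_with_positive_form by blast
  qed
qed

end
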